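(* Let $n\ge2$, $\beta>0$ and $R_2>R_1>0$. Let $v$ be a positive eigenfunction corresponding to $\lambda(\beta,A_{R_1,R_2})$. Then $v$ is radially symmetric, that is, there exists a function $\phi$ on $[R_1,R_2]$, positive on $(R_1,R_2)$, such that $v(x)=\phi(|x|)$. Moreover, there exists a unique $\bar R\in(R_1,R_2)$ such that $\phi'(\bar R)=0$, and $\phi$ is strictly increasing in $[R_1,\bar R]$ and strictly decreasing in $[\bar R,R_2]$.
   Context: $B_r\subset\mathbb R^n$ is the open ball of radius $r$ centered at the origin and $A_{R_1,R_2}=B_{R_2}\setminus\overline{B_{R_1}}$. $H^1_{\partial B_{R_1}}(A_{R_1,R_2})$ is the closure in $H^1(A_{R_1,R_2})$ of $\{u|_{A_{R_1,R_2}} : u\in C_0^\infty(\mathbb R^n),\ \operatorname{spt}(u)\cap\partial B_{R_1}=\emptyset\}$. Define $$\lambda(\beta,A_{R_1,R_2})=\min_{\psi\in H^1_{\partial B_{R_1}}(A_{R_1,R_2}),\ \psi\not\equiv0}\frac{\int_{A_{R_1,R_2}}|\nabla\psi|^2dx+\beta\int_{\partial B_{R_2}}\psi^2d\mathcal H^{n-1}}{\int_{A_{R_1,R_2}}\psi^2dx}.$$ An eigenfunction corresponding to $\lambda(\beta,A_{R_1,R_2})$ is a not identically zero $v\in H^1_{\partial B_{R_1}}(A_{R_1,R_2})$ with $$\int_{A_{R_1,R_2}}\langle\nabla v,\nabla\varphi\rangle dx+\beta\int_{\partial B_{R_2}}v\varphi\,d\mathcal H^{n-1}=\lambda(\beta,A_{R_1,R_2})\int_{A_{R_1,R_2}}v\varphi\,dx\quad\text{for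 all }\varphi\in H^1_{\partial B_{R_1}}(A_{R_1,R_2}),$$ i.e. a weak solution of $-\Delta v=\lambda v$ in $A_{R_1,R_2}$, $\partial_\nu v+\beta v=0$ on $\partial B_{R_2}$ ($\nu$ the outer unit normal), $v=0$ on $\partial B_{R_1}$. Positive means positive in $A_{R_1,R_2}$. *)

theory Defs
  imports "HOL-Analysis.Analysis"
begin

section \<open>Hausdorff measure\<close>

text \<open>The normalisation makes the \<open>k\<close>-dimensional measure agree with Lebesgue measure on
  \<open>\<real>\<^sup>k\<close>. The empty set is treated separately so that for \<open>k = 0\<close> (where \<open>0 ^ 0 = 1\<close>) one
  obtains the counting measure; boundedness is required since \<^const>\<open>diameter\<close> is only
  meaningful for bounded sets.\<close>

definition hausdorff_content :: "nat \<Rightarrow> real \<Rightarrow> 'a::metric_space set \<Rightarrow> ennreal" where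
  "hausdorff_content k \<delta> E =
     (INF C \<in> {C :: nat \<Rightarrow> 'a set. E \<subseteq> (\<Union>i. C i) \<and> (\<forall>i. bounded (C i) \<and> diameter (C i) \<le> \<delta>)}.
        \<Sum>i. ennreal (if C i = {} then 0 else unit_ball_vol (real k) * (diameter (C i) / 2) ^ k))"

definition hausdorff_outer :: "nat \<Rightarrow> 'a::metric_space set \<Rightarrow> ennreal" where
  "hausdorff_outer k E = (SUP \<delta>\<in>{0<..}. hausdorff_content k \<delta> E)"

text \<open>\<^const>\<open>measure_of\<close> takes the value of the given set function only if that function is
  countably additive on the \<open>\<sigma>\<close>-algebra; this holds here because Hausdorff outer measure is a
  metric outer measure.\<close>

definition hausdorff_measure :: "nat \<Rightarrow> 'a::metric_space measure" where
  "hausdorff_measure k = measure_of UNIV (sets borel) (hausdorff_outer k)"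

definition surface_measure :: "'a::euclidean_space set \<Rightarrow> 'a measure" where
  "surface_measure \<Gamma> = restrict_space (hausdorff_measure (DIM('a) - 1)) \<Gamma>"


section \<open>Smooth functions with compact support\<close>

definition gradient :: "('a::euclidean_space \<Rightarrow> real) \<Rightarrow> 'a \<Rightarrow> 'a" where
  "gradient u x = (\<Sum>b\<in>Basis. frechet_derivative u (at x) b *\<^sub>R b)"

primrec C_k :: "nat \<Rightarrow> ('a::euclidean_space \<Rightarrow> real) \<Rightarrow> bool" where
  "C_k 0 u \<longleftrightarrow> continuous_on UNIV u"
| "C_k (Suc k) u \<longleftrightarrow>
     (\<forall>x. u differentiable (at x)) \<and> (\<forall>b\<in>Basis. C_k k (\<lambda>x. gradient u x \<bullet> b))"

definition spt :: "('a::euclidean_space \<Rightarrow> real) \<Rightarrow> 'a set" where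
  "spt u = closure {x. u x \<noteq> 0}"

definition test_functions :: "'a::euclidean_space set \<Rightarrow> ('a \<Rightarrow> real) set" where
  "test_functions \<Omega> = {u. (\<forall>k. C_k k u) \<and> compact (spt u) \<and> spt u \<subseteq> \<Omega>}"


section \<open>Sobolev functions\<close>

text \<open>Elements of \<open>L\<^sup>2\<close> and \<open>H\<^sup>1\<close> are represented by functions on the whole space, of which only
  the values almost everywhere in the domain matter.\<close>

definition L2 :: "'a measure \<Rightarrow> ('a \<Rightarrow> 'b::euclidean_space) \<Rightarrow> bool" where
  "L2 M f \<longleftrightarrow> f \<in> borel_measurable M \<and> integrable M (\<lambda>x. (norm (f x))\<^sup>2)"

definition is_weak_gradient ::
    "'a::euclidean_space set \<Rightarrow> ('a \<Rightarrow> real) \<Rightarrow> ('a \<Rightarrow> 'a) \<Rightarrow> bool" where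
  "is_weak_gradient \<Omega> u g \<longleftrightarrow> L2 (lebesgue_on \<Omega>) g \<and>
     (\<forall>\<phi>\<in>test_functions \<Omega>.
        (LINT x|lebesgue_on \<Omega>. u x *\<^sub>R gradient \<phi> x) = - (LINT x|lebesgue_on \<Omega>. \<phi> x *\<^sub>R g x))"

definition H1 :: "'a::euclidean_space set \<Rightarrow> ('a \<Rightarrow> real) set" where
  "H1 \<Omega> = {u. L2 (lebesgue_on \<Omega>) u \<and> (\<exists>g. is_weak_gradient \<Omega> u g)}"

text \<open>Weak gradients and traces are determined only up to null sets; a representative is
  chosen.\<close>

definition weak_gradient :: "'a::euclidean_space set \<Rightarrow> ('a \<Rightarrow> real) \<Rightarrow> 'a \<Rightarrow> 'a" where
  "weak_gradient \<Omega> u = (SOME g. is_weak_gradient \<Omega> u g)"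

definition H1_norm :: "'a::euclidean_space set \<Rightarrow> ('a \<Rightarrow> real) \<Rightarrow> real" where
  "H1_norm \<Omega> u = sqrt ((LINT x|lebesgue_on \<Omega>. (u x)\<^sup>2) +
                        (LINT x|lebesgue_on \<Omega>. (norm (weak_gradient \<Omega> u x))\<^sup>2))"

definition H1_vanishing :: "'a::euclidean_space set \<Rightarrow> 'a set \<Rightarrow> ('a \<Rightarrow> real) set" where
  "H1_vanishing \<Gamma> \<Omega> = {u \<in> H1 \<Omega>. \<exists>f. (\<forall>k. f k \<in> test_functions UNIV \<and> spt (f k) \<inter> \<Gamma> = {}) \<and>
     (\<lambda>k. H1_norm \<Omega> (\<lambda>x. f k x - u x)) \<longlonglongrightarrow> 0}"

text \<open>The trace operator is the continuous extension to \<open>H\<^sup>1(\<Omega>)\<close> of the restriction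
  \<open>u \<mapsto> u|\<^sub>\<Gamma>\<close> of smooth functions, with values in \<open>L\<^sup>2(\<Gamma>, \<H>\<^sup>n\<^sup>-\<^sup>1)\<close>.\<close>

definition is_trace ::
    "'a::euclidean_space set \<Rightarrow> 'a set \<Rightarrow> ('a \<Rightarrow> real) \<Rightarrow> ('a \<Rightarrow> real) \<Rightarrow> bool" where
  "is_trace \<Omega> \<Gamma> u T \<longleftrightarrow> L2 (surface_measure \<Gamma>) T \<and>
     (\<exists>f. (\<forall>k. f k \<in> test_functions UNIV) \<and>
        (\<lambda>k. H1_norm \<Omega> (\<lambda>x. f k x - u x)) \<longlonglongrightarrow> 0 \<and>
        (\<lambda>k. LINT x|surface_measure \<Gamma>. (f k x - T x)\<^sup>2) \<longlonglongrightarrow> 0)"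

definition trace :: "'a::euclidean_space set \<Rightarrow> 'a set \<Rightarrow> ('a \<Rightarrow> real) \<Rightarrow> 'a \<Rightarrow> real" where
  "trace \<Omega> \<Gamma> u = (SOME T. is_trace \<Omega> \<Gamma> u T)"


section \<open>The Robin--Dirichlet eigenvalue problem on an annulus\<close>

definition annulus :: "real \<Rightarrow> real \<Rightarrow> 'a::euclidean_space set" where
  "annulus R\<^sub>1 R\<^sub>2 = ball 0 R\<^sub>2 - cball 0 R\<^sub>1"

abbreviation annulus_space :: "real \<Rightarrow> real \<Rightarrow> ('a::euclidean_space \<Rightarrow> real) set" where
  "annulus_space R\<^sub>1 R\<^sub>2 \<equiv> H1_vanishing (sphere 0 R\<^sub>1) (annulus R\<^sub>1 R\<^sub>2)"

definition robin_form ::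
    "real \<Rightarrow> real \<Rightarrow> real \<Rightarrow> ('a::euclidean_space \<Rightarrow> real) \<Rightarrow> ('a \<Rightarrow> real) \<Rightarrow> real" where
  "robin_form \<beta> R\<^sub>1 R\<^sub>2 u w =
     (LINT x|lebesgue_on (annulus R\<^sub>1 R\<^sub>2).
        weak_gradient (annulus R\<^sub>1 R\<^sub>2) u x \<bullet> weak_gradient (annulus R\<^sub>1 R\<^sub>2) w x) +
     \<beta> * (LINT x|surface_measure (sphere 0 R\<^sub>2).
        trace (annulus R\<^sub>1 R\<^sub>2) (sphere 0 R\<^sub>2) u x * trace (annulus R\<^sub>1 R\<^sub>2) (sphere 0 R\<^sub>2) w x)"

definition L2_form ::
    "real \<Rightarrow> real \<Rightarrow> ('a::euclidean_space \<Rightarrow> real) \<Rightarrow> ('a \<Rightarrow> real) \<Rightarrow> real" where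
  "L2_form R\<^sub>1 R\<^sub>2 u w = (LINT x|lebesgue_on (annulus R\<^sub>1 R\<^sub>2). u x * w x)"

text \<open>The minimum of the Rayleigh quotient is written as an infimum, since existence of a
  minimiser is a theorem. For \<open>\<beta> > 0\<close> the quotients are bounded below by \<open>0\<close>, and testing the
  weak equation with the eigenfunction itself shows that the infimum is attained as soon as an
  eigenfunction exists. The argument \<open>TYPE('a)\<close> supplies the ambient space.\<close>

definition robin_eigenvalue :: "'a::euclidean_space itself \<Rightarrow> real \<Rightarrow> real \<Rightarrow> real \<Rightarrow> real" where
  "robin_eigenvalue _ \<beta> R\<^sub>1 R\<^sub>2 =
     (INF \<psi> \<in> {\<psi> :: 'a \<Rightarrow> real. \<psi> \<in> annulus_space R\<^sub>1 R\<^sub>2 \<and>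
                 \<not> (AE x in lebesgue_on (annulus R\<^sub>1 R\<^sub>2). \<psi> x = 0)}.
        robin_form \<beta> R\<^sub>1 R\<^sub>2 \<psi> \<psi> / L2_form R\<^sub>1 R\<^sub>2 \<psi> \<psi>)"

definition robin_eigenfunction ::
    "real \<Rightarrow> real \<Rightarrow> real \<Rightarrow> ('a::euclidean_space \<Rightarrow> real) \<Rightarrow> bool" where
  "robin_eigenfunction \<beta> R\<^sub>1 R\<^sub>2 v \<longleftrightarrow>
     v \<in> annulus_space R\<^sub>1 R\<^sub>2 \<and>
     \<not> (AE x in lebesgue_on (annulus R\<^sub>1 R\<^sub>2). v x = 0) \<and>
     (\<forall>\<phi>\<in>annulus_space R\<^sub>1 R\<^sub>2.
        robin_form \<beta> R\<^sub>1 R\<^sub>2 v \<phi> = robin_eigenvalue TYPE('a) \<beta> R\<^sub>1 R\<^sub>2 * L2_form R\<^sub>1 R\<^sub>2 v \<phi>)"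

end

theory Submission
  imports Defs
begin

text \<open>Write \<open>s = |x|\<^sup>2 / R\<^sub>2\<^sup>2\<close>. Testing the weak equation with radial functions shows that the spherical
  means of \<open>v\<close>, as a function \<open>P\<close> of \<open>s\<close>, solve an integral equation, hence the radial eigenvalue ODE
  together with the Robin condition at \<open>s = 1\<close>; positivity of \<open>v\<close> makes \<open>P\<close> positive. Picone's identity with
  comparison function \<open>P\<close>, applied to smooth functions tending to \<open>v\<close>, then gives \<open>\<nabla>(v / P) = 0\<close>, so \<open>v\<close>
  is a multiple of \<open>P\<close>. The vanishing of \<open>v\<close> on the inner sphere gives \<open>P = 0\<close> there. Finally the flux
  \<open>s\<^sup>n\<^sup>/\<^sup>2 P'\<close> is strictly decreasing, positive at the inner and negative at the outer boundary, so it has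
  exactly one zero. Traces and the surface measure are handled through polar coordinates, which hold for
  the Hausdorff measure because uniformly distributed measures are proportional.\<close>

section \<open>Smooth functions\<close>

text \<open>The variable \<open>s\<close> is quadratic in \<open>x\<close> so that a smooth function
  of it is again smooth in \<open>x\<close>, also at the origin, with a gradient that is a scalar
  multiple of \<open>x\<close>. The delicate end is the inner sphere. When Picone's identity is
  applied it is still open whether \<open>P\<close> vanishes there, so the logarithmic derivative of
  \<open>P\<close> may be singular at \<open>a\<close>. The supports of the smooth
  \<open>f j\<close> avoid the inner sphere, which gives each \<open>f j\<close> its own threshold
  \<open>cut j > a\<close> below which it vanishes; the identities are integrated from
  \<open>cut j\<close> on, and no bound uniform in \<open>j\<close> enters. The value of
  \<open>P\<close> at \<open>a\<close> is settled only after the limit has been taken. The constant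
  \<open>c\<close> of the polar density is a proportionality factor between two uniformly
  distributed measures. Its true value, half the outer radius, is never computed:
  \<open>2 * c\<close> stands in for the outer radius in the divergence theorem, and the Robin
  condition takes the form \<open>2 * c * \<kappa> 1 = - \<beta>\<close>, which is exactly what
  removes the boundary term.\<close>

lemma gradient_inner_has_derivative:
  fixes u :: "'a::euclidean_space \<Rightarrow> real"
  assumes "(u has_derivative D) (at x)"
  shows "gradient u x \<bullet> y = D y"
proof -
  have D: "frechet_derivative u (at x) = D"
    using frechet_derivative_at[OF assms] by simp
  interpret bounded_linear D using assms by (rule has_derivative_bounded_linear)
  have "D y = D (\<Sum>b\<in>Basis. (y \<bullet> b) *\<^sub>R b)" by (simp add: euclidean_representation)
  also have "\<dots> = (\<Sum>b\<in>Basis. (y \<bullet> b) * D b)" by (simp add: sum scaleR)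
  finally show ?thesis
    unfolding gradient_def D by (simp add: inner_sum_left inner_commute[of y] mult.commute)
qed

lemma gradient_has_derivative:
  fixes u :: "'a::euclidean_space \<Rightarrow> real"
  assumes "u differentiable (at x)"
  shows "(u has_derivative (\<lambda>y. gradient u x \<bullet> y)) (at x)"
proof -
  obtain D where D: "(u has_derivative D) (at x)" using assms by (auto simp: differentiable_def)
  have "D = (\<lambda>y. gradient u x \<bullet> y)" using gradient_inner_has_derivative[OF D] by auto
  then show ?thesis using D by simp
qed

lemma gradient_eqI:
  fixes u :: "'a::euclidean_space \<Rightarrow> real"
  assumes "(u has_derivative (\<lambda>y. g \<bullet> y)) (at x)"
  shows "gradient u x = g"
  by (rule euclidean_eqI) (simp add: gradient_inner_has_derivative[OF assms])

lemma gradient_add: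
  assumes "u differentiable (at x)" "w differentiable (at x)"
  shows "gradient (\<lambda>y. u y + w y) x = gradient u x + gradient w x"
  by (rule gradient_eqI)
    (auto intro!: derivative_eq_intros gradient_has_derivative assms simp: inner_add_left)

lemma gradient_cmult:
  assumes "u differentiable (at x)"
  shows "gradient (\<lambda>y. c * u y) x = c *\<^sub>R gradient u x"
  by (rule gradient_eqI) (auto intro!: derivative_eq_intros gradient_has_derivative assms)

lemma gradient_mult:
  assumes "u differentiable (at x)" "w differentiable (at x)"
  shows "gradient (\<lambda>y. u y * w y) x = u x *\<^sub>R gradient w x + w x *\<^sub>R gradient u x"
  by (rule gradient_eqI)
    (auto intro!: derivative_eq_intros gradient_has_derivative assms simp: inner_add_left)

lemma gradient_const [simp]: "gradient (\<lambda>_. c) x = 0"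
  by (rule gradient_eqI) auto

lemma C_k_continuous: "C_k k u \<Longrightarrow> continuous_on UNIV u"
  by (cases k) (auto simp: continuous_on_eq_continuous_at intro: differentiable_imp_continuous_within)

lemma C_k_Suc_imp: "C_k (Suc k) u \<Longrightarrow> C_k k u"
proof (induction k arbitrary: u)
  case 0
  then show ?case
    by (auto simp: continuous_on_eq_continuous_at intro: differentiable_imp_continuous_within)
next
  case (Suc k)
  have "C_k (Suc k) (\<lambda>x. gradient u x \<bullet> b)" if "b \<in> Basis" for b
    using Suc.prems that by (simp only: C_k.simps(2)) blast
  then have "C_k k (\<lambda>x. gradient u x \<bullet> b)" if "b \<in> Basis" for b
    using that by (intro Suc.IH)
  then show ?case using Suc.prems by simp
qed

lemma C_k_const: "C_k k (\<lambda>_. c)"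
  by (induction k arbitrary: c) (auto simp: continuous_on_const)

lemma C_k_add: "C_k k u \<Longrightarrow> C_k k w \<Longrightarrow> C_k k (\<lambda>x. u x + w x)"
  by (induction k arbitrary: u w) (auto intro!: continuous_intros simp: gradient_add inner_add_left)

lemma C_k_cmult: "C_k k u \<Longrightarrow> C_k k (\<lambda>x. c * u x)"
  by (induction k arbitrary: u) (auto intro!: continuous_intros simp: gradient_cmult)

lemma C_k_mult: "C_k k u \<Longrightarrow> C_k k w \<Longrightarrow> C_k k (\<lambda>x. u x * w x)"
proof (induction k arbitrary: u w)
  case 0
  then show ?case by (auto intro!: continuous_intros)
next
  case (Suc k)
  have "C_k k (\<lambda>x. gradient (\<lambda>y. u y * w y) x \<bullet> b)" if "b \<in> Basis" for b
  proof -
    have "gradient (\<lambda>y. u y * w y) x \<bullet> b = u x * (gradient w x \<bullet> b) + w x * (gradient u x \<bullet> b)" for x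
      using Suc.prems by (subst gradient_mult) (auto simp: inner_add_left)
    moreover have "C_k k (\<lambda>x. u x * (gradient w x \<bullet> b) + w x * (gradient u x \<bullet> b))"
      using Suc.prems that by (auto intro!: C_k_add Suc.IH intro: C_k_Suc_imp[of k])
    ultimately show ?thesis by simp
  qed
  then show ?case using Suc.prems by auto
qed

lemma C_k_minus: "C_k k u \<Longrightarrow> C_k k w \<Longrightarrow> C_k k (\<lambda>x. u x - w x)"
  using C_k_add[of k u "\<lambda>x. (-1) * w x"] C_k_cmult[of k w "-1"] by simp

lemma C_k_prod: "finite I \<Longrightarrow> (\<And>i. i \<in> I \<Longrightarrow> C_k k (u i)) \<Longrightarrow> C_k k (\<lambda>x. \<Prod>i\<in>I. u i x)"
  by (induction I rule: finite_induct) (auto intro: C_k_const C_k_mult)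

lemma C_k_power: "C_k k u \<Longrightarrow> C_k k (\<lambda>x. u x ^ m)"
  by (induction m) (auto intro: C_k_const C_k_mult)

lemma C_k_SucI:
  assumes "\<And>x. (u has_derivative (\<lambda>y. G x \<bullet> y)) (at x)" "\<And>b. b \<in> Basis \<Longrightarrow> C_k k (\<lambda>x. G x \<bullet> b)"
  shows "C_k (Suc k) u"
proof -
  have "gradient u x = G x" for x using gradient_eqI[OF assms(1)] .
  then show ?thesis using assms by (auto simp: differentiable_def)
qed

lemma C_k_inner: "C_k k (\<lambda>x. x \<bullet> b)"
proof (cases k)
  case (Suc l)
  show ?thesis unfolding Suc
  proof (rule C_k_SucI[where G="\<lambda>x. b"])
    show "((\<lambda>x. x \<bullet> b) has_derivative (\<bullet>) b) (at x)" for x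
      by (auto intro!: derivative_eq_intros simp: inner_commute)
  qed (rule C_k_const)
qed (auto intro!: continuous_intros)

lemma C_k_inner_self: "C_k k (\<lambda>x. x \<bullet> x)"
proof (cases k)
  case (Suc l)
  show ?thesis unfolding Suc
  proof (rule C_k_SucI[where G="\<lambda>x. 2 *\<^sub>R x"])
    show "((\<lambda>x. x \<bullet> x) has_derivative (\<bullet>) (2 *\<^sub>R x)) (at x)" for x :: 'a
      by (auto intro!: derivative_eq_intros simp: inner_commute)
    show "C_k l (\<lambda>x. 2 *\<^sub>R x \<bullet> b)" for b :: 'a
      unfolding inner_scaleR_left by (intro C_k_cmult C_k_inner)
  qed
qed (auto intro!: continuous_intros)

lemma C_k_real_SucI:
  fixes u :: "real \<Rightarrow> real"
  assumes "\<And>x. (u has_real_derivative u' x) (at x)" "C_k k u'"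
  shows "C_k (Suc k) u"
proof (rule C_k_SucI[where G=u'])
  show "(u has_derivative (\<bullet>) (u' x)) (at x)" for x
    using assms(1)[of x] by (simp add: has_field_derivative_def inner_real_def)
qed (use assms in auto)

lemma C_k_real_SucD:
  fixes u :: "real \<Rightarrow> real"
  assumes "C_k (Suc k) u"
  shows "(u has_real_derivative gradient u x) (at x)" "C_k k (gradient u)"
proof -
  have "(u has_derivative (\<lambda>y. gradient u x \<bullet> y)) (at x)"
    using assms by (intro gradient_has_derivative) auto
  then show "(u has_real_derivative gradient u x) (at x)"
    by (simp add: has_field_derivative_def)
  show "C_k k (gradient u)" using assms by auto
qed

lemma C_k_compose:
  fixes \<psi> :: "real \<Rightarrow> real" and u :: "'a::euclidean_space \<Rightarrow> real"
  assumes "C_k k \<psi>" "C_k k u"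
  shows "C_k k (\<lambda>x. \<psi> (u x))"
  using assms
proof (induction k arbitrary: \<psi> u)
  case 0
  then show ?case by (auto intro: continuous_on_compose2)
next
  case (Suc k)
  show ?case
  proof (rule C_k_SucI[where G="\<lambda>x. gradient \<psi> (u x) *\<^sub>R gradient u x"])
    fix x
    have 1: "(u has_derivative (\<lambda>y. gradient u x \<bullet> y)) (at x)"
      using Suc.prems by (intro gradient_has_derivative) auto
    have eq: "(\<bullet>) (gradient \<psi> (u x) *\<^sub>R gradient u x) = (\<lambda>y. gradient \<psi> (u x) * (gradient u x \<bullet> y))"
      by (simp add: fun_eq_iff)
    show "((\<lambda>x. \<psi> (u x)) has_derivative (\<bullet>) (gradient \<psi> (u x) *\<^sub>R gradient u x)) (at x)"
      unfolding eq
      by (rule has_derivative_compose[OF 1 C_k_real_SucD(1)[OF Suc.prems(1), unfolded has_field_derivative_def]])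
  next
    fix b :: 'a assume "b \<in> Basis"
    then have "C_k k (\<lambda>x. gradient u x \<bullet> b)" using Suc.prems by simp
    moreover have "C_k k (\<lambda>x. gradient \<psi> (u x))"
      using Suc.IH[OF C_k_real_SucD(2)[OF Suc.prems(1)] C_k_Suc_imp[OF Suc.prems(2)]] .
    ultimately show "C_k k (\<lambda>x. gradient \<psi> (u x) *\<^sub>R gradient u x \<bullet> b)"
      unfolding inner_scaleR_left by (intro C_k_mult)
  qed
qed

section \<open>Functions flat at a point and smooth bumps\<close>

lemma poly_over_exp_tendsto_0:
  fixes q :: "real poly"
  shows "((\<lambda>y. poly q y / exp y) \<longlongrightarrow> 0) at_top"
proof -
  have "((\<lambda>y. \<Sum>i\<le>degree q. coeff q i * (y ^ i / exp y)) \<longlongrightarrow> (\<Sum>i\<le>degree q. coeff q i * 0)) at_top"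
    by (intro tendsto_intros tendsto_power_div_exp_0)
  then show ?thesis by (simp add: poly_altdef sum_divide_distrib)
qed

text \<open>The functions q(1/s) exp(-1/s), extended by 0, form a family closed under
  differentiation. Smoothness of all its members is then a single induction over the order, with
  \<open>q\<close> arbitrary.\<close>

definition poly_flat :: "real poly \<Rightarrow> real \<Rightarrow> real" where
  "poly_flat q s = (if s > 0 then poly q (1 / s) * exp (- 1 / s) else 0)"

text \<open>For s > 0 the derivative is s^-2 (q - q')(1/s) exp(-1/s), and the factor s^-2 is the
  polynomial \<open>[:0, 0, 1:]\<close> evaluated at 1/s.\<close>

lemma poly_flat_has_derivative:
  "(poly_flat q has_real_derivative poly_flat ([:0, 0, 1:] * (q - pderiv q)) s) (at s)"
proof (cases s "0::real" rule: linorder_cases)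
  case less
  have "((\<lambda>_. 0) has_real_derivative 0) (at s)" by simp
  then have "(poly_flat q has_real_derivative 0) (at s)"
    by (rule has_field_derivative_transform_within_open[where S="{..<0}"])
      (use less in \<open>auto simp: poly_flat_def\<close>)
  then show ?thesis using less by (simp add: poly_flat_def)
next
  case greater
  have "((\<lambda>s. poly q (1 / s) * exp (- 1 / s)) has_real_derivative
      poly_flat ([:0, 0, 1:] * (q - pderiv q)) s) (at s)"
  proof -
    have inv: "((\<lambda>s. 1 / s) has_real_derivative - (1 / s\<^sup>2)) (at s)"
      using greater by (auto intro!: derivative_eq_intros simp: power2_eq_square)
    have 1: "((\<lambda>s. poly q (1 / s)) has_real_derivative poly (pderiv q) (1 / s) * - (1 / s\<^sup>2)) (at s)"
      by (rule DERIV_chain2[OF poly_DERIV inv])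
    have 2: "((\<lambda>s. exp (- 1 / s)) has_real_derivative exp (- 1 / s) * (1 / s\<^sup>2)) (at s)"
      using DERIV_fun_exp[OF DERIV_minus[OF inv]] by simp
    show ?thesis
      using DERIV_mult[OF 1 2] greater by (simp add: poly_flat_def field_simps power2_eq_square)
  qed
  then show ?thesis
    by (rule has_field_derivative_transform_within_open[where S="{0<..}"])
      (use greater in \<open>auto simp: poly_flat_def\<close>)
next
  case equal
  \<comment> \<open>With y = 1/s the right difference quotient at 0 is y q(y) exp(-y), hence the
    shifted polynomial \<open>pCons 0 q\<close>. The left quotient is identically 0.\<close>
  have "((\<lambda>y. poly (pCons 0 q) y / exp y) \<longlongrightarrow> 0) at_top" by (rule poly_over_exp_tendsto_0)
  then have "((\<lambda>s. poly (pCons 0 q) (inverse s) / exp (inverse s)) \<longlongrightarrow> 0) (at_right 0)"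
    by (rule filterlim_compose) (rule filterlim_inverse_at_top_right)
  then have "((\<lambda>s. (poly_flat q s - poly_flat q 0) / (s - 0)) \<longlongrightarrow> 0) (at_right 0)"
    by (rule Lim_transform_eventually)
      (auto simp: poly_flat_def eventually_at_filter field_simps exp_minus intro!: always_eventually)
  moreover have "((\<lambda>s. (poly_flat q s - poly_flat q 0) / (s - 0)) \<longlongrightarrow> 0) (at_left 0)"
    by (rule Lim_transform_eventually[OF tendsto_const])
      (auto simp: poly_flat_def eventually_at_filter intro!: always_eventually)
  ultimately have "((\<lambda>s. (poly_flat q s - poly_flat q 0) / (s - 0)) \<longlongrightarrow> 0) (at 0)"
    by (simp add: filterlim_at_split)
  then show ?thesis using equal
    by (simp add: has_field_derivative_iff poly_flat_def)
qed

lemma C_k_poly_flat: "C_k k (poly_flat q)"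
proof (induction k arbitrary: q)
  case 0
  then show ?case
    using poly_flat_has_derivative[of q] by (auto simp: continuous_on_eq_continuous_at intro: DERIV_isCont)
next
  case (Suc k)
  show ?case by (rule C_k_real_SucI[OF poly_flat_has_derivative Suc])
qed

text \<open>Boxes are stable under intersection and generate the Borel sets, and in dimension one a
  box is an interval, so the same bump also yields cutoffs on the line.\<close>

definition box_bump :: "'a::euclidean_space \<Rightarrow> 'a \<Rightarrow> 'a \<Rightarrow> real" where
  "box_bump l h x = (\<Prod>b\<in>Basis. poly_flat 1 (x \<bullet> b - l \<bullet> b) * poly_flat 1 (h \<bullet> b - x \<bullet> b))"

lemma C_k_box_bump: "C_k k (box_bump l h)"
  unfolding box_bump_def[abs_def]
  by (intro C_k_prod C_k_mult C_k_compose[OF C_k_poly_flat] C_k_minus C_k_inner C_k_const) auto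

lemma poly_flat_1: "0 \<le> poly_flat 1 s" "poly_flat 1 s \<le> 1" "poly_flat 1 s > 0 \<longleftrightarrow> s > 0"
  by (auto simp: poly_flat_def)

lemma box_bump_bounds: "0 \<le> box_bump l h x" "box_bump l h x \<le> 1"
  unfolding box_bump_def
  by (auto intro!: prod_nonneg prod_le_1 mult_le_one simp: poly_flat_1)

lemma box_bump_pos_iff: "box_bump l h x > 0 \<longleftrightarrow> x \<in> box l h"
proof
  assume x: "x \<in> box l h"
  have "0 < poly_flat 1 (x \<bullet> b - l \<bullet> b) * poly_flat 1 (h \<bullet> b - x \<bullet> b)" if "b \<in> Basis" for b
    using x that by (intro mult_pos_pos) (auto simp: poly_flat_1(3) mem_box)
  then show "box_bump l h x > 0" unfolding box_bump_def by (intro prod_pos) auto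
next
  assume "box_bump l h x > 0"
  then have "poly_flat 1 (x \<bullet> b - l \<bullet> b) * poly_flat 1 (h \<bullet> b - x \<bullet> b) \<noteq> 0" if "b \<in> Basis" for b
    using that unfolding box_bump_def by (auto simp: less_le prod_zero_iff)
  then have "poly_flat 1 (x \<bullet> b - l \<bullet> b) > 0 \<and> poly_flat 1 (h \<bullet> b - x \<bullet> b) > 0" if "b \<in> Basis" for b
    using that by (force simp: less_le poly_flat_1(1))
  then show "x \<in> box l h" by (auto simp: mem_box poly_flat_1(3))
qed

lemma box_bump_eq_0_iff: "box_bump l h x = 0 \<longleftrightarrow> x \<notin> box l h"
  using box_bump_pos_iff[of l h x] box_bump_bounds(1)[of l h x] by auto

lemma spt_subset_cbox:
  assumes "\<And>x. x \<notin> box l h \<Longrightarrow> u x = 0"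
  shows "spt u \<subseteq> cbox l h"
proof -
  have "{x. u x \<noteq> 0} \<subseteq> cbox l h" using assms box_subset_cbox by blast
  then show ?thesis unfolding spt_def by (intro closure_minimal closed_cbox)
qed

lemma closed_spt: "closed (spt u)" by (simp add: spt_def)

lemma spt_not_in: "x \<notin> spt u \<Longrightarrow> u x = 0"
  unfolding spt_def using closure_subset[of "{x. u x \<noteq> 0}"] by auto

lemma test_functions_boxI:
  assumes "\<And>k. C_k k u" "\<And>x. x \<notin> box l h \<Longrightarrow> u x = 0" "cbox l h \<subseteq> \<Omega>"
  shows "u \<in> test_functions \<Omega>"
proof -
  have "spt u \<subseteq> cbox l h" using assms(2) by (rule spt_subset_cbox)
  moreover have "compact (spt u)"
    using \<open>spt u \<subseteq> cbox l h\<close> by (metis bounded_cbox bounded_subset closed_spt compact_eq_bounded_closed)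
  ultimately show ?thesis using assms unfolding test_functions_def by auto
qed

lemma test_functions_mono: "\<Omega> \<subseteq> \<Omega>' \<Longrightarrow> test_functions \<Omega> \<subseteq> test_functions \<Omega>'"
  by (auto simp: test_functions_def)

lemma test_functionsD:
  assumes "u \<in> test_functions \<Omega>"
  shows "C_k k u" "compact (spt u)" "spt u \<subseteq> \<Omega>"
  using assms by (auto simp: test_functions_def)

lemma test_functions_differentiable: "u \<in> test_functions \<Omega> \<Longrightarrow> u differentiable (at x)"
  using test_functionsD(1)[of u \<Omega> "Suc 0"] by auto

lemma test_functions_continuous: "u \<in> test_functions \<Omega> \<Longrightarrow> continuous_on UNIV u"
  using test_functionsD(1) C_k_continuous by blast

lemma C_1_continuous_gradient: "C_k (Suc 0) u \<Longrightarrow> continuous_on UNIV (gradient u)"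
  by (subst continuous_on_componentwise) auto

lemma test_functions_continuous_gradient: "u \<in> test_functions \<Omega> \<Longrightarrow> continuous_on UNIV (gradient u)"
  using test_functionsD(1) C_1_continuous_gradient by blast

lemma spt_mult_subset: "spt (\<lambda>x. u x * w x) \<subseteq> spt u"
  unfolding spt_def by (intro closure_mono) auto

lemma test_functions_mult:
  assumes "u \<in> test_functions \<Omega>" "\<And>k. C_k k w"
  shows "(\<lambda>x. u x * w x) \<in> test_functions \<Omega>"
proof -
  have "compact (spt u \<inter> spt (\<lambda>x. u x * w x))"
    using assms(1) by (intro compact_Int_closed closed_spt test_functionsD(2))
  then have "compact (spt (\<lambda>x. u x * w x))"
    using spt_mult_subset[of u w] by (simp add: Int_absorb1)
  then show ?thesis
    using assms spt_mult_subset[of u w] unfolding test_functions_def by (auto intro: C_k_mult)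
qed

lemma gradient_spt:
  assumes "x \<notin> spt u"
  shows "gradient u x = 0"
proof (rule gradient_eqI)
  have "((\<lambda>_. 0) has_derivative (\<lambda>y. 0 \<bullet> y)) (at x)" by simp
  then show "(u has_derivative (\<lambda>y. 0 \<bullet> y)) (at x)"
    by (rule has_derivative_transform_within_open[where s="- spt u"])
      (use assms closed_spt[of u] spt_not_in[of _ u] in \<open>auto simp: open_closed\<close>)
qed

lemma test_functions_mult':
  assumes "u \<in> test_functions \<Omega>" "\<And>k. C_k k w"
  shows "(\<lambda>x. w x * u x) \<in> test_functions \<Omega>"
  using test_functions_mult[OF assms] by (simp add: mult.commute)

lemma C_k_antiderivative:
  fixes g G :: "real \<Rightarrow> real"
  assumes "\<And>k. C_k k g" "\<And>x. (G has_real_derivative g x) (at x)"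
  shows "C_k k G"
  using C_k_Suc_imp[OF C_k_real_SucI[OF assms(2) assms(1)]] .

section \<open>Square-integrable functions\<close>

lemma L2_measurable: "L2 M f \<Longrightarrow> f \<in> borel_measurable M"
  and L2_integrable: "L2 M f \<Longrightarrow> integrable M (\<lambda>x. (norm (f x))\<^sup>2)"
  by (auto simp: L2_def)

lemma L2_dominated:
  assumes "f \<in> borel_measurable M" "integrable M w" "AE x in M. (norm (f x))\<^sup>2 \<le> w x"
  shows "L2 M f"
  unfolding L2_def using assms
  by (auto intro!: Bochner_Integration.integrable_bound[OF assms(2)] elim!: eventually_mono)

lemma norm_add_power2_le: "(norm (x + y))\<^sup>2 \<le> 2 * (norm x)\<^sup>2 + 2 * (norm (y::'a::real_inner))\<^sup>2"
proof -
  have "(norm (x + y))\<^sup>2 + (norm (x - y))\<^sup>2 = 2 * (norm x)\<^sup>2 + 2 * (norm y)\<^sup>2"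
    by (simp add: power2_norm_eq_inner algebra_simps)
  then show ?thesis by (smt (verit) zero_le_power2)
qed

lemma L2_add:
  assumes "L2 M f" "L2 M g"
  shows "L2 M (\<lambda>x. f x + g x)"
  by (rule L2_dominated[where w="\<lambda>x. 2 * (norm (f x))\<^sup>2 + 2 * (norm (g x))\<^sup>2"])
    (use assms in \<open>auto simp: L2_def intro!: norm_add_power2_le\<close>)

lemma L2_bounded_scaleR:
  fixes f :: "'a \<Rightarrow> 'b::euclidean_space"
  assumes "L2 M f" "c \<in> borel_measurable M" "AE x in M. \<bar>c x\<bar> \<le> (B::real)"
  shows "L2 M (\<lambda>x. c x *\<^sub>R f x)"
proof (rule L2_dominated[where w="\<lambda>x. B\<^sup>2 * (norm (f x))\<^sup>2"])
  show "AE x in M. (norm (c x *\<^sub>R f x))\<^sup>2 \<le> B\<^sup>2 * (norm (f x))\<^sup>2"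
    using assms(3)
  proof eventually_elim
    case (elim x)
    then have "\<bar>c x\<bar>\<^sup>2 \<le> B\<^sup>2" by (intro power_mono) auto
    then show ?case by (auto simp: power_mult_distrib intro: mult_right_mono)
  qed
qed (use assms in \<open>auto simp: L2_def intro: borel_measurable_scaleR\<close>)

lemma L2_scaleR: "L2 M f \<Longrightarrow> L2 M (\<lambda>x. c *\<^sub>R f x)"
  by (rule L2_bounded_scaleR[where B="\<bar>c\<bar>"]) auto

lemma L2_diff:
  assumes "L2 M f" "L2 M g"
  shows "L2 M (\<lambda>x. f x - g x)"
  using L2_add[OF assms(1) L2_scaleR[OF assms(2), of "-1"]] by simp

lemma L2_cong_AE:
  assumes "L2 M f" "AE x in M. f x = g x" "g \<in> borel_measurable M"
  shows "L2 M g"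
  by (rule L2_dominated[where w="\<lambda>x. (norm (f x))\<^sup>2"]) (use assms in \<open>auto simp: L2_def elim: eventually_mono\<close>)

lemma L2_zero: "L2 M (\<lambda>_. 0)" by (simp add: L2_def)

lemma integrable_L2_inner:
  assumes "L2 M f" "L2 M g"
  shows "integrable M (\<lambda>x. f x \<bullet> g x)"
proof (rule Bochner_Integration.integrable_bound)
  show "integrable M (\<lambda>x. (norm (f x))\<^sup>2 + (norm (g x))\<^sup>2)" using assms by (auto simp: L2_def)
  show "(\<lambda>x. f x \<bullet> g x) \<in> borel_measurable M" using assms by (auto simp: L2_def)
  have "\<bar>f x \<bullet> g x\<bar> \<le> (norm (f x))\<^sup>2 + (norm (g x))\<^sup>2" for x
  proof -
    have "0 \<le> (norm (f x) - norm (g x))\<^sup>2" "0 \<le> (norm (f x))\<^sup>2" "0 \<le> (norm (g x))\<^sup>2" by auto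
    then show ?thesis using Cauchy_Schwarz_ineq2[of "f x" "g x"] by (simp add: power2_diff)
  qed
  then show "AE x in M. norm (f x \<bullet> g x) \<le> norm ((norm (f x))\<^sup>2 + (norm (g x))\<^sup>2)" by auto
qed

lemma (in finite_measure) L2_imp_integrable:
  assumes "L2 M (f :: 'a \<Rightarrow> 'b::euclidean_space)"
  shows "integrable M f"
proof (rule Bochner_Integration.integrable_bound)
  show "integrable M (\<lambda>x. (norm (f x))\<^sup>2 + 1)" using assms by (auto simp: L2_def)
  show "f \<in> borel_measurable M" using assms by (auto simp: L2_def)
  have "norm y \<le> (norm y)\<^sup>2 + 1" for y :: 'b
    using zero_le_power2[of "norm y - 1/2"] by (simp add: power2_diff field_simps)
  then show "AE x in M. norm (f x) \<le> norm ((norm (f x))\<^sup>2 + 1)" by auto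
qed

text \<open>Discriminant argument: the integral of |f + t g|^2 is a nonnegative polynomial of degree
  at most two in \<open>t\<close>.\<close>

lemma Cauchy_Schwarz_integral:
  assumes f: "L2 M f" and g: "L2 M g"
  shows "\<bar>LINT x|M. f x \<bullet> g x\<bar> \<le> sqrt (LINT x|M. (norm (f x))\<^sup>2) * sqrt (LINT x|M. (norm (g x))\<^sup>2)"
proof -
  define A where "A = (LINT x|M. (norm (f x))\<^sup>2)"
  define B where "B = (LINT x|M. f x \<bullet> g x)"
  define C where "C = (LINT x|M. (norm (g x))\<^sup>2)"
  have nonneg: "A \<ge> 0" "C \<ge> 0" by (auto simp: A_def C_def)
  have quad: "0 \<le> A + 2 * t * B + t\<^sup>2 * C" for t
  proof -
    have "0 \<le> (LINT x|M. (norm (f x + t *\<^sub>R g x))\<^sup>2)" by simp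
    also have "\<dots> = (LINT x|M. (norm (f x))\<^sup>2 + 2 * t * (f x \<bullet> g x) + t\<^sup>2 * (norm (g x))\<^sup>2)"
      by (intro Bochner_Integration.integral_cong refl)
        (simp only: power2_norm_eq_inner, simp add: inner_add_left inner_add_right inner_commute power2_eq_square algebra_simps)
    also have "\<dots> = A + 2 * t * B + t\<^sup>2 * C"
      using f g integrable_L2_inner[OF f g] unfolding A_def B_def C_def by (simp add: L2_def)
    finally show ?thesis .
  qed
  have "B\<^sup>2 \<le> A * C"
  proof (cases "C = 0")
    case True
    have "B = 0"
    proof (rule ccontr)
      assume "B \<noteq> 0"
      \<comment> \<open>Without leading coefficient the polynomial is affine in \<open>t\<close>; at
        this argument its value is -1.\<close>
      then show False using quad[of "- (A + 1) / (2 * B)"] True by (simp add: field_simps)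
    qed
    then show ?thesis using nonneg by simp
  next
    case False
    \<comment> \<open>The minimiser of the quadratic, where its value is A - B^2 / C.\<close>
    then show ?thesis using quad[of "- B / C"] nonneg by (simp add: field_simps power2_eq_square)
  qed
  then have "sqrt (B\<^sup>2) \<le> sqrt (A * C)" by (rule real_sqrt_le_mono)
  then show ?thesis by (simp add: A_def B_def C_def real_sqrt_mult)
qed

section \<open>Strong convergence of square-integrable functions\<close>

text \<open>Membership of all terms and of the limit is part of the notion: the integral of a
  non-integrable square is 0 by default, so the limit statement alone would say nothing.\<close>

definition L2_tendsto :: "'a measure \<Rightarrow> (nat \<Rightarrow> 'a \<Rightarrow> 'b::euclidean_space) \<Rightarrow> ('a \<Rightarrow> 'b) \<Rightarrow> bool" where
  "L2_tendsto M F f \<longleftrightarrow> (\<forall>k. L2 M (F k)) \<and> L2 M f \<and> (\<lambda>k. LINT x|M. (norm (F k x - f x))\<^sup>2) \<longlonglongrightarrow> 0"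

text \<open>F G - f g = (F - f)(G - g) + (F - f) g + f (G - g), and Cauchy-Schwarz bounds each term.
  Limits of the quadratic and bilinear forms below are taken through this.\<close>

lemma L2_tendsto_inner:
  assumes F: "L2_tendsto M F f" and G: "L2_tendsto M G g"
  shows "(\<lambda>k. LINT x|M. F k x \<bullet> G k x) \<longlonglongrightarrow> (LINT x|M. f x \<bullet> g x)"
proof -
  have L2: "L2 M (F k)" "L2 M f" "L2 M (G k)" "L2 M g" for k using F G by (auto simp: L2_tendsto_def)
  let ?n = "\<lambda>h. sqrt (LINT x|M. (norm (h x :: 'b))\<^sup>2)"
  have "(\<lambda>k. ?n (\<lambda>x. F k x - f x)) \<longlonglongrightarrow> 0" "(\<lambda>k. ?n (\<lambda>x. G k x - g x)) \<longlonglongrightarrow> 0"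
    using F G tendsto_real_sqrt[of _ 0] by (auto simp: L2_tendsto_def)
  then have lim: "(\<lambda>k. ?n (\<lambda>x. F k x - f x) * ?n (\<lambda>x. G k x - g x) + ?n (\<lambda>x. F k x - f x) * ?n g
      + ?n f * ?n (\<lambda>x. G k x - g x)) \<longlonglongrightarrow> 0 * 0 + 0 * ?n g + ?n f * 0"
    by (intro tendsto_intros)
  have "(\<lambda>k. (LINT x|M. F k x \<bullet> G k x) - (LINT x|M. f x \<bullet> g x)) \<longlonglongrightarrow> 0"
  proof (rule Lim_null_comparison[OF _ lim[simplified]], intro always_eventually allI)
    fix k
    have "(LINT x|M. F k x \<bullet> G k x) - (LINT x|M. f x \<bullet> g x) = (LINT x|M. F k x \<bullet> G k x - f x \<bullet> g x)"
      using L2 by (simp add: integrable_L2_inner)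
    also have "\<dots> = (LINT x|M. ((F k x - f x) \<bullet> (G k x - g x) + (F k x - f x) \<bullet> g x) + f x \<bullet> (G k x - g x))"
      by (intro Bochner_Integration.integral_cong refl) (simp add: algebra_simps)
    also have "\<dots> = (LINT x|M. (F k x - f x) \<bullet> (G k x - g x)) + (LINT x|M. (F k x - f x) \<bullet> g x)
        + (LINT x|M. f x \<bullet> (G k x - g x))"
      by (subst Bochner_Integration.integral_add Bochner_Integration.integrable_add;
          (intro Bochner_Integration.integrable_add integrable_L2_inner L2_diff L2)?)+ simp
    finally show "norm ((LINT x|M. F k x \<bullet> G k x) - (LINT x|M. f x \<bullet> g x)) \<le>
       ?n (\<lambda>x. F k x - f x) * ?n (\<lambda>x. G k x - g x) + ?n (\<lambda>x. F k x - f x) * ?n g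
      + ?n f * ?n (\<lambda>x. G k x - g x)"
      using Cauchy_Schwarz_integral[OF L2_diff[OF L2(1)[of k] L2(2)] L2_diff[OF L2(3)[of k] L2(4)]]
        Cauchy_Schwarz_integral[OF L2_diff[OF L2(1)[of k] L2(2)] L2(4)]
        Cauchy_Schwarz_integral[OF L2(2) L2_diff[OF L2(3)[of k] L2(4)]]
      by simp
  qed
  then show ?thesis by (simp add: LIM_zero_iff)
qed

lemma L2_tendsto_const: "L2 M f \<Longrightarrow> L2_tendsto M (\<lambda>_. f) f"
  by (simp add: L2_tendsto_def)

lemma L2_tendsto_bounded_scaleR:
  fixes f :: "'a \<Rightarrow> 'b::euclidean_space"
  assumes F: "L2_tendsto M F f" and c: "c \<in> borel_measurable M" "AE x in M. \<bar>c x\<bar> \<le> (B::real)"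
  shows "L2_tendsto M (\<lambda>k x. c x *\<^sub>R F k x) (\<lambda>x. c x *\<^sub>R f x)"
  unfolding L2_tendsto_def
proof (intro conjI allI)
  have L2: "L2 M (F k)" "L2 M f" for k using F by (auto simp: L2_tendsto_def)
  show "L2 M (\<lambda>x. c x *\<^sub>R F k x)" "L2 M (\<lambda>x. c x *\<^sub>R f x)" for k
    using L2 c by (auto intro: L2_bounded_scaleR)
  have lim: "(\<lambda>k. B\<^sup>2 * (LINT x|M. (norm (F k x - f x))\<^sup>2)) \<longlonglongrightarrow> 0"
    using F by (intro tendsto_mult_right_zero) (auto simp: L2_tendsto_def)
  show "(\<lambda>k. LINT x|M. (norm (c x *\<^sub>R F k x - c x *\<^sub>R f x))\<^sup>2) \<longlonglongrightarrow> 0"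
  proof (rule Lim_null_comparison[OF _ lim], intro always_eventually allI)
    fix k
    have "(LINT x|M. (norm (c x *\<^sub>R F k x - c x *\<^sub>R f x))\<^sup>2) \<le> (LINT x|M. B\<^sup>2 * (norm (F k x - f x))\<^sup>2)"
    proof (rule integral_mono_AE)
      show "integrable M (\<lambda>x. (norm (c x *\<^sub>R F k x - c x *\<^sub>R f x))\<^sup>2)"
        using L2_integrable[OF L2_bounded_scaleR[OF L2_diff[OF L2] c]] by (simp add: scaleR_diff_right)
      show "integrable M (\<lambda>x. B\<^sup>2 * (norm (F k x - f x))\<^sup>2)" using L2_integrable[OF L2_diff[OF L2]] by simp
      show "AE x in M. (norm (c x *\<^sub>R F k x - c x *\<^sub>R f x))\<^sup>2 \<le> B\<^sup>2 * (norm (F k x - f x))\<^sup>2"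
        using c(2)
      proof eventually_elim
        case (elim x)
        then have "\<bar>c x\<bar>\<^sup>2 \<le> B\<^sup>2" by (intro power_mono) auto
        then show ?case
          by (simp flip: scaleR_diff_right add: power_mult_distrib mult_right_mono)
      qed
    qed
    then show "norm (LINT x|M. (norm (c x *\<^sub>R F k x - c x *\<^sub>R f x))\<^sup>2) \<le> B\<^sup>2 * (LINT x|M. (norm (F k x - f x))\<^sup>2)"
      by simp
  qed
qed

lemma L2_tendsto_add:
  assumes F: "L2_tendsto M F f" and G: "L2_tendsto M G g"
  shows "L2_tendsto M (\<lambda>k x. F k x + G k x) (\<lambda>x. f x + g x)"
  unfolding L2_tendsto_def
proof (intro conjI allI)
  have L2: "L2 M (F k)" "L2 M f" "L2 M (G k)" "L2 M g" for k using F G by (auto simp: L2_tendsto_def)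
  show "L2 M (\<lambda>x. F k x + G k x)" "L2 M (\<lambda>x. f x + g x)" for k using L2 by (auto intro: L2_add)
  have lim: "(\<lambda>k. 2 * (LINT x|M. (norm (F k x - f x))\<^sup>2) + 2 * (LINT x|M. (norm (G k x - g x))\<^sup>2)) \<longlonglongrightarrow> 0"
    using F G by (auto simp: L2_tendsto_def intro!: tendsto_add_zero tendsto_mult_right_zero)
  show "(\<lambda>k. LINT x|M. (norm (F k x + G k x - (f x + g x)))\<^sup>2) \<longlonglongrightarrow> 0"
  proof (rule Lim_null_comparison[OF _ lim], intro always_eventually allI)
    fix k
    have "(LINT x|M. (norm (F k x + G k x - (f x + g x)))\<^sup>2) \<le>
      (LINT x|M. 2 * (norm (F k x - f x))\<^sup>2 + 2 * (norm (G k x - g x))\<^sup>2)"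
    proof (rule integral_mono)
      show "integrable M (\<lambda>x. (norm (F k x + G k x - (f x + g x)))\<^sup>2)"
        using L2 by (intro L2_integrable L2_diff L2_add)
      show "integrable M (\<lambda>x. 2 * (norm (F k x - f x))\<^sup>2 + 2 * (norm (G k x - g x))\<^sup>2)"
        using L2_integrable[OF L2_diff[OF L2(1,2)]] L2_integrable[OF L2_diff[OF L2(3,4)]] by simp
      show "(norm (F k x + G k x - (f x + g x)))\<^sup>2 \<le> 2 * (norm (F k x - f x))\<^sup>2 + 2 * (norm (G k x - g x))\<^sup>2" for x
        using norm_add_power2_le[of "F k x - f x" "G k x - g x"] by (simp add: algebra_simps)
    qed
    also have "\<dots> = 2 * (LINT x|M. (norm (F k x - f x))\<^sup>2) + 2 * (LINT x|M. (norm (G k x - g x))\<^sup>2)"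
      using L2_integrable[OF L2_diff[OF L2(1,2)]] L2_integrable[OF L2_diff[OF L2(3,4)]] by simp
    finally show "norm (LINT x|M. (norm (F k x + G k x - (f x + g x)))\<^sup>2) \<le>
       2 * (LINT x|M. (norm (F k x - f x))\<^sup>2) + 2 * (LINT x|M. (norm (G k x - g x))\<^sup>2)" by simp
  qed
qed

lemma L2_tendsto_cong_AE:
  assumes F: "L2_tendsto M F f" and fg: "AE x in M. f x = g x" "g \<in> borel_measurable M"
  shows "L2_tendsto M F g"
proof -
  have L2: "L2 M (F k)" "L2 M f" for k using F by (auto simp: L2_tendsto_def)
  have g: "L2 M g" using L2_cong_AE[OF L2(2) fg] .
  have "(LINT x|M. (norm (F k x - g x))\<^sup>2) = (LINT x|M. (norm (F k x - f x))\<^sup>2)" for k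
    by (rule integral_cong_AE) (use L2(1)[of k] L2(2) fg in \<open>auto simp: L2_def elim: eventually_mono\<close>)
  then show ?thesis using F g by (simp add: L2_tendsto_def)
qed

text \<open>Subtracting the sequence from itself leaves the zero sequence, which converges to f -
  g.\<close>

lemma L2_tendsto_unique:
  assumes F: "L2_tendsto M F f" and G: "L2_tendsto M F g"
  shows "AE x in M. f x = g x"
proof -
  have L2: "L2 M f" "L2 M g" using F G by (auto simp: L2_tendsto_def)
  have "L2_tendsto M (\<lambda>k x. F k x + (-1) *\<^sub>R F k x) (\<lambda>x. f x + (-1) *\<^sub>R g x)"
    by (intro L2_tendsto_add L2_tendsto_bounded_scaleR[where B=1] F G) auto
  then have "L2_tendsto M (\<lambda>k x. 0) (\<lambda>x. f x - g x)" by simp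
  then have "(\<lambda>k::nat. LINT x|M. (norm (f x - g x))\<^sup>2) \<longlonglongrightarrow> 0" by (simp add: L2_tendsto_def norm_minus_commute)
  then have "(LINT x|M. (norm (f x - g x))\<^sup>2) = 0" by (simp add: LIMSEQ_const_iff)
  then have "AE x in M. (norm (f x - g x))\<^sup>2 = 0"
    using L2_integrable[OF L2_diff[OF L2]] by (subst (asm) integral_nonneg_eq_0_iff_AE) auto
  then show ?thesis by (auto elim: eventually_mono)
qed

lemma L2_continuous_bounded_set:
  fixes f :: "'a::euclidean_space \<Rightarrow> 'b::euclidean_space"
  assumes "continuous_on UNIV f" "bounded \<Omega>" "\<Omega> \<in> sets lebesgue"
  shows "L2 (lebesgue_on \<Omega>) f"
proof -
  interpret finite_measure "lebesgue_on \<Omega>"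
    using assms(2,3) by (intro finite_measure_lebesgue_on bounded_set_imp_lmeasurable)
  have "compact (f ` closure \<Omega>)"
    using assms by (intro compact_continuous_image continuous_on_subset[OF assms(1)]) (auto simp: compact_closure)
  then obtain B where B: "\<And>y. y \<in> f ` closure \<Omega> \<Longrightarrow> norm y \<le> B" "B > 0"
    using compact_imp_bounded bounded_pos by metis
  show ?thesis
  proof (rule L2_dominated[where w="\<lambda>_. B\<^sup>2"])
    have "f \<in> borel_measurable borel" using assms(1) by (rule borel_measurable_continuous_onI)
    then have "f \<in> borel_measurable lebesgue" by (simp add: measurable_completion)
    then show "f \<in> borel_measurable (lebesgue_on \<Omega>)" by (rule measurable_restrict_space1)
    have "(norm (f x))\<^sup>2 \<le> B\<^sup>2" if "x \<in> \<Omega>" for x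
      using B(1)[of "f x"] that closure_subset by (intro power_mono) auto
    then show "AE x in lebesgue_on \<Omega>. (norm (f x))\<^sup>2 \<le> B\<^sup>2" by (intro AE_I2) auto
  qed auto
qed

section \<open>Weak gradients\<close>

lemma integral_lebesgue_on_borel:
  fixes f :: "'a::euclidean_space \<Rightarrow> 'b::{banach, second_countable_topology}"
  assumes "\<Omega> \<in> sets borel" "f \<in> borel_measurable borel"
  shows "integral\<^sup>L (lebesgue_on \<Omega>) f = (LINT x|lborel. indicator \<Omega> x *\<^sub>R f x)"
  using assms by (simp add: integral_restrict_space integral_completion)

lemma continuous_on_UNIV_borel: "continuous_on UNIV f \<Longrightarrow> f \<in> borel_measurable borel"
  by (rule borel_measurable_continuous_onI)

lemma integrable_continuous_compact_support:
  fixes f :: "'a::euclidean_space \<Rightarrow> 'b::{banach, second_countable_topology}"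
  assumes "continuous_on UNIV f" "compact K" "\<And>x. x \<notin> K \<Longrightarrow> f x = 0"
  shows "integrable lborel f"
proof -
  have "integrable lborel (\<lambda>x. indicator K x *\<^sub>R f x)"
    using assms by (intro borel_integrable_compact) (auto intro: continuous_on_subset)
  moreover have "(\<lambda>x. indicator K x *\<^sub>R f x) = f"
    using assms(3) by (auto simp: indicator_def fun_eq_iff)
  ultimately show ?thesis by simp
qed

lemma bounded_continuous_compact_support:
  fixes f :: "'a::euclidean_space \<Rightarrow> 'b::real_normed_vector"
  assumes "continuous_on UNIV f" "compact K" "\<And>x. x \<notin> K \<Longrightarrow> f x = 0"
  obtains B where "\<And>x. norm (f x) \<le> B" "B > 0"
proof -
  have "compact (f ` K)" using assms by (intro compact_continuous_image) (auto intro: continuous_on_subset)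
  then obtain B where "\<And>y. y \<in> f ` K \<Longrightarrow> norm y \<le> B" "B > 0"
    using compact_imp_bounded bounded_pos by metis
  then have "norm (f x) \<le> B" for x using assms(3)[of x] by (cases "x \<in> K") auto
  then show thesis using \<open>B > 0\<close> that by blast
qed

section \<open>Integration by parts against test functions\<close>

lemma integral_lborel_translation:
  fixes f :: "'a::euclidean_space \<Rightarrow> real"
  assumes "f \<in> borel_measurable borel"
  shows "(LINT x|lborel. f (x + c)) = (LINT x|lborel. f x)"
proof -
  have "lborel = distr lborel borel (\<lambda>x. c + (x::'a))"
    using lborel_affine[of 1 c] by (simp add: density_1)
  then have "(LINT x|lborel. f x) = (LINT x|distr lborel borel (\<lambda>x. c + x). f x)" by simp
  also have "\<dots> = (LINT x|lborel. f (c + x))" using assms by (intro integral_distr) auto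
  finally show ?thesis by (simp add: add.commute)
qed

text \<open>Translation invariance makes the integral of every difference quotient zero. The
  quotients converge to the directional derivative and are dominated, through a Lipschitz bound, by
  a constant on a fixed ball.\<close>

lemma integral_gradient_eq_0:
  fixes u :: "'a::euclidean_space \<Rightarrow> real"
  assumes u: "u \<in> test_functions UNIV"
  shows "(LINT x|lborel. gradient u x \<bullet> b) = 0"
proof -
  define K where "K = spt u"
  have K: "compact K" using test_functionsD(2)[OF u] by (simp add: K_def)
  obtain M where M: "\<And>x. x \<in> K \<Longrightarrow> norm x \<le> M" "M > 0"
    using compact_imp_bounded[OF K] bounded_pos by metis
  obtain B where B: "\<And>x. norm (gradient u x) \<le> B" "B > 0"
    using bounded_continuous_compact_support[OF test_functions_continuous_gradient[OF u] K] gradient_spt K_def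
    by metis
  have cu: "continuous_on UNIV u" using test_functions_continuous[OF u] .
  have [measurable]: "u \<in> borel_measurable borel" using cu by (rule continuous_on_UNIV_borel)
  have der: "(u has_derivative (\<lambda>y. gradient u x \<bullet> y)) (at x)" for x
    using test_functions_differentiable[OF u] by (rule gradient_has_derivative)
  have lip: "norm (u y - u x) \<le> B * norm (y - x)" for x y
  proof (rule differentiable_bound[of UNIV])
    show "(u has_derivative (\<lambda>y. gradient u x \<bullet> y)) (at x within UNIV)" for x using der by simp
    show "onorm (\<lambda>y. gradient u x \<bullet> y) \<le> B" for x
    proof (rule onorm_le)
      show "norm (gradient u x \<bullet> y) \<le> B * norm y" for y
        using Cauchy_Schwarz_ineq2[of "gradient u x" y] B(1)[of x] mult_right_mono[of "norm (gradient u x)" B "norm y"]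
        by simp
    qed
  qed auto
  define t where "t k = 1 / real (Suc k)" for k
  have t: "0 < t k" "t k \<le> 1" for k by (auto simp: t_def)
  have t0: "t \<longlonglongrightarrow> 0" unfolding t_def using LIMSEQ_inverse_real_of_nat by (simp add: inverse_eq_divide)
  \<comment> \<open>The increments \<open>t k\<close> are at most 1, so outside this radius both
    \<open>u x\<close> and \<open>u (x + t k *\<^sub>R b)\<close> vanish.\<close>
  define N where "N = M + norm b"
  have out: "u x = 0" if "x \<notin> cball 0 M" for x
    using that M spt_not_in[of x u] by (force simp: K_def)
  have "(\<lambda>k. LINT x|lborel. (u (x + t k *\<^sub>R b) - u x) / t k) \<longlonglongrightarrow> (LINT x|lborel. gradient u x \<bullet> b)"
  proof (rule integral_dominated_convergence[where w="\<lambda>x. (B * norm b) * indicator (cball 0 N) x"])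
    show "(\<lambda>x. gradient u x \<bullet> b) \<in> borel_measurable lborel"
      using continuous_on_UNIV_borel[OF test_functions_continuous_gradient[OF u]] by simp
    show "integrable lborel (\<lambda>x::'a. B * norm b * indicator (cball 0 N) x)"
      using emeasure_lborel_cball_finite[of 0 N] by (intro integrable_mult_right integrable_real_indicator) auto
    show "AE x in lborel. (\<lambda>k. (u (x + t k *\<^sub>R b) - u x) / t k) \<longlonglongrightarrow> gradient u x \<bullet> b"
    proof (rule AE_I2)
      fix x
      have "((\<lambda>s. u (x + s *\<^sub>R b)) has_derivative (\<lambda>s. gradient u x \<bullet> (s *\<^sub>R b))) (at 0)"
        by (rule has_derivative_compose[of "\<lambda>s. x + s *\<^sub>R b" _ _ UNIV u, simplified])
          (use der[of x] in \<open>auto intro!: derivative_eq_intros\<close>)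
      then have "((\<lambda>s. u (x + s *\<^sub>R b)) has_real_derivative (gradient u x \<bullet> b)) (at 0)"
        by (simp add: has_field_derivative_def mult.commute[of _ "gradient u x \<bullet> b"])
      then have "((\<lambda>s. (u (x + s *\<^sub>R b) - u x) / s) \<longlongrightarrow> gradient u x \<bullet> b) (at 0)"
        by (simp add: has_field_derivative_iff)
      moreover have "filterlim t (at 0) sequentially"
        using t0 t(1) by (auto simp: filterlim_at intro!: always_eventually) (metis less_irrefl)
      ultimately show "(\<lambda>k. (u (x + t k *\<^sub>R b) - u x) / t k) \<longlonglongrightarrow> gradient u x \<bullet> b"
        by (rule filterlim_compose)
    qed
    show "AE x in lborel. norm ((u (x + t k *\<^sub>R b) - u x) / t k) \<le> B * norm b * indicator (cball 0 N) x" for k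
    proof (rule AE_I2)
      fix x
      show "norm ((u (x + t k *\<^sub>R b) - u x) / t k) \<le> B * norm b * indicator (cball 0 N) x"
      proof (cases "x \<in> cball 0 N")
        case True
        have "norm (u (x + t k *\<^sub>R b) - u x) \<le> B * (t k * norm b)"
          using lip[of "x + t k *\<^sub>R b" x] t(1)[of k] by simp
        then show ?thesis using True t(1)[of k] by (simp add: field_simps)
      next
        case False
        then have x: "norm x > M + norm b" by (simp add: N_def)
        have "t k * norm b \<le> norm b" using t(2)[of k] by (simp add: mult_left_le_one_le t(1) less_imp_le)
        moreover have "norm x \<le> norm (x + t k *\<^sub>R b) + t k * norm b"
          using norm_triangle_ineq4[of "x + t k *\<^sub>R b" "t k *\<^sub>R b"] t(1)[of k] by simp
        ultimately have "norm (x + t k *\<^sub>R b) > M" using x by linarith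
        moreover have "norm x > M" using x norm_ge_zero[of b] by linarith
        ultimately have "u (x + t k *\<^sub>R b) = 0" "u x = 0" using out by auto
        then show ?thesis using B by (simp add: indicator_def)
      qed
    qed
  qed auto
  moreover have "(LINT x|lborel. (u (x + t k *\<^sub>R b) - u x) / t k) = 0" for k
  proof -
    have i: "integrable lborel u" using integrable_continuous_compact_support[OF cu K] spt_not_in K_def by metis
    have "integrable (distr lborel borel (\<lambda>x. t k *\<^sub>R b + x)) u"
      using i lborel_affine[of 1 "t k *\<^sub>R b"] by (simp add: density_1)
    then have "integrable lborel (\<lambda>x. u (t k *\<^sub>R b + x))" by (subst (asm) integrable_distr_eq) auto
    then have "(LINT x|lborel. u (x + t k *\<^sub>R b) - u x) = 0"
      using i integral_lborel_translation[of u "t k *\<^sub>R b"] by (simp add: add.commute)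
    then show ?thesis by simp
  qed
  ultimately have "(\<lambda>k::nat. 0) \<longlonglongrightarrow> (LINT x|lborel. gradient u x \<bullet> b)" by (simp only:)
  then show ?thesis by (simp only: LIMSEQ_const_iff)
qed

lemma spt_mult_test:
  assumes "\<phi> \<in> test_functions \<Omega>" "\<And>k. C_k k w"
  shows "(\<lambda>x. w x * \<phi> x) \<in> test_functions UNIV"
  using test_functions_mult'[OF assms] test_functions_mono[of \<Omega> UNIV] by auto

text \<open>The product \<open>w x * \<phi> x\<close> is smooth with compact support, so its
  gradient integrates to zero; the product rule splits this into the two integrals of the
  definition.\<close>

lemma is_weak_gradient_smooth:
  fixes w :: "'a::euclidean_space \<Rightarrow> real"
  assumes w: "\<And>k. C_k k w" and \<Omega>: "open \<Omega>" "bounded \<Omega>"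
  shows "is_weak_gradient \<Omega> w (gradient w)"
  unfolding is_weak_gradient_def
proof (intro conjI ballI)
  have cgw: "continuous_on UNIV (gradient w)" using w by (intro C_1_continuous_gradient)
  have cw: "continuous_on UNIV w" using w C_k_continuous by blast
  have [measurable]: "\<Omega> \<in> sets borel" using \<Omega> by auto
  show "L2 (lebesgue_on \<Omega>) (gradient w)"
    using \<Omega> cgw by (intro L2_continuous_bounded_set) auto
  fix \<phi> assume \<phi>: "\<phi> \<in> test_functions \<Omega>"
  have c\<phi>: "continuous_on UNIV \<phi>" "continuous_on UNIV (gradient \<phi>)"
    using \<phi> test_functions_continuous test_functions_continuous_gradient by auto
  have dw: "w differentiable (at x)" for x using w[of "Suc 0"] by auto
  have d\<phi>: "\<phi> differentiable (at x)" for x using test_functions_differentiable[OF \<phi>] .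
  have [measurable]: "w \<in> borel_measurable borel" "\<phi> \<in> borel_measurable borel"
    "gradient w \<in> borel_measurable borel" "gradient \<phi> \<in> borel_measurable borel"
    using c\<phi> cw cgw by (auto intro: continuous_on_UNIV_borel)
  have out: "\<phi> x = 0" "gradient \<phi> x = 0" if "x \<notin> spt \<phi>" for x
    using spt_not_in[OF that] gradient_spt[OF that] by auto
  have sub: "spt \<phi> \<subseteq> \<Omega>" "compact (spt \<phi>)" using test_functionsD[OF \<phi>] by auto
  have i1: "integrable lborel (\<lambda>x. w x *\<^sub>R gradient \<phi> x)"
    by (rule integrable_continuous_compact_support[OF _ sub(2)]) (use c\<phi> cw out in \<open>auto intro!: continuous_intros\<close>)
  have i2: "integrable lborel (\<lambda>x. \<phi> x *\<^sub>R gradient w x)"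
    by (rule integrable_continuous_compact_support[OF _ sub(2)]) (use c\<phi> cgw out in \<open>auto intro!: continuous_intros\<close>)
  have e1: "(\<lambda>x. indicator \<Omega> x *\<^sub>R (w x *\<^sub>R gradient \<phi> x)) = (\<lambda>x. w x *\<^sub>R gradient \<phi> x)"
    using sub out by (auto simp: fun_eq_iff indicator_def)
  have e2: "(\<lambda>x. indicator \<Omega> x *\<^sub>R (\<phi> x *\<^sub>R gradient w x)) = (\<lambda>x. \<phi> x *\<^sub>R gradient w x)"
    using sub out by (auto simp: fun_eq_iff indicator_def)
  have "(LINT x|lborel. w x *\<^sub>R gradient \<phi> x) + (LINT x|lborel. \<phi> x *\<^sub>R gradient w x) = 0"
  proof (rule euclidean_eqI)
    fix b :: 'a assume "b \<in> Basis"
    have "((LINT x|lborel. w x *\<^sub>R gradient \<phi> x) + (LINT x|lborel. \<phi> x *\<^sub>R gradient w x)) \<bullet> b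
      = (LINT x|lborel. (w x *\<^sub>R gradient \<phi> x + \<phi> x *\<^sub>R gradient w x) \<bullet> b)"
      using i1 i2 by simp
    also have "\<dots> = (LINT x|lborel. gradient (\<lambda>x. w x * \<phi> x) x \<bullet> b)"
      using gradient_mult[OF dw d\<phi>] by simp
    also have "\<dots> = 0" by (rule integral_gradient_eq_0[OF spt_mult_test[OF \<phi> w]])
    finally show "((LINT x|lborel. w x *\<^sub>R gradient \<phi> x) + (LINT x|lborel. \<phi> x *\<^sub>R gradient w x)) \<bullet> b = 0 \<bullet> b"
      by simp
  qed
  then show "(LINT x|lebesgue_on \<Omega>. w x *\<^sub>R gradient \<phi> x) = - (LINT x|lebesgue_on \<Omega>. \<phi> x *\<^sub>R gradient w x)"
    by (simp add: integral_lebesgue_on_borel e1 e2 eq_neg_iff_add_eq_0 del: scaleR_scaleR)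
qed

section \<open>The fundamental lemma of the calculus of variations\<close>

text \<open>The positive and the negative part of \<open>f\<close> are densities of two measures
  that agree on boxes, an intersection-stable generator. Hence the parts are equal almost
  everywhere, and they are never both positive.\<close>

lemma AE_eq_0_if_integral_boxes_eq_0:
  fixes f :: "'a::euclidean_space \<Rightarrow> real"
  assumes f: "integrable lborel f" and boxes: "\<And>l h. (LINT x|lborel. indicator (box l h) x * f x) = 0"
  shows "AE x in lborel. f x = 0"
proof -
  have [measurable]: "f \<in> borel_measurable borel" using f by auto
  define p where "p x = ennreal (f x)" for x
  define q where "q x = ennreal (- f x)" for x
  have [measurable]: "p \<in> borel_measurable borel" "q \<in> borel_measurable borel"
    by (auto simp: p_def[abs_def] q_def[abs_def])
  have eq: "emeasure (density lborel p) (box l h) = emeasure (density lborel q) (box l h)" for l h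
  proof -
    have i: "integrable lborel (\<lambda>x. indicator (box l h) x * f x)"
      using integrable_mult_indicator[of "box l h" lborel f] f by simp
    have "(\<integral>\<^sup>+x. ennreal (indicator (box l h) x * f x) \<partial>lborel) = (\<integral>\<^sup>+x. ennreal (- (indicator (box l h) x * f x)) \<partial>lborel)"
    proof -
      have fin: "(\<integral>\<^sup>+x. ennreal (indicator (box l h) x * f x) \<partial>lborel) \<noteq> \<infinity>"
        "(\<integral>\<^sup>+x. ennreal (- (indicator (box l h) x * f x)) \<partial>lborel) \<noteq> \<infinity>"
        using i by (auto simp: real_integrable_def)
      have "enn2real (\<integral>\<^sup>+x. ennreal (indicator (box l h) x * f x) \<partial>lborel) =
        enn2real (\<integral>\<^sup>+x. ennreal (- (indicator (box l h) x * f x)) \<partial>lborel)"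
        using real_lebesgue_integral_def[OF i] boxes[of l h] by simp
      then have "ennreal (enn2real (\<integral>\<^sup>+x. ennreal (indicator (box l h) x * f x) \<partial>lborel)) =
        ennreal (enn2real (\<integral>\<^sup>+x. ennreal (- (indicator (box l h) x * f x)) \<partial>lborel))" by (rule arg_cong)
      then show ?thesis using fin
        by (subst (asm) (1 2) ennreal_enn2real) (simp_all only: infinity_ennreal_def top.not_eq_extremum)
    qed
    moreover have "ennreal (indicator (box l h) x * f x) = p x * indicator (box l h) x"
      "ennreal (- (indicator (box l h) x * f x)) = q x * indicator (box l h) x" for x
      by (auto simp: indicator_def p_def q_def)
    ultimately show ?thesis by (simp add: emeasure_density)
  qed
  have "density lborel p = density lborel q"
  proof (rule measure_eqI_generator_eq)
    let ?E = "range (\<lambda>(a, b). box a b::'a set)"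
    show "Int_stable ?E" by (auto simp: Int_stable_def box_Int_box)
    show "?E \<subseteq> Pow UNIV" "sets (density lborel p) = sigma_sets UNIV ?E" "sets (density lborel q) = sigma_sets UNIV ?E"
      by (simp_all add: borel_eq_box)
    let ?A = "\<lambda>n::nat. box (- (real n *\<^sub>R One)) (real n *\<^sub>R One) :: 'a set"
    show "range ?A \<subseteq> ?E" "(\<Union>i. ?A i) = UNIV" unfolding UN_box_eq_UNIV by auto
    show "emeasure (density lborel p) (?A i) \<noteq> \<infinity>" for i
    proof -
      have "emeasure (density lborel p) (?A i) \<le> (\<integral>\<^sup>+x. ennreal (f x) \<partial>lborel)"
        by (auto simp: emeasure_density p_def indicator_def intro!: nn_integral_mono)
      then show ?thesis using f by (auto simp: real_integrable_def top_unique)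
    qed
    show "emeasure (density lborel p) X = emeasure (density lborel q) X" if "X \<in> ?E" for X
      using that eq by auto
  qed
  then have "AE x in lborel. p x = q x"
    by (intro sigma_finite_measure.density_unique[OF lborel.sigma_finite_measure_axioms]) auto
  then show ?thesis
  proof eventually_elim
    case (elim x)
    then show ?case
      by (cases "f x" "0::real" rule: linorder_cases) (auto simp: p_def q_def ennreal_eq_0_iff ennreal_neg)
  qed
qed

text \<open>Smooth functions built from a bump tend to the indicator of its box, which reduces the
  claim to boxes inside \<Omega>; countably many of them cover \<Omega>.\<close>

lemma AE_eq_0_if_integral_test_functions_eq_0:
  fixes f :: "'a::euclidean_space \<Rightarrow> real"
  assumes \<Omega>: "open \<Omega>" and f: "integrable lborel f"
    and test: "\<And>\<phi>. \<phi> \<in> test_functions \<Omega> \<Longrightarrow> (LINT x|lborel. \<phi> x * f x) = 0"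
  shows "AE x in lborel. x \<in> \<Omega> \<longrightarrow> f x = 0"
proof -
  have [measurable]: "f \<in> borel_measurable borel" using f by auto
  have box0: "(LINT x|lborel. indicator (box l h) x * f x) = 0" if "cbox l h \<subseteq> \<Omega>" for l h
  proof -
    \<comment> \<open>Smooth, with values in [0, 1], zero off the box, and tending to 1 wherever the
      bump is positive, since 1 - bump is less than 1 there.\<close>
    define \<phi> where "\<phi> k x = 1 - (1 - box_bump l h x) ^ k" for k :: nat and x
    have ck: "C_k j (\<phi> k)" for j k
      unfolding \<phi>_def[abs_def] by (intro C_k_minus C_k_const C_k_power C_k_box_bump)
    have [measurable]: "\<phi> k \<in> borel_measurable borel" for k
      using C_k_continuous[OF ck] by (rule continuous_on_UNIV_borel)
    have bd: "0 \<le> \<phi> k x" "\<phi> k x \<le> 1" for k x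
      using box_bump_bounds[of l h x] by (auto simp: \<phi>_def intro!: power_le_one)
    have lim: "(\<lambda>k. \<phi> k x) \<longlonglongrightarrow> indicator (box l h) x" for x
    proof (cases "x \<in> box l h")
      case True
      then have "norm (1 - box_bump l h x) < 1"
        using box_bump_bounds[of l h x] box_bump_pos_iff[of l h x] by simp
      then have "(\<lambda>k. (1 - box_bump l h x) ^ k) \<longlonglongrightarrow> 0" by (rule LIMSEQ_power_zero)
      then have "(\<lambda>k. 1 - (1 - box_bump l h x) ^ k) \<longlonglongrightarrow> 1 - 0" by (intro tendsto_diff tendsto_const)
      then show ?thesis using True by (simp add: \<phi>_def)
    next
      case False
      then have "\<phi> k x = 0" for k using box_bump_eq_0_iff[of l h x] by (simp add: \<phi>_def)
      then show ?thesis using False by simp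
    qed
    have "\<phi> k \<in> test_functions \<Omega>" for k
      by (rule test_functions_boxI[OF ck _ that]) (simp add: \<phi>_def box_bump_eq_0_iff[THEN iffD2])
    then have "(LINT x|lborel. \<phi> k x * f x) = 0" for k by (rule test)
    moreover have "(\<lambda>k. LINT x|lborel. \<phi> k x * f x) \<longlonglongrightarrow> (LINT x|lborel. indicator (box l h) x * f x)"
    proof (rule integral_dominated_convergence[where w="\<lambda>x. norm (f x)"])
      show "AE x in lborel. (\<lambda>k. \<phi> k x * f x) \<longlonglongrightarrow> indicator (box l h) x * f x"
        using lim by (auto intro!: tendsto_intros)
      show "AE x in lborel. norm (\<phi> k x * f x) \<le> norm (f x)" for k
        using bd[of k] by (auto simp: abs_mult intro!: mult_left_le_one_le)
    qed (use f in auto)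
    ultimately show ?thesis by (simp add: LIMSEQ_const_iff)
  qed
  have AE_box: "AE x in lborel. x \<in> box l h \<longrightarrow> f x = 0" if "cbox l h \<subseteq> \<Omega>" for l h
  proof -
    have "AE x in lborel. indicator (box l h) x * f x = 0"
    proof (rule AE_eq_0_if_integral_boxes_eq_0)
      show "integrable lborel (\<lambda>x. indicator (box l h) x * f x)"
        using integrable_mult_indicator[of "box l h" lborel f] f by simp
      fix l' h'
      have "\<exists>l'' h''. box l' h' \<inter> box l h = box l'' h''" unfolding box_Int_box by blast
      then obtain l'' h'' where b: "box l' h' \<inter> box l h = box l'' h''" by blast
      have "(LINT x|lborel. indicator (box l'' h'') x * f x) = 0"
      proof (cases "box l'' h'' = {}")
        case True
        then show ?thesis by simp
      next
        case False
        then have "cbox l'' h'' \<subseteq> cbox l h"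
          using b closure_box[of l'' h''] closure_mono[of "box l'' h''" "cbox l h"] box_subset_cbox[of l h] by auto
        then show ?thesis using box0 that by blast
      qed
      moreover have "indicator (box l' h') x * (indicator (box l h) x * f x) = indicator (box l'' h'') x * f x" for x
        unfolding b[symmetric] by (auto simp: indicator_def)
      ultimately show "(LINT x|lborel. indicator (box l' h') x * (indicator (box l h) x * f x)) = 0" by (simp only:)
    qed
    then show ?thesis by (rule eventually_mono) (auto simp: indicator_def split: if_splits)
  qed
  \<comment> \<open>The covering boxes are closed, while the statement obtained so far concerns open
    boxes; the faces in between are negligible.\<close>
  obtain D where D: "countable D" "\<And>X. X \<in> D \<Longrightarrow> \<exists>a b. X = cbox a b" "D \<subseteq> Pow \<Omega>" "\<Union>D = \<Omega>"
    using open_countable_Union_open_cbox[OF \<Omega>] by metis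
  have "AE x in lborel. x \<in> X \<longrightarrow> f x = 0" if XD: "X \<in> D" for X
  proof -
    obtain a b where X: "X = cbox a b" using D(2) XD by blast
    then have "cbox a b \<subseteq> \<Omega>" using D(3) XD by auto
    then have "AE x in lborel. x \<in> box a b \<longrightarrow> f x = 0" by (rule AE_box)
    moreover have "AE x in lborel. x \<notin> cbox a b - box a b"
    proof -
      have "cbox a b - box a b \<in> null_sets lebesgue"
        using negligible_frontier_interval[of a b] by (simp add: negligible_iff_null_sets)
      then have "cbox a b - box a b \<in> null_sets lborel"
        by (simp add: null_sets_def)
      then show ?thesis by (rule AE_not_in)
    qed
    ultimately show ?thesis by eventually_elim (auto simp: X)
  qed
  then have "AE x in lborel. \<forall>X\<in>D. x \<in> X \<longrightarrow> f x = 0" using D(1) by (intro AE_ball_countable[THEN iffD2] ballI)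
  then show ?thesis by eventually_elim (use D(4) in auto)
qed

lemma finite_measure_bounded_open:
  fixes \<Omega> :: "'a::euclidean_space set"
  assumes "open \<Omega>" "bounded \<Omega>"
  shows "finite_measure (lebesgue_on \<Omega>)"
  using assms by (intro finite_measure_lebesgue_on bounded_set_imp_lmeasurable) auto

lemma L2_test:
  fixes w :: "'a::euclidean_space \<Rightarrow> real"
  assumes "\<And>k. C_k k w" "open \<Omega>" "bounded \<Omega>"
  shows "L2 (lebesgue_on \<Omega>) w" "L2 (lebesgue_on \<Omega>) (gradient w)"
  using assms C_k_continuous[OF assms(1)] C_1_continuous_gradient[OF assms(1)] 
  by (auto intro!: L2_continuous_bounded_set)

lemma integrable_test_scaleR:
  fixes g :: "'a::euclidean_space \<Rightarrow> 'b::euclidean_space"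
  assumes "\<phi> \<in> test_functions \<Omega>'" "integrable (lebesgue_on \<Omega>) g"
  shows "integrable (lebesgue_on \<Omega>) (\<lambda>x. \<phi> x *\<^sub>R g x)"
proof -
  obtain B where B: "\<And>x. norm (\<phi> x) \<le> B" "B > 0"
    using bounded_continuous_compact_support[OF test_functions_continuous[OF assms(1)] test_functionsD(2)[OF assms(1)]]
      spt_not_in by metis
  have m: "\<phi> \<in> borel_measurable (lebesgue_on \<Omega>)"
    using continuous_on_UNIV_borel[OF test_functions_continuous[OF assms(1)]]
    by (intro measurable_restrict_space1 measurable_completion) simp
  show ?thesis
  proof (rule Bochner_Integration.integrable_bound)
    show "integrable (lebesgue_on \<Omega>) (\<lambda>x. B * norm (g x))" using assms(2) by auto
    show "(\<lambda>x. \<phi> x *\<^sub>R g x) \<in> borel_measurable (lebesgue_on \<Omega>)" using m assms(2) by auto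
    show "AE x in lebesgue_on \<Omega>. norm (\<phi> x *\<^sub>R g x) \<le> norm (B * norm (g x))"
      using B by (auto intro!: AE_I2 mult_mono simp: abs_mult)
  qed
qed

text \<open>Functions on \<open>lebesgue_on \<Omega>\<close> are Lebesgue measurable, whereas
  product measures and polar coordinates are set up over the Borel sets. A Borel version equal
  almost everywhere bridges the two.\<close>

lemma borel_representative:
  fixes f :: "'a::euclidean_space \<Rightarrow> real"
  assumes "f \<in> borel_measurable (lebesgue_on \<Omega>)" "\<Omega> \<in> sets borel"
  obtains f' where "f' \<in> borel_measurable borel" "AE x in lebesgue_on \<Omega>. f x = f' x"
    "\<And>x. x \<notin> \<Omega> \<Longrightarrow> f' x = 0"
proof -
  have "(\<lambda>x. indicator \<Omega> x * f x) \<in> borel_measurable lebesgue"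
    using assms by (subst (asm) borel_measurable_restrict_space_iff) auto
  then obtain f'' where f'': "f'' \<in> borel_measurable lborel" "AE x in lborel. indicator \<Omega> x * f x = f'' x"
    using completion_ex_borel_measurable_real by blast
  have "AE x in lebesgue. indicator \<Omega> x * f x = f'' x" using f''(2) by (rule AE_completion)
  then have "AE x in lebesgue. x \<in> \<Omega> \<longrightarrow> f x = indicator \<Omega> x * f'' x" by eventually_elim (auto simp: indicator_def split: if_splits)
  then have "AE x in lebesgue_on \<Omega>. f x = indicator \<Omega> x * f'' x" using assms(2) by (subst AE_restrict_space_iff) auto
  then show thesis using f''(1) assms(2) by (intro that[of "\<lambda>x. indicator \<Omega> x * f'' x"]) auto
qed

lemma borel_representative_vector:
  fixes f :: "'a::euclidean_space \<Rightarrow> 'b::euclidean_space"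
  assumes "f \<in> borel_measurable (lebesgue_on \<Omega>)" "\<Omega> \<in> sets borel"
  obtains f' where "f' \<in> borel_measurable borel" "AE x in lebesgue_on \<Omega>. f x = f' x"
    "\<And>x. x \<notin> \<Omega> \<Longrightarrow> f' x = 0"
proof -
  have "\<exists>h. h \<in> borel_measurable borel \<and> (AE x in lebesgue_on \<Omega>. f x \<bullet> b = h x) \<and> (\<forall>x. x \<notin> \<Omega> \<longrightarrow> h x = 0)" for b
  proof -
    have "(\<lambda>x. f x \<bullet> b) \<in> borel_measurable (lebesgue_on \<Omega>)" using assms(1) by auto
    from borel_representative[OF this assms(2)] show ?thesis by metis
  qed
  then obtain h where h: "\<And>b. h b \<in> borel_measurable borel" "\<And>b. AE x in lebesgue_on \<Omega>. f x \<bullet> b = h b x"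
    "\<And>b x. x \<notin> \<Omega> \<Longrightarrow> h b x = 0" by metis
  show thesis
  proof (rule that[of "\<lambda>x. \<Sum>b\<in>Basis. h b x *\<^sub>R b"])
    show "(\<lambda>x. \<Sum>b\<in>Basis. h b x *\<^sub>R b) \<in> borel_measurable borel" using h(1) by auto
    have "AE x in lebesgue_on \<Omega>. \<forall>b\<in>Basis. f x \<bullet> b = h b x"
      using h(2) by (intro AE_ball_countable[THEN iffD2]) (auto simp: countable_finite)
    then show "AE x in lebesgue_on \<Omega>. f x = (\<Sum>b\<in>Basis. h b x *\<^sub>R b)"
    proof eventually_elim
      case (elim x)
      have "f x = (\<Sum>b\<in>Basis. (f x \<bullet> b) *\<^sub>R b)" by (simp add: euclidean_representation)
      then show ?case using elim by simp
    qed
  qed (use h(3) in auto)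
qed

text \<open>Both fields have the same integral against every test function, so the fundamental lemma
  applies to each component of their difference. Thereby the choice made in
  \<open>weak_gradient\<close> is determined up to null sets.\<close>

lemma is_weak_gradient_unique:
  fixes u :: "'a::euclidean_space \<Rightarrow> real"
  assumes \<Omega>: "open \<Omega>" "bounded \<Omega>" and g: "is_weak_gradient \<Omega> u g" and h: "is_weak_gradient \<Omega> u h"
  shows "AE x in lebesgue_on \<Omega>. g x = h x"
proof -
  interpret finite_measure "lebesgue_on \<Omega>" using finite_measure_bounded_open[OF \<Omega>] .
  have [measurable]: "\<Omega> \<in> sets borel" using \<Omega> by auto
  have ig: "integrable (lebesgue_on \<Omega>) g" "integrable (lebesgue_on \<Omega>) h"
    using g h by (auto simp: is_weak_gradient_def intro: L2_imp_integrable)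
  have "AE x in lebesgue_on \<Omega>. (g x - h x) \<bullet> b = 0" for b
  proof -
    define f where "f x = (g x - h x) \<bullet> b" for x
    have intf: "integrable (lebesgue_on \<Omega>) f" unfolding f_def using ig by auto
    obtain f' where f': "f' \<in> borel_measurable borel" "AE x in lebesgue_on \<Omega>. f x = f' x" "\<And>x. x \<notin> \<Omega> \<Longrightarrow> f' x = 0"
      by (rule borel_representative[OF borel_measurable_integrable[OF intf]]) (simp, blast)
    have "integrable (lebesgue_on \<Omega>) f'"
      by (rule integrable_cong_AE_imp[OF intf _ f'(2)])
        (use f'(1) in \<open>auto intro!: measurable_restrict_space1 measurable_completion\<close>)
    then have "integrable lebesgue (\<lambda>x. indicator \<Omega> x *\<^sub>R f' x)" by (subst (asm) integrable_restrict_space) auto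
    moreover have ind: "(\<lambda>x. indicator \<Omega> x *\<^sub>R f' x) = f'" using f'(3) by (auto simp: fun_eq_iff indicator_def)
    ultimately have "integrable lborel f'" using f'(1) by (simp add: integrable_completion)
    moreover have "(LINT x|lborel. \<phi> x * f' x) = 0" if \<phi>: "\<phi> \<in> test_functions \<Omega>" for \<phi>
    proof -
      have m\<phi>: "\<phi> \<in> borel_measurable borel" using continuous_on_UNIV_borel[OF test_functions_continuous[OF \<phi>]] .
      have "(LINT x|lborel. \<phi> x * f' x) = (LINT x|lebesgue_on \<Omega>. \<phi> x * f' x)"
        using m\<phi> f'(1,3) by (subst integral_lebesgue_on_borel)
          (auto intro!: Bochner_Integration.integral_cong simp: indicator_def)
      also have "\<dots> = (LINT x|lebesgue_on \<Omega>. \<phi> x * f x)"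
      proof (rule integral_cong_AE)
        have "\<phi> \<in> borel_measurable (lebesgue_on \<Omega>)" "f' \<in> borel_measurable (lebesgue_on \<Omega>)"
          using m\<phi> f'(1) by (auto intro!: measurable_restrict_space1 measurable_completion)
        then show "(\<lambda>x. \<phi> x * f' x) \<in> borel_measurable (lebesgue_on \<Omega>)" "(\<lambda>x. \<phi> x * f x) \<in> borel_measurable (lebesgue_on \<Omega>)"
          using intf by auto
        show "AE x in lebesgue_on \<Omega>. \<phi> x * f' x = \<phi> x * f x" using f'(2) by eventually_elim simp
      qed
      also have "\<dots> = (LINT x|lebesgue_on \<Omega>. (\<phi> x *\<^sub>R g x - \<phi> x *\<^sub>R h x) \<bullet> b)"
        by (simp add: f_def inner_diff_left algebra_simps)
      also have "\<dots> = ((LINT x|lebesgue_on \<Omega>. \<phi> x *\<^sub>R g x) - (LINT x|lebesgue_on \<Omega>. \<phi> x *\<^sub>R h x)) \<bullet> b"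
        using ig[THEN integrable_test_scaleR[OF \<phi>]] by simp
      also have "\<dots> = 0" using g h \<phi> by (simp add: is_weak_gradient_def)
      finally show ?thesis .
    qed
    ultimately have "AE x in lborel. x \<in> \<Omega> \<longrightarrow> f' x = 0"
      by (rule AE_eq_0_if_integral_test_functions_eq_0[OF \<Omega>(1)])
    then have "AE x in lebesgue_on \<Omega>. f' x = 0"
      by (subst AE_restrict_space_iff) (auto intro: AE_completion)
    with f'(2) show ?thesis by eventually_elim (simp add: f_def)
  qed
  then have "AE x in lebesgue_on \<Omega>. \<forall>b\<in>Basis. (g x - h x) \<bullet> b = 0"
    by (intro AE_ball_countable[THEN iffD2]) (auto simp: countable_finite)
  then show ?thesis
  proof eventually_elim
    case (elim x)
    show ?case by (rule euclidean_eqI) (use elim in \<open>simp add: inner_diff_left\<close>)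
  qed
qed

lemma weak_gradient_AE_eq:
  assumes "open \<Omega>" "bounded \<Omega>" "is_weak_gradient \<Omega> u g"
  shows "AE x in lebesgue_on \<Omega>. weak_gradient \<Omega> u x = g x"
  using is_weak_gradient_unique[OF assms(1,2) _ assms(3)] someI[of "is_weak_gradient \<Omega> u", OF assms(3)]
  by (simp add: weak_gradient_def)

lemma is_weak_gradient_weak_gradient: "u \<in> H1 \<Omega> \<Longrightarrow> is_weak_gradient \<Omega> u (weak_gradient \<Omega> u)"
  unfolding weak_gradient_def by (rule someI_ex[where P="is_weak_gradient \<Omega> u"]) (simp add: H1_def)

lemma is_weak_gradient_diff:
  fixes u :: "'a::euclidean_space \<Rightarrow> real"
  assumes \<Omega>: "open \<Omega>" "bounded \<Omega>" and g: "is_weak_gradient \<Omega> u g" "L2 (lebesgue_on \<Omega>) u"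
    and h: "is_weak_gradient \<Omega> w h" "L2 (lebesgue_on \<Omega>) w"
  shows "is_weak_gradient \<Omega> (\<lambda>x. u x - w x) (\<lambda>x. g x - h x)"
  unfolding is_weak_gradient_def
proof (intro conjI ballI)
  interpret finite_measure "lebesgue_on \<Omega>" using finite_measure_bounded_open[OF \<Omega>] .
  have L2: "L2 (lebesgue_on \<Omega>) g" "L2 (lebesgue_on \<Omega>) h" using g h by (auto simp: is_weak_gradient_def)
  then show "L2 (lebesgue_on \<Omega>) (\<lambda>x. g x - h x)" by (rule L2_diff)
  fix \<phi> assume \<phi>: "\<phi> \<in> test_functions \<Omega>"
  have i: "integrable (lebesgue_on \<Omega>) (\<lambda>x. f x *\<^sub>R gradient \<phi> x)" if "L2 (lebesgue_on \<Omega>) f" for f :: "'a \<Rightarrow> real"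
  proof -
    obtain B where B: "\<And>x. norm (gradient \<phi> x) \<le> B" "B > 0"
      using bounded_continuous_compact_support[OF test_functions_continuous_gradient[OF \<phi>] test_functionsD(2)[OF \<phi>]]
        gradient_spt by metis
    have m: "gradient \<phi> \<in> borel_measurable (lebesgue_on \<Omega>)"
      using continuous_on_UNIV_borel[OF test_functions_continuous_gradient[OF \<phi>]]
      by (intro measurable_restrict_space1 measurable_completion) simp
    have f: "integrable (lebesgue_on \<Omega>) f" using that by (rule L2_imp_integrable)
    show ?thesis
    proof (rule Bochner_Integration.integrable_bound)
      show "integrable (lebesgue_on \<Omega>) (\<lambda>x. B * norm (f x))" using f by auto
      show "(\<lambda>x. f x *\<^sub>R gradient \<phi> x) \<in> borel_measurable (lebesgue_on \<Omega>)" using m f by auto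
      show "AE x in lebesgue_on \<Omega>. norm (f x *\<^sub>R gradient \<phi> x) \<le> norm (B * norm (f x))"
      proof (rule AE_I2)
        fix x
        show "norm (f x *\<^sub>R gradient \<phi> x) \<le> norm (B * norm (f x))"
          using mult_left_mono[OF B(1)[of x], of "\<bar>f x\<bar>"] B(2) by (simp add: abs_mult mult.commute)
      qed
    qed
  qed
  have "(LINT x|lebesgue_on \<Omega>. (u x - w x) *\<^sub>R gradient \<phi> x) =
    (LINT x|lebesgue_on \<Omega>. u x *\<^sub>R gradient \<phi> x) - (LINT x|lebesgue_on \<Omega>. w x *\<^sub>R gradient \<phi> x)"
    using i g h by (simp add: scaleR_diff_left)
  also have "\<dots> = - ((LINT x|lebesgue_on \<Omega>. \<phi> x *\<^sub>R g x) - (LINT x|lebesgue_on \<Omega>. \<phi> x *\<^sub>R h x))"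
    using g h \<phi> by (simp add: is_weak_gradient_def)
  also have "\<dots> = - (LINT x|lebesgue_on \<Omega>. \<phi> x *\<^sub>R (g x - h x))"
    using L2[THEN L2_imp_integrable, THEN integrable_test_scaleR[OF \<phi>]] by (simp add: scaleR_diff_right)
  finally show "(LINT x|lebesgue_on \<Omega>. (u x - w x) *\<^sub>R gradient \<phi> x) = - (LINT x|lebesgue_on \<Omega>. \<phi> x *\<^sub>R (g x - h x))" .
qed

lemma H1_test:
  fixes w :: "'a::euclidean_space \<Rightarrow> real"
  assumes "\<And>k. C_k k w" "open \<Omega>" "bounded \<Omega>"
  shows "w \<in> H1 \<Omega>"
  using L2_test[OF assms] is_weak_gradient_smooth[OF assms] by (auto simp: H1_def)

text \<open>\<open>H1_norm\<close> is computed from a chosen weak gradient of f k - u. By uniqueness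
  that is gradient (f k) - g almost everywhere, and each of the two squared norms lies below the
  square of \<open>H1_norm\<close>.\<close>

lemma H1_tendsto_imp_L2_tendsto:
  fixes u :: "'a::euclidean_space \<Rightarrow> real"
  assumes \<Omega>: "open \<Omega>" "bounded \<Omega>" and f: "\<And>k. f k \<in> test_functions UNIV"
    and u: "L2 (lebesgue_on \<Omega>) u" "is_weak_gradient \<Omega> u g"
    and lim: "(\<lambda>k. H1_norm \<Omega> (\<lambda>x. f k x - u x)) \<longlonglongrightarrow> 0"
  shows "L2_tendsto (lebesgue_on \<Omega>) f u" "L2_tendsto (lebesgue_on \<Omega>) (\<lambda>k. gradient (f k)) g"
proof -
  have f': "C_k j (f k)" for j k using f by (rule test_functionsD(1))
  note L2f = L2_test[OF f' \<Omega>]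
  have L2g: "L2 (lebesgue_on \<Omega>) g" using u(2) by (simp add: is_weak_gradient_def)
  define A where "A k = (LINT x|lebesgue_on \<Omega>. (norm (f k x - u x))\<^sup>2)" for k
  define B where "B k = (LINT x|lebesgue_on \<Omega>. (norm (gradient (f k) x - g x))\<^sup>2)" for k
  have "(LINT x|lebesgue_on \<Omega>. (norm (weak_gradient \<Omega> (\<lambda>x. f k x - u x) x))\<^sup>2) = B k" for k
    unfolding B_def
  proof (rule integral_cong_AE)
    have d: "is_weak_gradient \<Omega> (\<lambda>x. f k x - u x) (\<lambda>x. gradient (f k) x - g x)"
      by (intro is_weak_gradient_diff \<Omega> is_weak_gradient_smooth f' L2f u)
    then have "is_weak_gradient \<Omega> (\<lambda>x. f k x - u x) (weak_gradient \<Omega> (\<lambda>x. f k x - u x))"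
      unfolding weak_gradient_def by (rule someI[where P="is_weak_gradient \<Omega> (\<lambda>x. f k x - u x)"])
    then show "(\<lambda>x. (norm (weak_gradient \<Omega> (\<lambda>x. f k x - u x) x))\<^sup>2) \<in> borel_measurable (lebesgue_on \<Omega>)"
      by (auto simp: is_weak_gradient_def L2_def)
    show "(\<lambda>x. (norm (gradient (f k) x - g x))\<^sup>2) \<in> borel_measurable (lebesgue_on \<Omega>)"
      using L2_diff[OF L2f(2)[of k] L2g] by (auto simp: L2_def)
    show "AE x in lebesgue_on \<Omega>. (norm (weak_gradient \<Omega> (\<lambda>x. f k x - u x) x))\<^sup>2 = (norm (gradient (f k) x - g x))\<^sup>2"
      using weak_gradient_AE_eq[OF \<Omega> d] by eventually_elim simp
  qed
  then have "(\<lambda>k. sqrt (A k + B k)) \<longlonglongrightarrow> 0" using lim by (simp add: H1_norm_def A_def)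
  then have "(\<lambda>k. (sqrt (A k + B k))\<^sup>2) \<longlonglongrightarrow> 0\<^sup>2" by (intro tendsto_intros)
  moreover have nn: "0 \<le> A k" "0 \<le> B k" for k by (auto simp: A_def B_def)
  ultimately have AB: "(\<lambda>k. A k + B k) \<longlonglongrightarrow> 0" by simp
  have "A \<longlonglongrightarrow> 0" by (rule Lim_null_comparison[OF _ AB]) (use nn in auto)
  moreover have "B \<longlonglongrightarrow> 0" by (rule Lim_null_comparison[OF _ AB]) (use nn in auto)
  ultimately show "L2_tendsto (lebesgue_on \<Omega>) f u" "L2_tendsto (lebesgue_on \<Omega>) (\<lambda>k. gradient (f k)) g"
    using L2f L2g u(1) unfolding L2_tendsto_def A_def[abs_def] B_def[abs_def] by blast+
qed

section \<open>Hausdorff measure on Euclidean space\<close>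

lemma countable_subadditive_imp_Un:
  fixes f :: "'a set \<Rightarrow> ennreal"
  assumes "f {} = 0" "\<And>A. f (\<Union>i. A i) \<le> (\<Sum>i. f (A i :: 'a set))"
  shows "f (A \<union> B) \<le> f A + f B"
  using assms(2)[of "binaryset A B"] suminf_binaryset_eq[of f A B, OF assms(1)]
  by (simp add: UN_binaryset_eq)

text \<open>Caratheodory's argument. The part of X near F but off it is cut into shells
  \<open>R j\<close> by the distance to F. Shells of equal parity are separated, so their values add
  up to at most f X; hence the series over all shells converges. Its tails bound the error of
  replacing X - F by \<open>Y n\<close>, which has positive distance from F.\<close>

lemma metric_outer_measure_closed:
  fixes f :: "'a::metric_space set \<Rightarrow> ennreal"
  assumes empty: "f {} = 0" and mono: "\<And>A B. A \<subseteq> B \<Longrightarrow> f A \<le> f B"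
    and csub: "\<And>A. f (\<Union>i. A i) \<le> (\<Sum>i. f (A i))"
    and metric: "\<And>A B d. 0 < d \<Longrightarrow> (\<And>a b. a \<in> A \<Longrightarrow> b \<in> B \<Longrightarrow> d \<le> dist a b) \<Longrightarrow> f A + f B \<le> f (A \<union> B)"
    and F: "closed F"
  shows "f (X \<inter> F) + f (X - F) \<le> f X"
proof (cases "F = {} \<or> f X = \<infinity>")
  case True
  then show ?thesis using empty by (auto simp: top_unique)
next
  case False
  then have Fne: "F \<noteq> {}" and fin: "f X \<noteq> \<infinity>" by auto
  define I where "I x = infdist x F" for x
  have I: "I x \<le> dist x a" if "a \<in> F" for x a using that by (simp add: I_def infdist_le)
  have Itri: "I x \<le> I y + dist x y" for x y unfolding I_def by (rule infdist_triangle)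
  define R where "R j = {x \<in> X. 1 / real (j + 2) \<le> I x \<and> I x < 1 / real (j + 1)}" for j
  define Y where "Y n = {x \<in> X. 1 / real (n + 1) \<le> I x}" for n
  have RX: "R j \<subseteq> X" for j by (auto simp: R_def)
  \<comment> \<open>Only every second shell is taken: between two of them lies at least one full
    shell, whose width is the gap \<open>?d\<close>.\<close>
  have part: "(\<Sum>j<m. f (R (2 * j + c))) \<le> f (\<Union>j<m. R (2 * j + c))" for m c
  proof (induction m)
    case (Suc m)
    let ?A = "\<Union>j<m. R (2 * j + c)"
    \<comment> \<open>For m = 0 the union \<open>?A\<close> is empty, so any positive distance
      serves.\<close>
    let ?d = "if m = 0 then 1 else 1 / real (2 * m + c) - 1 / real (2 * m + c + 1)"
    have "f ?A + f (R (2 * m + c)) \<le> f (?A \<union> R (2 * m + c))"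
    proof (rule metric[of ?d])
      have "1 / real (2 * m + c + 1) < 1 / real (2 * m + c)" if "m \<noteq> 0"
        using that by (intro divide_strict_left_mono) auto
      then show "0 < ?d" by simp
      fix a b assume a: "a \<in> ?A" and b: "b \<in> R (2 * m + c)"
      from a obtain j where j: "j < m" "a \<in> R (2 * j + c)" by auto
      have "1 / real (2 * m + c) \<le> 1 / real (2 * j + c + 2)" using j(1) by (intro divide_left_mono) auto
      also have "\<dots> \<le> I a" using j(2) by (simp add: R_def)
      finally have "1 / real (2 * m + c) \<le> I a" .
      moreover have "I b < 1 / real (2 * m + c + 1)" using b by (simp add: R_def)
      ultimately show "?d \<le> dist a b" using Itri[of a b] j(1) by (simp split: if_splits)
    qed
    moreover have "?A \<union> R (2 * m + c) = (\<Union>j<Suc m. R (2 * j + c))" by (auto simp: less_Suc_eq)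
    ultimately show ?case
      using order.trans[OF add_right_mono[OF Suc.IH], of "f (R (2 * m + c))" "f (\<Union>j<Suc m. R (2 * j + c))"]
      by (simp only: lessThan_Suc_atMost[symmetric] sum.lessThan_Suc)
  qed (simp add: empty)
  define r where "r j = enn2real (f (R j))" for j
  have r: "f (R j) = ennreal (r j)" "0 \<le> r j" for j
  proof -
    have "f (R j) \<le> f X" by (rule mono[OF RX])
    then have "f (R j) < top" using fin by (metis infinity_ennreal_def le_less_trans top.not_eq_extremum)
    then show "f (R j) = ennreal (r j)" "0 \<le> r j" by (auto simp: r_def)
  qed
  obtain L where L: "f X = ennreal L" "0 \<le> L" using fin by (cases "f X") auto
  have bound: "(\<Sum>j<m. r (2 * j + c)) \<le> L" for m c
  proof -
    have "ennreal (\<Sum>j<m. r (2 * j + c)) = (\<Sum>j<m. f (R (2 * j + c)))" using r by (simp add: sum_ennreal)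
    also have "\<dots> \<le> f (\<Union>j<m. R (2 * j + c))" by (rule part)
    also have "\<dots> \<le> ennreal L" unfolding L(1)[symmetric] using RX by (intro mono) auto
    finally show ?thesis using L(2) by simp
  qed
  have summ: "summable r"
  proof (rule summableI_nonneg_bounded[where x="2 * L"])
    fix m
    have "(\<Sum>j<m. r j) \<le> (\<Sum>j<2 * m. r j)" using r(2) by (intro sum_mono2) auto
    also have "\<dots> = (\<Sum>j<m. r (2 * j + 0)) + (\<Sum>j<m. r (2 * j + 1))"
      by (induction m) auto
    also have "\<dots> \<le> 2 * L" using bound[where c=0] bound[where c=1] by (simp only: mult_2 add_mono)
    finally show "(\<Sum>j<m. r j) \<le> 2 * L" .
  qed (use r in auto)
  have sub: "X - F \<subseteq> Y n \<union> (\<Union>k. R (k + n))" for n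
  proof
    fix x assume x: "x \<in> X - F"
    then have pos: "0 < I x" using F Fne by (simp add: I_def infdist_pos_not_in_closed)
    show "x \<in> Y n \<union> (\<Union>k. R (k + n))"
    proof (cases "x \<in> Y n")
      case False
      then have lt: "I x < 1 / real (n + 1)" using x by (auto simp: Y_def)
      \<comment> \<open>The lower bound of shell \<open>j\<close> holds by definition; minimality
        provides its upper bound.\<close>
      define j where "j = (LEAST j. 1 / real (j + 2) \<le> I x)"
      obtain N where "inverse (real (Suc N)) < I x" using reals_Archimedean[OF pos] by auto
      then have "1 / real (N + 2) \<le> I x"
        by (smt (verit) add_2_eq_Suc' inverse_eq_divide inverse_le_imp_le of_nat_Suc frac_le of_nat_0_le_iff)
      then have j: "1 / real (j + 2) \<le> I x" unfolding j_def by (rule LeastI)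
      have "n \<le> j"
      proof (rule ccontr)
        assume "\<not> n \<le> j"
        then have "1 / real (n + 1) \<le> 1 / real (j + 2)" by (intro divide_left_mono) auto
        then show False using j lt by simp
      qed
      moreover have "I x < 1 / real (j + 1)"
      proof (cases j)
        case 0
        then have "n = 0" using \<open>n \<le> j\<close> by simp
        then show ?thesis using lt 0 by simp
      next
        case (Suc i)
        then have "\<not> 1 / real (i + 2) \<le> I x" unfolding j_def using not_less_Least[of i "\<lambda>j. 1 / real (j + 2) \<le> I x"] by simp
        then show ?thesis using Suc by (simp add: add.commute)
      qed
      ultimately have "x \<in> R ((j - n) + n)" using x j by (simp add: R_def)
      then show ?thesis by blast
    qed simp
  qed
  have main: "f (X \<inter> F) + f (X - F) \<le> f X + ennreal (\<Sum>k. r (k + n))" for n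
  proof -
    have "f (X - F) \<le> f (Y n \<union> (\<Union>k. R (k + n)))" by (rule mono[OF sub])
    also have "\<dots> \<le> f (Y n) + f (\<Union>k. R (k + n))" by (rule countable_subadditive_imp_Un[OF empty csub])
    also have "f (\<Union>k. R (k + n)) \<le> (\<Sum>k. f (R (k + n)))" by (rule csub)
    also have "(\<Sum>k. f (R (k + n))) = ennreal (\<Sum>k. r (k + n))"
      using r summable_ignore_initial_segment[OF summ, of n] by (simp add: suminf_ennreal2)
    finally have 1: "f (X - F) \<le> f (Y n) + ennreal (\<Sum>k. r (k + n))" by (simp add: add_left_mono)
    have "f (X \<inter> F) + f (Y n) \<le> f ((X \<inter> F) \<union> Y n)"
    proof (rule metric[of "1 / real (n + 1)"])
      fix a b assume "a \<in> X \<inter> F" "b \<in> Y n"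
      then show "1 / real (n + 1) \<le> dist a b" using I[of a b] by (auto simp: Y_def dist_commute)
    qed simp
    also have "\<dots> \<le> f X" by (rule mono) (auto simp: Y_def)
    finally have "f (X \<inter> F) + f (Y n) + ennreal (\<Sum>k. r (k + n)) \<le> f X + ennreal (\<Sum>k. r (k + n))"
      by (rule add_right_mono)
    then show ?thesis using add_left_mono[OF 1, of "f (X \<inter> F)"] unfolding add.assoc by (rule order.trans[rotated])
  qed
  have "(\<lambda>n. f X + ennreal (\<Sum>k. r (k + n))) \<longlonglongrightarrow> f X + ennreal 0"
    by (intro tendsto_add tendsto_const tendsto_ennrealI suminf_exist_split2[OF summ])
  then show ?thesis using main by (intro LIMSEQ_le_const[where X="\<lambda>n. f X + ennreal (\<Sum>k. r (k + n))"]) auto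
qed

text \<open>Closed sets belong to the Caratheodory sigma-algebra, hence all Borel sets do. There
  \<open>f\<close> is countably additive, which is the condition under which
  \<open>measure_of\<close> returns its values.\<close>

lemma emeasure_metric_outer_measure:
  fixes f :: "'a::metric_space set \<Rightarrow> ennreal"
  assumes empty: "f {} = 0" and mono: "\<And>A B. A \<subseteq> B \<Longrightarrow> f A \<le> f B"
    and csub: "\<And>A. f (\<Union>i. A i) \<le> (\<Sum>i. f (A i))"
    and metric: "\<And>A B d. 0 < d \<Longrightarrow> (\<And>a b. a \<in> A \<Longrightarrow> b \<in> B \<Longrightarrow> d \<le> dist a b) \<Longrightarrow> f A + f B \<le> f (A \<union> B)"
    and B: "B \<in> sets borel"
  shows "emeasure (measure_of UNIV (sets borel) f) B = f B"
proof -
  interpret P: sigma_algebra "UNIV :: 'a set" "Pow UNIV" by (rule sigma_algebra_Pow)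
  define L where "L = lambda_system UNIV (Pow UNIV) f"
  have om: "outer_measure_space (Pow UNIV) f"
    unfolding outer_measure_space_def positive_def increasing_def countably_subadditive_def
    using empty mono csub by auto
  then have ms: "measure_space UNIV L f" unfolding L_def by (rule P.caratheodory_lemma)
  have sa: "sigma_algebra UNIV L" using ms by (simp add: measure_space_def)
  have "S \<in> L" if "closed S" for S
  proof -
    have "f (X \<inter> S) + f (X - S) = f X" for X
    proof (rule antisym)
      show "f (X \<inter> S) + f (X - S) \<le> f X"
        by (rule metric_outer_measure_closed[OF empty mono csub metric that])
      have "f ((X \<inter> S) \<union> (X - S)) \<le> f (X \<inter> S) + f (X - S)"
        by (rule countable_subadditive_imp_Un[OF empty csub])
      then show "f X \<le> f (X \<inter> S) + f (X - S)" by (simp add: Int_Diff_Un)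
    qed
    then show ?thesis unfolding L_def P.lambda_system_eq by auto
  qed
  then have "sets borel \<subseteq> L"
    unfolding borel_eq_closed using sigma_algebra.sigma_sets_subset[OF sa, of "Collect closed"] by auto
  then have "measure_space UNIV (sets borel) f"
    using measure_down[OF ms] sets.sigma_algebra_axioms[of borel] by simp
  then show ?thesis
    using B by (intro emeasure_measure_of_sigma)
      (auto simp: measure_space_def sigma_algebra_def)
qed

section \<open>Hausdorff content and the Hausdorff measure of Borel sets\<close>

definition hausdorff_weight :: "nat \<Rightarrow> 'a::metric_space set \<Rightarrow> ennreal" where
  "hausdorff_weight k C = ennreal (if C = {} then 0 else unit_ball_vol (real k) * (diameter C / 2) ^ k)"

lemma hausdorff_weight_empty [simp]: "hausdorff_weight k {} = 0"
  by (simp add: hausdorff_weight_def)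

lemma hausdorff_content_le:
  assumes "E \<subseteq> (\<Union>i. C i)" "\<And>i. bounded (C i)" "\<And>i. diameter (C i) \<le> \<delta>"
  shows "hausdorff_content k \<delta> E \<le> (\<Sum>i. hausdorff_weight k (C i))"
  unfolding hausdorff_content_def hausdorff_weight_def using assms by (intro INF_lower) auto

lemma hausdorff_content_ge:
  assumes "\<And>C. E \<subseteq> (\<Union>i. C i) \<Longrightarrow> (\<And>i. bounded (C i)) \<Longrightarrow> (\<And>i. diameter (C i) \<le> \<delta>) \<Longrightarrow>
    x \<le> (\<Sum>i. hausdorff_weight k (C i))"
  shows "x \<le> hausdorff_content k \<delta> E"
  unfolding hausdorff_content_def hausdorff_weight_def[symmetric] using assms by (intro INF_greatest) auto

lemma hausdorff_content_approx:
  assumes "hausdorff_content k \<delta> E \<noteq> \<infinity>" "e > 0"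
  obtains C where "E \<subseteq> (\<Union>i. C i)" "\<And>i. bounded (C i)" "\<And>i. diameter (C i) \<le> \<delta>"
    "(\<Sum>i. hausdorff_weight k (C i)) \<le> hausdorff_content k \<delta> E + ennreal e"
proof -
  have "hausdorff_content k \<delta> E = (INF C \<in> {C :: nat \<Rightarrow> 'a set. E \<subseteq> (\<Union>i. C i) \<and> (\<forall>i. bounded (C i) \<and> diameter (C i) \<le> \<delta>)}.
        \<Sum>i. hausdorff_weight k (C i))"
    unfolding hausdorff_content_def hausdorff_weight_def ..
  from INF_approx_ennreal[OF assms(2) this assms(1)] show thesis using that by (auto intro: less_imp_le)
qed

lemma hausdorff_content_mono: "E \<subseteq> E' \<Longrightarrow> hausdorff_content k \<delta> E \<le> hausdorff_content k \<delta> E'"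
  by (rule hausdorff_content_ge, rule hausdorff_content_le) auto

lemma hausdorff_content_antimono: "\<delta> \<le> \<delta>' \<Longrightarrow> hausdorff_content k \<delta>' E \<le> hausdorff_content k \<delta> E"
  by (rule hausdorff_content_ge, rule hausdorff_content_le) (auto intro: order_trans)

lemma hausdorff_content_empty: "0 < \<delta> \<Longrightarrow> hausdorff_content k \<delta> {} = 0"
  using hausdorff_content_le[of "{}" "\<lambda>_. {}" \<delta> k] by simp

text \<open>Covers of the \<open>A n\<close> that are optimal up to e / 2^(n+1) are merged into one
  sequence of sets by the pairing of indices, at a total loss of e.\<close>

lemma hausdorff_content_UN:
  fixes A :: "nat \<Rightarrow> 'a::metric_space set"
  shows "hausdorff_content k \<delta> (\<Union>n. A n) \<le> (\<Sum>n. hausdorff_content k \<delta> (A n))"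
proof (cases "\<exists>n. hausdorff_content k \<delta> (A n) = \<infinity>")
  case True
  then obtain n where "hausdorff_content k \<delta> (A n) = \<infinity>" by blast
  then have "(\<Sum>n. hausdorff_content k \<delta> (A n)) = \<infinity>"
    using ennreal_suminf_lessD[of "\<lambda>n. hausdorff_content k \<delta> (A n)" top n] by (intro ccontr[of "(\<Sum>n. hausdorff_content k \<delta> (A n)) = \<infinity>"]) (auto simp: top.not_eq_extremum)
  then show ?thesis by simp
next
  case False
  show ?thesis
  proof (rule ennreal_le_epsilon)
    fix e :: real assume e: "0 < e"
    have "\<exists>C. A n \<subseteq> (\<Union>i. C i) \<and> (\<forall>i. bounded (C i) \<and> diameter (C i) \<le> \<delta>) \<and>
      (\<Sum>i. hausdorff_weight k (C i)) \<le> hausdorff_content k \<delta> (A n) + ennreal (e * (1/2) ^ Suc n)" for n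
      by (rule hausdorff_content_approx[of k \<delta> "A n" "e * (1/2) ^ Suc n"]) (use False e in auto)
    then obtain C where C: "\<And>n. A n \<subseteq> (\<Union>i. C n i)" "\<And>n i. bounded (C n i)" "\<And>n i. diameter (C n i) \<le> \<delta>"
      "\<And>n. (\<Sum>i. hausdorff_weight k (C n i)) \<le> hausdorff_content k \<delta> (A n) + ennreal (e * (1/2) ^ Suc n)"
      by metis
    define D where "D = (\<lambda>(n, i). C n i) \<circ> prod_decode"
    have "hausdorff_content k \<delta> (\<Union>n. A n) \<le> (\<Sum>j. hausdorff_weight k (D j))"
    proof (rule hausdorff_content_le)
      show "(\<Union>n. A n) \<subseteq> (\<Union>j. D j)"
      proof safe
        fix x n assume "x \<in> A n"
        then obtain i where "x \<in> C n i" using C(1) by blast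
        then have "x \<in> D (prod_encode (n, i))" by (simp add: D_def)
        then show "x \<in> (\<Union>j. D j)" by blast
      qed
    qed (use C in \<open>auto simp: D_def split: prod.splits\<close>)
    also have "\<dots> = (\<Sum>n. \<Sum>i. hausdorff_weight k (C n i))"
    proof -
      have "(\<Sum>j. (\<lambda>(n, i). hausdorff_weight k (C n i)) (prod_decode j)) = (\<Sum>n. \<Sum>i. hausdorff_weight k (C n i))"
        by (rule suminf_ennreal_2dimen) simp
      then show ?thesis by (simp add: D_def case_prod_beta)
    qed
    also have "\<dots> \<le> (\<Sum>n. hausdorff_content k \<delta> (A n) + ennreal e * ennreal ((1/2) ^ Suc n))"
      using C(4) e by (intro suminf_le) (simp_all only: ennreal_mult' less_imp_le summableI)
    also have "... = (\<Sum>n. hausdorff_content k \<delta> (A n)) + (\<Sum>n. ennreal e * ennreal ((1/2) ^ Suc n))"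
      by (subst suminf_add[symmetric]) (auto simp del: ennreal_suminf_cmult)
    also have "\<dots> = (\<Sum>n. hausdorff_content k \<delta> (A n)) + ennreal e"
      unfolding ennreal_suminf_cmult by (subst suminf_ennreal_eq[OF zero_le_power power_half_series]) auto
    finally show "hausdorff_content k \<delta> (\<Union>n. A n) \<le> (\<Sum>n. hausdorff_content k \<delta> (A n)) + ennreal e" .
  qed
qed

lemma hausdorff_content_le_outer: "0 < \<delta> \<Longrightarrow> hausdorff_content k \<delta> E \<le> hausdorff_outer k E"
  unfolding hausdorff_outer_def by (rule SUP_upper) auto

text \<open>A covering set of diameter at most \<delta> < d cannot meet both A and B, so a cover of
  the union splits into a cover of each without sharing a set.\<close>

lemma hausdorff_content_metric:
  assumes d: "\<delta> < d" and sep: "\<And>a b. a \<in> A \<Longrightarrow> b \<in> B \<Longrightarrow> d \<le> dist a b"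
  shows "hausdorff_content k \<delta> A + hausdorff_content k \<delta> B \<le> hausdorff_content k \<delta> (A \<union> B)"
proof (rule hausdorff_content_ge)
  fix C :: "nat \<Rightarrow> 'a set"
  assume C: "A \<union> B \<subseteq> (\<Union>i. C i)" "\<And>i. bounded (C i)" "\<And>i. diameter (C i) \<le> \<delta>"
  show "hausdorff_content k \<delta> A + hausdorff_content k \<delta> B \<le> (\<Sum>i. hausdorff_weight k (C i))"
  proof (cases "\<delta> < 0")
    case True
    then show ?thesis using C(2,3)[of 0] diameter_ge_0[of "C 0"] by force
  next
    case False
    define CA where "CA i = (if C i \<inter> A = {} then {} else C i)" for i
    define CB where "CB i = (if C i \<inter> B = {} then {} else C i)" for i
    have A: "hausdorff_content k \<delta> A \<le> (\<Sum>i. hausdorff_weight k (CA i))"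
      using C False by (intro hausdorff_content_le) (force simp: CA_def)+
    have B: "hausdorff_content k \<delta> B \<le> (\<Sum>i. hausdorff_weight k (CB i))"
      using C False by (intro hausdorff_content_le) (force simp: CB_def)+
    have "hausdorff_weight k (CA i) + hausdorff_weight k (CB i) \<le> hausdorff_weight k (C i)" for i
    proof -
      have "C i \<inter> A = {} \<or> C i \<inter> B = {}"
      proof (rule ccontr)
        assume "\<not> ?thesis"
        then obtain a b where "a \<in> C i" "a \<in> A" "b \<in> C i" "b \<in> B" by auto
        then have "d \<le> dist a b" "dist a b \<le> diameter (C i)"
          using sep C(2) by (auto intro: diameter_bounded_bound)
        then show False using C(3)[of i] d by linarith
      qed
      then show ?thesis by (auto simp: CA_def CB_def)
    qed
    then have "(\<Sum>i. hausdorff_weight k (CA i) + hausdorff_weight k (CB i)) \<le> (\<Sum>i. hausdorff_weight k (C i))"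
      by (intro suminf_le) auto
    then show ?thesis using add_mono[OF A B] by (subst (asm) suminf_add[symmetric]) auto
  qed
qed

text \<open>Checks the axioms of a metric outer measure, so that the measure introduced through
  \<open>measure_of\<close> really takes the values of \<open>hausdorff_outer\<close>.\<close>

lemma emeasure_hausdorff_measure:
  fixes B :: "'a::metric_space set"
  assumes "B \<in> sets borel"
  shows "emeasure (hausdorff_measure k) B = hausdorff_outer k B"
  unfolding hausdorff_measure_def
proof (rule emeasure_metric_outer_measure[OF _ _ _ _ assms])
  have ne: "{0<..} \<noteq> ({} :: real set)" by (metis greaterThan_non_empty)
  show "hausdorff_outer k ({} :: 'a set) = 0"
  proof -
    have "hausdorff_outer k ({} :: 'a set) \<le> 0"
      unfolding hausdorff_outer_def by (intro SUP_least) (simp add: hausdorff_content_empty)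
    then show ?thesis by simp
  qed
  show "hausdorff_outer k A \<le> hausdorff_outer k B" if "A \<subseteq> B" for A B :: "'a set"
    unfolding hausdorff_outer_def using that by (intro SUP_mono') (rule hausdorff_content_mono)
  show "hausdorff_outer k (\<Union>i. A i) \<le> (\<Sum>i. hausdorff_outer k (A i))" for A :: "nat \<Rightarrow> 'a set"
    unfolding hausdorff_outer_def[of k "\<Union>i. A i"]
  proof (rule SUP_least)
    fix \<delta> :: real assume "\<delta> \<in> {0<..}"
    then show "hausdorff_content k \<delta> (\<Union>i. A i) \<le> (\<Sum>i. hausdorff_outer k (A i))"
      by (intro order_trans[OF hausdorff_content_UN] suminf_le hausdorff_content_le_outer) auto
  qed
  show "hausdorff_outer k A + hausdorff_outer k B \<le> hausdorff_outer k (A \<union> B)"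
    if d: "0 < d" and sep: "\<And>a b. a \<in> A \<Longrightarrow> b \<in> B \<Longrightarrow> d \<le> dist a b" for A B :: "'a set" and d
  proof -
    have "hausdorff_content k \<delta>1 A + hausdorff_content k \<delta>2 B \<le> hausdorff_outer k (A \<union> B)"
      if "0 < \<delta>1" "0 < \<delta>2" for \<delta>1 \<delta>2
    proof -
      \<comment> \<open>The suprema for A and for B run over independent scales. A common smaller
        scale, also below the separation of the sets, dominates both because contents grow as the
        scale shrinks.\<close>
      define \<delta> where "\<delta> = min (min \<delta>1 \<delta>2) (d / 2)"
      have \<delta>: "0 < \<delta>" "\<delta> \<le> \<delta>1" "\<delta> \<le> \<delta>2" "\<delta> < d" using that d by (auto simp: \<delta>_def)
      have "hausdorff_content k \<delta>1 A + hausdorff_content k \<delta>2 B \<le> hausdorff_content k \<delta> A + hausdorff_content k \<delta> B"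
        using \<delta> by (intro add_mono hausdorff_content_antimono)
      also have "\<dots> \<le> hausdorff_content k \<delta> (A \<union> B)" by (rule hausdorff_content_metric[OF \<delta>(4) sep])
      also have "\<dots> \<le> hausdorff_outer k (A \<union> B)" using \<delta>(1) by (rule hausdorff_content_le_outer)
      finally show ?thesis .
    qed
    then show ?thesis
      unfolding hausdorff_outer_def[of k A] hausdorff_outer_def[of k B]
      by (auto simp: ennreal_SUP_add_left[symmetric] ennreal_SUP_add_right ne intro!: SUP_least)
  qed
qed

lemma sets_hausdorff_measure [simp, measurable_cong]: "sets (hausdorff_measure k) = sets borel"
  and space_hausdorff_measure [simp]: "space (hausdorff_measure k) = UNIV"
  by (simp_all add: hausdorff_measure_def sigma_algebra.sets_measure_of_eq[OF sets.sigma_algebra_axioms[of borel, simplified]]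
      space_measure_of_conv)

section \<open>Isometries and the size of the Hausdorff measure on a sphere\<close>

lemma hausdorff_outer_isometry_le:
  fixes T :: "'a::metric_space \<Rightarrow> 'b::metric_space"
  assumes T: "\<And>x y. dist (T x) (T y) = dist x y"
  shows "hausdorff_outer k (T ` E) \<le> hausdorff_outer k E"
  unfolding hausdorff_outer_def
proof (rule SUP_mono', rule hausdorff_content_ge)
  fix \<delta> and C :: "nat \<Rightarrow> 'a set"
  assume C: "E \<subseteq> (\<Union>i. C i)" "\<And>i. bounded (C i)" "\<And>i. diameter (C i) \<le> \<delta>"
  have dia: "diameter (T ` D) = diameter D" for D
  proof -
    have "(\<lambda>(x, y). dist x y) ` (T ` D \<times> T ` D) = (\<lambda>(x, y). dist x y) ` (D \<times> D)"
      by (force simp: T image_iff)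
    then show ?thesis unfolding diameter_def by (metis image_is_empty case_prod_beta')
  qed
  have "bounded (T ` D)" if "bounded D" for D
  proof -
    obtain x e where "\<And>y. y \<in> D \<Longrightarrow> dist x y \<le> e" using \<open>bounded D\<close> by (auto simp: bounded_def)
    then show ?thesis unfolding bounded_def by (intro exI[of _ "T x"] exI[of _ e]) (auto simp: T)
  qed
  moreover have "T ` E \<subseteq> (\<Union>i. T ` C i)" using C(1) by blast
  ultimately have "hausdorff_content k \<delta> (T ` E) \<le> (\<Sum>i. hausdorff_weight k (T ` C i))"
    using C dia by (intro hausdorff_content_le) auto
  also have "\<dots> = (\<Sum>i. hausdorff_weight k (C i))" by (intro suminf_cong) (auto simp: hausdorff_weight_def dia)
  finally show "hausdorff_content k \<delta> (T ` E) \<le> (\<Sum>i. hausdorff_weight k (C i))" .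
qed

text \<open>Packing: the balls of radius e/2 around an e-separated subset of the sphere are disjoint
  and lie in a shell of width e, whose volume is of order e; hence the subset has at most K /
  e^(n-1) points. A subset with the largest number of points covers the sphere by balls of radius e,
  and the total weight of these balls is bounded independently of e.\<close>

lemma hausdorff_sphere_finite:
  assumes R: "0 < R"
  shows "hausdorff_outer (DIM('a) - 1) (sphere (0::'a::euclidean_space) R) < \<infinity>"
proof -
  define n where "n = DIM('a)"
  have n: "n \<ge> 1" by (simp add: n_def DIM_positive Suc_leI)
  define \<beta> where "\<beta> = unit_ball_vol (real n)"
  have \<beta>: "\<beta> > 0" by (simp add: \<beta>_def)
  define S where "S = sphere (0::'a) R"
  define K where "K = real n * 2 ^ n * (2 * R) ^ (n - 1)"
  have pack: "real (card N) * e ^ (n - 1) \<le> K"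
    if e: "0 < e" "e \<le> R" and N: "finite N" "N \<subseteq> S" "\<And>x y. x \<in> N \<Longrightarrow> y \<in> N \<Longrightarrow> x \<noteq> y \<Longrightarrow> e \<le> dist x y" for e N
  proof -
    have vol: "measure lborel (ball x r) = \<beta> * r ^ n" "measure lborel (cball x r) = \<beta> * r ^ n" if "0 \<le> r" for x :: 'a and r
      using that content_ball[of r x] content_cball[of r x] by (auto simp: \<beta>_def n_def)
    have "real (card N) * (\<beta> * (e / 2) ^ n) = (\<Sum>x\<in>N. measure lborel (ball x (e / 2)))" using e by (simp add: vol)
    also have "\<dots> = measure lborel (\<Union>x\<in>N. ball x (e / 2))"
    proof (rule measure_finite_Union[symmetric])
      show "disjoint_family_on (\<lambda>x. ball x (e / 2)) N"
        unfolding disjoint_family_on_def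
      proof (intro ballI impI)
        fix x y assume "x \<in> N" "y \<in> N" "x \<noteq> y"
        then have "e \<le> dist x y" using N by auto
        then show "ball x (e / 2) \<inter> ball y (e / 2) = {}" by (intro disjoint_ballI) simp
      qed
      show "emeasure lborel (ball x (e / 2)) \<noteq> \<infinity>" for x :: 'a
        using emeasure_lborel_ball_finite[of x "e / 2"] by simp
    qed (use N in auto)
    also have "\<dots> \<le> measure lborel (cball (0::'a) (R + e / 2) - ball 0 (R - e / 2))"
    proof (rule measure_mono_fmeasurable)
      show "(\<Union>x\<in>N. ball x (e / 2)) \<subseteq> cball 0 (R + e / 2) - ball 0 (R - e / 2)"
      proof
        fix y assume "y \<in> (\<Union>x\<in>N. ball x (e / 2))"
        then obtain x where x: "norm x = R" "norm (x - y) < e / 2" using N by (auto simp: S_def dist_norm)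
        then show "y \<in> cball 0 (R + e / 2) - ball 0 (R - e / 2)"
          using norm_triangle_ineq2[of y x] norm_triangle_ineq2[of x y] by (auto simp: norm_minus_commute)
      qed
      have "cball (0::'a) (R + e / 2) \<in> fmeasurable lborel"
        using emeasure_lborel_cball_finite[of "0::'a" "R + e / 2"] by (intro fmeasurableI) auto
      then show "cball (0::'a) (R + e / 2) - ball 0 (R - e / 2) \<in> fmeasurable lborel"
        by (rule fmeasurable_Diff) simp
    qed (auto intro!: borel_open)
    also have "\<dots> = \<beta> * (R + e / 2) ^ n - \<beta> * (R - e / 2) ^ n"
    proof -
      have "cball (0::'a) (R + e / 2) \<in> fmeasurable lborel"
        using emeasure_lborel_cball_finite[of "0::'a" "R + e / 2"] by (intro fmeasurableI) auto
      moreover have "ball (0::'a) (R - e / 2) \<subseteq> cball 0 (R + e / 2)" using e by auto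
      ultimately show ?thesis using e R by (subst measurable_measure_Diff) (auto simp: vol)
    qed
    \<comment> \<open>The difference of the two n-th powers has the factor e; the remaining n
      products are bounded through R + e/2 \<le> 2 R.\<close>
    also have "\<dots> = \<beta> * (e * (\<Sum>i<n. (R - e / 2) ^ (n - Suc i) * (R + e / 2) ^ i))"
    proof -
      have "(R + e / 2) ^ n - (R - e / 2) ^ n = e * (\<Sum>i<n. (R - e / 2) ^ (n - Suc i) * (R + e / 2) ^ i)"
        using power_diff_sumr2[of "R + e / 2" n "R - e / 2"] by simp
      then show ?thesis by (simp only: right_diff_distrib[symmetric])
    qed
    also have "\<dots> \<le> \<beta> * (e * (\<Sum>i<n. (2 * R) ^ (n - 1)))"
    proof (intro mult_left_mono sum_mono)
      fix i assume i: "i \<in> {..<n}"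
      have "(R - e / 2) ^ (n - Suc i) * (R + e / 2) ^ i \<le> (2 * R) ^ (n - Suc i) * (2 * R) ^ i"
        using e R by (intro mult_mono power_mono) auto
      also have "\<dots> = (2 * R) ^ (n - Suc i + i)" by (simp only: power_add)
      also have "n - Suc i + i = n - 1" using i by auto
      finally show "(R - e / 2) ^ (n - Suc i) * (R + e / 2) ^ i \<le> (2 * R) ^ (n - 1)" .
    qed (use \<beta> e in auto)
    finally have "real (card N) * (e / 2) ^ n \<le> e * (real n * (2 * R) ^ (n - 1))"
    proof -
      assume *: "real (card N) * (\<beta> * (e / 2) ^ n) \<le> \<beta> * (e * (\<Sum>i<n. (2 * R) ^ (n - 1)))"
      have "\<beta> * (real (card N) * (e / 2) ^ n) \<le> \<beta> * (e * (real n * (2 * R) ^ (n - 1)))"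
        using * unfolding sum_constant card_lessThan mult.left_commute[of \<beta>] .
      then show ?thesis using \<beta> by (rule mult_left_le_imp_le)
    qed
    then have "real (card N) * (e ^ n / 2 ^ n) \<le> e * (real n * (2 * R) ^ (n - 1))" by (simp only: power_divide)
    then have "real (card N) * e ^ n / 2 ^ n \<le> e * (real n * (2 * R) ^ (n - 1))" by (simp only: times_divide_eq_right)
    then have "real (card N) * e ^ n \<le> e * (real n * (2 * R) ^ (n - 1)) * 2 ^ n"
      by (subst (asm) pos_divide_le_eq) auto
    then have "real (card N) * e ^ n \<le> e * K" unfolding K_def by (simp only: ac_simps)
    moreover have "e ^ n = e * e ^ (n - 1)" using n by (simp add: power_eq_if)
    ultimately have "e * (real (card N) * e ^ (n - 1)) \<le> e * K" by (simp only: mult.left_commute)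
    then show ?thesis using e(1) by (rule mult_left_le_imp_le)
  qed
  define M where "M = unit_ball_vol (real (n - 1)) * K"
  have "hausdorff_content (n - 1) \<delta> S \<le> ennreal M" if \<delta>: "0 < \<delta>" for \<delta>
  proof -
    \<comment> \<open>Covering balls of radius e have diameter at most 2 e, which must not exceed
      \<delta>; the packing bound asks for e \<le> R.\<close>
    define e where "e = min R (\<delta> / 2)"
    have e: "0 < e" "e \<le> R" "2 * e \<le> \<delta>" using R \<delta> by (auto simp: e_def)
    define P where "P N \<longleftrightarrow> finite N \<and> N \<subseteq> S \<and> (\<forall>x\<in>N. \<forall>y\<in>N. x \<noteq> y \<longrightarrow> e \<le> dist x y)" for N
    have bd: "card N \<le> nat \<lceil>K / e ^ (n - 1)\<rceil>" if "P N" for N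
    proof -
      have "real (card N) \<le> K / e ^ (n - 1)" using pack[OF e(1,2), of N] that e by (auto simp: P_def field_simps)
      then show ?thesis by linarith
    qed
    \<comment> \<open>The packing bound limits the cardinality, so a largest separated set exists. A
      point it leaves uncovered could be added to it.\<close>
    have "\<exists>N. P N \<and> (\<forall>N'. P N' \<longrightarrow> card N' \<le> card N)"
      by (rule ex_has_greatest_nat[where k="{}" and b="Suc (nat \<lceil>K / e ^ (n - 1)\<rceil>)"])
        (use bd in \<open>auto simp: P_def less_Suc_eq_le\<close>)
    then obtain N where N: "P N" "\<And>N'. P N' \<Longrightarrow> card N' \<le> card N" by blast
    have finN: "finite N" using N by (simp add: P_def)
    have cov: "S \<subseteq> (\<Union>x\<in>N. cball x e)"
    proof
      fix y assume y: "y \<in> S"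
      show "y \<in> (\<Union>x\<in>N. cball x e)"
      proof (rule ccontr)
        assume no: "y \<notin> (\<Union>x\<in>N. cball x e)"
        then have "y \<notin> N" using e by auto
        have "P (insert y N)" using no y N(1) by (auto simp: P_def dist_commute)
        from N(2)[OF this] show False using \<open>y \<notin> N\<close> finN by simp
      qed
    qed
    obtain h where h: "bij_betw h {0..<card N} N" using ex_bij_betw_nat_finite[OF finN] by blast
    define C where "C i = (if i < card N then cball (h i) e else {})" for i
    have "hausdorff_content (n - 1) \<delta> S \<le> (\<Sum>i. hausdorff_weight (n - 1) (C i))"
    proof (rule hausdorff_content_le)
      show "S \<subseteq> (\<Union>i. C i)"
      proof
        fix y assume "y \<in> S"
        then obtain x where "x \<in> N" "y \<in> cball x e" using cov by auto
        have "h ` {0..<card N} = N" using h by (simp add: bij_betw_def)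
        then have "x \<in> h ` {0..<card N}" using \<open>x \<in> N\<close> by (simp only:)
        then obtain i where "i < card N" "h i = x" by (elim imageE) simp
        then show "y \<in> (\<Union>i. C i)" using \<open>y \<in> cball x e\<close> by (auto simp: C_def intro!: exI[of _ i])
      qed
    qed (use e in \<open>auto simp: C_def\<close>)
    also have "\<dots> = (\<Sum>i<card N. hausdorff_weight (n - 1) (C i))"
      by (rule suminf_finite) (auto simp: C_def)
    also have "\<dots> = (\<Sum>i<card N. ennreal (unit_ball_vol (real (n - 1)) * e ^ (n - 1)))"
      using e by (intro sum.cong) (auto simp: C_def hausdorff_weight_def)
    also have "\<dots> = ennreal (unit_ball_vol (real (n - 1)) * (real (card N) * e ^ (n - 1)))"
      using e by (subst sum_ennreal) (auto simp: ac_simps)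
    also have "\<dots> \<le> ennreal M"
      unfolding M_def using N(1) by (intro ennreal_leI mult_left_mono pack e) (auto simp: P_def)
    finally show ?thesis .
  qed
  then have "hausdorff_outer (n - 1) S \<le> ennreal M" unfolding hausdorff_outer_def by (intro SUP_least) auto
  then show ?thesis unfolding n_def S_def by (simp add: le_less_trans)
qed

text \<open>Lower bound: project along a basis vector; the cylinder over a ball is covered by the
  boxes circumscribing the cylinders over the covering sets.\<close>

lemma hausdorff_sphere_positive:
  assumes R: "0 < R"
  shows "0 < hausdorff_outer (DIM('a) - 1) (sphere (0::'a::euclidean_space) R)"
proof -
  define n where "n = DIM('a)"
  have n: "n \<ge> 1" by (simp add: n_def DIM_positive Suc_leI)
  define b where "b = (SOME b. b \<in> (Basis :: 'a set))"
  have b: "b \<in> Basis" unfolding b_def by (rule SOME_Basis)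
  \<comment> \<open>With the remaining coordinates bounded by R/n, the projection of a point of
    \<open>V\<close> has norm at most R and therefore lifts to the sphere.\<close>
  define \<rho> where "\<rho> = R / real n"
  have \<rho>: "\<rho> > 0" using R n by (simp add: \<rho>_def)
  define V where "V = cbox (\<Sum>c\<in>Basis - {b}. (- \<rho>) *\<^sub>R c) (b + (\<Sum>c\<in>Basis - {b}. \<rho> *\<^sub>R c))"
  have inner_sum: "(\<Sum>c\<in>Basis - {b}. f c *\<^sub>R c) \<bullet> c' = (if c' = b then 0 else f c')" if "c' \<in> Basis" for f c'
  proof -
    have "(\<Sum>c\<in>Basis - {b}. f c *\<^sub>R c) \<bullet> c' = (\<Sum>c\<in>Basis - {b}. if c = c' then f c else 0)"
      unfolding inner_sum_left using that by (intro sum.cong) (auto simp: inner_Basis)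
    then show ?thesis using that by simp
  qed
  \<comment> \<open>The extent in direction \<open>b\<close> is 1, so the volume of such a box is
    the (n-1)-dimensional volume of its base.\<close>
  have volbox: "emeasure lborel (cbox (\<Sum>c\<in>Basis - {b}. (f c - r) *\<^sub>R c) (b + (\<Sum>c\<in>Basis - {b}. (f c + r) *\<^sub>R c))) = ennreal ((2 * r) ^ (n - 1))"
    if "0 \<le> r" for r :: real and f
  proof -
    let ?l = "\<Sum>c\<in>Basis - {b}. (f c - r) *\<^sub>R c" and ?h = "b + (\<Sum>c\<in>Basis - {b}. (f c + r) *\<^sub>R c)"
    have le: "?l \<bullet> c \<le> ?h \<bullet> c" and di: "(?h - ?l) \<bullet> c = (if c = b then 1 else 2 * r)" if "c \<in> Basis" for c
      using that b \<open>0 \<le> r\<close> by (auto simp: inner_add_left inner_diff_left inner_sum inner_Basis)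
    have "(\<Prod>c\<in>Basis. (?h - ?l) \<bullet> c) = (\<Prod>c\<in>Basis. if c = b then 1 else 2 * r)" using di by (intro prod.cong) auto
    also have "\<dots> = (2 * r) ^ (n - 1)"
    proof -
      have "(\<Prod>c\<in>Basis - {b}. if c = b then 1 else 2 * r) = (\<Prod>c\<in>Basis - {b}. 2 * r)" by (intro prod.cong) auto
      then show ?thesis
        using b prod.remove[OF _ b, of "\<lambda>c. if c = b then 1 else 2 * r"] by (simp add: n_def card_Diff_singleton)
    qed
    finally show ?thesis using le by (simp add: emeasure_lborel_cbox_eq)
  qed
  have cover: "ennreal ((2 * \<rho>) ^ (n - 1)) \<le> (\<Sum>i. ennreal (if C i = {} then 0 else (2 * diameter (C i)) ^ (n - 1)))"
    if C: "sphere (0::'a) R \<subseteq> (\<Union>i. C i)" "\<And>i. bounded (C i)" for C :: "nat \<Rightarrow> 'a set"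
  proof -
    define x where "x i = (SOME x. x \<in> C i)" for i
    have x: "x i \<in> C i" if "C i \<noteq> {}" for i using that unfolding x_def by (simp add: some_in_eq)
    define d where "d i = diameter (C i)" for i
    have d: "0 \<le> d i" for i using C(2) by (simp add: d_def diameter_ge_0)
    \<comment> \<open>In every coordinate the points of \<open>C i\<close> lie within
      \<open>d i\<close> of the chosen point \<open>x i\<close>; the base of the box has side 2 d
      i.\<close>
    define Z where "Z i = (if C i = {} then {} else
      cbox (\<Sum>c\<in>Basis - {b}. (x i \<bullet> c - d i) *\<^sub>R c) (b + (\<Sum>c\<in>Basis - {b}. (x i \<bullet> c + d i) *\<^sub>R c)))" for i
    have "V \<subseteq> (\<Union>i. Z i)"
    proof
      fix y assume y: "y \<in> V"
      define y' where "y' = (\<Sum>c\<in>Basis - {b}. (y \<bullet> c) *\<^sub>R c)"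
      have yV: "(\<Sum>c\<in>Basis - {b}. (- \<rho>) *\<^sub>R c) \<bullet> c \<le> y \<bullet> c \<and> y \<bullet> c \<le> (b + (\<Sum>c\<in>Basis - {b}. \<rho> *\<^sub>R c)) \<bullet> c"
        if "c \<in> Basis" for c using y that unfolding V_def mem_box by blast
      have yc: "\<bar>y \<bullet> c\<bar> \<le> \<rho>" if "c \<in> Basis - {b}" for c
        using yV[of c] inner_sum[of c "\<lambda>_. - \<rho>"] inner_sum[of c "\<lambda>_. \<rho>"] that b
        unfolding inner_add_left by (auto simp: inner_Basis abs_le_iff simp del: scaleR_minus_left)
      have yb: "0 \<le> y \<bullet> b" "y \<bullet> b \<le> 1"
        using yV[OF b] inner_sum[OF b, of "\<lambda>_. - \<rho>"] inner_sum[OF b, of "\<lambda>_. \<rho>"] b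
        unfolding inner_add_left by (simp_all add: inner_Basis del: scaleR_minus_left)
      have "norm y' \<le> (\<Sum>c\<in>Basis - {b}. norm ((y \<bullet> c) *\<^sub>R c))" unfolding y'_def by (rule norm_sum)
      also have "\<dots> \<le> (\<Sum>c\<in>Basis - {b}. \<rho>)" using yc by (intro sum_mono) auto
      also have "\<dots> \<le> real n * \<rho>" using b \<rho> by (simp add: n_def mult_right_mono card_Diff_singleton)
      also have "\<dots> = R" using n by (simp add: \<rho>_def)
      finally have ny': "norm y' \<le> R" .
      have ortho: "y' \<bullet> b = 0" unfolding y'_def using inner_sum[OF b] by simp
      \<comment> \<open>The point of the sphere above \<open>y'\<close> in direction
        \<open>b\<close>. It shares all other coordinates with \<open>y\<close>, so the covering set
        that contains it controls \<open>y\<close>.\<close>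
      define z where "z = y' + sqrt (R\<^sup>2 - (norm y')\<^sup>2) *\<^sub>R b"
      have "(norm z)\<^sup>2 = (norm y')\<^sup>2 + (sqrt (R\<^sup>2 - (norm y')\<^sup>2))\<^sup>2"
        unfolding z_def power2_norm_eq_inner using b ortho
        by (simp add: inner_add_left inner_add_right inner_commute[of b y'] power2_eq_square[symmetric] inner_Basis)
      also have "\<dots> = R\<^sup>2" using ny' by (simp add: power_mono)
      finally have "norm z = R" using R by (simp add: power2_eq_iff_nonneg)
      then have "z \<in> (\<Union>i. C i)" using C(1) by (auto simp: subset_eq)
      then obtain i where i: "z \<in> C i" by blast
      then have ne: "C i \<noteq> {}" by auto
      have "y \<in> Z i"
      proof -
        have zc: "\<bar>y \<bullet> c - x i \<bullet> c\<bar> \<le> d i" if "c \<in> Basis" "c \<noteq> b" for c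
        proof -
          have "z \<bullet> c = y \<bullet> c" unfolding z_def y'_def using that inner_sum[of c "\<lambda>c. y \<bullet> c"] b
            by (simp add: inner_add_left inner_Basis)
          then have "\<bar>y \<bullet> c - x i \<bullet> c\<bar> = \<bar>(z - x i) \<bullet> c\<bar>" by (simp add: inner_diff_left)
          also have "\<dots> \<le> norm (z - x i)" using that by (intro Basis_le_norm)
          also have "\<dots> \<le> d i" using diameter_bounded_bound[OF C(2) i x[OF ne]] by (simp add: d_def dist_norm)
          finally show ?thesis .
        qed
        have Zi: "Z i = cbox (\<Sum>c\<in>Basis - {b}. (x i \<bullet> c - d i) *\<^sub>R c) (b + (\<Sum>c\<in>Basis - {b}. (x i \<bullet> c + d i) *\<^sub>R c))"
          using ne by (simp add: Z_def)
        show ?thesis unfolding Zi mem_box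
        proof (intro ballI conjI)
          fix c :: 'a assume c: "c \<in> Basis"
          show "(\<Sum>c\<in>Basis - {b}. (x i \<bullet> c - d i) *\<^sub>R c) \<bullet> c \<le> y \<bullet> c"
            using zc[OF c] yb c by (auto simp: inner_sum[OF c] abs_le_iff)
          show "y \<bullet> c \<le> (b + (\<Sum>c\<in>Basis - {b}. (x i \<bullet> c + d i) *\<^sub>R c)) \<bullet> c"
            using zc[OF c] yb c b by (auto simp: inner_add_left inner_sum[OF c] abs_le_iff inner_Basis)
        qed
      qed
      then show "y \<in> (\<Union>i. Z i)" by blast
    qed
    moreover have Zs: "Z i \<in> sets lborel" for i by (simp add: Z_def)
    ultimately have "emeasure lborel V \<le> emeasure lborel (\<Union>i. Z i)" by (intro emeasure_mono) auto
    also have "\<dots> \<le> (\<Sum>i. emeasure lborel (Z i))" using Zs by (intro emeasure_subadditive_countably) auto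
    also have "\<dots> = (\<Sum>i. ennreal (if C i = {} then 0 else (2 * d i) ^ (n - 1)))"
      using volbox d by (intro suminf_cong) (simp add: Z_def)
    finally show ?thesis using volbox[of \<rho> "\<lambda>_. 0"] \<rho> unfolding V_def d_def by simp
  qed
  \<comment> \<open>Since d/2 = (2 d)/4, this factor converts the volumes (2 d)^(n-1) into Hausdorff
    weights.\<close>
  define \<alpha> where "\<alpha> = unit_ball_vol (real (n - 1)) / 4 ^ (n - 1)"
  have \<alpha>: "\<alpha> > 0" by (simp add: \<alpha>_def)
  have "ennreal (\<alpha> * (2 * \<rho>) ^ (n - 1)) \<le> hausdorff_content (n - 1) 1 (sphere (0::'a) R)"
  proof (rule hausdorff_content_ge)
    fix C :: "nat \<Rightarrow> 'a set" assume C: "sphere 0 R \<subseteq> (\<Union>i. C i)" "\<And>i. bounded (C i)"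
    have "ennreal (\<alpha> * (2 * \<rho>) ^ (n - 1)) = ennreal \<alpha> * ennreal ((2 * \<rho>) ^ (n - 1))"
      using \<alpha> \<rho> by (simp add: ennreal_mult)
    also have "\<dots> \<le> ennreal \<alpha> * (\<Sum>i. ennreal (if C i = {} then 0 else (2 * diameter (C i)) ^ (n - 1)))"
      by (rule mult_left_mono[OF cover[OF C]]) auto
    also have "\<dots> = (\<Sum>i. ennreal \<alpha> * ennreal (if C i = {} then 0 else (2 * diameter (C i)) ^ (n - 1)))" by simp
    also have "\<dots> = (\<Sum>i. hausdorff_weight (n - 1) (C i))"
    proof (rule suminf_cong)
      fix i
      have d: "0 \<le> diameter (C i)" using C(2) by (rule diameter_ge_0)
      have "(2 * diameter (C i)) ^ (n - 1) / 4 ^ (n - 1) = (diameter (C i) / 2) ^ (n - 1)"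
        unfolding power_divide[symmetric] by (rule arg_cong[where f="\<lambda>x. x ^ (n - 1)"]) simp
      then have "\<alpha> * (2 * diameter (C i)) ^ (n - 1) = unit_ball_vol (real (n - 1)) * (diameter (C i) / 2) ^ (n - 1)"
        unfolding \<alpha>_def by (metis times_divide_eq_left times_divide_eq_right)
      then show "ennreal \<alpha> * ennreal (if C i = {} then 0 else (2 * diameter (C i)) ^ (n - 1)) = hausdorff_weight (n - 1) (C i)"
        using \<alpha> d unfolding hausdorff_weight_def by (cases "C i = {}") (simp_all only: ennreal_mult[symmetric] if_True if_False less_imp_le zero_le_power mult_nonneg_nonneg zero_le_numeral, simp_all)
    qed
    finally show "ennreal (\<alpha> * (2 * \<rho>) ^ (n - 1)) \<le> (\<Sum>i. hausdorff_weight (n - 1) (C i))" .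
  qed
  also have "\<dots> \<le> hausdorff_outer (n - 1) (sphere (0::'a) R)" by (rule hausdorff_content_le_outer) simp
  finally show ?thesis using \<alpha> \<rho> unfolding n_def[symmetric]
    by (metis ennreal_less_zero_iff less_le_trans mult_pos_pos zero_less_mult_iff zero_less_numeral zero_less_power)
qed

section \<open>The surface measure of a sphere\<close>

text \<open>If the balls of radius \<open>r\<close> were null sets, finitely many of them would
  cover the compact set \<open>S\<close>.\<close>

lemma uniformly_distributed_ball_pos:
  fixes M :: "'a::metric_space measure"
  assumes sets: "sets M = sets borel" and S: "compact S" "emeasure M S \<noteq> 0"
    and g: "\<And>x. x \<in> S \<Longrightarrow> emeasure M (ball x r) = g" and r: "0 < r"
  shows "g \<noteq> 0"
proof
  assume g0: "g = 0"
  have "S \<subseteq> (\<Union>x\<in>S. ball x r)" using r by auto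
  then obtain C where C: "C \<subseteq> S" "finite C" "S \<subseteq> (\<Union>x\<in>C. ball x r)"
    using compactE_image[OF S(1), of S "\<lambda>x. ball x r"] by (metis open_ball)
  have "(\<Union>x\<in>C. ball x r) \<in> null_sets M"
    using C(1,2) g g0 sets by (intro null_sets_UN') (auto simp: null_sets_def countable_finite)
  then have "S \<in> null_sets M"
    by (rule null_sets_subset) (use C(3) S(1) sets in \<open>auto intro: borel_compact\<close>)
  then show False using S(2) by (simp add: null_sets_def)
qed

text \<open>Fubini on the set of pairs at distance less than \<open>r\<close>, a condition symmetric
  in the two points.\<close>

lemma nn_integral_emeasure_Int_ball:
  fixes M N :: "'a::{metric_space, second_countable_topology} measure"
  assumes fin: "sigma_finite_measure M" "sigma_finite_measure N" and sets: "sets M = sets borel" "sets N = sets borel"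
    and U: "U \<in> sets borel"
  shows "(\<integral>\<^sup>+x. emeasure N (U \<inter> ball x r) \<partial>M) = (\<integral>\<^sup>+y. indicator U y * emeasure M (ball y r) \<partial>N)"
    and "(\<lambda>x. emeasure N (U \<inter> ball x r)) \<in> borel_measurable M"
proof -
  interpret M: sigma_finite_measure M by fact
  interpret N: sigma_finite_measure N by fact
  interpret pair_sigma_finite M N by standard
  note [measurable_cong] = sets
  note [measurable] = U
  have *: "(\<lambda>p. indicator U (snd p) * indicator {..<r} (dist (fst p) (snd p)) :: ennreal) \<in> borel_measurable (M \<Otimes>\<^sub>M N)"
    by measurable
  have inner: "emeasure N (U \<inter> ball x r) = (\<integral>\<^sup>+y. indicator U y * indicator {..<r} (dist x y) \<partial>N)" for x
  proof -
    have "(\<integral>\<^sup>+y. indicator U y * indicator {..<r} (dist x y) \<partial>N) = (\<integral>\<^sup>+y. indicator (U \<inter> ball x r) y \<partial>N)"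
      by (intro nn_integral_cong) (auto simp: indicator_def)
    then show ?thesis using sets U by simp
  qed
  show "(\<lambda>x. emeasure N (U \<inter> ball x r)) \<in> borel_measurable M"
    using N.borel_measurable_nn_integral_fst[OF *] by (simp add: inner)
  have "(\<integral>\<^sup>+x. emeasure N (U \<inter> ball x r) \<partial>M) = (\<integral>\<^sup>+y. \<integral>\<^sup>+x. indicator U y * indicator {..<r} (dist x y) \<partial>M \<partial>N)"
    unfolding inner
    using Fubini'[of "\<lambda>x y. indicator U y * indicator {..<r} (dist x y)"] * by (simp add: case_prod_beta')
  also have "\<dots> = (\<integral>\<^sup>+y. indicator U y * emeasure M (ball y r) \<partial>N)"
  proof (rule nn_integral_cong)
    fix y
    have [measurable]: "ball y r \<in> sets M" using sets by simp
    have "(\<integral>\<^sup>+x. indicator U y * indicator {..<r} (dist x y) \<partial>M) = (\<integral>\<^sup>+x. indicator U y * indicator (ball y r) x \<partial>M)"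
      by (intro nn_integral_cong) (auto simp: indicator_def dist_commute)
    then show "(\<integral>\<^sup>+x. indicator U y * indicator {..<r} (dist x y) \<partial>M) = indicator U y * emeasure M (ball y r)"
      by (simp add: nn_integral_cmult)
  qed
  finally show "(\<integral>\<^sup>+x. emeasure N (U \<inter> ball x r) \<partial>M) = (\<integral>\<^sup>+y. indicator U y * emeasure M (ball y r) \<partial>N)" .
qed

text \<open>At a point x of the open set U the quotient of the N-measure of
  \<open>U \<inter> ball x r\<close> by \<open>h r\<close> equals 1 for small r. Fatou's lemma
  bounds the M-measure of U by the lower limit of the integrals of these quotients, and the Fubini
  identity evaluates each integral as c times the N-measure of U.\<close>

lemma emeasure_open_le_if_ball_le:
  fixes M N :: "'a::{metric_space, second_countable_topology} measure"
  assumes fin: "sigma_finite_measure M" "sigma_finite_measure N" and sets: "sets M = sets borel" "sets N = sets borel"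
    and S: "AE x in M. x \<in> S" "AE x in N. x \<in> S"
    and g: "\<And>x r. 0 < r \<Longrightarrow> x \<in> S \<Longrightarrow> emeasure M (ball x r) = g r"
    and h: "\<And>x r. 0 < r \<Longrightarrow> x \<in> S \<Longrightarrow> emeasure N (ball x r) = h r"
    and hpos: "\<And>r. 0 < r \<Longrightarrow> h r \<noteq> 0" and hfin: "\<And>r. 0 < r \<Longrightarrow> h r \<noteq> \<infinity>"
    and ratio: "\<And>r. 0 < r \<Longrightarrow> g r = c * h r"
    and U: "open U"
  shows "emeasure M U \<le> c * emeasure N U"
proof -
  have U': "U \<in> sets borel" using U by simp
  note meas = nn_integral_emeasure_Int_ball(2)[OF fin sets U']
  have key: "(\<integral>\<^sup>+x. emeasure N (U \<inter> ball x r) \<partial>M) = g r * emeasure N U" if "0 < r" for r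
  proof -
    have "(\<integral>\<^sup>+y. indicator U y * emeasure M (ball y r) \<partial>N) = (\<integral>\<^sup>+y. g r * indicator U y \<partial>N)"
      using S(2) that by (intro nn_integral_cong_AE) (auto elim!: eventually_mono simp: g mult.commute)
    also have "\<dots> = g r * emeasure N U" using U' sets by (subst nn_integral_cmult_indicator) auto
    finally show ?thesis using nn_integral_emeasure_Int_ball(1)[OF fin sets U'] by simp
  qed
  define \<rho> where "\<rho> j = 1 / real (Suc j)" for j
  have \<rho>: "0 < \<rho> j" for j by (simp add: \<rho>_def)
  have \<rho>0: "\<rho> \<longlonglongrightarrow> 0" unfolding \<rho>_def[abs_def] using LIMSEQ_inverse_real_of_nat by (simp add: inverse_eq_divide)
  have "emeasure M U = (\<integral>\<^sup>+x. indicator U x \<partial>M)" using U' sets by simp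
  also have "\<dots> \<le> (\<integral>\<^sup>+x. liminf (\<lambda>j. emeasure N (U \<inter> ball x (\<rho> j)) / h (\<rho> j)) \<partial>M)"
  proof (rule nn_integral_mono_AE)
    show "AE x in M. indicator U x \<le> liminf (\<lambda>j. emeasure N (U \<inter> ball x (\<rho> j)) / h (\<rho> j))"
      using S(1)
    proof eventually_elim
      case (elim x)
      show ?case
      proof (cases "x \<in> U")
        case True
        then obtain e where e: "0 < e" "ball x e \<subseteq> U" using U open_contains_ball by metis
        have "\<forall>\<^sub>F j in sequentially. \<rho> j < e" using order_tendstoD(2)[OF \<rho>0 e(1)] .
        then have "\<forall>\<^sub>F j in sequentially. 1 \<le> emeasure N (U \<inter> ball x (\<rho> j)) / h (\<rho> j)"
        proof eventually_elim
          case (elim j)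
          then have "U \<inter> ball x (\<rho> j) = ball x (\<rho> j)" using e(2) by force
          then have "emeasure N (U \<inter> ball x (\<rho> j)) = h (\<rho> j)" using h[OF \<rho> \<open>x \<in> S\<close>] by simp
          then show ?case using hpos[OF \<rho>] hfin[OF \<rho>] by (simp add: ennreal_divide_self less_top)
        qed
        then show ?thesis using True by (simp add: Liminf_bounded)
      qed simp
    qed
  qed
  also have "\<dots> \<le> liminf (\<lambda>j. \<integral>\<^sup>+x. emeasure N (U \<inter> ball x (\<rho> j)) / h (\<rho> j) \<partial>M)"
    using meas by (intro nn_integral_liminf) auto
  also have "(\<lambda>j. \<integral>\<^sup>+x. emeasure N (U \<inter> ball x (\<rho> j)) / h (\<rho> j) \<partial>M) = (\<lambda>j. c * emeasure N U)"
  proof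
    fix j
    have "(\<integral>\<^sup>+x. emeasure N (U \<inter> ball x (\<rho> j)) / h (\<rho> j) \<partial>M) = c * h (\<rho> j) * emeasure N U / h (\<rho> j)"
      using meas key[OF \<rho>] ratio[OF \<rho>] by (simp add: nn_integral_divide)
    also have "\<dots> = c * emeasure N U"
      using hpos[OF \<rho>] hfin[OF \<rho>] mult_divide_eq_ennreal[of "h (\<rho> j)" "c * emeasure N U"]
      by (simp add: ac_simps)
    finally show "(\<integral>\<^sup>+x. emeasure N (U \<inter> ball x (\<rho> j)) / h (\<rho> j) \<partial>M) = c * emeasure N U" .
  qed
  finally show ?thesis by (simp add: Liminf_const)
qed

text \<open>The ratio of \<open>g\<close> to \<open>h\<close> is read off by putting the whole space
  into the Fubini identity. Clearing the denominator makes the conclusion symmetric under exchange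
  of M and N.\<close>

lemma uniformly_distributed_open_le:
  fixes M N :: "'a::{metric_space, second_countable_topology} measure"
  assumes fin: "finite_measure M" "finite_measure N" and sets: "sets M = sets borel" "sets N = sets borel"
    and S: "compact S" "emeasure M (- S) = 0" "emeasure N (- S) = 0" "emeasure M S \<noteq> 0" "emeasure N S \<noteq> 0"
    and g: "\<And>x r. x \<in> S \<Longrightarrow> emeasure M (ball x r) = g r"
    and h: "\<And>x r. x \<in> S \<Longrightarrow> emeasure N (ball x r) = h r"
    and U: "open U"
  shows "emeasure N S * emeasure M U \<le> emeasure M S * emeasure N U"
proof -
  interpret M: finite_measure M by fact
  interpret N: finite_measure N by fact
  have sf: "sigma_finite_measure M" "sigma_finite_measure N" by standard+
  have Sb: "S \<in> sets borel" "- S \<in> sets borel" using S(1) by (auto intro: borel_compact borel_comp)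
  have AEM: "AE x in M. x \<in> S"
    by (rule AE_I[where N="- S"]) (use S(2) Sb sets in auto)
  have AEN: "AE x in N. x \<in> S"
    by (rule AE_I[where N="- S"]) (use S(3) Sb sets in auto)
  have spaces: "space M = UNIV" "space N = UNIV" using sets_eq_imp_space_eq[OF sets(1)] sets_eq_imp_space_eq[OF sets(2)] by auto
  have univ: "emeasure M UNIV = emeasure M S" "emeasure N UNIV = emeasure N S"
    using AEM AEN Sb sets by (auto intro!: emeasure_eq_AE)
  have hfin: "h r \<noteq> \<infinity>" and hpos: "h r \<noteq> 0" if "0 < r" for r
  proof -
    have "S \<noteq> {}" using S(4) by auto
    then obtain x where "x \<in> S" by blast
    then show "h r \<noteq> \<infinity>" using h[of x r] N.emeasure_finite[of "ball x r"] by simp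
    show "h r \<noteq> 0" by (rule uniformly_distributed_ball_pos[OF sets(2) S(1) S(5) h that])
  qed
  have ratio: "h r * emeasure M S = g r * emeasure N S" for r
  proof -
    have "(\<integral>\<^sup>+x. emeasure N (UNIV \<inter> ball x r) \<partial>M) = (\<integral>\<^sup>+x. h r \<partial>M)"
      using AEM by (intro nn_integral_cong_AE) (auto elim!: eventually_mono simp: h)
    moreover have "(\<integral>\<^sup>+y. indicator UNIV y * emeasure M (ball y r) \<partial>N) = (\<integral>\<^sup>+y. g r \<partial>N)"
      using AEN by (intro nn_integral_cong_AE) (auto elim!: eventually_mono simp: g)
    ultimately show ?thesis using nn_integral_emeasure_Int_ball(1)[OF sf sets, of UNIV r] by (simp add: spaces univ)
  qed
  have ratio': "g r = emeasure M S / emeasure N S * h r" for r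
  proof -
    have "g r = g r * emeasure N S / emeasure N S"
      using S(5) N.emeasure_finite[of S] by (simp add: mult_divide_eq_ennreal)
    then show ?thesis by (simp add: ratio[symmetric] divide_ennreal_def ac_simps)
  qed
  have "emeasure M U \<le> emeasure M S / emeasure N S * emeasure N U"
    by (rule emeasure_open_le_if_ball_le[OF sf sets AEM AEN g h hpos hfin ratio' U])
  then have "emeasure N S * emeasure M U \<le> emeasure N S * (emeasure M S / emeasure N S * emeasure N U)"
    by (rule mult_left_mono) simp
  also have "\<dots> = emeasure M S * emeasure N U"
    using S(5) N.emeasure_finite[of S] mult_divide_eq_ennreal[of "emeasure N S" "emeasure M S * emeasure N U"]
    by (simp add: divide_ennreal_def ac_simps)
  finally show ?thesis .
qed

text \<open>Both measures give all balls of a given radius the same volume; this replaces the change of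
  variables formula, which the library has only for well-ordered index types.\<close>

lemma lborel_distr_isometry:
  fixes T :: "'a::euclidean_space \<Rightarrow> 'a"
  assumes T: "orthogonal_transformation T"
  shows "distr lborel borel T = lborel"
proof (rule measure_eqI_generator_eq)
  let ?N = "distr lborel borel T"
  let ?E = "{S :: 'a set. open S}"
  have lin: "linear T" using T by (rule orthogonal_transformation_linear)
  have cont: "continuous_on UNIV T" by (simp add: lin linear_continuous_on linear_conv_bounded_linear[THEN iffD1])
  have [measurable]: "T \<in> borel_measurable borel" using cont by (rule borel_measurable_continuous_onI)
  have dist: "dist (T x) (T y) = dist x y" for x y
    using T lin by (metis dist_norm linear_diff orthogonal_transformation_norm)
  have ballN: "emeasure ?N (ball x r) = ennreal (unit_ball_vol (real DIM('a)) * r ^ DIM('a))" if "0 < r" for x r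
  proof -
    obtain y where "T y = x" using orthogonal_transformation_surj[OF T] by (metis surjD)
    then have "T -` ball x r = ball y r" using dist[of y] by auto
    then show ?thesis using that by (simp add: emeasure_distr emeasure_ball)
  qed
  have ballL: "emeasure lborel (ball x r) = ennreal (unit_ball_vol (real DIM('a)) * r ^ DIM('a))" if "0 < r" for x :: 'a and r
    using that by (simp add: emeasure_ball)
  have UN: "(\<Union>i::nat. ball 0 (real (Suc i))) = (UNIV :: 'a set)"
  proof (intro equalityI subsetI)
    fix x :: 'a
    obtain i :: nat where "norm x < real i" using reals_Archimedean2 by blast
    then have "x \<in> ball 0 (real (Suc i))" by simp
    then show "x \<in> (\<Union>i::nat. ball 0 (real (Suc i)))" by blast
  qed simp
  have sfN: "sigma_finite_measure ?N"
  proof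
    show "\<exists>A. countable A \<and> A \<subseteq> sets ?N \<and> \<Union>A = space ?N \<and> (\<forall>a\<in>A. emeasure ?N a \<noteq> \<infinity>)"
    proof (intro exI[of _ "range (\<lambda>i::nat. ball 0 (real (Suc i)))"] conjI)
      show "\<Union> (range (\<lambda>i::nat. ball 0 (real (Suc i)))) = space ?N" by (simp only: UN space_distr space_borel)
    qed (auto simp: ballN)
  qed
  have sfL: "sigma_finite_measure (lborel :: 'a measure)" by standard
  have vp: "unit_ball_vol (real DIM('a)) \<noteq> 0" using unit_ball_vol_pos[of "real DIM('a)"] by (metis less_irrefl of_nat_0_le_iff)
  show "Int_stable ?E" by (auto simp: Int_stable_def)
  show "?E \<subseteq> Pow UNIV" "sets ?N = sigma_sets UNIV ?E" "sets lborel = sigma_sets UNIV ?E"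
    by (auto simp: borel_def)
  show "range (\<lambda>i::nat. ball 0 (real (Suc i))) \<subseteq> ?E" by auto
  show "(\<Union>i::nat. ball 0 (real (Suc i))) = (UNIV :: 'a set)"
    by (rule UN)
  show "emeasure ?N (ball 0 (real (Suc i))) \<noteq> \<infinity>" for i by (simp add: ballN)
  fix U :: "'a set" assume "U \<in> ?E"
  then have U: "open U" by simp
  \<comment> \<open>Balls of equal radius have equal volume for both measures, so the comparison
    constant is 1 in either direction.\<close>
  have "emeasure ?N U \<le> 1 * emeasure lborel U"
    by (rule emeasure_open_le_if_ball_le[OF sfN sfL _ _ _ _ ballN ballL _ _ _ U, where S=UNIV]) (use vp in auto)
  moreover have "emeasure lborel U \<le> 1 * emeasure ?N U"
    by (rule emeasure_open_le_if_ball_le[OF sfL sfN _ _ _ _ ballL ballN _ _ _ U, where S=UNIV]) (use vp in auto)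
  ultimately show "emeasure ?N U = emeasure lborel U" by simp
qed

text \<open>The hypotheses are symmetric in the two measures, so the inequality on open sets holds
  both ways, and open sets generate the Borel sets.\<close>

lemma uniformly_distributed_proportional:
  fixes M N :: "'a::{metric_space, second_countable_topology} measure"
  assumes fin: "finite_measure M" "finite_measure N" and sets: "sets M = sets borel" "sets N = sets borel"
    and S: "compact S" "emeasure M (- S) = 0" "emeasure N (- S) = 0" "emeasure M S \<noteq> 0" "emeasure N S \<noteq> 0"
    and g: "\<And>x r. x \<in> S \<Longrightarrow> emeasure M (ball x r) = g r"
    and h: "\<And>x r. x \<in> S \<Longrightarrow> emeasure N (ball x r) = h r"
  shows "scale_measure (emeasure N S) M = scale_measure (emeasure M S) N"
proof (rule measure_eqI_generator_eq)
  interpret M: finite_measure M by fact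
  interpret N: finite_measure N by fact
  let ?E = "{S :: 'a set. open S}"
  show "Int_stable ?E" by (auto simp: Int_stable_def)
  show "?E \<subseteq> Pow UNIV" "sets (scale_measure (emeasure N S) M) = sigma_sets UNIV ?E"
    "sets (scale_measure (emeasure M S) N) = sigma_sets UNIV ?E"
    by (auto simp: sets borel_def)
  show "range (\<lambda>_::nat. UNIV) \<subseteq> ?E" "(\<Union>i::nat. UNIV) = (UNIV :: 'a set)" by auto
  show "emeasure (scale_measure (emeasure N S) M) UNIV \<noteq> \<infinity>"
    by (simp add: ennreal_mult_eq_top_iff M.emeasure_finite N.emeasure_finite)
  fix U assume "U \<in> ?E"
  then show "emeasure (scale_measure (emeasure N S) M) U = emeasure (scale_measure (emeasure M S) N) U"
    using uniformly_distributed_open_le[OF fin sets S g h, of U]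
      uniformly_distributed_open_le[OF fin(2,1) sets(2,1) S(1,3,2,5,4) h g, of U]
    by (auto intro: antisym)
qed

section \<open>Direction and radius under Lebesgue measure on a ball\<close>

text \<open>At the origin, division by zero gives the value 0, a point off the sphere of radius R >
  0; the exception is a single point and thus null.\<close>

definition radial_projection :: "real \<Rightarrow> 'a::real_normed_vector \<Rightarrow> 'a" where
  "radial_projection R x = (R / norm x) *\<^sub>R x"

lemma radial_projection_measurable [measurable]:
  "radial_projection R \<in> borel_measurable (borel :: 'a::euclidean_space measure)"
  unfolding radial_projection_def[abs_def] by measurable

lemma radial_projection_scaleR: "0 < c \<Longrightarrow> radial_projection R (c *\<^sub>R x) = radial_projection R x"
  by (cases "x = 0") (auto simp: radial_projection_def)

definition ball_measure :: "real \<Rightarrow> 'a::euclidean_space measure" where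
  "ball_measure R = density lborel (indicator (ball 0 R))"

text \<open>A set of directions receives the Lebesgue volume of the cone over it inside the ball.
  Rotation invariance is inherited from Lebesgue measure.\<close>

definition cone_measure :: "real \<Rightarrow> 'a::euclidean_space measure" where
  "cone_measure R = distr (ball_measure R) borel (radial_projection R)"

text \<open>The law of |x|^2 / R^2 for x uniform in an n-dimensional ball of radius R: mass t^(n/2)
  below t, total mass 1. The volume of the ball is carried by \<open>cone_measure\<close>.\<close>

definition radial_law :: "nat \<Rightarrow> real measure" where
  "radial_law n = density lborel (\<lambda>s. ennreal (indicator {0<..<1} s * (real n / 2 * s powr (real n / 2 - 1))))"

lemma sets_ball_measure [simp, measurable_cong]: "sets (ball_measure R) = sets borel"
  and space_ball_measure [simp]: "space (ball_measure R) = UNIV"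
  by (simp_all add: ball_measure_def)

lemma sets_cone_measure [simp, measurable_cong]: "sets (cone_measure R) = sets borel"
  and space_cone_measure [simp]: "space (cone_measure R) = UNIV"
  by (simp_all add: cone_measure_def)

lemma sets_radial_law [simp, measurable_cong]: "sets (radial_law n) = sets borel"
  and space_radial_law [simp]: "space (radial_law n) = UNIV"
  by (simp_all add: radial_law_def)

lemma emeasure_ball_measure: "X \<in> sets borel \<Longrightarrow> emeasure (ball_measure R) X = emeasure lborel (ball 0 R \<inter> X)"
  unfolding ball_measure_def by (simp add: emeasure_restricted)

lemma finite_ball_measure: "finite_measure (ball_measure R :: 'a::euclidean_space measure)"
proof
  show "emeasure (ball_measure R :: 'a measure) (space (ball_measure R)) \<noteq> \<infinity>"
    using emeasure_lborel_ball_finite[of "0::'a" R] by (simp add: emeasure_ball_measure)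
qed

lemma finite_cone_measure: "finite_measure (cone_measure R :: 'a::euclidean_space measure)"
  unfolding cone_measure_def
  by (rule finite_measure.finite_measure_distr[OF finite_ball_measure]) simp

lemma emeasure_cone_measure:
  "X \<in> sets borel \<Longrightarrow> emeasure (cone_measure R) X = emeasure lborel (ball 0 R \<inter> radial_projection R -` X)"
  unfolding cone_measure_def
  by (subst emeasure_distr) (auto intro!: emeasure_ball_measure measurable_sets_borel)

lemma radial_law_lessThan:
  assumes n: "n \<ge> 1"
  shows "emeasure (radial_law n) {..<t} = ennreal (if t \<le> 0 then 0 else if t \<le> 1 then t powr (real n / 2) else 1)"
proof -
  have main: "(\<integral>\<^sup>+s. ennreal (indicator {0<..<t} s * (real n / 2 * s powr (real n / 2 - 1))) \<partial>lborel) = ennreal (t powr (real n / 2))"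
    if t: "0 < t" for t :: real
  proof (rule nn_integral_has_integral_lborel)
    have "((\<lambda>s. real n / 2 * s powr (real n / 2 - 1)) has_integral (t powr (real n / 2) - 0 powr (real n / 2))) {0..t}"
    \<comment> \<open>The interior form of the fundamental theorem is used because for n = 1 the
      antiderivative s^(n/2) is not differentiable at 0.\<close>
    proof (rule fundamental_theorem_of_calculus_interior)
      show "continuous_on {0..t} (\<lambda>s. s powr (real n / 2))" using n by (intro continuous_on_powr' continuous_intros) auto
      show "((\<lambda>s. s powr (real n / 2)) has_vector_derivative real n / 2 * s powr (real n / 2 - 1)) (at s)" if "s \<in> {0<..<t}" for s
        using that has_real_derivative_powr[of s "real n / 2"] by (simp add: has_real_derivative_iff_has_vector_derivative)
    qed (use t in auto)
    moreover have "(0::real) powr (real n / 2) = 0" by simp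
    ultimately have "((\<lambda>s. real n / 2 * s powr (real n / 2 - 1)) has_integral t powr (real n / 2)) {0<..<t}"
      by (simp only: has_integral_Icc_iff_Ioo diff_zero)
    then have "((\<lambda>s. if s \<in> {0<..<t} then real n / 2 * s powr (real n / 2 - 1) else 0) has_integral t powr (real n / 2)) UNIV"
      by (simp only: has_integral_restrict_UNIV)
    then show "((\<lambda>s. indicator {0<..<t} s * (real n / 2 * s powr (real n / 2 - 1))) has_integral t powr (real n / 2)) UNIV"
      by (rule has_integral_eq[rotated]) (auto simp: indicator_def)
  qed (auto simp: indicator_def)
  define u where "u = min t 1"
  have "emeasure (radial_law n) {..<t} = (\<integral>\<^sup>+s. ennreal (indicator {0<..<u} s * (real n / 2 * s powr (real n / 2 - 1))) \<partial>lborel)"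
    unfolding radial_law_def u_def
    by (subst emeasure_density) (auto intro!: nn_integral_cong simp: indicator_def)
  also have "\<dots> = ennreal (if t \<le> 0 then 0 else if t \<le> 1 then t powr (real n / 2) else 1)"
  proof (cases "t \<le> 0")
    case True
    then have "indicator {0<..<u} s = (0::real)" for s by (auto simp: u_def indicator_def)
    then show ?thesis using True by simp
  next
    case False
    then show ?thesis using main[of u] by (auto simp: u_def min_def)
  qed
  finally show ?thesis .
qed

lemma finite_radial_law: "n \<ge> 1 \<Longrightarrow> finite_measure (radial_law n)"
proof
  assume n: "n \<ge> 1"
  have "emeasure (radial_law n) UNIV = emeasure (radial_law n) {..<1}"
    unfolding radial_law_def by (subst (1 2) emeasure_density) (auto intro!: nn_integral_cong simp: indicator_def)
  then show "emeasure (radial_law n) (space (radial_law n)) \<noteq> \<infinity>"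
    using radial_law_lessThan[OF n, of 1] by simp
qed

text \<open>Dilation by \<open>t\<close> maps the cone of radius R onto that of radius t R, and the
  projection to the sphere is invariant under dilations.\<close>

lemma emeasure_lborel_cone:
  fixes X :: "'a::euclidean_space set"
  assumes X: "X \<in> sets borel" and R: "0 < R" and t: "0 < t"
  shows "emeasure lborel {x. norm x < t * R \<and> radial_projection R x \<in> X}
    = ennreal (t ^ DIM('a)) * emeasure lborel (ball 0 R \<inter> radial_projection R -` X)"
proof -
  define E where "E = {x. norm x < t * R \<and> radial_projection R x \<in> X}"
  have E: "E \<in> sets borel" unfolding E_def using X by measurable
  have "emeasure lborel E = emeasure (density (distr lborel borel (\<lambda>x. 0 + t *\<^sub>R x)) (\<lambda>_. ennreal (\<bar>t\<bar>^DIM('a)))) E"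
    using lborel_affine[of t "0::'a"] t by (metis less_irrefl)
  also have "\<dots> = ennreal (t ^ DIM('a)) * emeasure lborel ((\<lambda>x. t *\<^sub>R x) -` E)"
    using t E by (simp add: emeasure_density emeasure_distr nn_integral_cmult_indicator)
  also have "(\<lambda>x. t *\<^sub>R x) -` E = ball 0 R \<inter> radial_projection R -` X"
    using t by (auto simp: E_def radial_projection_scaleR)
  finally show ?thesis by (simp add: E_def)
qed

text \<open>Direction and radius are independent. On a rectangle X \<times> T the law of the squared
  radius within the cone over X is compared with \<open>radial_law\<close> on half-lines, where the
  claim is the dilation formula with factor sqrt t.\<close>

lemma polar_joint_law:
  assumes R: "0 < R"
  shows "cone_measure R \<Otimes>\<^sub>M radial_law (DIM('a)) =
    distr (ball_measure R) (borel \<Otimes>\<^sub>M borel) (\<lambda>x::'a::euclidean_space. (radial_projection R x, (norm x)\<^sup>2 / R\<^sup>2))"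
proof (rule pair_measure_eqI)
  let ?n = "DIM('a)"
  let ?s = "\<lambda>x::'a. (norm x)\<^sup>2 / R\<^sup>2"
  have n: "?n \<ge> 1" by (simp add: DIM_positive Suc_leI)
  interpret B: finite_measure "ball_measure R :: 'a measure" by (rule finite_ball_measure)
  interpret C: finite_measure "cone_measure R :: 'a measure" by (rule finite_cone_measure)
  interpret L: finite_measure "radial_law ?n" using n by (rule finite_radial_law)
  show "sigma_finite_measure (cone_measure R :: 'a measure)" "sigma_finite_measure (radial_law ?n)" by standard+
  show "sets (cone_measure R \<Otimes>\<^sub>M radial_law ?n) = sets (distr (ball_measure R) (borel \<Otimes>\<^sub>M borel) (\<lambda>x::'a. (radial_projection R x, ?s x)))"
    by (simp cong: sets_pair_measure_cong)
  fix X :: "'a set" and T :: "real set"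
  assume "X \<in> sets (cone_measure R)" and "T \<in> sets (radial_law ?n)"
  then have X [measurable]: "X \<in> sets borel" and T [measurable]: "T \<in> sets borel" by auto
  \<comment> \<open>\<open>P\<close> is volume on the cone over X, and \<open>Q\<close> is the law
    of the squared relative radius under \<open>P\<close>.\<close>
  define P where "P = density (ball_measure R) (indicator (radial_projection R -` X))"
  define Q where "Q = distr P borel ?s"
  have Xp [measurable]: "radial_projection R -` X \<in> sets borel" using X by (intro measurable_sets_borel[OF radial_projection_measurable])
  have emQ: "emeasure Q Y = emeasure (ball_measure R) (radial_projection R -` X \<inter> ?s -` Y)" if "Y \<in> sets borel" for Y
  proof -
    have m: "?s \<in> borel_measurable borel" by measurable
    have [measurable]: "?s -` Y \<in> sets borel" by (rule measurable_sets_borel[OF m that])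
    show ?thesis unfolding Q_def P_def using that
      by (subst emeasure_distr) (auto simp: emeasure_density simp flip: indicator_inter_arith)
  qed
  have "Q = scale_measure (emeasure (cone_measure R) X) (radial_law ?n)"
  proof (rule measure_eqI_generator_eq)
    let ?E = "range (\<lambda>a::real. {..<a})"
    show "Int_stable ?E"
    proof (rule Int_stableI)
      fix V W assume "V \<in> ?E" "W \<in> ?E"
      then obtain a b where "V = {..<a}" "W = {..<b}" by blast
      then have "V \<inter> W = {..<min a b}" by auto
      then show "V \<inter> W \<in> ?E" by blast
    qed
    have "borel = sigma UNIV ?E" using borel_eq_lessThan[where 'a=real] by (simp only: eucl_lessThan)
    then have "sets borel = sets (sigma UNIV ?E)" by (rule arg_cong)
    also have "\<dots> = sigma_sets UNIV ?E" by (rule sets_measure_of) simp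
    finally have "sets borel = sigma_sets UNIV ?E" .
    then show "?E \<subseteq> Pow UNIV" "sets Q = sigma_sets UNIV ?E"
      "sets (scale_measure (emeasure (cone_measure R) X) (radial_law ?n)) = sigma_sets UNIV ?E"
      by (auto simp: Q_def)
    show "range (\<lambda>i::nat. {..<real i}) \<subseteq> ?E" "(\<Union>i::nat. {..<real i}) = UNIV"
      by (auto intro: reals_Archimedean2)
    show "emeasure Q {..<real i} \<noteq> \<infinity>" for i
      by (simp add: emQ B.emeasure_finite)
    fix Y assume "Y \<in> ?E"
    then obtain t where Y: "Y = {..<t}" by auto
    have "?s \<in> borel_measurable borel" by measurable
    then have Ys: "?s -` Y \<in> sets borel" using Y by (intro measurable_sets_borel[of ?s borel]) auto
    have eq: "emeasure Q Y = emeasure lborel (ball 0 R \<inter> (radial_projection R -` X \<inter> ?s -` Y))"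
      using Ys by (simp add: emQ Y emeasure_ball_measure)
    show "emeasure Q Y = emeasure (scale_measure (emeasure (cone_measure R) X) (radial_law ?n)) Y"
    proof (cases "t \<le> 0")
      case True
      have "?s x \<notin> Y" for x
      proof -
        have "0 \<le> ?s x" by simp
        then have "t \<le> ?s x" by (rule order_trans[OF True])
        then show ?thesis unfolding Y lessThan_iff not_less .
      qed
      then have "?s -` Y = {}" by blast
      then have "emeasure Q Y = 0" unfolding eq by simp
      moreover have "emeasure (radial_law ?n) Y = 0" unfolding Y using True n by (simp add: radial_law_lessThan)
      ultimately show ?thesis by simp
    next
      case False
      show ?thesis
      proof (cases "t \<le> 1")
        case True
        have iff: "norm x < R \<and> ?s x < t \<longleftrightarrow> norm x < sqrt t * R" for x :: 'a
        proof -
          have "(sqrt t * R)\<^sup>2 = t * R\<^sup>2" using False by (simp add: power_mult_distrib)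
          then have "?s x < t \<longleftrightarrow> (norm x)\<^sup>2 < (sqrt t * R)\<^sup>2"
            using R by (simp only: pos_divide_less_eq zero_less_power)
          moreover have "(norm x)\<^sup>2 < (sqrt t * R)\<^sup>2 \<longleftrightarrow> norm x < sqrt t * R"
            using R False power2_less_imp_less[of "norm x" "sqrt t * R"] power_strict_mono[of "norm x" "sqrt t * R" 2] by auto
          moreover have "sqrt t * R \<le> R" using True R by simp
          ultimately show ?thesis by auto
        qed
        have "ball 0 R \<inter> (radial_projection R -` X \<inter> ?s -` Y) = {x. norm x < sqrt t * R \<and> radial_projection R x \<in> X}"
        proof (intro set_eqI)
          fix x :: 'a
          have "x \<in> ball 0 R \<inter> (radial_projection R -` X \<inter> ?s -` Y) \<longleftrightarrow> (norm x < R \<and> ?s x < t) \<and> radial_projection R x \<in> X"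
            unfolding Y Int_iff vimage_eq lessThan_iff mem_ball_0 by blast
          then show "x \<in> ball 0 R \<inter> (radial_projection R -` X \<inter> ?s -` Y) \<longleftrightarrow> x \<in> {x. norm x < sqrt t * R \<and> radial_projection R x \<in> X}"
            unfolding iff mem_Collect_eq .
        qed
        then have "emeasure Q Y = ennreal (sqrt t ^ ?n) * emeasure (cone_measure R) X"
          using emeasure_lborel_cone[OF X R, of "sqrt t"] False by (simp add: eq emeasure_cone_measure)
        moreover have "sqrt t ^ ?n = t powr (real ?n / 2)"
          using False by (simp add: powr_half_sqrt[symmetric] powr_powr powr_realpow[symmetric] mult.commute)
        ultimately show ?thesis using True False n by (simp add: Y radial_law_lessThan mult.commute)
      next
        case t1: False
        have "?s x < t" if "norm x < R" for x
        proof -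
          have "(norm x)\<^sup>2 < R\<^sup>2" using that by (intro power_strict_mono) auto
          then have "?s x < 1" using R by simp
          then show ?thesis using t1 by linarith
        qed
        then have "ball 0 R \<inter> (radial_projection R -` X \<inter> ?s -` Y) = ball 0 R \<inter> radial_projection R -` X"
          unfolding Y by (intro set_eqI) (simp only: Int_iff vimage_eq lessThan_iff mem_ball_0, blast)
        then have "emeasure Q Y = emeasure (cone_measure R) X" unfolding eq emeasure_cone_measure[OF X] by (rule arg_cong)
        moreover have "emeasure (radial_law ?n) Y = 1" unfolding Y using t1 n by (simp add: radial_law_lessThan)
        ultimately show ?thesis by simp
      qed
    qed
  qed
  then have "emeasure Q T = emeasure (cone_measure R) X * emeasure (radial_law ?n) T" by simp
  moreover have "emeasure Q T = emeasure (distr (ball_measure R) (borel \<Otimes>\<^sub>M borel) (\<lambda>x::'a. (radial_projection R x, ?s x))) (X \<times> T)"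
  proof -
    have "(\<lambda>x::'a. (radial_projection R x, ?s x)) -` (X \<times> T) \<inter> space (ball_measure R) = radial_projection R -` X \<inter> ?s -` T"
      by auto
    then show ?thesis
      using emeasure_distr[of "\<lambda>x::'a. (radial_projection R x, ?s x)" "ball_measure R" "borel \<Otimes>\<^sub>M borel" "X \<times> T"]
      by (simp only: emQ[OF T]) measurable
  qed
  ultimately show "emeasure (cone_measure R) X * emeasure (radial_law ?n) T =
      emeasure (distr (ball_measure R) (borel \<Otimes>\<^sub>M borel) (\<lambda>x::'a. (radial_projection R x, ?s x))) (X \<times> T)" by simp
qed

section \<open>Proportionality of cone measure and surface measure\<close>

text \<open>Surface measure as a density on the whole space instead of a restricted space, so that
  it lives on the same Borel sets as \<open>cone_measure\<close> and can enter products.\<close>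

definition sphere_measure :: "real \<Rightarrow> 'a::euclidean_space measure" where
  "sphere_measure R = density (hausdorff_measure (DIM('a) - 1)) (indicator (sphere 0 R))"

lemma sets_sphere_measure [simp, measurable_cong]: "sets (sphere_measure R) = sets borel"
  and space_sphere_measure [simp]: "space (sphere_measure R) = UNIV"
  by (simp_all add: sphere_measure_def)

lemma emeasure_sphere_measure:
  "X \<in> sets borel \<Longrightarrow> emeasure (sphere_measure R) X = hausdorff_outer (DIM('a) - 1) (sphere (0::'a::euclidean_space) R \<inter> X)"
  unfolding sphere_measure_def
  by (simp add: emeasure_restricted emeasure_hausdorff_measure)

lemma finite_sphere_measure: "0 < R \<Longrightarrow> finite_measure (sphere_measure R :: 'a::euclidean_space measure)"
  by standard (use hausdorff_sphere_finite[of R, where 'a='a] in \<open>simp add: emeasure_sphere_measure less_top[symmetric]\<close>)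

lemma orthogonal_transformation_dist:
  "orthogonal_transformation T \<Longrightarrow> dist (T x) (T y) = dist x y"
  by (metis dist_norm linear_diff orthogonal_transformation_linear orthogonal_transformation_norm)

text \<open>A rotation taking x to y is an isometry that preserves the sphere. One inequality for
  arbitrary pairs of points yields both.\<close>

lemma sphere_measure_ball:
  fixes x y :: "real ^ 'n"
  assumes x: "norm x = R" and y: "norm y = R"
  shows "emeasure (sphere_measure R) (ball x r) = emeasure (sphere_measure R) (ball y r)"
proof -
  have le: "hausdorff_outer k (sphere 0 R \<inter> ball y r) \<le> hausdorff_outer k (sphere 0 R \<inter> ball x r)"
    if xy: "norm x = R" "norm y = R" for x y :: "real ^ 'n" and k
  proof -
    obtain T where T: "orthogonal_transformation T" "T x = y" using orthogonal_transformation_exists xy by metis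
    have "sphere 0 R \<inter> ball y r \<subseteq> T ` (sphere 0 R \<inter> ball x r)"
    proof
      fix z assume z: "z \<in> sphere 0 R \<inter> ball y r"
      obtain w where w: "T w = z" using orthogonal_transformation_surj[OF T(1)] by (metis surjD)
      have "norm w = R" using z w T(1) by (auto simp: orthogonal_transformation_norm)
      moreover have "dist x w < r" using z w T orthogonal_transformation_dist[OF T(1), of x w] by auto
      ultimately show "z \<in> T ` (sphere 0 R \<inter> ball x r)" using w by auto
    qed
    then have "hausdorff_outer k (sphere 0 R \<inter> ball y r) \<le> hausdorff_outer k (T ` (sphere 0 R \<inter> ball x r))"
      unfolding hausdorff_outer_def by (intro SUP_mono') (rule hausdorff_content_mono)
    also have "\<dots> \<le> hausdorff_outer k (sphere 0 R \<inter> ball x r)"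
      by (rule hausdorff_outer_isometry_le) (rule orthogonal_transformation_dist[OF T(1)])
    finally show ?thesis .
  qed
  show ?thesis using le[OF x y] le[OF y x] by (auto simp: emeasure_sphere_measure intro!: antisym)
qed

text \<open>Rotations commute with \<open>radial_projection\<close> and preserve Lebesgue measure,
  so they carry the cone over one ball to the cone over the other.\<close>

lemma cone_measure_ball:
  fixes x y :: "real ^ 'n"
  assumes x: "norm x = R" and y: "norm y = R"
  shows "emeasure (cone_measure R) (ball x r) = emeasure (cone_measure R) (ball y r)"
proof -
  obtain T where T: "orthogonal_transformation T" "T x = y" using orthogonal_transformation_exists x y by metis
  define E where "E z = ball 0 R \<inter> radial_projection R -` ball z r" for z :: "real ^ 'n"
  have Eb: "E z \<in> sets borel" for z unfolding E_def by (intro sets.Int measurable_sets_borel[OF radial_projection_measurable]) auto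
  have comm: "radial_projection R (T w) = T (radial_projection R w)" for w
    using T(1) by (simp add: radial_projection_def orthogonal_transformation_norm linear_cmul orthogonal_transformation_linear)
  have "T -` E y = E x"
  proof (intro set_eqI)
    fix w
    have "dist y (T (radial_projection R w)) = dist x (radial_projection R w)"
      using orthogonal_transformation_dist[OF T(1), of x] T(2) by simp
    then show "w \<in> T -` E y \<longleftrightarrow> w \<in> E x" using T(1) by (auto simp: E_def comm orthogonal_transformation_norm)
  qed
  moreover have "T \<in> borel_measurable borel"
    using orthogonal_transformation_linear[OF T(1)]
    by (intro borel_measurable_continuous_onI) (simp add: linear_continuous_on linear_conv_bounded_linear[THEN iffD1])
  ultimately have "emeasure lborel (E y) = emeasure lborel (E x)"
    using Eb emeasure_distr[of T lborel borel "E y"] by (simp add: lborel_distr_isometry[OF T(1)])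
  then show ?thesis using Eb by (simp add: emeasure_cone_measure E_def[symmetric])
qed

text \<open>Both measures are finite, carried by the sphere, and give equal mass to balls of equal
  radius centred on it. That the Hausdorff measure of the sphere is neither zero nor infinite makes
  the factor a positive real.\<close>

lemma cone_measure_eq_sphere_measure:
  assumes R: "0 < R"
  obtains c where "0 < c" "cone_measure R = scale_measure (ennreal c) (sphere_measure R :: (real ^ 'n) measure)"
proof -
  let ?S = "sphere (0 :: real ^ 'n) R"
  let ?C = "cone_measure R :: (real ^ 'n) measure" and ?H = "sphere_measure R :: (real ^ 'n) measure"
  interpret C: finite_measure ?C by (rule finite_cone_measure)
  interpret H: finite_measure ?H using R by (rule finite_sphere_measure)
  have Sb: "?S \<in> sets borel" by simp
  have rp: "radial_projection R x \<notin> ?S \<longleftrightarrow> x = 0" for x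
    using R by (cases "x = 0") (simp_all add: radial_projection_def)
  \<comment> \<open>Only the origin is projected off the sphere.\<close>
  have proj: "ball 0 R \<inter> radial_projection R -` (- ?S) = {0}"
    unfolding vimage_def Compl_iff rp using R by simp
  have C0: "emeasure ?C (- ?S) = 0" using Sb by (simp add: emeasure_cone_measure proj)
  have H0: "emeasure ?H (- ?S) = 0"
    using emeasure_sphere_measure[of "- ?S" R] emeasure_sphere_measure[of "{} :: (real ^ 'n) set" R] Sb by simp
  have CS: "emeasure ?C ?S \<noteq> 0"
  proof
    assume "emeasure ?C ?S = 0"
    then have "emeasure ?C UNIV = 0"
      using C0 emeasure_Un_null_set[of ?S ?C "- ?S"] Sb by (simp add: null_sets_def)
    then have "emeasure lborel (ball (0 :: real ^ 'n) R) = 0" by (simp add: emeasure_cone_measure)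
    have "unit_ball_vol (real DIM(real ^ 'n)) > 0" by (rule unit_ball_vol_pos) simp
    then have "0 < unit_ball_vol (real CARD('n)) * R ^ CARD('n)" using R by simp
    with \<open>emeasure lborel (ball (0 :: real ^ 'n) R) = 0\<close> show False
      using emeasure_ball[of R "0 :: real ^ 'n"] R by (simp add: ennreal_eq_0_iff)
  qed
  have HS: "emeasure ?H ?S \<noteq> 0" using hausdorff_sphere_positive[OF R, where 'a="real ^ 'n"] by (simp add: emeasure_sphere_measure)
  obtain x0 :: "real ^ 'n" where x0: "norm x0 = R" by (rule vector_choose_size[of R]) (use R in auto)
  have eq: "scale_measure (emeasure ?H ?S) ?C = scale_measure (emeasure ?C ?S) ?H"
  proof (rule uniformly_distributed_proportional[OF C.finite_measure_axioms H.finite_measure_axioms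
        sets_cone_measure sets_sphere_measure compact_sphere C0 H0 CS HS])
    fix x :: "real ^ 'n" and r assume "x \<in> ?S"
    then have x: "norm x = R" by simp
    show "emeasure ?C (ball x r) = emeasure ?C (ball x0 r)" by (rule cone_measure_ball[OF x x0])
    show "emeasure ?H (ball x r) = emeasure ?H (ball x0 r)" by (rule sphere_measure_ball[OF x x0])
  qed
  define c where "c = measure ?C ?S / measure ?H ?S"
  have pos: "measure ?C ?S > 0" "measure ?H ?S > 0"
    using CS HS by (simp_all add: C.emeasure_eq_measure H.emeasure_eq_measure zero_less_measure_iff)
  show thesis
  proof (rule that[of c])
    show "0 < c" using pos by (simp add: c_def)
    show "?C = scale_measure (ennreal c) ?H"
    proof (rule measure_eqI)
      fix A :: "(real ^ 'n) set" assume A: "A \<in> sets ?C"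
      have "emeasure ?H ?S * emeasure ?C A = emeasure ?C ?S * emeasure ?H A"
        using arg_cong[OF eq, of "\<lambda>M. emeasure M A"] by simp
      then have "measure ?H ?S * measure ?C A = measure ?C ?S * measure ?H A"
        by (simp add: C.emeasure_eq_measure H.emeasure_eq_measure ennreal_mult[symmetric])
      then have "measure ?C A = c * measure ?H A" using pos by (simp add: c_def field_simps)
      then show "emeasure ?C A = emeasure (scale_measure (ennreal c) ?H) A"
        using pos by (simp add: C.emeasure_eq_measure H.emeasure_eq_measure ennreal_mult[symmetric] c_def)
    qed simp
  qed
qed

section \<open>Polar coordinates on an annulus\<close>

lemma annulus_iff: "x \<in> annulus R\<^sub>1 R\<^sub>2 \<longleftrightarrow> R\<^sub>1 < norm x \<and> norm x < R\<^sub>2"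
  by (auto simp: annulus_def)

lemma open_annulus: "open (annulus R\<^sub>1 R\<^sub>2)"
  and bounded_annulus: "bounded (annulus R\<^sub>1 R\<^sub>2)"
  unfolding annulus_def by (auto intro: bounded_subset[OF bounded_ball])

lemma annulus_borel [measurable, simp]: "annulus R\<^sub>1 R\<^sub>2 \<in> sets borel"
  using open_annulus by (rule borel_open)

text \<open>The parameter \<open>a\<close> will be the squared relative radius of the inner sphere.
  Up to a constant, s^(n/2 - 1) is the Jacobian of the map taking \<omega> and s to sqrt s times
  \<omega>, and \<open>c\<close> absorbs the normalisation.\<close>

definition annulus_law :: "nat \<Rightarrow> real \<Rightarrow> real \<Rightarrow> real measure" where
  "annulus_law n a c = density lborel (\<lambda>s. ennreal (indicator {a<..<1} s * (c * s powr (real n / 2 - 1))))"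

lemma sets_annulus_law [simp, measurable_cong]: "sets (annulus_law n a c) = sets borel"
  and space_annulus_law [simp]: "space (annulus_law n a c) = UNIV"
  by (simp_all add: annulus_law_def)

lemma sqrt_mult_R_iff:
  assumes "0 < R\<^sub>1" "R\<^sub>1 < R\<^sub>2" "0 < s"
  shows "R\<^sub>1 < sqrt s * R\<^sub>2 \<and> sqrt s * R\<^sub>2 < R\<^sub>2 \<longleftrightarrow> (R\<^sub>1 / R\<^sub>2)\<^sup>2 < s \<and> s < 1"
proof -
  have "R\<^sub>1 < sqrt s * R\<^sub>2 \<longleftrightarrow> R\<^sub>1 / R\<^sub>2 < sqrt s" using assms by (simp add: pos_divide_less_eq)
  also have "\<dots> \<longleftrightarrow> sqrt ((R\<^sub>1 / R\<^sub>2)\<^sup>2) < sqrt s" using assms by simp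
  also have "\<dots> \<longleftrightarrow> (R\<^sub>1 / R\<^sub>2)\<^sup>2 < s" by (rule real_sqrt_less_iff)
  finally have 1: "R\<^sub>1 < sqrt s * R\<^sub>2 \<longleftrightarrow> (R\<^sub>1 / R\<^sub>2)\<^sup>2 < s" .
  have 2: "sqrt s * R\<^sub>2 < R\<^sub>2 \<longleftrightarrow> s < 1" using assms by simp
  show ?thesis using 1 2 by blast
qed

text \<open>The cone measure in \<open>polar_joint_law\<close> is replaced by the proportional
  surface measure, and the factor is moved into the radial law. Passing from the ball to the annulus
  cuts the radial law to the interval from \<open>(R\<^sub>1 / R\<^sub>2)\<^sup>2\<close> to
  1.\<close>

lemma annulus_polar:
  assumes R: "0 < R\<^sub>1" "R\<^sub>1 < R\<^sub>2"
  obtains c where "0 < c"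
    "distr (sphere_measure R\<^sub>2 \<Otimes>\<^sub>M annulus_law CARD('n) ((R\<^sub>1 / R\<^sub>2)\<^sup>2) c) borel (\<lambda>p. sqrt (snd p) *\<^sub>R fst p)
      = density lborel (indicator (annulus R\<^sub>1 R\<^sub>2 :: (real ^ 'n) set))"
proof -
  let ?n = "CARD('n)" and ?a = "(R\<^sub>1 / R\<^sub>2)\<^sup>2"
  let ?H = "sphere_measure R\<^sub>2 :: (real ^ 'n) measure" and ?C = "cone_measure R\<^sub>2 :: (real ^ 'n) measure"
  let ?A = "annulus R\<^sub>1 R\<^sub>2 :: (real ^ 'n) set"
  have R2: "0 < R\<^sub>2" using R by simp
  obtain c0 where c0: "0 < c0" "?C = scale_measure (ennreal c0) ?H" by (rule cone_measure_eq_sphere_measure[OF R2])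
  \<comment> \<open>The proportionality factor times the constant n/2 in the density of
    \<open>radial_law\<close>.\<close>
  define c where "c = c0 * (real ?n / 2)"
  have n1: "?n \<ge> 1" by (simp add: Suc_leI)
  let ?L = "annulus_law ?n ?a c"
  interpret H: finite_measure ?H using R2 by (rule finite_sphere_measure)
  interpret RL: finite_measure "radial_law ?n" using n1 by (rule finite_radial_law)
  \<comment> \<open>The annulus law is \<open>radial_law\<close> restricted to the interval and
    scaled by \<open>c0\<close>; finiteness follows from this.\<close>
  have L_le: "emeasure ?L X = ennreal c0 * emeasure (radial_law ?n) ({?a<..<1} \<inter> X)" if [measurable]: "X \<in> sets borel" for X
  proof -
    have "emeasure ?L X = (\<integral>\<^sup>+s. ennreal c0 * (ennreal (indicator {0<..<1} s * (real ?n / 2 * s powr (real ?n / 2 - 1))) * indicator ({?a<..<1} \<inter> X) s) \<partial>lborel)"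
      unfolding annulus_law_def
    proof (subst emeasure_density, measurable, rule nn_integral_cong)
      fix s :: real
      show "ennreal (indicator {?a<..<1} s * (c * s powr (real ?n / 2 - 1))) * indicator X s =
        ennreal c0 * (ennreal (indicator {0<..<1} s * (real ?n / 2 * s powr (real ?n / 2 - 1))) * indicator ({?a<..<1} \<inter> X) s)"
      proof (cases "s \<in> {?a<..<1} \<inter> X")
        case True
        then have "0 < s" using order_le_less_trans[of 0 ?a s] by simp
        then show ?thesis using True c0(1) by (simp add: c_def ennreal_mult[symmetric] mult.assoc)
      next
        case False
        then show ?thesis by (auto simp: indicator_def)
      qed
    qed
    also have "\<dots> = ennreal c0 * emeasure (radial_law ?n) ({?a<..<1} \<inter> X)"
      unfolding radial_law_def by (subst emeasure_density) (auto simp: nn_integral_cmult)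
    finally show ?thesis .
  qed
  interpret L: finite_measure ?L
    by standard (simp add: L_le ennreal_mult_eq_top_iff RL.emeasure_finite)
  interpret HL: pair_sigma_finite ?H ?L by standard
  have AEH: "AE \<omega> in ?H. norm \<omega> = R\<^sub>2"
  proof (rule AE_I[where N="- sphere 0 R\<^sub>2"])
    show "emeasure ?H (- sphere 0 R\<^sub>2) = 0"
      using emeasure_sphere_measure[of "- sphere 0 R\<^sub>2 :: (real ^ 'n) set" R\<^sub>2] emeasure_sphere_measure[of "{} :: (real ^ 'n) set" R\<^sub>2] by (simp add: borel_comp)
  qed (auto simp: borel_comp)
  have g [measurable]: "(\<lambda>p. sqrt (snd p) *\<^sub>R fst p) \<in> borel_measurable (borel \<Otimes>\<^sub>M borel :: ((real ^ 'n) \<times> real) measure)"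
    by measurable
  have g' [measurable]: "(\<lambda>p. sqrt (snd p) *\<^sub>R fst p) \<in> borel_measurable (?H \<Otimes>\<^sub>M ?L)"
    using g by (simp cong: measurable_cong_sets sets_pair_measure_cong)
  have "distr (?H \<Otimes>\<^sub>M ?L) borel (\<lambda>p. sqrt (snd p) *\<^sub>R fst p) = density lborel (indicator ?A)"
  proof (rule measure_eqI)
    fix X :: "(real ^ 'n) set" assume "X \<in> sets (distr (?H \<Otimes>\<^sub>M ?L) borel (\<lambda>p. sqrt (snd p) *\<^sub>R fst p))"
    then have X [measurable]: "X \<in> sets borel" by simp
    define Y where "Y = (\<lambda>p. sqrt (snd p) *\<^sub>R fst p) -` (?A \<inter> X)"
    have Y: "Y \<in> sets (borel \<Otimes>\<^sub>M borel)"
      using measurable_sets[OF g, of "?A \<inter> X"] by (simp add: Y_def space_pair_measure)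
    have fibre: "Pair \<omega> -` ((\<lambda>p. sqrt (snd p) *\<^sub>R fst p) -` X) \<in> sets borel"
      "Pair \<omega> -` Y \<in> sets borel" for \<omega> :: "real ^ 'n"
    proof -
      have m: "(\<lambda>s. sqrt s *\<^sub>R \<omega>) \<in> borel_measurable borel" by measurable
      have "(\<lambda>s. sqrt s *\<^sub>R \<omega>) -` X \<in> sets borel" "(\<lambda>s. sqrt s *\<^sub>R \<omega>) -` (?A \<inter> X) \<in> sets borel"
        by (rule measurable_sets_borel[OF m], simp)+
      then show "Pair \<omega> -` ((\<lambda>p. sqrt (snd p) *\<^sub>R fst p) -` X) \<in> sets borel" "Pair \<omega> -` Y \<in> sets borel"
        by (simp_all add: Y_def vimage_def)
    qed
    have "emeasure (density lborel (indicator ?A)) X = emeasure lborel (?A \<inter> X)" by (simp add: emeasure_restricted)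
    also have "?A \<inter> X = ball 0 R\<^sub>2 \<inter> (?A \<inter> X)" by (auto simp: annulus_def)
    also have "emeasure lborel \<dots> = emeasure (ball_measure R\<^sub>2) (?A \<inter> X)" by (simp add: emeasure_ball_measure)
    also have "\<dots> = emeasure (distr (ball_measure R\<^sub>2) (borel \<Otimes>\<^sub>M borel) (\<lambda>x. (radial_projection R\<^sub>2 x, (norm x)\<^sup>2 / R\<^sub>2\<^sup>2))) Y"
    proof -
      have "sqrt ((norm x)\<^sup>2 / R\<^sub>2\<^sup>2) *\<^sub>R radial_projection R\<^sub>2 x = x" for x :: "real ^ 'n"
        using R2 by (cases "x = 0") (simp_all add: radial_projection_def real_sqrt_divide)
      then have "(\<lambda>x. (radial_projection R\<^sub>2 x, (norm x)\<^sup>2 / R\<^sub>2\<^sup>2)) -` Y \<inter> space (ball_measure R\<^sub>2) = ?A \<inter> X"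
        by (auto simp: Y_def)
      then show ?thesis
        using Y emeasure_distr[of "\<lambda>x::real ^ 'n. (radial_projection R\<^sub>2 x, (norm x)\<^sup>2 / R\<^sub>2\<^sup>2)" "ball_measure R\<^sub>2" "borel \<Otimes>\<^sub>M borel" Y]
        by simp
    qed
    also have "\<dots> = emeasure (?C \<Otimes>\<^sub>M radial_law ?n) Y" using polar_joint_law[OF R2, where 'a="real ^ 'n"] by simp
    also have "\<dots> = (\<integral>\<^sup>+\<omega>. emeasure (radial_law ?n) (Pair \<omega> -` Y) \<partial>?C)"
      using Y by (intro RL.emeasure_pair_measure_alt) (simp cong: sets_pair_measure_cong)
    also have "\<dots> = ennreal c0 * (\<integral>\<^sup>+\<omega>. emeasure (radial_law ?n) (Pair \<omega> -` Y) \<partial>?H)"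
      unfolding c0(2) using Y RL.measurable_emeasure_Pair[of Y ?H] by (subst nn_integral_scale_measure) (auto cong: sets_pair_measure_cong)
    also have "\<dots> = (\<integral>\<^sup>+\<omega>. ennreal c0 * emeasure (radial_law ?n) (Pair \<omega> -` Y) \<partial>?H)"
      using Y RL.measurable_emeasure_Pair[of Y ?H] by (subst nn_integral_cmult) (auto cong: sets_pair_measure_cong)
    also have "\<dots> = (\<integral>\<^sup>+\<omega>. emeasure ?L (Pair \<omega> -` ((\<lambda>p. sqrt (snd p) *\<^sub>R fst p) -` X)) \<partial>?H)"
    proof (rule nn_integral_cong_AE, use AEH in eventually_elim)
      fix \<omega> :: "real ^ 'n" assume \<omega>: "norm \<omega> = R\<^sub>2"
      have iff: "s \<in> {0<..<1} \<and> s \<in> Pair \<omega> -` Y \<longleftrightarrow> s \<in> {0<..<1} \<and> s \<in> {?a<..<1} \<inter> Pair \<omega> -` ((\<lambda>p. sqrt (snd p) *\<^sub>R fst p) -` X)" for s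
        using sqrt_mult_R_iff[OF R, of s] \<omega> by (auto simp: Y_def annulus_iff)
      have dens: "emeasure (radial_law ?n) Z = (\<integral>\<^sup>+s. ennreal (indicator {0<..<1} s * (real ?n / 2 * s powr (real ?n / 2 - 1))) * indicator Z s \<partial>lborel)"
        if "Z \<in> sets borel" for Z unfolding radial_law_def using that by (subst emeasure_density) auto
      have "emeasure (radial_law ?n) (Pair \<omega> -` Y) = emeasure (radial_law ?n) ({?a<..<1} \<inter> Pair \<omega> -` ((\<lambda>p. sqrt (snd p) *\<^sub>R fst p) -` X))"
      proof (subst (1 2) dens)
        show "Pair \<omega> -` Y \<in> sets borel" "{?a<..<1} \<inter> Pair \<omega> -` ((\<lambda>p. sqrt (snd p) *\<^sub>R fst p) -` X) \<in> sets borel"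
          using fibre by auto
      qed (intro nn_integral_cong, use iff in \<open>simp add: indicator_def, blast\<close>)
      then show "ennreal c0 * emeasure (radial_law ?n) (Pair \<omega> -` Y) = emeasure ?L (Pair \<omega> -` ((\<lambda>p. sqrt (snd p) *\<^sub>R fst p) -` X))"
        using L_le[OF fibre(1)] by simp
    qed
    also have "\<dots> = emeasure (?H \<Otimes>\<^sub>M ?L) ((\<lambda>p. sqrt (snd p) *\<^sub>R fst p) -` X)"
      using measurable_sets[OF g', of X] by (intro L.emeasure_pair_measure_alt[symmetric]) (simp add: space_pair_measure)
    also have "\<dots> = emeasure (distr (?H \<Otimes>\<^sub>M ?L) borel (\<lambda>p. sqrt (snd p) *\<^sub>R fst p)) X"
      by (subst emeasure_distr) (auto simp: space_pair_measure)
    finally show "emeasure (distr (?H \<Otimes>\<^sub>M ?L) borel (\<lambda>p. sqrt (snd p) *\<^sub>R fst p)) X = emeasure (density lborel (indicator ?A)) X" by simp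
  qed simp
  moreover have "0 < c" using c0(1) n1 by (simp add: c_def)
  ultimately show thesis using that by blast
qed

text \<open>The equation \<open>polar\<close> is the only link between volume and the product of
  \<open>H\<close> and \<open>L\<close>. The dimension is kept as a real number \<open>n\<close>
  because it appears in the exponents n/2.\<close>

locale annulus_polar_coordinates =
  fixes R\<^sub>1 R\<^sub>2 c a :: real and A :: "(real ^ 'n) set" and H :: "(real ^ 'n) measure" and L :: "real measure" and n :: real
  assumes R1: "0 < R\<^sub>1" and R12: "R\<^sub>1 < R\<^sub>2" and dim: "2 \<le> CARD('n)" and c: "0 < c"
    and A_def: "A = annulus R\<^sub>1 R\<^sub>2" and a_def: "a = (R\<^sub>1 / R\<^sub>2)\<^sup>2" and H_def: "H = sphere_measure R\<^sub>2"
    and L_def: "L = annulus_law CARD('n) a c" and n_def: "n = real CARD('n)"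
    and polar: "distr (H \<Otimes>\<^sub>M L) borel (\<lambda>p. sqrt (snd p) *\<^sub>R fst p) = density lborel (indicator A)"
begin

lemma R2: "0 < R\<^sub>2" using R1 R12 by simp

lemma a_bounds: "0 < a" "a < 1"
proof -
  show "0 < a" using R1 R2 by (simp add: a_def)
  have "(R\<^sub>1 / R\<^sub>2)\<^sup>2 < 1\<^sup>2" using R1 R12 R2 by (intro power_strict_mono) auto
  then show "a < 1" by (simp add: a_def)
qed

lemma n2: "2 \<le> n" using dim by (simp add: n_def)

lemma A_open: "open A" and A_bounded: "bounded A" and A_borel [measurable, simp]: "A \<in> sets borel"
  unfolding A_def by (auto simp: open_annulus bounded_annulus)

lemma sets_H [simp, measurable_cong]: "sets H = sets borel" and space_H [simp]: "space H = UNIV"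
  and sets_L [simp, measurable_cong]: "sets L = sets borel" and space_L [simp]: "space L = UNIV"
  by (simp_all add: H_def L_def)

sublocale H: finite_measure H unfolding H_def by (rule finite_sphere_measure[OF R2])

lemma powr_continuous_on: "continuous_on {a..1} (\<lambda>s. s powr p)"
  using a_bounds by (intro continuous_on_powr' continuous_intros) auto

text \<open>The density is continuous on the compact interval [a, 1], where a > 0, and hence
  bounded.\<close>

sublocale L: finite_measure L
proof
  have "compact ((\<lambda>s. s powr (n / 2 - 1)) ` {a..1})" by (intro compact_continuous_image powr_continuous_on) auto
  then obtain B where "\<And>y. y \<in> (\<lambda>s. s powr (n / 2 - 1)) ` {a..1} \<Longrightarrow> norm y \<le> B" "B > 0"
    using compact_imp_bounded bounded_pos by metis
  then have B: "s powr (n / 2 - 1) \<le> B" if "s \<in> {a<..<1}" for s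
    using that by (metis atLeastAtMost_iff greaterThanLessThan_iff image_eqI less_imp_le norm_ge_zero order_trans real_norm_def abs_ge_self)
  have "emeasure L UNIV = (\<integral>\<^sup>+s. ennreal (indicator {a<..<1} s * (c * s powr (n / 2 - 1))) \<partial>lborel)"
    unfolding L_def annulus_law_def n_def by (subst emeasure_density) auto
  also have "\<dots> \<le> (\<integral>\<^sup>+s. ennreal (c * B) * indicator {a<..<1} s \<partial>lborel)"
    using B c by (intro nn_integral_mono) (auto simp: indicator_def intro!: ennreal_leI)
  also have "\<dots> = ennreal (c * B) * ennreal (1 - a)" using a_bounds by (subst nn_integral_cmult_indicator) auto
  also have "\<dots> < \<infinity>" by (simp add: ennreal_mult_less_top)
  finally show "emeasure L (space L) \<noteq> \<infinity>" by simp
qed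

sublocale HL: pair_sigma_finite H L by standard

lemma AE_H: "AE \<omega> in H. norm \<omega> = R\<^sub>2"
  unfolding H_def
proof (rule AE_I[where N="- sphere 0 R\<^sub>2"])
  show "emeasure (sphere_measure R\<^sub>2) (- sphere 0 R\<^sub>2 :: (real ^ 'n) set) = 0"
    using emeasure_sphere_measure[of "- sphere 0 R\<^sub>2 :: (real ^ 'n) set" R\<^sub>2] emeasure_sphere_measure[of "{} :: (real ^ 'n) set" R\<^sub>2]
    by (simp add: borel_comp)
qed (auto simp: borel_comp)

lemma AE_L: "AE s in L. s \<in> {a<..<1}"
  unfolding L_def annulus_law_def by (subst AE_density) (auto simp: indicator_def)

lemma polar_map [measurable]: "(\<lambda>p. sqrt (snd p) *\<^sub>R fst p) \<in> borel_measurable (H \<Otimes>\<^sub>M L)"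
proof -
  have "(\<lambda>p. sqrt (snd p) *\<^sub>R fst p) \<in> borel_measurable (borel \<Otimes>\<^sub>M borel :: ((real ^ 'n) \<times> real) measure)" by measurable
  then show ?thesis by (simp cong: measurable_cong_sets sets_pair_measure_cong)
qed

lemma A_density: "density lborel (indicator A) = density lborel (\<lambda>x. ennreal (indicator A x))"
  by (simp add: ennreal_indicator)

lemma integrable_A_iff:
  fixes f :: "real ^ 'n \<Rightarrow> 'b::{banach, second_countable_topology}"
  assumes [measurable]: "f \<in> borel_measurable borel"
  shows "integrable (lebesgue_on A) f \<longleftrightarrow> integrable (H \<Otimes>\<^sub>M L) (\<lambda>p. f (sqrt (snd p) *\<^sub>R fst p))"
proof -
  have "integrable (lebesgue_on A) f \<longleftrightarrow> integrable lborel (\<lambda>x. indicator A x *\<^sub>R f x)"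
    by (simp add: integrable_restrict_space integrable_completion)
  also have "\<dots> \<longleftrightarrow> integrable (density lborel (\<lambda>x. ennreal (indicator A x))) f"
    by (rule integrable_density[symmetric]) auto
  also have "\<dots> \<longleftrightarrow> integrable (H \<Otimes>\<^sub>M L) (\<lambda>p. f (sqrt (snd p) *\<^sub>R fst p))"
    unfolding A_density[symmetric] polar[symmetric] by (rule integrable_distr_eq) auto
  finally show ?thesis .
qed

lemma integral_A_pair:
  fixes f :: "real ^ 'n \<Rightarrow> 'b::{banach, second_countable_topology}"
  assumes [measurable]: "f \<in> borel_measurable borel"
  shows "(LINT x|lebesgue_on A. f x) = (LINT p|(H \<Otimes>\<^sub>M L). f (sqrt (snd p) *\<^sub>R fst p))"
proof -
  have "(LINT x|lebesgue_on A. f x) = (LINT x|lborel. indicator A x *\<^sub>R f x)"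
    by (simp add: integral_lebesgue_on_borel)
  also have "\<dots> = (LINT x|density lborel (\<lambda>x. ennreal (indicator A x)). f x)"
    by (rule integral_density[symmetric]) auto
  also have "\<dots> = (LINT p|(H \<Otimes>\<^sub>M L). f (sqrt (snd p) *\<^sub>R fst p))"
    unfolding A_density[symmetric] polar[symmetric] by (rule integral_distr) auto
  finally show ?thesis .
qed

text \<open>Both orders of integration are recorded: rays inside for the divergence theorem and for
  traces, spheres inside for spherical means.\<close>

lemma integral_A:
  fixes f :: "real ^ 'n \<Rightarrow> real"
  assumes f: "f \<in> borel_measurable borel" "integrable (lebesgue_on A) f"
  shows "(LINT x|lebesgue_on A. f x) = (LINT \<omega>|H. LINT s|L. f (sqrt s *\<^sub>R \<omega>))"
    and "integrable H (\<lambda>\<omega>. LINT s|L. f (sqrt s *\<^sub>R \<omega>))"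
    and "AE \<omega> in H. integrable L (\<lambda>s. f (sqrt s *\<^sub>R \<omega>))"
    and "(LINT x|lebesgue_on A. f x) = (LINT s|L. LINT \<omega>|H. f (sqrt s *\<^sub>R \<omega>))"
    and "integrable L (\<lambda>s. LINT \<omega>|H. f (sqrt s *\<^sub>R \<omega>))"
proof -
  have i: "integrable (H \<Otimes>\<^sub>M L) (\<lambda>p. f (sqrt (snd p) *\<^sub>R fst p))" using integrable_A_iff f by blast
  then have i': "integrable (H \<Otimes>\<^sub>M L) (\<lambda>(\<omega>, s). f (sqrt s *\<^sub>R \<omega>))" by (simp add: case_prod_beta')
  show "(LINT x|lebesgue_on A. f x) = (LINT \<omega>|H. LINT s|L. f (sqrt s *\<^sub>R \<omega>))"
    using HL.integral_fst'[OF i] integral_A_pair[OF f(1)] by simp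
  show "integrable H (\<lambda>\<omega>. LINT s|L. f (sqrt s *\<^sub>R \<omega>))" using HL.integrable_fst'[OF i] by simp
  show "AE \<omega> in H. integrable L (\<lambda>s. f (sqrt s *\<^sub>R \<omega>))" using HL.AE_integrable_fst'[OF i] by simp
  show "(LINT x|lebesgue_on A. f x) = (LINT s|L. LINT \<omega>|H. f (sqrt s *\<^sub>R \<omega>))"
    using HL.integral_snd[OF i'] integral_A_pair[OF f(1)] by (simp add: case_prod_beta')
  show "integrable L (\<lambda>s. LINT \<omega>|H. f (sqrt s *\<^sub>R \<omega>))" using HL.integrable_snd[OF i'] by simp
qed

lemma integral_L:
  fixes f :: "real \<Rightarrow> real"
  assumes [measurable]: "f \<in> borel_measurable borel"
  shows "(LINT s|L. f s) = (LINT s|lborel. indicator {a<..<1} s * (c * s powr (n / 2 - 1) * f s))"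
proof -
  have "(LINT s|L. f s) = (LINT s|lborel. (indicator {a<..<1} s * (c * s powr (n / 2 - 1))) *\<^sub>R f s)"
    unfolding L_def annulus_law_def n_def using c by (intro integral_density) (auto simp: indicator_def)
  then show ?thesis by (simp add: mult.assoc)
qed

text \<open>Radial divergence theorem: along the ray through \<open>\<omega>\<close> the integrand is, up to the factor \<open>2 c\<close>,
  the derivative of \<open>s powr (n/2) * k s * f (sqrt s *\<^sub>R \<omega>)\<close>.\<close>

lemma radial_identity_ray:
  fixes f :: "real ^ 'n \<Rightarrow> real" and k k' :: "real \<Rightarrow> real"
  assumes f: "\<And>x. f differentiable (at x)" "continuous_on UNIV (gradient f)"
    and k: "continuous_on UNIV k" "continuous_on UNIV k'"
      "\<And>s. s \<in> {b..1} \<Longrightarrow> (k has_real_derivative k' s) (at s within {b..1})"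
    and b: "a \<le> b" "b < 1" and zero: "\<And>s. a < s \<Longrightarrow> s < b \<Longrightarrow> f (sqrt s *\<^sub>R \<omega>) = 0 \<and> gradient f (sqrt s *\<^sub>R \<omega>) = 0"
  shows "(LINT s|L. (n * k s + 2 * s * k' s) * f (sqrt s *\<^sub>R \<omega>) + k s * (gradient f (sqrt s *\<^sub>R \<omega>) \<bullet> (sqrt s *\<^sub>R \<omega>)))
    = 2 * c * (k 1 * f \<omega> - b powr (n / 2) * k b * f (sqrt b *\<^sub>R \<omega>))"
proof -
  define G where "G s = (n * k s + 2 * s * k' s) * f (sqrt s *\<^sub>R \<omega>) + k s * (gradient f (sqrt s *\<^sub>R \<omega>) \<bullet> (sqrt s *\<^sub>R \<omega>))" for s
  have b0: "0 < b" using a_bounds b by simp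
  have cf: "continuous_on UNIV f" using f(1) by (simp add: continuous_on_eq_continuous_at differentiable_imp_continuous_within)
  have cfs: "continuous_on UNIV (\<lambda>s. f (sqrt s *\<^sub>R \<omega>))" "continuous_on UNIV (\<lambda>s. gradient f (sqrt s *\<^sub>R \<omega>))"
    by (rule continuous_on_compose2[OF cf] continuous_on_compose2[OF f(2)]; auto intro!: continuous_intros)+
  have cG: "continuous_on UNIV G"
    unfolding G_def[abs_def] using cfs k(1,2) by (intro continuous_intros)
  then have [measurable]: "G \<in> borel_measurable borel" by (rule borel_measurable_continuous_onI)
  \<comment> \<open>The coefficients n and 2 s in \<open>G\<close> come from differentiating this
    product: the power contributes n/2, and \<open>f\<close> along the ray has derivative (gradient
    f) \<bullet> x / (2 s) at x = sqrt s \<omega>.\<close>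
  define F where "F s = 2 * c * (s powr (n / 2) * (k s * f (sqrt s *\<^sub>R \<omega>)))" for s
  have der: "(F has_real_derivative c * s powr (n / 2 - 1) * G s) (at s within {b..1})" if s: "s \<in> {b..1}" for s
  proof -
    have s0: "0 < s" using s b0 by simp
    have "((\<lambda>s. sqrt s *\<^sub>R \<omega>) has_derivative (\<lambda>t. (t * (inverse (sqrt s) / 2)) *\<^sub>R \<omega>)) (at s within {b..1})"
    proof (rule has_derivative_scaleR_left)
      have "(*) (inverse (sqrt s) / 2) = (\<lambda>t. t * (inverse (sqrt s) / 2))" by (simp add: fun_eq_iff)
      then show "(sqrt has_derivative (\<lambda>t. t * (inverse (sqrt s) / 2))) (at s within {b..1})"
        using has_derivative_at_withinI[OF DERIV_real_sqrt[OF s0, unfolded has_field_derivative_def]] by simp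
    qed
    from has_derivative_compose[OF this gradient_has_derivative[OF f(1)]]
    have "((\<lambda>s. f (sqrt s *\<^sub>R \<omega>)) has_derivative (\<lambda>t. gradient f (sqrt s *\<^sub>R \<omega>) \<bullet> ((t * (inverse (sqrt s) / 2)) *\<^sub>R \<omega>))) (at s within {b..1})" .
    moreover have "gradient f (sqrt s *\<^sub>R \<omega>) \<bullet> ((t * (inverse (sqrt s) / 2)) *\<^sub>R \<omega>) = gradient f (sqrt s *\<^sub>R \<omega>) \<bullet> (sqrt s *\<^sub>R \<omega>) / (2 * s) * t" for t
      using s0 real_sqrt_mult_self[of s] by (simp add: field_simps)
    ultimately have df: "((\<lambda>s. f (sqrt s *\<^sub>R \<omega>)) has_real_derivative gradient f (sqrt s *\<^sub>R \<omega>) \<bullet> (sqrt s *\<^sub>R \<omega>) / (2 * s)) (at s within {b..1})"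
      unfolding has_field_derivative_def by (simp only:)
    have dp: "((\<lambda>s. s powr (n / 2)) has_real_derivative n / 2 * s powr (n / 2 - 1)) (at s within {b..1})"
      by (rule has_field_derivative_at_within[OF has_real_derivative_powr[OF s0]])
    have "(F has_real_derivative 2 * c * (s powr (n / 2) * (k s * (gradient f (sqrt s *\<^sub>R \<omega>) \<bullet> (sqrt s *\<^sub>R \<omega>) / (2 * s)) + k' s * f (sqrt s *\<^sub>R \<omega>))
      + n / 2 * s powr (n / 2 - 1) * (k s * f (sqrt s *\<^sub>R \<omega>)))) (at s within {b..1})"
      unfolding F_def[abs_def] using DERIV_cmult[OF DERIV_mult'[OF dp DERIV_mult'[OF k(3)[OF s] df]], of "2 * c"] .
    moreover have "s powr (n / 2) = s * s powr (n / 2 - 1)" using s0 by (simp add: powr_diff)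
    moreover have "2 * c * ((s * p) * (k s * (d / (2 * s)) + k' s * y) + n / 2 * p * (k s * y)) =
      c * p * ((n * k s + 2 * s * k' s) * y + k s * d)" for p d y
      using s0 by (simp add: field_simps)
    ultimately show ?thesis unfolding G_def by (simp only:)
  qed
  have hi: "((\<lambda>s. c * s powr (n / 2 - 1) * G s) has_integral (F 1 - F b)) {b..1}"
    using der b by (intro fundamental_theorem_of_calculus) (auto simp: has_real_derivative_iff_has_vector_derivative)
  have cc: "continuous_on {b..1} (\<lambda>s. c * s powr (n / 2 - 1) * G s)"
    using cG b by (intro continuous_intros continuous_on_subset[OF cG] continuous_on_subset[OF powr_continuous_on]) auto
  have "(LINT s|L. G s) = (LINT s|lborel. indicator {a<..<1} s * (c * s powr (n / 2 - 1) * G s))" by (rule integral_L) simp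
  \<comment> \<open>Below \<open>b\<close> the integrand is zero, so differentiability of the weight
    matters only on [b, 1]. This admits weights that are singular at \<open>a\<close>.\<close>
  also have "\<dots> = (LINT s|lborel. indicator {b..1} s *\<^sub>R (c * s powr (n / 2 - 1) * G s))"
  proof (rule integral_cong_AE)
    have "AE s in lborel. s \<noteq> b" "AE s in lborel. s \<noteq> (1::real)" by (rule AE_lborel_singleton)+
    then show "AE s in lborel. indicator {a<..<1} s * (c * s powr (n / 2 - 1) * G s) = indicator {b..1} s *\<^sub>R (c * s powr (n / 2 - 1) * G s)"
    proof eventually_elim
      case (elim s)
      show ?case
      proof (cases "a < s \<and> s < b")
        case True
        then have "G s = 0" using zero by (simp add: G_def)
        then show ?thesis by simp
      next
        case False
        then show ?thesis using elim b by (auto simp: indicator_def)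
      qed
    qed
  qed auto
  also have "\<dots> = F 1 - F b"
    using set_borel_integral_eq_integral(2)[OF borel_integrable_atLeastAtMost'[OF cc]] integral_unique[OF hi]
    unfolding set_lebesgue_integral_def by simp
  finally show ?thesis unfolding G_def by (simp add: F_def algebra_simps)
qed

end

section \<open>Radial divergence theorem and traces\<close>

lemma L2_tendsto_inner_bounded:
  fixes F :: "nat \<Rightarrow> 'a \<Rightarrow> 'b::euclidean_space"
  assumes F: "L2_tendsto M F f" and X: "X \<in> borel_measurable M" "AE x in M. norm (X x) \<le> B"
  shows "L2_tendsto M (\<lambda>k x. F k x \<bullet> X x) (\<lambda>x. f x \<bullet> X x)"
proof -
  have L2: "L2 M (F k)" "L2 M f" for k using F by (auto simp: L2_tendsto_def)
  have AEle: "AE x in M. (norm (g x \<bullet> X x))\<^sup>2 \<le> B\<^sup>2 * (norm (g x))\<^sup>2" for g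
    using X(2)
  proof eventually_elim
    case (elim x)
    have "\<bar>g x \<bullet> X x\<bar> \<le> norm (g x) * norm (X x)" by (rule Cauchy_Schwarz_ineq2)
    also have "\<dots> \<le> norm (g x) * B" using elim by (intro mult_left_mono) auto
    finally have "\<bar>g x \<bullet> X x\<bar>\<^sup>2 \<le> (norm (g x) * B)\<^sup>2" by (intro power_mono) auto
    then show ?case by (simp add: power_mult_distrib mult.commute)
  qed
  have L2g: "L2 M (\<lambda>x. g x \<bullet> X x)" if "L2 M g" for g
    by (rule L2_dominated[where w="\<lambda>x. B\<^sup>2 * (norm (g x))\<^sup>2"]) (use that X AEle in \<open>auto simp: L2_def\<close>)
  have lim: "(\<lambda>k. B\<^sup>2 * (LINT x|M. (norm (F k x - f x))\<^sup>2)) \<longlonglongrightarrow> 0"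
    using F by (intro tendsto_mult_right_zero) (auto simp: L2_tendsto_def)
  have "(\<lambda>k. LINT x|M. (norm (F k x \<bullet> X x - f x \<bullet> X x))\<^sup>2) \<longlonglongrightarrow> 0"
  proof (rule Lim_null_comparison[OF _ lim], intro always_eventually allI)
    fix k
    have "(LINT x|M. (norm ((F k x - f x) \<bullet> X x))\<^sup>2) \<le> (LINT x|M. B\<^sup>2 * (norm (F k x - f x))\<^sup>2)"
      using L2_integrable[OF L2g[OF L2_diff[OF L2]]] L2_integrable[OF L2_diff[OF L2]] AEle by (intro integral_mono_AE) auto
    then show "norm (LINT x|M. (norm (F k x \<bullet> X x - f x \<bullet> X x))\<^sup>2) \<le> B\<^sup>2 * (LINT x|M. (norm (F k x - f x))\<^sup>2)"
      by (simp add: inner_diff_left)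
  qed
  then show ?thesis using L2g L2 by (auto simp: L2_tendsto_def)
qed

lemma L2_tendsto_imp_integral_tendsto:
  fixes F :: "nat \<Rightarrow> 'a \<Rightarrow> real"
  assumes "finite_measure M" "L2_tendsto M F f"
  shows "(\<lambda>k. LINT x|M. F k x) \<longlonglongrightarrow> (LINT x|M. f x)"
proof -
  have "L2 M (\<lambda>_. 1::real)" using assms(1) by (simp add: L2_def finite_measure.integrable_const)
  then show ?thesis using L2_tendsto_inner[OF assms(2) L2_tendsto_const, of "\<lambda>_. 1"] by simp
qed

context annulus_polar_coordinates
begin

definition rad :: "real ^ 'n \<Rightarrow> real" where
  "rad x = (norm x)\<^sup>2 / R\<^sub>2\<^sup>2"

lemma rad_polar: "norm \<omega> = R\<^sub>2 \<Longrightarrow> 0 \<le> s \<Longrightarrow> rad (sqrt s *\<^sub>R \<omega>) = s"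
  using R2 by (simp add: rad_def power_mult_distrib)

lemma continuous_on_rad: "continuous_on UNIV rad"
  unfolding rad_def[abs_def] using R2 by (intro continuous_intros) auto

lemma bounded_on_A:
  fixes f :: "real ^ 'n \<Rightarrow> 'b::real_normed_vector"
  assumes "continuous_on UNIV f"
  obtains B where "\<And>x. x \<in> A \<Longrightarrow> norm (f x) \<le> B"
proof -
  have "compact (f ` cball 0 R\<^sub>2)"
    using assms by (intro compact_continuous_image) (auto intro: continuous_on_subset)
  then obtain B where "\<And>y. y \<in> f ` cball 0 R\<^sub>2 \<Longrightarrow> norm y \<le> B"
    using compact_imp_bounded bounded_iff by metis
  then show thesis using that[of B] by (auto simp: A_def annulus_def)
qed

lemma finite_measure_A: "finite_measure (lebesgue_on A)"
  using A_open A_bounded by (rule finite_measure_bounded_open)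

lemma borel_imp_measurable_A: "f \<in> borel_measurable borel \<Longrightarrow> f \<in> borel_measurable (lebesgue_on A)"
  by (intro measurable_restrict_space1 measurable_completion) simp

lemma L2_continuous_A:
  fixes f :: "real ^ 'n \<Rightarrow> 'b::euclidean_space"
  assumes "continuous_on UNIV f"
  shows "L2 (lebesgue_on A) f"
  using assms A_bounded by (intro L2_continuous_bounded_set) auto

lemma integrable_continuous_A:
  fixes f :: "real ^ 'n \<Rightarrow> 'b::euclidean_space"
  assumes "continuous_on UNIV f"
  shows "integrable (lebesgue_on A) f"
  using finite_measure.L2_imp_integrable[OF finite_measure_A L2_continuous_A[OF assms]] .

lemma L2_continuous_H:
  fixes f :: "real ^ 'n \<Rightarrow> 'b::euclidean_space"
  assumes "continuous_on UNIV f"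
  shows "L2 H f"
proof -
  have "compact (f ` sphere 0 R\<^sub>2)"
    using assms by (intro compact_continuous_image) (auto intro: continuous_on_subset)
  then obtain B where B: "\<And>y. y \<in> f ` sphere 0 R\<^sub>2 \<Longrightarrow> norm y \<le> B"
    using compact_imp_bounded bounded_iff by metis
  show ?thesis
  proof (rule L2_dominated[where w="\<lambda>_. B\<^sup>2"])
    show "f \<in> borel_measurable H" using borel_measurable_continuous_onI[OF assms] by simp
    show "AE x in H. (norm (f x))\<^sup>2 \<le> B\<^sup>2"
      using AE_H by eventually_elim (auto intro!: power_mono B)
  qed simp
qed

lemma integrable_continuous_H:
  fixes f :: "real ^ 'n \<Rightarrow> 'b::euclidean_space"
  assumes "continuous_on UNIV f"
  shows "integrable H f"
  using H.L2_imp_integrable[OF L2_continuous_H[OF assms]] .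

text \<open>The divergence theorem for the field k(rad x) f(x) x, whose divergence is the integrand:
  the gradient of \<open>rad\<close> paired with x gives 2 rad x. It is the ray identity integrated
  over the sphere.\<close>

lemma radial_identity:
  fixes f :: "real ^ 'n \<Rightarrow> real" and k k' :: "real \<Rightarrow> real"
  assumes f: "\<And>x. f differentiable (at x)" "continuous_on UNIV (gradient f)"
    and k: "continuous_on UNIV k" "continuous_on UNIV k'"
      "\<And>s. s \<in> {b..1} \<Longrightarrow> (k has_real_derivative k' s) (at s within {b..1})"
    and b: "a \<le> b" "b < 1" and zero: "\<And>x. a < rad x \<Longrightarrow> rad x < b \<Longrightarrow> f x = 0 \<and> gradient f x = 0"
  shows "(LINT x|lebesgue_on A. (n * k (rad x) + 2 * rad x * k' (rad x)) * f x + k (rad x) * (gradient f x \<bullet> x))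
    = 2 * c * (k 1 * (LINT \<omega>|H. f \<omega>) - b powr (n / 2) * k b * (LINT \<omega>|H. f (sqrt b *\<^sub>R \<omega>)))"
proof -
  have cf: "continuous_on UNIV f" using f(1) by (simp add: continuous_on_eq_continuous_at differentiable_imp_continuous_within)
  have ck: "continuous_on UNIV (\<lambda>x. k (rad x))" "continuous_on UNIV (\<lambda>x. k' (rad x))"
    by (rule continuous_on_compose2[OF k(1) continuous_on_rad] continuous_on_compose2[OF k(2) continuous_on_rad]; simp)+
  define G where "G x = (n * k (rad x) + 2 * rad x * k' (rad x)) * f x + k (rad x) * (gradient f x \<bullet> x)" for x
  have cG: "continuous_on UNIV G"
    unfolding G_def[abs_def] using cf ck f(2) continuous_on_rad by (intro continuous_intros)
  have "(LINT x|lebesgue_on A. G x) = (LINT \<omega>|H. LINT s|L. G (sqrt s *\<^sub>R \<omega>))"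
    by (rule integral_A(1)[OF borel_measurable_continuous_onI[OF cG] integrable_continuous_A[OF cG]])
  also have "\<dots> = (LINT \<omega>|H. 2 * c * (k 1 * f \<omega> - b powr (n / 2) * k b * f (sqrt b *\<^sub>R \<omega>)))"
  proof (rule integral_cong_AE)
    show "(\<lambda>\<omega>. LINT s|L. G (sqrt s *\<^sub>R \<omega>)) \<in> borel_measurable H"
      using integral_A(2)[OF borel_measurable_continuous_onI[OF cG] integrable_continuous_A[OF cG]] by simp
    have "continuous_on UNIV (\<lambda>\<omega>. 2 * c * (k 1 * f \<omega> - b powr (n / 2) * k b * f (sqrt b *\<^sub>R \<omega>)))"
      by (intro continuous_intros cf continuous_on_compose2[OF cf]) auto
    then show "(\<lambda>\<omega>. 2 * c * (k 1 * f \<omega> - b powr (n / 2) * k b * f (sqrt b *\<^sub>R \<omega>))) \<in> borel_measurable H"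
      using borel_measurable_continuous_onI by (simp cong: measurable_cong_sets)
    show "AE \<omega> in H. (LINT s|L. G (sqrt s *\<^sub>R \<omega>)) = 2 * c * (k 1 * f \<omega> - b powr (n / 2) * k b * f (sqrt b *\<^sub>R \<omega>))"
      using AE_H
    proof eventually_elim
      case (elim \<omega>)
      have cs: "continuous_on UNIV (\<lambda>s. f (sqrt s *\<^sub>R \<omega>))" "continuous_on UNIV (\<lambda>s. gradient f (sqrt s *\<^sub>R \<omega>))"
        "continuous_on UNIV (\<lambda>s. G (sqrt s *\<^sub>R \<omega>))"
        by (rule continuous_on_compose2[OF cf] continuous_on_compose2[OF f(2)] continuous_on_compose2[OF cG]; auto intro!: continuous_intros)+
      have "(LINT s|L. G (sqrt s *\<^sub>R \<omega>)) =
        (LINT s|L. (n * k s + 2 * s * k' s) * f (sqrt s *\<^sub>R \<omega>) + k s * (gradient f (sqrt s *\<^sub>R \<omega>) \<bullet> (sqrt s *\<^sub>R \<omega>)))"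
      proof (rule integral_cong_AE)
        show "(\<lambda>s. G (sqrt s *\<^sub>R \<omega>)) \<in> borel_measurable L"
          using borel_measurable_continuous_onI[OF cs(3)] by (simp cong: measurable_cong_sets)
        have "continuous_on UNIV (\<lambda>s. (n * k s + 2 * s * k' s) * f (sqrt s *\<^sub>R \<omega>) + k s * (gradient f (sqrt s *\<^sub>R \<omega>) \<bullet> (sqrt s *\<^sub>R \<omega>)))"
          using cs k(1,2) by (intro continuous_intros)
        then show "(\<lambda>s. (n * k s + 2 * s * k' s) * f (sqrt s *\<^sub>R \<omega>) + k s * (gradient f (sqrt s *\<^sub>R \<omega>) \<bullet> (sqrt s *\<^sub>R \<omega>))) \<in> borel_measurable L"
          using borel_measurable_continuous_onI by (simp cong: measurable_cong_sets)
        show "AE s in L. G (sqrt s *\<^sub>R \<omega>) = (n * k s + 2 * s * k' s) * f (sqrt s *\<^sub>R \<omega>) + k s * (gradient f (sqrt s *\<^sub>R \<omega>) \<bullet> (sqrt s *\<^sub>R \<omega>))"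
          using AE_L
        proof eventually_elim
          case (elim s)
          then have "0 \<le> s" using a_bounds by simp
          then show ?case using rad_polar[OF \<open>norm \<omega> = R\<^sub>2\<close>] by (simp add: G_def)
        qed
      qed
      also have "\<dots> = 2 * c * (k 1 * f \<omega> - b powr (n / 2) * k b * f (sqrt b *\<^sub>R \<omega>))"
      proof (rule radial_identity_ray[OF f k b])
        fix s assume s: "a < s" "s < b"
        then have "rad (sqrt s *\<^sub>R \<omega>) = s" using a_bounds elim by (intro rad_polar) auto
        then show "f (sqrt s *\<^sub>R \<omega>) = 0 \<and> gradient f (sqrt s *\<^sub>R \<omega>) = 0" using s by (intro zero) auto
      qed
      finally show ?case .
    qed
  qed
  also have "\<dots> = 2 * c * (k 1 * (LINT \<omega>|H. f \<omega>) - b powr (n / 2) * k b * (LINT \<omega>|H. f (sqrt b *\<^sub>R \<omega>)))"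
  proof -
    have "integrable H f" by (rule integrable_continuous_H[OF cf])
    moreover have "continuous_on UNIV (\<lambda>\<omega>. f (sqrt b *\<^sub>R \<omega>))"
      by (rule continuous_on_compose2[OF cf]) (auto intro!: continuous_intros)
    then have "integrable H (\<lambda>\<omega>. f (sqrt b *\<^sub>R \<omega>))" by (rule integrable_continuous_H)
    ultimately show ?thesis by simp
  qed
  finally show ?thesis unfolding G_def .
qed

section \<open>Boundary values as averages along rays\<close>

definition ray_average :: "(real ^ 'n \<Rightarrow> real) \<Rightarrow> real ^ 'n \<Rightarrow> real" where
  "ray_average Q \<omega> = (LINT s|L. Q (sqrt s *\<^sub>R \<omega>))"

text \<open>Cauchy-Schwarz on each ray against the constant 1, then integration over the sphere:
  averaging is bounded from L2 of the annulus to L2 of the sphere.\<close>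

lemma ray_average_L2:
  assumes Q: "Q \<in> borel_measurable borel" "L2 (lebesgue_on A) Q"
  shows "L2 H (ray_average Q)"
    and "(LINT \<omega>|H. (norm (ray_average Q \<omega>))\<^sup>2) \<le> measure L UNIV * (LINT x|lebesgue_on A. (norm (Q x))\<^sup>2)"
proof -
  have Q2: "(\<lambda>x. (norm (Q x))\<^sup>2) \<in> borel_measurable borel" using Q(1) by measurable
  note i2 = integral_A[OF Q2 L2_integrable[OF Q(2)]]
  note i1 = integral_A[OF Q(1) finite_measure.L2_imp_integrable[OF finite_measure_A Q(2)]]
  have le: "AE \<omega> in H. (norm (ray_average Q \<omega>))\<^sup>2 \<le> measure L UNIV * (LINT s|L. (norm (Q (sqrt s *\<^sub>R \<omega>)))\<^sup>2)"
    using i2(3)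
  proof eventually_elim
    case (elim \<omega>)
    have m: "(\<lambda>s. Q (sqrt s *\<^sub>R \<omega>)) \<in> borel_measurable L"
      using measurable_compose[OF _ Q(1), of "\<lambda>s. sqrt s *\<^sub>R \<omega>" borel] by (simp cong: measurable_cong_sets)
    have "L2 L (\<lambda>s. Q (sqrt s *\<^sub>R \<omega>))" using elim m by (simp add: L2_def)
    moreover have "L2 L (\<lambda>_. 1::real)" by (simp add: L2_def)
    ultimately have "\<bar>LINT s|L. Q (sqrt s *\<^sub>R \<omega>) \<bullet> 1\<bar> \<le> sqrt (LINT s|L. (norm (Q (sqrt s *\<^sub>R \<omega>)))\<^sup>2) * sqrt (LINT s|L. (norm (1::real))\<^sup>2)"
      by (rule Cauchy_Schwarz_integral)
    then have "\<bar>ray_average Q \<omega>\<bar> \<le> sqrt (LINT s|L. (norm (Q (sqrt s *\<^sub>R \<omega>)))\<^sup>2) * sqrt (measure L UNIV)"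
      by (simp add: ray_average_def)
    then have "\<bar>ray_average Q \<omega>\<bar>\<^sup>2 \<le> (sqrt (LINT s|L. (norm (Q (sqrt s *\<^sub>R \<omega>)))\<^sup>2) * sqrt (measure L UNIV))\<^sup>2"
      by (intro power_mono) auto
    then show ?case by (simp add: power_mult_distrib mult.commute)
  qed
  have m: "ray_average Q \<in> borel_measurable H"
    using i1(2) by (simp add: ray_average_def[abs_def] borel_measurable_integrable)
  have iW: "integrable H (\<lambda>\<omega>. measure L UNIV * (LINT s|L. (norm (Q (sqrt s *\<^sub>R \<omega>)))\<^sup>2))" using i2(2) by simp
  show L2: "L2 H (ray_average Q)" by (rule L2_dominated[OF m iW le])
  have "(LINT \<omega>|H. (norm (ray_average Q \<omega>))\<^sup>2) \<le> (LINT \<omega>|H. measure L UNIV * (LINT s|L. (norm (Q (sqrt s *\<^sub>R \<omega>)))\<^sup>2))"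
    by (rule integral_mono_AE[OF L2_integrable[OF L2] iW le])
  then show "(LINT \<omega>|H. (norm (ray_average Q \<omega>))\<^sup>2) \<le> measure L UNIV * (LINT x|lebesgue_on A. (norm (Q x))\<^sup>2)"
    using i2(1) by simp
qed

lemma ray_average_tendsto:
  assumes Q: "\<And>k. Q k \<in> borel_measurable borel" "q \<in> borel_measurable borel" and lim: "L2_tendsto (lebesgue_on A) Q q"
  shows "L2_tendsto H (\<lambda>k. ray_average (Q k)) (ray_average q)"
proof -
  have L2: "L2 (lebesgue_on A) (Q k)" "L2 (lebesgue_on A) q" for k using lim by (auto simp: L2_tendsto_def)
  have diff: "AE \<omega> in H. ray_average (\<lambda>x. Q k x - q x) \<omega> = ray_average (Q k) \<omega> - ray_average q \<omega>" for k
    using integral_A(3)[OF Q(1)[of k] finite_measure.L2_imp_integrable[OF finite_measure_A L2(1)]]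
      integral_A(3)[OF Q(2) finite_measure.L2_imp_integrable[OF finite_measure_A L2(2)]]
    by eventually_elim (simp add: ray_average_def)
  have bound: "(\<lambda>k. measure L UNIV * (LINT x|lebesgue_on A. (norm (Q k x - q x))\<^sup>2)) \<longlonglongrightarrow> 0"
    using lim by (intro tendsto_mult_right_zero) (auto simp: L2_tendsto_def)
  have "(\<lambda>k. LINT \<omega>|H. (norm (ray_average (Q k) \<omega> - ray_average q \<omega>))\<^sup>2) \<longlonglongrightarrow> 0"
  proof (rule Lim_null_comparison[OF _ bound], intro always_eventually allI)
    fix k
    have mk: "(\<lambda>x. Q k x - q x) \<in> borel_measurable borel" using Q by measurable
    have "(LINT \<omega>|H. (norm (ray_average (Q k) \<omega> - ray_average q \<omega>))\<^sup>2) = (LINT \<omega>|H. (norm (ray_average (\<lambda>x. Q k x - q x) \<omega>))\<^sup>2)"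
    proof (rule integral_cong_AE)
      show "(\<lambda>\<omega>. (norm (ray_average (Q k) \<omega> - ray_average q \<omega>))\<^sup>2) \<in> borel_measurable H"
        using L2_integrable[OF L2_diff[OF ray_average_L2(1)[OF Q(1)[of k] L2(1)] ray_average_L2(1)[OF Q(2) L2(2)]]] by simp
      show "(\<lambda>\<omega>. (norm (ray_average (\<lambda>x. Q k x - q x) \<omega>))\<^sup>2) \<in> borel_measurable H"
        using L2_integrable[OF ray_average_L2(1)[OF mk L2_diff[OF L2]]] by simp
      show "AE \<omega> in H. (norm (ray_average (Q k) \<omega> - ray_average q \<omega>))\<^sup>2 = (norm (ray_average (\<lambda>x. Q k x - q x) \<omega>))\<^sup>2"
        using diff[of k] by eventually_elim simp
    qed
    also have "\<dots> \<le> measure L UNIV * (LINT x|lebesgue_on A. (norm (Q k x - q x))\<^sup>2)"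
      by (rule ray_average_L2(2)[OF mk L2_diff[OF L2]])
    finally show "norm (LINT \<omega>|H. (norm (ray_average (Q k) \<omega> - ray_average q \<omega>))\<^sup>2) \<le> measure L UNIV * (LINT x|lebesgue_on A. (norm (Q k x - q x))\<^sup>2)"
      by simp
  qed
  then show ?thesis using ray_average_L2(1)[OF Q(1) L2(1)] ray_average_L2(1)[OF Q(2) L2(2)] by (auto simp: L2_tendsto_def)
qed

text \<open>An affine weight with value 0 on the inner and 1 on the outer sphere; in the divergence
  theorem it leaves the outer boundary term alone.\<close>

definition cutoff :: "real \<Rightarrow> real" where
  "cutoff s = (s - a) / (1 - a)"

text \<open>The divergence of cutoff(rad x) u(x) x with \<open>g\<close> in place of the gradient of
  \<open>u\<close>, so that it makes sense for a function and a weak gradient. The constant 1 / (1 -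
  a) is the derivative of \<open>cutoff\<close>.\<close>

definition trace_density :: "(real ^ 'n \<Rightarrow> real) \<Rightarrow> (real ^ 'n \<Rightarrow> real ^ 'n) \<Rightarrow> real ^ 'n \<Rightarrow> real" where
  "trace_density u g x = (n * cutoff (rad x) + 2 * rad x * (1 / (1 - a))) * u x + cutoff (rad x) * (g x \<bullet> x)"

text \<open>The trace is written as a ray average, which makes sense for \<open>L\<^sup>2\<close> functions; by the
  radial divergence theorem it reproduces the boundary values of smooth functions.\<close>

definition ray_trace :: "(real ^ 'n \<Rightarrow> real) \<Rightarrow> (real ^ 'n \<Rightarrow> real ^ 'n) \<Rightarrow> real ^ 'n \<Rightarrow> real" where
  "ray_trace u g \<omega> = 1 / (2 * c) * ray_average (trace_density u g) \<omega>"

lemma continuous_on_cutoff: "continuous_on UNIV (\<lambda>x. cutoff (rad x))"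
  unfolding cutoff_def using a_bounds by (intro continuous_intros continuous_on_rad) auto

lemma ray_trace_smooth:
  assumes f: "\<And>x. f differentiable (at x)" "continuous_on UNIV (gradient f)" and \<omega>: "norm \<omega> = R\<^sub>2"
  shows "ray_trace f (gradient f) \<omega> = f \<omega>"
proof -
  have cf: "continuous_on UNIV f" using f(1) by (simp add: continuous_on_eq_continuous_at differentiable_imp_continuous_within)
  have ck: "continuous_on UNIV cutoff" "continuous_on UNIV (\<lambda>_. 1 / (1 - a))"
    unfolding cutoff_def[abs_def] using a_bounds by (auto intro!: continuous_intros)
  have "ray_average (trace_density f (gradient f)) \<omega> =
    (LINT s|L. (n * cutoff s + 2 * s * (1 / (1 - a))) * f (sqrt s *\<^sub>R \<omega>) + cutoff s * (gradient f (sqrt s *\<^sub>R \<omega>) \<bullet> (sqrt s *\<^sub>R \<omega>)))"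
    unfolding ray_average_def
  proof (rule integral_cong_AE)
    have cs: "continuous_on UNIV (\<lambda>s. f (sqrt s *\<^sub>R \<omega>))" "continuous_on UNIV (\<lambda>s. gradient f (sqrt s *\<^sub>R \<omega>))"
      "continuous_on UNIV (\<lambda>s. rad (sqrt s *\<^sub>R \<omega>))" "continuous_on UNIV (\<lambda>s. cutoff (rad (sqrt s *\<^sub>R \<omega>)))"
      by (rule continuous_on_compose2[OF cf] continuous_on_compose2[OF f(2)] continuous_on_compose2[OF continuous_on_rad]
          continuous_on_compose2[OF continuous_on_cutoff]; auto intro!: continuous_intros)+
    have "continuous_on UNIV (\<lambda>s. trace_density f (gradient f) (sqrt s *\<^sub>R \<omega>))"
      unfolding trace_density_def by (intro continuous_intros cs)
    then show "(\<lambda>s. trace_density f (gradient f) (sqrt s *\<^sub>R \<omega>)) \<in> borel_measurable L"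
      using borel_measurable_continuous_onI by (simp cong: measurable_cong_sets)
    have "continuous_on UNIV (\<lambda>s. (n * cutoff s + 2 * s * (1 / (1 - a))) * f (sqrt s *\<^sub>R \<omega>) + cutoff s * (gradient f (sqrt s *\<^sub>R \<omega>) \<bullet> (sqrt s *\<^sub>R \<omega>)))"
      by (intro continuous_intros cs ck)
    then show "(\<lambda>s. (n * cutoff s + 2 * s * (1 / (1 - a))) * f (sqrt s *\<^sub>R \<omega>) + cutoff s * (gradient f (sqrt s *\<^sub>R \<omega>) \<bullet> (sqrt s *\<^sub>R \<omega>))) \<in> borel_measurable L"
      using borel_measurable_continuous_onI by (simp cong: measurable_cong_sets)
    show "AE s in L. trace_density f (gradient f) (sqrt s *\<^sub>R \<omega>) =
      (n * cutoff s + 2 * s * (1 / (1 - a))) * f (sqrt s *\<^sub>R \<omega>) + cutoff s * (gradient f (sqrt s *\<^sub>R \<omega>) \<bullet> (sqrt s *\<^sub>R \<omega>))"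
      using AE_L
    proof eventually_elim
      case (elim s)
      then have "rad (sqrt s *\<^sub>R \<omega>) = s" using a_bounds by (intro rad_polar[OF \<omega>]) auto
      then show ?case by (simp add: trace_density_def)
    qed
  qed
  also have "\<dots> = 2 * c * (cutoff 1 * f \<omega> - a powr (n / 2) * cutoff a * f (sqrt a *\<^sub>R \<omega>))"
  proof (rule radial_identity_ray[OF f ck])
    show "(cutoff has_real_derivative 1 / (1 - a)) (at s within {a..1})" for s
      unfolding cutoff_def[abs_def] using a_bounds by (auto intro!: derivative_eq_intros)
  qed (use a_bounds in auto)
  also have "\<dots> = 2 * c * f \<omega>" using a_bounds by (simp add: cutoff_def)
  finally show ?thesis using c by (simp add: ray_trace_def)
qed

lemma trace_density_tendsto:
  assumes F: "L2_tendsto (lebesgue_on A) F u" and G: "L2_tendsto (lebesgue_on A) G g"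
  shows "L2_tendsto (lebesgue_on A) (\<lambda>k. trace_density (F k) (G k)) (trace_density u g)"
proof -
  let ?\<alpha> = "\<lambda>x. n * cutoff (rad x) + 2 * rad x * (1 / (1 - a))" and ?X = "\<lambda>x. cutoff (rad x) *\<^sub>R x"
  have c\<alpha>: "continuous_on UNIV ?\<alpha>" and cX: "continuous_on UNIV ?X"
    by (intro continuous_intros continuous_on_cutoff continuous_on_rad)+
  obtain B1 where B1: "\<And>x. x \<in> A \<Longrightarrow> norm (?\<alpha> x) \<le> B1" by (rule bounded_on_A[OF c\<alpha>]) blast
  obtain B2 where B2: "\<And>x. x \<in> A \<Longrightarrow> norm (?X x) \<le> B2" by (rule bounded_on_A[OF cX]) blast
  have "L2_tendsto (lebesgue_on A) (\<lambda>k x. ?\<alpha> x *\<^sub>R F k x) (\<lambda>x. ?\<alpha> x *\<^sub>R u x)"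
  proof (rule L2_tendsto_bounded_scaleR[OF F])
    show "?\<alpha> \<in> borel_measurable (lebesgue_on A)" by (rule borel_imp_measurable_A[OF borel_measurable_continuous_onI[OF c\<alpha>]])
    show "AE x in lebesgue_on A. \<bar>?\<alpha> x\<bar> \<le> B1" using B1 by (intro AE_I2) (simp only: space_restrict_space space_completion Int_iff real_norm_def[symmetric])
  qed
  moreover have "L2_tendsto (lebesgue_on A) (\<lambda>k x. G k x \<bullet> ?X x) (\<lambda>x. g x \<bullet> ?X x)"
  proof (rule L2_tendsto_inner_bounded[OF G])
    show "?X \<in> borel_measurable (lebesgue_on A)" by (rule borel_imp_measurable_A[OF borel_measurable_continuous_onI[OF cX]])
    show "AE x in lebesgue_on A. norm (?X x) \<le> B2" using B2 by (intro AE_I2) (simp only: space_restrict_space Int_iff)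
  qed
  ultimately have "L2_tendsto (lebesgue_on A) (\<lambda>k x. ?\<alpha> x *\<^sub>R F k x + G k x \<bullet> ?X x) (\<lambda>x. ?\<alpha> x *\<^sub>R u x + g x \<bullet> ?X x)"
    by (rule L2_tendsto_add)
  then show ?thesis by (simp add: trace_density_def[abs_def])
qed

text \<open>The trace theorem. \<open>ray_trace\<close> depends continuously on function and
  gradient and is the restriction for smooth functions, so the boundary values of \<open>f k\<close>
  converge, to a limit determined by \<open>u\<close> and \<open>g\<close>.\<close>

lemma ray_trace_tendsto:
  assumes f: "\<And>k. f k \<in> test_functions UNIV" and u: "u \<in> borel_measurable borel" "g \<in> borel_measurable borel"
    and F: "L2_tendsto (lebesgue_on A) f u" and G: "L2_tendsto (lebesgue_on A) (\<lambda>k. gradient (f k)) g"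
  shows "L2_tendsto H f (ray_trace u g)"
proof -
  have m: "trace_density u g \<in> borel_measurable borel" if "u \<in> borel_measurable borel" "g \<in> borel_measurable borel" for u g
  proof -
    have [measurable]: "(\<lambda>x. cutoff (rad x)) \<in> borel_measurable borel" "rad \<in> borel_measurable borel"
      using borel_measurable_continuous_onI continuous_on_cutoff continuous_on_rad by blast+
    show ?thesis unfolding trace_density_def[abs_def] using that by measurable
  qed
  have mf: "f k \<in> borel_measurable borel" "gradient (f k) \<in> borel_measurable borel" for k
    using f by (auto intro: continuous_on_UNIV_borel test_functions_continuous test_functions_continuous_gradient)
  have "L2_tendsto H (\<lambda>k. ray_average (trace_density (f k) (gradient (f k)))) (ray_average (trace_density u g))"
    by (rule ray_average_tendsto[OF m[OF mf] m[OF u] trace_density_tendsto[OF F G]])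
  then have lim: "L2_tendsto H (\<lambda>k. ray_trace (f k) (gradient (f k))) (ray_trace u g)"
    unfolding ray_trace_def[abs_def] real_scaleR_def[symmetric]
    by (rule L2_tendsto_bounded_scaleR[where B="1 / (2 * c)"]) (use c in auto)
  have AE: "AE \<omega> in H. ray_trace (f k) (gradient (f k)) \<omega> = f k \<omega>" for k
    using AE_H by eventually_elim
      (rule ray_trace_smooth[OF test_functions_differentiable[OF f] test_functions_continuous_gradient[OF f]])
  have L2f: "L2 H (f k)" for k using L2_continuous_H[OF test_functions_continuous[OF f]] .
  have L2T: "L2 H (ray_trace u g)" "L2 H (ray_trace (f k) (gradient (f k)))" for k using lim by (auto simp: L2_tendsto_def)
  have "(LINT \<omega>|H. (norm (f k \<omega> - ray_trace u g \<omega>))\<^sup>2) = (LINT \<omega>|H. (norm (ray_trace (f k) (gradient (f k)) \<omega> - ray_trace u g \<omega>))\<^sup>2)" for k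
  proof (rule integral_cong_AE)
    show "(\<lambda>\<omega>. (norm (f k \<omega> - ray_trace u g \<omega>))\<^sup>2) \<in> borel_measurable H"
      using L2_integrable[OF L2_diff[OF L2f L2T(1)]] by simp
    show "(\<lambda>\<omega>. (norm (ray_trace (f k) (gradient (f k)) \<omega> - ray_trace u g \<omega>))\<^sup>2) \<in> borel_measurable H"
      using L2_integrable[OF L2_diff[OF L2T(2) L2T(1)]] by simp
    show "AE \<omega> in H. (norm (f k \<omega> - ray_trace u g \<omega>))\<^sup>2 = (norm (ray_trace (f k) (gradient (f k)) \<omega> - ray_trace u g \<omega>))\<^sup>2"
      using AE[of k] by eventually_elim simp
  qed
  then show ?thesis using lim L2f L2T by (simp add: L2_tendsto_def)
qed

section \<open>Comparison with the chosen trace\<close>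

text \<open>Translates between surface measure as a restricted space, over which traces are defined,
  and \<open>H\<close>, its version on the whole space, over which polar coordinates are set
  up.\<close>

lemma sphere_restrict:
  fixes T :: "real ^ 'n \<Rightarrow> real"
  shows "T \<in> borel_measurable (surface_measure (sphere 0 R\<^sub>2)) \<Longrightarrow>
      integral\<^sup>L (surface_measure (sphere 0 R\<^sub>2)) T = (LINT \<omega>|H. indicator (sphere 0 R\<^sub>2) \<omega> * T \<omega>)"
    and "L2 (surface_measure (sphere 0 R\<^sub>2)) T \<longleftrightarrow> L2 H (\<lambda>\<omega>. indicator (sphere 0 R\<^sub>2) \<omega> * T \<omega>)"
proof -
  let ?S = "sphere (0 :: real ^ 'n) R\<^sub>2" and ?M = "hausdorff_measure (DIM(real ^ 'n) - 1) :: (real ^ 'n) measure"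
  have dens: "H = density ?M (\<lambda>x. ennreal (indicator ?S x))"
    unfolding H_def sphere_measure_def by (simp add: ennreal_indicator)
  have S: "?S \<inter> space ?M \<in> sets ?M" by simp
  have ind: "(indicator ?S :: _ \<Rightarrow> real) \<in> borel_measurable ?M" using S by (intro borel_measurable_indicator) simp
  have meas: "T \<in> borel_measurable (surface_measure ?S) \<longleftrightarrow> (\<lambda>\<omega>. indicator ?S \<omega> * T \<omega>) \<in> borel_measurable borel"
    unfolding surface_measure_def by (subst borel_measurable_restrict_space_iff[OF S]) (simp cong: measurable_cong_sets)
  show "integral\<^sup>L (surface_measure ?S) T = (LINT \<omega>|H. indicator ?S \<omega> * T \<omega>)"
    if "T \<in> borel_measurable (surface_measure ?S)"
  proof -
    have m: "(\<lambda>\<omega>. indicator ?S \<omega> * T \<omega>) \<in> borel_measurable ?M" using that meas by (simp cong: measurable_cong_sets)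
    have "(LINT \<omega>|H. indicator ?S \<omega> * T \<omega>) = (LINT \<omega>|?M. indicator ?S \<omega> *\<^sub>R (indicator ?S \<omega> * T \<omega>))"
      unfolding dens using m ind by (intro integral_density) auto
    also have "\<dots> = (LINT \<omega>|?M. indicator ?S \<omega> *\<^sub>R T \<omega>)" by (intro Bochner_Integration.integral_cong) (auto simp: indicator_def)
    also have "\<dots> = integral\<^sup>L (surface_measure ?S) T"
      unfolding surface_measure_def by (rule integral_restrict_space[OF S, symmetric])
    finally show ?thesis by simp
  qed
  show "L2 (surface_measure ?S) T \<longleftrightarrow> L2 H (\<lambda>\<omega>. indicator ?S \<omega> * T \<omega>)"
  proof (cases "T \<in> borel_measurable (surface_measure ?S)")
    case False
    then show ?thesis using meas by (simp add: L2_def cong: measurable_cong_sets)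
  next
    case True
    then have m: "(\<lambda>\<omega>. indicator ?S \<omega> * T \<omega>) \<in> borel_measurable ?M" "(\<lambda>\<omega>. indicator ?S \<omega> * T \<omega>) \<in> borel_measurable H"
      using meas by (simp_all cong: measurable_cong_sets)
    have "integrable H (\<lambda>\<omega>. (norm (indicator ?S \<omega> * T \<omega>))\<^sup>2) \<longleftrightarrow> integrable ?M (\<lambda>\<omega>. indicator ?S \<omega> *\<^sub>R (norm (indicator ?S \<omega> * T \<omega>))\<^sup>2)"
      unfolding dens using m(1) ind by (intro integrable_density borel_measurable_power borel_measurable_norm) auto
    also have "\<dots> \<longleftrightarrow> integrable ?M (\<lambda>\<omega>. indicator ?S \<omega> *\<^sub>R (norm (T \<omega>))\<^sup>2)"
      by (intro Bochner_Integration.integrable_cong) (auto simp: indicator_def)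
    also have "\<dots> \<longleftrightarrow> integrable (surface_measure ?S) (\<lambda>\<omega>. (norm (T \<omega>))\<^sup>2)"
      unfolding surface_measure_def by (rule integrable_restrict_space[OF S, symmetric])
    finally show ?thesis using True m(2) by (simp add: L2_def)
  qed
qed

lemma borel_representative_L2_tendsto:
  fixes v :: "real ^ 'n \<Rightarrow> 'b::euclidean_space"
  assumes "L2 (lebesgue_on A) v"
  obtains u where "u \<in> borel_measurable borel" "AE x in lebesgue_on A. v x = u x"
    "\<And>F. L2_tendsto (lebesgue_on A) F v \<Longrightarrow> L2_tendsto (lebesgue_on A) F u"
proof -
  obtain u where u: "u \<in> borel_measurable borel" "AE x in lebesgue_on A. v x = u x"
    using borel_representative_vector[OF L2_measurable[OF assms] A_borel] by metis
  then show thesis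
    using that L2_tendsto_cong_AE[of "lebesgue_on A" _ v u] borel_imp_measurable_A by blast
qed

text \<open>The last property covers every sequence with the same two limits. It allows
  \<open>T\<close> to be compared with a trace that was chosen along another sequence.\<close>

lemma boundary_values_tendsto:
  assumes f: "\<And>k. f k \<in> test_functions UNIV" and F: "L2_tendsto (lebesgue_on A) f u"
    and G: "L2_tendsto (lebesgue_on A) (\<lambda>k. gradient (f k)) g"
  obtains T where "T \<in> borel_measurable borel" "L2_tendsto H f T"
    "\<And>h. (\<And>k. h k \<in> test_functions UNIV) \<Longrightarrow> L2_tendsto (lebesgue_on A) h u \<Longrightarrow>
      L2_tendsto (lebesgue_on A) (\<lambda>k. gradient (h k)) g \<Longrightarrow> L2_tendsto H h T"
proof -
  have L2: "L2 (lebesgue_on A) u" "L2 (lebesgue_on A) g" using F G by (auto simp: L2_tendsto_def)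
  obtain u' where u': "u' \<in> borel_measurable borel" "AE x in lebesgue_on A. u x = u' x"
    "\<And>F. L2_tendsto (lebesgue_on A) F u \<Longrightarrow> L2_tendsto (lebesgue_on A) F u'"
    using borel_representative_L2_tendsto[OF L2(1)] by blast
  obtain g' where g': "g' \<in> borel_measurable borel" "AE x in lebesgue_on A. g x = g' x"
    "\<And>F. L2_tendsto (lebesgue_on A) F g \<Longrightarrow> L2_tendsto (lebesgue_on A) F g'"
    using borel_representative_L2_tendsto[OF L2(2)] by blast
  have lim: "L2_tendsto H h (ray_trace u' g')"
    if "\<And>k. h k \<in> test_functions UNIV" "L2_tendsto (lebesgue_on A) h u"
      "L2_tendsto (lebesgue_on A) (\<lambda>k. gradient (h k)) g" for h
    using ray_trace_tendsto[OF that(1) u'(1) g'(1) u'(3)[OF that(2)] g'(3)[OF that(3)]] .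
  have "ray_trace u' g' \<in> borel_measurable borel"
    using lim[OF f F G] by (simp add: L2_tendsto_def L2_def cong: measurable_cong_sets)
  then show thesis using that lim[OF f F G] lim by blast
qed

lemma indicator_sphere_AE: "AE \<omega> in H. indicator (sphere 0 R\<^sub>2) \<omega> * (T \<omega> :: real) = T \<omega>"
  using AE_H by eventually_elim simp

text \<open>A chosen trace is arbitrary off the sphere and may fail to be measurable there; the
  indicator removes those values.\<close>

definition tr :: "(real ^ 'n \<Rightarrow> real) \<Rightarrow> real ^ 'n \<Rightarrow> real" where
  "tr v \<omega> = indicator (sphere 0 R\<^sub>2) \<omega> * trace A (sphere 0 R\<^sub>2) v \<omega>"

lemma is_trace_L2_tendsto:
  assumes T: "is_trace A (sphere 0 R\<^sub>2) v T"
  obtains f where "\<And>k. f k \<in> test_functions UNIV" "(\<lambda>k. H1_norm A (\<lambda>x. f k x - v x)) \<longlonglongrightarrow> 0"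
    "L2_tendsto H f (\<lambda>\<omega>. indicator (sphere 0 R\<^sub>2) \<omega> * T \<omega>)"
proof -
  let ?S = "sphere (0 :: real ^ 'n) R\<^sub>2"
  obtain f where f: "\<And>k. f k \<in> test_functions UNIV" "(\<lambda>k. H1_norm A (\<lambda>x. f k x - v x)) \<longlonglongrightarrow> 0"
    "(\<lambda>k. LINT x|surface_measure ?S. (f k x - T x)\<^sup>2) \<longlonglongrightarrow> 0" and L2T: "L2 (surface_measure ?S) T"
    using T unfolding is_trace_def by blast
  have L2T': "L2 H (\<lambda>\<omega>. indicator ?S \<omega> * T \<omega>)" using L2T sphere_restrict(2) by blast
  have L2f: "L2 H (f k)" for k using L2_continuous_H[OF test_functions_continuous[OF f(1)]] .
  have "(LINT x|surface_measure ?S. (f k x - T x)\<^sup>2) = (LINT \<omega>|H. (norm (f k \<omega> - indicator ?S \<omega> * T \<omega>))\<^sup>2)" for k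
  proof -
    have mf: "f k \<in> borel_measurable (surface_measure ?S)"
      unfolding surface_measure_def using continuous_on_UNIV_borel[OF test_functions_continuous[OF f(1)]]
      by (intro measurable_restrict_space1) (simp cong: measurable_cong_sets)
    have m: "(\<lambda>x. (f k x - T x)\<^sup>2) \<in> borel_measurable (surface_measure ?S)"
      using mf L2_measurable[OF L2T] by measurable
    have "(LINT x|surface_measure ?S. (f k x - T x)\<^sup>2) = (LINT \<omega>|H. indicator ?S \<omega> * (f k \<omega> - T \<omega>)\<^sup>2)"
      by (rule sphere_restrict(1)[OF m])
    also have "\<dots> = (LINT \<omega>|H. (norm (f k \<omega> - indicator ?S \<omega> * T \<omega>))\<^sup>2)"
    proof (rule integral_cong_AE)
      have "?S \<in> sets H" by simp
      then have iS: "(indicator ?S :: _ \<Rightarrow> real) \<in> borel_measurable H" by (rule borel_measurable_indicator)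
      show m2: "(\<lambda>\<omega>. (norm (f k \<omega> - indicator ?S \<omega> * T \<omega>))\<^sup>2) \<in> borel_measurable H"
        using L2_integrable[OF L2_diff[OF L2f L2T']] by simp
      have "(\<lambda>\<omega>. indicator ?S \<omega> * (norm (f k \<omega> - indicator ?S \<omega> * T \<omega>))\<^sup>2) \<in> borel_measurable H"
        using iS m2 by (rule borel_measurable_times)
      moreover have "indicator ?S \<omega> * (norm (f k \<omega> - indicator ?S \<omega> * T \<omega>))\<^sup>2 = indicator ?S \<omega> * (f k \<omega> - T \<omega>)\<^sup>2" for \<omega>
        by (auto simp: indicator_def)
      ultimately show "(\<lambda>\<omega>. indicator ?S \<omega> * (f k \<omega> - T \<omega>)\<^sup>2) \<in> borel_measurable H" by (simp only:)
      show "AE \<omega> in H. indicator ?S \<omega> * (f k \<omega> - T \<omega>)\<^sup>2 = (norm (f k \<omega> - indicator ?S \<omega> * T \<omega>))\<^sup>2"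
        using AE_H by eventually_elim simp
    qed
    finally show ?thesis .
  qed
  then have "L2_tendsto H f (\<lambda>\<omega>. indicator ?S \<omega> * T \<omega>)" using f(3) L2f L2T' by (simp add: L2_tendsto_def)
  then show thesis using that f(1,2) by blast
qed

lemma L2_tendsto_imp_is_trace:
  assumes f: "\<And>k. f k \<in> test_functions UNIV" "(\<lambda>k. H1_norm A (\<lambda>x. f k x - v x)) \<longlonglongrightarrow> 0"
    and T: "T \<in> borel_measurable borel" "L2_tendsto H f T"
  shows "is_trace A (sphere 0 R\<^sub>2) v T"
  unfolding is_trace_def
proof (intro conjI exI[of _ f] allI f)
  let ?S = "sphere (0 :: real ^ 'n) R\<^sub>2"
  have L2f: "L2 H (f k)" and L2T: "L2 H T" for k using T(2) by (auto simp: L2_tendsto_def)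
  have mS: "(\<lambda>\<omega>. indicator ?S \<omega> * T \<omega>) \<in> borel_measurable H" proof -
    have [measurable]: "?S \<in> sets borel" by simp
    have "(\<lambda>\<omega>. indicator ?S \<omega> * T \<omega>) \<in> borel_measurable borel" using T(1) by measurable
    then show ?thesis by (simp cong: measurable_cong_sets)
  qed
  have "L2 H (\<lambda>\<omega>. indicator ?S \<omega> * T \<omega>)"
  proof (rule L2_cong_AE[OF L2T _ mS])
    show "AE \<omega> in H. T \<omega> = indicator ?S \<omega> * T \<omega>" using indicator_sphere_AE[of T] by eventually_elim (rule sym)
  qed
  then show "L2 (surface_measure ?S) T" using sphere_restrict(2) by blast
  have "(LINT x|surface_measure ?S. (f k x - T x)\<^sup>2) = (LINT \<omega>|H. (norm (f k \<omega> - T \<omega>))\<^sup>2)" for k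
  proof -
    have mb: "(\<lambda>x. (f k x - T x)\<^sup>2) \<in> borel_measurable borel"
      using continuous_on_UNIV_borel[OF test_functions_continuous[OF f(1)]] T(1) by measurable
    then have m: "(\<lambda>x. (f k x - T x)\<^sup>2) \<in> borel_measurable (surface_measure ?S)"
      unfolding surface_measure_def by (intro measurable_restrict_space1) (simp cong: measurable_cong_sets)
    have "(LINT x|surface_measure ?S. (f k x - T x)\<^sup>2) = (LINT \<omega>|H. indicator ?S \<omega> * (f k \<omega> - T \<omega>)\<^sup>2)"
      by (rule sphere_restrict(1)[OF m])
    also have "\<dots> = (LINT \<omega>|H. (norm (f k \<omega> - T \<omega>))\<^sup>2)"
    proof (rule integral_cong_AE)
      have [measurable]: "?S \<in> sets borel" by simp
      have "(\<lambda>\<omega>. indicator ?S \<omega> * (f k \<omega> - T \<omega>)\<^sup>2) \<in> borel_measurable borel" using mb by measurable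
      then show "(\<lambda>\<omega>. indicator ?S \<omega> * (f k \<omega> - T \<omega>)\<^sup>2) \<in> borel_measurable H" by (simp cong: measurable_cong_sets)
      show "(\<lambda>\<omega>. (norm (f k \<omega> - T \<omega>))\<^sup>2) \<in> borel_measurable H" using mb by (simp cong: measurable_cong_sets)
      show "AE \<omega> in H. indicator ?S \<omega> * (f k \<omega> - T \<omega>)\<^sup>2 = (norm (f k \<omega> - T \<omega>))\<^sup>2"
        using indicator_sphere_AE[of "\<lambda>\<omega>. (f k \<omega> - T \<omega>)\<^sup>2"] by simp
    qed
    finally show ?thesis .
  qed
  then show "(\<lambda>k. LINT x|surface_measure ?S. (f k x - T x)\<^sup>2) \<longlonglongrightarrow> 0" using T(2) by (simp add: L2_tendsto_def)
qed

text \<open>Independence of the approximating sequence is what makes the choice in \<^const>\<open>trace\<close> harmless.\<close>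

lemma trace_tendsto:
  assumes v: "v \<in> H1 A" and f: "\<And>k. f k \<in> test_functions UNIV" "(\<lambda>k. H1_norm A (\<lambda>x. f k x - v x)) \<longlonglongrightarrow> 0"
  shows "L2_tendsto (lebesgue_on A) f v" "L2_tendsto (lebesgue_on A) (\<lambda>k. gradient (f k)) (weak_gradient A v)"
    "L2_tendsto H f (tr v)"
proof -
  have L2v: "L2 (lebesgue_on A) v" using v by (simp add: H1_def)
  have wg: "is_weak_gradient A v (weak_gradient A v)" by (rule is_weak_gradient_weak_gradient[OF v])
  note conv = H1_tendsto_imp_L2_tendsto[OF A_open A_bounded _ L2v wg]
  show cv: "L2_tendsto (lebesgue_on A) f v" "L2_tendsto (lebesgue_on A) (\<lambda>k. gradient (f k)) (weak_gradient A v)"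
    using conv[of f] f by blast+
  obtain T where T: "T \<in> borel_measurable borel" "L2_tendsto H f T"
    "\<And>h. (\<And>k. h k \<in> test_functions UNIV) \<Longrightarrow> L2_tendsto (lebesgue_on A) h v \<Longrightarrow>
      L2_tendsto (lebesgue_on A) (\<lambda>k. gradient (h k)) (weak_gradient A v) \<Longrightarrow> L2_tendsto H h T"
    using boundary_values_tendsto[OF f(1) cv] by blast
  have "is_trace A (sphere 0 R\<^sub>2) v T" by (rule L2_tendsto_imp_is_trace[OF f T(1,2)])
  \<comment> \<open>The explicit trace \<open>T\<close> shows that the choice in
    \<open>trace\<close> is made from a nonempty set.\<close>
  then have "is_trace A (sphere 0 R\<^sub>2) v (trace A (sphere 0 R\<^sub>2) v)"
    unfolding trace_def by (rule someI[where P="is_trace A (sphere 0 R\<^sub>2) v"])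
  \<comment> \<open>The sequence hidden in the chosen trace. Its boundary values converge to
    \<open>T\<close> as well, so \<open>T\<close> and the chosen trace agree almost
    everywhere.\<close>
  then obtain h where h: "\<And>k. h k \<in> test_functions UNIV" "(\<lambda>k. H1_norm A (\<lambda>x. h k x - v x)) \<longlonglongrightarrow> 0" "L2_tendsto H h (tr v)"
    unfolding tr_def[abs_def] by (rule is_trace_L2_tendsto) blast
  have "L2_tendsto H h T" using T(3)[of h] conv[of h] h(1,2) by blast
  then have "AE \<omega> in H. T \<omega> = tr v \<omega>" using h(3) by (rule L2_tendsto_unique)
  moreover have "tr v \<in> borel_measurable H" using h(3) by (auto simp: L2_tendsto_def L2_def)
  ultimately show "L2_tendsto H f (tr v)" by (rule L2_tendsto_cong_AE[OF T(2)])
qed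

text \<open>Replaces the forms, defined through chosen weak gradients and traces, by limits of
  classical integrals of smooth functions.\<close>

lemma robin_form_tendsto:
  assumes v: "v \<in> H1 A" and f: "\<And>k. f k \<in> test_functions UNIV" "(\<lambda>k. H1_norm A (\<lambda>x. f k x - v x)) \<longlonglongrightarrow> 0"
    and w: "w \<in> H1 A" and h: "\<And>k. h k \<in> test_functions UNIV" "(\<lambda>k. H1_norm A (\<lambda>x. h k x - w x)) \<longlonglongrightarrow> 0"
  shows "(\<lambda>k. (LINT x|lebesgue_on A. gradient (f k) x \<bullet> gradient (h k) x) + \<beta> * (LINT \<omega>|H. f k \<omega> * h k \<omega>))
      \<longlonglongrightarrow> robin_form \<beta> R\<^sub>1 R\<^sub>2 v w"
    and "(\<lambda>k. LINT x|lebesgue_on A. f k x * h k x) \<longlonglongrightarrow> L2_form R\<^sub>1 R\<^sub>2 v w"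
proof -
  let ?S = "sphere (0 :: real ^ 'n) R\<^sub>2"
  note tv = trace_tendsto[OF v f] and tw = trace_tendsto[OF w h]
  show "(\<lambda>k. LINT x|lebesgue_on A. f k x * h k x) \<longlonglongrightarrow> L2_form R\<^sub>1 R\<^sub>2 v w"
    using L2_tendsto_inner[OF tv(1) tw(1)] by (simp add: L2_form_def A_def)
  have L2t: "L2 H (tr v)" "L2 H (tr w)" using tv(3) tw(3) by (auto simp: L2_tendsto_def)
  have "trace A ?S v \<in> borel_measurable (surface_measure ?S)" "trace A ?S w \<in> borel_measurable (surface_measure ?S)"
    using L2t sphere_restrict(2) unfolding tr_def[abs_def] by (blast intro: L2_measurable)+
  then have "(\<lambda>\<omega>. trace A ?S v \<omega> * trace A ?S w \<omega>) \<in> borel_measurable (surface_measure ?S)" by (rule borel_measurable_times)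
  then have "(LINT \<omega>|surface_measure ?S. trace A ?S v \<omega> * trace A ?S w \<omega>) = (LINT \<omega>|H. indicator ?S \<omega> * (trace A ?S v \<omega> * trace A ?S w \<omega>))"
    by (rule sphere_restrict(1))
  also have "\<dots> = (LINT \<omega>|H. tr v \<omega> * tr w \<omega>)"
    by (intro Bochner_Integration.integral_cong) (auto simp: tr_def indicator_def)
  finally have "robin_form \<beta> R\<^sub>1 R\<^sub>2 v w = (LINT x|lebesgue_on A. weak_gradient A v x \<bullet> weak_gradient A w x) + \<beta> * (LINT \<omega>|H. tr v \<omega> * tr w \<omega>)"
    by (simp add: robin_form_def A_def)
  moreover have "(\<lambda>k. LINT \<omega>|H. f k \<omega> * h k \<omega>) \<longlonglongrightarrow> (LINT \<omega>|H. tr v \<omega> * tr w \<omega>)"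
    using L2_tendsto_inner[OF tv(3) tw(3)] by simp
  ultimately show "(\<lambda>k. (LINT x|lebesgue_on A. gradient (f k) x \<bullet> gradient (h k) x) + \<beta> * (LINT \<omega>|H. f k \<omega> * h k \<omega>))
      \<longlonglongrightarrow> robin_form \<beta> R\<^sub>1 R\<^sub>2 v w"
    using L2_tendsto_inner[OF tv(2) tw(2)] by (auto intro!: tendsto_intros)
qed

end

section \<open>The radial profile of an eigenfunction\<close>

lemma H1_norm_zero:
  fixes \<Omega> :: "'a::euclidean_space set"
  assumes "open \<Omega>" "bounded \<Omega>"
  shows "H1_norm \<Omega> (\<lambda>_. 0) = 0"
proof -
  have "is_weak_gradient \<Omega> (\<lambda>_. 0) (\<lambda>_. 0)" by (auto simp: is_weak_gradient_def L2_zero)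
  from weak_gradient_AE_eq[OF assms this] is_weak_gradient_unique[OF assms this this]
  have "(LINT x|lebesgue_on \<Omega>. (norm (weak_gradient \<Omega> (\<lambda>_. 0) x))\<^sup>2) = 0"
    by (intro integral_eq_zero_AE) (auto elim: eventually_mono)
  then show ?thesis by (simp add: H1_norm_def)
qed

lemma H1_vanishing_test:
  fixes u :: "'a::euclidean_space \<Rightarrow> real"
  assumes "open \<Omega>" "bounded \<Omega>" "u \<in> test_functions UNIV" "spt u \<inter> \<Gamma> = {}"
  shows "u \<in> H1_vanishing \<Gamma> \<Omega>"
proof -
  have "u \<in> H1 \<Omega>" using H1_test[OF test_functionsD(1)[OF assms(3)] assms(1,2)] .
  moreover have "(\<lambda>k::nat. H1_norm \<Omega> (\<lambda>x. u x - u x)) \<longlonglongrightarrow> 0" by (simp add: H1_norm_zero assms)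
  ultimately show ?thesis unfolding H1_vanishing_def using assms(3,4) by (intro CollectI conjI exI[of _ "\<lambda>_. u"]) auto
qed

section \<open>Antiderivatives and cutoffs on the line\<close>

text \<open>Written as a Lebesgue integral over the line, ready for Fubini. Since \<open>g\<close>
  vanishes up to \<alpha> > 0, for s \<ge> 0 it equals the integral from 0, to which the fundamental
  theorem applies.\<close>

lemma smooth_antiderivative:
  fixes g :: "real \<Rightarrow> real"
  assumes g: "g \<in> test_functions {\<alpha><..<\<beta>}" and \<alpha>: "0 < \<alpha>"
  shows "((\<lambda>s. LINT t|lborel. indicator {..<s} t * g t) has_real_derivative g s) (at s)"
proof -
  define G where "G s = (LINT t|lborel. indicator {..<s} t * g t)" for s
  have cg: "continuous_on UNIV g" by (rule test_functions_continuous[OF g])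
  have [measurable]: "g \<in> borel_measurable borel" by (rule continuous_on_UNIV_borel[OF cg])
  have out: "g t = 0" if "t \<le> \<alpha> \<or> \<beta> \<le> t" for t
    using that test_functionsD(3)[OF g] spt_not_in[of t g] by force
  have low: "G s = 0" if "s \<le> \<alpha>" for s
  proof -
    have *: "indicator {..<s} t * g t = 0" for t using out[of t] that by (auto simp: indicator_def)
    show ?thesis unfolding G_def * by simp
  qed
  have G: "G s = integral {0..s} g" if "0 \<le> s" for s
  proof -
    have cs: "continuous_on {0..s} g" using cg by (rule continuous_on_subset) simp
    have "G s = (LINT t|lborel. indicator {0..s} t *\<^sub>R g t)"
      unfolding G_def
    proof (rule integral_cong_AE)
      have "AE t in lborel. t \<noteq> s" by (rule AE_lborel_singleton)
      then show "AE t in lborel. indicator {..<s} t * g t = indicator {0..s} t *\<^sub>R g t"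
        by eventually_elim (use out \<alpha> in \<open>auto simp: indicator_def\<close>)
    qed auto
    also have "\<dots> = integral {0..s} g"
      using set_borel_integral_eq_integral(2)[OF borel_integrable_atLeastAtMost'[OF cs]] by (simp add: set_lebesgue_integral_def)
    finally show ?thesis .
  qed
  show ?thesis
  proof (cases "s < \<alpha>")
    case True
    have "((\<lambda>_. 0) has_real_derivative 0) (at s)" by simp
    then have "(G has_real_derivative 0) (at s)"
      by (rule has_field_derivative_transform_within_open[where S="{..<\<alpha>}"]) (use True low in auto)
    then show ?thesis using True out[of s] by (simp add: G_def[abs_def])
  next
    case False
    then have s: "0 < s" using \<alpha> by simp
    have "((\<lambda>u. integral {0..u} g) has_real_derivative g s) (at s within {0..s + 1})"
      using s by (intro integral_has_real_derivative continuous_on_subset[OF cg]) auto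
    then have "((\<lambda>u. integral {0..u} g) has_real_derivative g s) (at s)"
      using s by (subst (asm) at_within_interior) auto
    then have "(G has_real_derivative g s) (at s)"
      by (rule has_field_derivative_transform_within_open[where S="{0<..}"]) (use s G in auto)
    then show ?thesis by (simp add: G_def[abs_def])
  qed
qed

text \<open>The outer sphere sits at s = 1, so as a function of \<open>rad x\<close> this cutoff is
  1 near the closed annulus and makes a radial function vanish far out without changing it
  there.\<close>

lemma smooth_cutoff_exists:
  obtains \<rho> :: "real \<Rightarrow> real" where "\<And>k. C_k k \<rho>" "\<And>s. s \<le> 3 / 2 \<Longrightarrow> \<rho> s = 1" "\<And>s. 2 \<le> s \<Longrightarrow> \<rho> s = 0"
proof -
  define g :: "real \<Rightarrow> real" where "g = box_bump (3 / 2) 2"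
  have out: "g t = 0" if "t \<notin> {3/2<..<2}" for t
    using that box_bump_eq_0_iff[of "3/2" 2 t] by (simp add: g_def box_real)
  have pos: "0 < g t" if "t \<in> {3/2<..<2}" for t
    using that box_bump_pos_iff[of "3/2" 2 t] by (simp add: g_def box_real)
  have nonneg: "0 \<le> g t" for t unfolding g_def by (rule box_bump_bounds)
  have g: "g \<in> test_functions {1<..<3}"
    by (rule test_functions_boxI[of _ "3/2" 2]) (use out in \<open>auto simp: g_def C_k_box_bump box_real\<close>)
  define G where "G s = (LINT t|lborel. indicator {..<s} t * g t)" for s
  have der: "(G has_real_derivative g s) (at s)" for s
    unfolding G_def[abs_def] by (rule smooth_antiderivative[OF g]) simp
  have G0: "G s = 0" if "s \<le> 3/2" for s
  proof -
    have *: "indicator {..<s} t * g t = 0" for t using out[of t] that by (auto simp: indicator_def)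
    show ?thesis unfolding G_def * by simp
  qed
  have G2: "G s = G 2" if "2 \<le> s" for s
  proof -
    have *: "indicator {..<s} t * g t = indicator {..<2} t * g t" for t using out[of t] that by (auto simp: indicator_def)
    show ?thesis unfolding G_def * ..
  qed
  have "G (3/2) < G 2"
  proof (rule DERIV_pos_imp_increasing_open[of "3/2" 2 G])
    show "\<exists>y. (G has_real_derivative y) (at x) \<and> 0 < y" if "3/2 < x" "x < 2" for x
      using der pos that by auto
    show "continuous_on {3/2..2} G" using der by (meson DERIV_isCont continuous_at_imp_continuous_on)
  qed simp
  then have pos2: "0 < G 2" using G0 by simp
  have "C_k k G" for k using C_k_antiderivative[OF test_functionsD(1)[OF g] der] .
  then have ck: "C_k k (\<lambda>s. 1 - 1 / G 2 * G s)" for k by (intro C_k_minus C_k_const C_k_cmult)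
  show thesis
  proof (rule that[of "\<lambda>s. 1 - 1 / G 2 * G s", OF ck])
    show "1 - 1 / G 2 * G s = 1" if "s \<le> 3 / 2" for s using G0[OF that] by simp
    show "1 - 1 / G 2 * G s = 0" if "2 \<le> s" for s unfolding G2[OF that] using pos2 by simp
  qed
qed

context annulus_polar_coordinates
begin

lemma rad_has_derivative: "(rad has_derivative (\<lambda>y. (2 / R\<^sub>2\<^sup>2) * (x \<bullet> y))) (at x)"
proof -
  have "((\<lambda>x. (1 / R\<^sub>2\<^sup>2) * (x \<bullet> x)) has_derivative (\<lambda>y. (1 / R\<^sub>2\<^sup>2) * (x \<bullet> y + y \<bullet> x))) (at x)"
    by (intro has_derivative_mult_right has_derivative_inner has_derivative_ident)
  moreover have "rad = (\<lambda>x. (1 / R\<^sub>2\<^sup>2) * (x \<bullet> x))" by (simp add: rad_def fun_eq_iff power2_norm_eq_inner)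
  moreover have "(\<lambda>y. (1 / R\<^sub>2\<^sup>2) * (x \<bullet> y + y \<bullet> x)) = (\<lambda>y. (2 / R\<^sub>2\<^sup>2) * (x \<bullet> y))"
    by (simp add: fun_eq_iff inner_commute[of _ x])
  ultimately show ?thesis by simp
qed

lemma C_k_rad: "C_k k rad"
proof -
  have "rad = (\<lambda>x. (1 / R\<^sub>2\<^sup>2) * (x \<bullet> x))" by (simp add: rad_def fun_eq_iff power2_norm_eq_inner)
  moreover have "C_k k (\<lambda>x. (1 / R\<^sub>2\<^sup>2) * (x \<bullet> x))" by (intro C_k_cmult C_k_inner_self)
  ultimately show ?thesis by (simp only:)
qed

lemma radial_has_derivative:
  assumes "(\<xi> has_real_derivative d) (at (rad x))"
  shows "((\<lambda>x. \<xi> (rad x)) has_derivative (\<lambda>y. ((2 * d / R\<^sub>2\<^sup>2) *\<^sub>R x) \<bullet> y)) (at x)"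
proof -
  have "((\<lambda>x. \<xi> (rad x)) has_derivative (\<lambda>y. d * ((2 / R\<^sub>2\<^sup>2) * (x \<bullet> y)))) (at x)"
    by (rule has_derivative_compose[OF rad_has_derivative assms[unfolded has_field_derivative_def]])
  moreover have "(\<lambda>y. d * ((2 / R\<^sub>2\<^sup>2) * (x \<bullet> y))) = (\<lambda>y. ((2 * d / R\<^sub>2\<^sup>2) *\<^sub>R x) \<bullet> y)" by (simp add: fun_eq_iff)
  ultimately show ?thesis by simp
qed

lemma gradient_radial:
  assumes "(\<xi> has_real_derivative d) (at (rad x))"
  shows "gradient (\<lambda>x. \<xi> (rad x)) x = (2 * d / R\<^sub>2\<^sup>2) *\<^sub>R x"
  by (rule gradient_eqI[OF radial_has_derivative[OF assms]])

lemma rad_sphere_R1: "norm x = R\<^sub>1 \<Longrightarrow> rad x = a"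
  by (simp add: rad_def a_def power_divide)

lemma A_rad_iff: "x \<in> A \<longleftrightarrow> a < rad x \<and> rad x < 1"
proof -
  have "R\<^sub>1 < norm x \<longleftrightarrow> R\<^sub>1\<^sup>2 < (norm x)\<^sup>2"
    using R1 power2_less_imp_less[of R\<^sub>1 "norm x"] power_strict_mono[of R\<^sub>1 "norm x" 2] by auto
  moreover have "norm x < R\<^sub>2 \<longleftrightarrow> (norm x)\<^sup>2 < R\<^sub>2\<^sup>2"
    using R2 power2_less_imp_less[of "norm x" R\<^sub>2] power_strict_mono[of "norm x" R\<^sub>2 2] by auto
  ultimately show ?thesis
    using R2 by (simp add: A_def annulus_iff rad_def a_def power_divide divide_strict_right_mono divide_less_cancel)
qed

text \<open>Vanishing below some b > a keeps the support off the inner sphere, and vanishing above 2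
  makes it compact.\<close>

lemma radial_test:
  assumes \<xi>: "\<And>k. C_k k \<xi>" "\<And>s. s < b \<Longrightarrow> \<xi> s = 0" "\<And>s. 2 < s \<Longrightarrow> \<xi> s = 0" and b: "a < b"
  shows "(\<lambda>x. \<xi> (rad x)) \<in> test_functions UNIV" "spt (\<lambda>x. \<xi> (rad x)) \<inter> sphere 0 R\<^sub>1 = {}"
proof -
  have sub: "spt (\<lambda>x. \<xi> (rad x)) \<subseteq> {x. b \<le> rad x \<and> rad x \<le> 2}"
    unfolding spt_def
  proof (rule closure_minimal)
    show "closed {x. b \<le> rad x \<and> rad x \<le> 2}"
      by (intro closed_Collect_conj closed_Collect_le continuous_on_rad continuous_on_const)
    show "{x. \<xi> (rad x) \<noteq> 0} \<subseteq> {x. b \<le> rad x \<and> rad x \<le> 2}" using \<xi>(2,3) by (auto simp: not_less[symmetric])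
  qed
  have "spt (\<lambda>x. \<xi> (rad x)) \<subseteq> cball 0 (2 * R\<^sub>2)"
  proof
    fix x assume "x \<in> spt (\<lambda>x. \<xi> (rad x))"
    then have "rad x \<le> 2" using sub by blast
    then have "(norm x)\<^sup>2 \<le> 2 * R\<^sub>2\<^sup>2" using R2 by (simp add: rad_def pos_divide_le_eq)
    moreover have "(2 * R\<^sub>2)\<^sup>2 = 4 * R\<^sub>2\<^sup>2" by (simp add: power2_eq_square)
    moreover have "0 \<le> R\<^sub>2\<^sup>2" by simp
    ultimately have "(norm x)\<^sup>2 \<le> (2 * R\<^sub>2)\<^sup>2" by linarith
    then have "norm x \<le> 2 * R\<^sub>2" by (rule power2_le_imp_le) (use R2 in simp)
    then show "x \<in> cball 0 (2 * R\<^sub>2)" by simp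
  qed
  then have "bounded (spt (\<lambda>x. \<xi> (rad x)))" by (rule bounded_subset[OF bounded_cball])
  then have "compact (spt (\<lambda>x. \<xi> (rad x)))" unfolding compact_eq_bounded_closed by (intro conjI closed_spt)
  then show "(\<lambda>x. \<xi> (rad x)) \<in> test_functions UNIV"
    unfolding test_functions_def using C_k_compose[OF \<xi>(1) C_k_rad] by auto
  show "spt (\<lambda>x. \<xi> (rad x)) \<inter> sphere 0 R\<^sub>1 = {}" using sub b rad_sphere_R1 by fastforce
qed

end

text \<open>The approximating sequence is fixed together with \<open>v\<close>, because the
  Dirichlet condition is encoded in the supports of its members.\<close>

locale robin_solution = annulus_polar_coordinates R\<^sub>1 R\<^sub>2 c a A H L n
  for R\<^sub>1 R\<^sub>2 c a :: real and A :: "(real ^ 'n) set" and H L n +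
  fixes \<beta> lam :: real and v :: "real ^ 'n \<Rightarrow> real" and f :: "nat \<Rightarrow> real ^ 'n \<Rightarrow> real"
  assumes \<beta>: "0 < \<beta>" and v_H1: "v \<in> H1 A"
    and f_test: "\<And>k. f k \<in> test_functions UNIV" and f_spt: "\<And>k. spt (f k) \<inter> sphere 0 R\<^sub>1 = {}"
    and f_lim: "(\<lambda>k. H1_norm A (\<lambda>x. f k x - v x)) \<longlonglongrightarrow> 0"
    and eigen: "\<And>\<phi>. \<phi> \<in> H1_vanishing (sphere 0 R\<^sub>1) A \<Longrightarrow> robin_form \<beta> R\<^sub>1 R\<^sub>2 v \<phi> = lam * L2_form R\<^sub>1 R\<^sub>2 v \<phi>"
    and v_pos: "AE x in lebesgue_on A. 0 < v x"
begin

text \<open>The total trace on the outer sphere; it fixes the value and the flux of the profile at s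
  = 1.\<close>

definition \<tau> :: real where "\<tau> = (LINT \<omega>|H. tr v \<omega>)"

lemma f_tendsto: "L2_tendsto (lebesgue_on A) f v" "L2_tendsto (lebesgue_on A) (\<lambda>k. gradient (f k)) (weak_gradient A v)"
    "L2_tendsto H f (tr v)"
  using trace_tendsto[OF v_H1 f_test f_lim] by auto

lemma f_integral_H: "(\<lambda>k. LINT \<omega>|H. f k \<omega>) \<longlonglongrightarrow> \<tau>"
  unfolding \<tau>_def by (rule L2_tendsto_imp_integral_tendsto[OF H.finite_measure_axioms f_tendsto(3)])

lemma f_integral_A:
  assumes "continuous_on UNIV q"
  shows "(\<lambda>k. LINT x|lebesgue_on A. q x * f k x) \<longlonglongrightarrow> (LINT x|lebesgue_on A. q x * v x)"
  using L2_tendsto_inner[OF L2_tendsto_const[OF L2_continuous_A[OF assms]] f_tendsto(1)] by simp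

section \<open>The weak equation tested with radial functions\<close>

text \<open>For a radial test function the gradient is k(rad x) x with
  \<open>k s = 2 / R\<^sub>2\<^sup>2 * \<xi>1 s\<close>, so the divergence theorem moves the
  derivative off \<open>f j\<close>. In the limit only \<open>v\<close> and its total trace remain.
  The equation is multiplied by \<open>R\<^sub>2\<^sup>2\<close> at the end.\<close>

lemma weak_radial_equation:
  assumes \<xi>: "\<And>k. C_k k \<xi>" "\<And>s. s < b \<Longrightarrow> \<xi> s = 0" "\<And>s. 2 < s \<Longrightarrow> \<xi> s = 0" and b: "a < b"
    and der: "\<And>s. (\<xi> has_real_derivative \<xi>1 s) (at s)" "\<And>s. (\<xi>1 has_real_derivative \<xi>2 s) (at s)" "continuous_on UNIV \<xi>2"
  shows "(4 * c * \<xi>1 1 + \<beta> * R\<^sub>2\<^sup>2 * \<xi> 1) * \<tau> =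
    (LINT x|lebesgue_on A. (2 * n * \<xi>1 (rad x) + 4 * rad x * \<xi>2 (rad x) + lam * R\<^sub>2\<^sup>2 * \<xi> (rad x)) * v x)"
proof -
  define \<Psi> where "\<Psi> x = \<xi> (rad x)" for x
  have test1: "\<Psi> \<in> test_functions UNIV" unfolding \<Psi>_def[abs_def] by (rule radial_test(1)[OF \<xi> b])
  have test2: "spt \<Psi> \<inter> sphere 0 R\<^sub>1 = {}" unfolding \<Psi>_def[abs_def] by (rule radial_test(2)[OF \<xi> b])
  note test = test1 test2
  have \<Psi>: "\<Psi> \<in> H1_vanishing (sphere 0 R\<^sub>1) A" by (rule H1_vanishing_test[OF A_open A_bounded test])
  have \<Psi>H1: "\<Psi> \<in> H1 A" using \<Psi> by (simp add: H1_vanishing_def)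
  have \<Psi>lim: "(\<lambda>k::nat. H1_norm A (\<lambda>x. \<Psi> x - \<Psi> x)) \<longlonglongrightarrow> 0" by (simp add: H1_norm_zero A_open A_bounded)
  define k k' where "k s = 2 / R\<^sub>2\<^sup>2 * \<xi>1 s" and "k' s = 2 / R\<^sub>2\<^sup>2 * \<xi>2 s" for s
  have c\<xi>: "continuous_on UNIV \<xi>" "continuous_on UNIV \<xi>1"
    using der(1,2) by (meson DERIV_isCont continuous_at_imp_continuous_on)+
  have ck: "continuous_on UNIV k" "continuous_on UNIV k'"
    unfolding k_def[abs_def] k'_def[abs_def] using c\<xi> der(3) R2 by (auto intro!: continuous_intros)
  have dk: "(k has_real_derivative k' s) (at s within {a..1})" for s
    unfolding k_def[abs_def] k'_def using der(2) by (intro DERIV_cmult) (rule has_field_derivative_at_within)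
  have grad: "gradient \<Psi> x = k (rad x) *\<^sub>R x" for x
    unfolding \<Psi>_def[abs_def] k_def using gradient_radial[OF der(1)] by simp
  have "\<xi>1 a = 0"
  proof -
    have "(\<xi> has_real_derivative 0) (at a)"
      by (rule has_field_derivative_transform_within_open[of "\<lambda>_. 0" 0 a "{..<b}"]) (use b \<xi>(2) in auto)
    then show ?thesis using der(1)[of a] DERIV_unique by blast
  qed
  then have ka: "k a = 0" by (simp add: k_def)
  define q where "q x = n * k (rad x) + 2 * rad x * k' (rad x)" for x
  have cq: "continuous_on UNIV q" and c\<Psi>: "continuous_on UNIV \<Psi>"
    unfolding q_def[abs_def] \<Psi>_def[abs_def]
    by (intro continuous_intros continuous_on_rad continuous_on_compose2[OF ck(1) continuous_on_rad]
        continuous_on_compose2[OF ck(2) continuous_on_rad] continuous_on_compose2[OF c\<xi>(1) continuous_on_rad]; simp)+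
  have id: "(LINT x|lebesgue_on A. gradient (f j) x \<bullet> gradient \<Psi> x) + \<beta> * (LINT \<omega>|H. f j \<omega> * \<Psi> \<omega>) =
    (2 * c * k 1 + \<beta> * \<xi> 1) * (LINT \<omega>|H. f j \<omega>) - (LINT x|lebesgue_on A. q x * f j x)" for j
  proof -
    have cf: "continuous_on UNIV (f j)" "continuous_on UNIV (gradient (f j))"
      using f_test test_functions_continuous test_functions_continuous_gradient by blast+
    have i1: "integrable (lebesgue_on A) (\<lambda>x. q x * f j x)" "integrable (lebesgue_on A) (\<lambda>x. k (rad x) * (gradient (f j) x \<bullet> x))"
      by (intro integrable_continuous_A continuous_intros cq cf continuous_on_compose2[OF ck(1) continuous_on_rad]; simp)+
    have "(LINT x|lebesgue_on A. q x * f j x + k (rad x) * (gradient (f j) x \<bullet> x)) =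
      2 * c * (k 1 * (LINT \<omega>|H. f j \<omega>) - a powr (n / 2) * k a * (LINT \<omega>|H. f j (sqrt a *\<^sub>R \<omega>)))"
      unfolding q_def
      by (rule radial_identity[OF test_functions_differentiable[OF f_test] cf(2) ck dk]) (use a_bounds in auto)
    then have "(LINT x|lebesgue_on A. q x * f j x) + (LINT x|lebesgue_on A. k (rad x) * (gradient (f j) x \<bullet> x)) = 2 * c * k 1 * (LINT \<omega>|H. f j \<omega>)"
      using i1 by (simp add: ka)
    moreover have "(LINT \<omega>|H. f j \<omega> * \<Psi> \<omega>) = (LINT \<omega>|H. \<xi> 1 * f j \<omega>)"
    proof (rule integral_cong_AE)
      show "(\<lambda>\<omega>. f j \<omega> * \<Psi> \<omega>) \<in> borel_measurable H" "(\<lambda>\<omega>. \<xi> 1 * f j \<omega>) \<in> borel_measurable H"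
        by (intro borel_measurable_integrable integrable_continuous_H continuous_intros cf c\<Psi>)+
      show "AE \<omega> in H. f j \<omega> * \<Psi> \<omega> = \<xi> 1 * f j \<omega>"
        using AE_H by eventually_elim (use R2 in \<open>simp add: \<Psi>_def rad_def\<close>)
    qed
    ultimately show ?thesis by (simp add: grad algebra_simps)
  qed
  have "(\<lambda>j. (LINT x|lebesgue_on A. gradient (f j) x \<bullet> gradient \<Psi> x) + \<beta> * (LINT \<omega>|H. f j \<omega> * \<Psi> \<omega>)) \<longlonglongrightarrow> robin_form \<beta> R\<^sub>1 R\<^sub>2 v \<Psi>"
    by (rule robin_form_tendsto(1)[OF v_H1 f_test f_lim \<Psi>H1 test(1) \<Psi>lim])
  moreover have "(\<lambda>j. (2 * c * k 1 + \<beta> * \<xi> 1) * (LINT \<omega>|H. f j \<omega>) - (LINT x|lebesgue_on A. q x * f j x)) \<longlonglongrightarrow>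
    (2 * c * k 1 + \<beta> * \<xi> 1) * \<tau> - (LINT x|lebesgue_on A. q x * v x)"
    by (intro tendsto_intros f_integral_H f_integral_A cq)
  ultimately have "robin_form \<beta> R\<^sub>1 R\<^sub>2 v \<Psi> = (2 * c * k 1 + \<beta> * \<xi> 1) * \<tau> - (LINT x|lebesgue_on A. q x * v x)"
    unfolding id by (rule LIMSEQ_unique)
  moreover have "L2_form R\<^sub>1 R\<^sub>2 v \<Psi> = (LINT x|lebesgue_on A. \<Psi> x * v x)"
    by (simp add: L2_form_def A_def mult.commute)
  ultimately have "(2 * c * k 1 + \<beta> * \<xi> 1) * \<tau> = (LINT x|lebesgue_on A. q x * v x) + lam * (LINT x|lebesgue_on A. \<Psi> x * v x)"
    using eigen[OF \<Psi>] by simp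
  moreover have "integrable (lebesgue_on A) (\<lambda>x. q x * v x)" "integrable (lebesgue_on A) (\<lambda>x. \<Psi> x * v x)"
    using integrable_L2_inner[of "lebesgue_on A" _ v] L2_continuous_A[OF cq] L2_continuous_A[OF c\<Psi>] v_H1 by (force simp: H1_def)+
  ultimately have eq: "(2 * c * k 1 + \<beta> * \<xi> 1) * \<tau> = (LINT x|lebesgue_on A. (q x + lam * \<Psi> x) * v x)"
    by (simp add: distrib_right mult.assoc)
  have "R\<^sub>2\<^sup>2 * ((2 * c * k 1 + \<beta> * \<xi> 1) * \<tau>) = (LINT x|lebesgue_on A. R\<^sub>2\<^sup>2 * ((q x + lam * \<Psi> x) * v x))"
    unfolding eq by simp
  also have "(\<lambda>x. R\<^sub>2\<^sup>2 * ((q x + lam * \<Psi> x) * v x)) = (\<lambda>x. (2 * n * \<xi>1 (rad x) + 4 * rad x * \<xi>2 (rad x) + lam * R\<^sub>2\<^sup>2 * \<xi> (rad x)) * v x)"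
    using R2 by (simp add: fun_eq_iff q_def k_def k'_def \<Psi>_def field_simps)
  also have "R\<^sub>2\<^sup>2 * ((2 * c * k 1 + \<beta> * \<xi> 1) * \<tau>) = (4 * c * \<xi>1 1 + \<beta> * R\<^sub>2\<^sup>2 * \<xi> 1) * \<tau>"
    using R2 by (simp add: k_def field_simps)
  finally show ?thesis .
qed

text \<open>\<open>p\<close> is the density of the image under \<open>rad\<close> of the measure
  with density \<open>v\<close>, obtained by integrating over spheres first. At this stage it is
  merely integrable.\<close>

lemma radial_density:
  obtains p where "integrable lborel p" "\<And>s. s \<notin> {a<..<1} \<Longrightarrow> p s = 0"
    "\<And>q B. q \<in> borel_measurable borel \<Longrightarrow> (\<And>s. \<bar>q s\<bar> \<le> B) \<Longrightarrow>
      (LINT x|lebesgue_on A. q (rad x) * v x) = (LINT s|lborel. q s * p s)"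
proof -
  have L2v: "L2 (lebesgue_on A) v" using v_H1 by (simp add: H1_def)
  obtain u where u: "u \<in> borel_measurable borel" "AE x in lebesgue_on A. v x = u x"
    using borel_representative_L2_tendsto[OF L2v] by blast
  have iv: "integrable (lebesgue_on A) v" by (rule finite_measure.L2_imp_integrable[OF finite_measure_A L2v])
  have iu: "integrable (lebesgue_on A) u"
    by (rule integrable_cong_AE_imp[OF iv borel_imp_measurable_A[OF u(1)] u(2)])
  define p0 where "p0 s = (LINT \<omega>|H. u (sqrt s *\<^sub>R \<omega>))" for s
  have ip0: "integrable L p0" unfolding p0_def[abs_def] by (rule integral_A(5)[OF u(1) iu])
  then have mp0: "p0 \<in> borel_measurable borel" by (simp add: borel_measurable_integrable cong: measurable_cong_sets)
  define p where "p s = indicator {a<..<1} s * (c * s powr (n / 2 - 1) * p0 s)" for s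
  show thesis
  proof (rule that[of p])
    have "integrable L p0 \<longleftrightarrow> integrable lborel (\<lambda>s. (indicator {a<..<1} s * (c * s powr (n / 2 - 1))) *\<^sub>R p0 s)"
      unfolding L_def annulus_law_def n_def using c mp0 by (intro integrable_density) (auto simp: indicator_def)
    then show "integrable lborel p" using ip0 by (simp add: p_def[abs_def] mult.assoc)
    show "p s = 0" if "s \<notin> {a<..<1}" for s using that by (simp add: p_def)
    fix q :: "real \<Rightarrow> real" and B assume q: "q \<in> borel_measurable borel" "\<And>s. \<bar>q s\<bar> \<le> B"
    have mq: "(\<lambda>x. q (rad x)) \<in> borel_measurable borel"
      using measurable_compose[OF borel_measurable_continuous_onI[OF continuous_on_rad] q(1)] .
    have mqu: "(\<lambda>x. q (rad x) * u x) \<in> borel_measurable borel" using mq u(1) by measurable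
    have iqu: "integrable (lebesgue_on A) (\<lambda>x. q (rad x) * u x)"
    proof (rule Bochner_Integration.integrable_bound[of _ "\<lambda>x. B * norm (u x)"])
      show "AE x in lebesgue_on A. norm (q (rad x) * u x) \<le> norm (B * norm (u x))"
        using q(2) by (intro AE_I2) (simp add: abs_mult, meson abs_ge_self abs_ge_zero mult_right_mono order_trans)
    qed (use iu borel_imp_measurable_A[OF mqu] in auto)
    have "(LINT x|lebesgue_on A. q (rad x) * v x) = (LINT x|lebesgue_on A. q (rad x) * u x)"
    proof (rule integral_cong_AE)
      show "(\<lambda>x. q (rad x) * v x) \<in> borel_measurable (lebesgue_on A)"
        using borel_imp_measurable_A[OF mq] L2_measurable[OF L2v] by (rule borel_measurable_times)
      show "AE x in lebesgue_on A. q (rad x) * v x = q (rad x) * u x" using u(2) by eventually_elim simp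
    qed (use borel_imp_measurable_A[OF mqu] in auto)
    also have "\<dots> = (LINT s|L. LINT \<omega>|H. q (rad (sqrt s *\<^sub>R \<omega>)) * u (sqrt s *\<^sub>R \<omega>))"
      by (rule integral_A(4)[OF mqu iqu])
    also have "\<dots> = (LINT s|L. q s * p0 s)"
    proof (rule integral_cong_AE)
      show "(\<lambda>s. LINT \<omega>|H. q (rad (sqrt s *\<^sub>R \<omega>)) * u (sqrt s *\<^sub>R \<omega>)) \<in> borel_measurable L"
        using integral_A(5)[OF mqu iqu] by simp
      show "(\<lambda>s. q s * p0 s) \<in> borel_measurable L" using q(1) mp0 by (simp cong: measurable_cong_sets)
      show "AE s in L. (LINT \<omega>|H. q (rad (sqrt s *\<^sub>R \<omega>)) * u (sqrt s *\<^sub>R \<omega>)) = q s * p0 s"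
        using AE_L
      proof eventually_elim
        case (elim s)
        have mus: "(\<lambda>\<omega>. u (sqrt s *\<^sub>R \<omega>)) \<in> borel_measurable H"
          using measurable_compose[OF _ u(1), of "\<lambda>\<omega>. sqrt s *\<^sub>R \<omega>" borel] by (simp cong: measurable_cong_sets)
        have mqs: "(\<lambda>\<omega>. q (rad (sqrt s *\<^sub>R \<omega>)) * u (sqrt s *\<^sub>R \<omega>)) \<in> borel_measurable H"
          using measurable_compose[OF _ mqu, of "\<lambda>\<omega>. sqrt s *\<^sub>R \<omega>" borel] by (simp cong: measurable_cong_sets)
        have "(LINT \<omega>|H. q (rad (sqrt s *\<^sub>R \<omega>)) * u (sqrt s *\<^sub>R \<omega>)) = (LINT \<omega>|H. q s * u (sqrt s *\<^sub>R \<omega>))"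
        proof (rule integral_cong_AE[OF mqs])
          show "AE \<omega> in H. q (rad (sqrt s *\<^sub>R \<omega>)) * u (sqrt s *\<^sub>R \<omega>) = q s * u (sqrt s *\<^sub>R \<omega>)"
            using AE_H
          proof eventually_elim
            case (elim \<omega>)
            then have "rad (sqrt s *\<^sub>R \<omega>) = s" using \<open>s \<in> {a<..<1}\<close> a_bounds by (intro rad_polar) auto
            then show ?case by simp
          qed
        qed (use mus in auto)
        then show ?case by (simp add: p0_def)
      qed
    qed
    also have "\<dots> = (LINT s|lborel. indicator {a<..<1} s * (c * s powr (n / 2 - 1) * (q s * p0 s)))"
      using q(1) mp0 by (intro integral_L) measurable
    also have "\<dots> = (LINT s|lborel. q s * p s)"
      by (intro Bochner_Integration.integral_cong) (auto simp: p_def)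
    finally show "(LINT x|lebesgue_on A. q (rad x) * v x) = (LINT s|lborel. q s * p s)" .
  qed
qed

section \<open>From tested equations to an integral equation and its profile\<close>

abbreviation "\<Lambda> \<equiv> lam * R\<^sub>2\<^sup>2"
abbreviation "\<beta>\<^sub>R \<equiv> \<beta> * R\<^sub>2\<^sup>2"

text \<open>The transpose of taking antiderivatives: if G1 and G2 are the first and second
  antiderivatives of g, then integrating (2 n G1 + \<Lambda> G2) p is the same as integrating g
  against this function.\<close>

definition kernel :: "(real \<Rightarrow> real) \<Rightarrow> real \<Rightarrow> real" where
  "kernel p t = (LINT s|lborel. (if t < s then (2 * n + \<Lambda> * (s - t)) * p s else 0))"

lemma test_function_support_bound:
  fixes g :: "real \<Rightarrow> real"
  assumes g: "g \<in> test_functions {a<..<1}"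
  obtains b where "a < b" "\<And>t. t < b \<Longrightarrow> g t = 0"
proof (cases "spt g = {}")
  case True
  then have "g t = 0" for t by (intro spt_not_in) auto
  then show thesis using that[of 1] a_bounds by simp
next
  case False
  then obtain b where b: "b \<in> spt g" "\<And>t. t \<in> spt g \<Longrightarrow> b \<le> t"
    using compact_attains_inf[OF test_functionsD(2)[OF g]] by blast
  have "a < b" using b(1) test_functionsD(3)[OF g] by auto
  moreover have "g t = 0" if "t < b" for t using b(2)[of t] that by (intro spt_not_in) auto
  ultimately show thesis by (rule that)
qed

text \<open>Testing with the function of \<open>rad x\<close> whose second derivative is a given bump turns the
  weak equation into an integral equation, which gives the regularity of the spherical means.\<close>

lemma tested_equation:
  assumes p: "integrable lborel p" "\<And>s. s \<notin> {a<..<1} \<Longrightarrow> p s = 0"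
    "\<And>q B. q \<in> borel_measurable borel \<Longrightarrow> (\<And>s. \<bar>q s\<bar> \<le> B) \<Longrightarrow>
      (LINT x|lebesgue_on A. q (rad x) * v x) = (LINT s|lborel. q s * p s)"
    and g: "g \<in> test_functions {a<..<1}"
  defines "G1 \<equiv> \<lambda>s. LINT t|lborel. indicator {..<s} t * g t"
    and "G2 \<equiv> \<lambda>s. s * (LINT t|lborel. indicator {..<s} t * g t) - (LINT t|lborel. indicator {..<s} t * (t * g t))"
  shows "(4 * c * G1 1 + \<beta>\<^sub>R * G2 1) * \<tau> = (LINT s|lborel. (2 * n * G1 s + 4 * s * g s + \<Lambda> * G2 s) * p s)"
proof -
  obtain b where b: "a < b" "\<And>t. t < b \<Longrightarrow> g t = 0" using test_function_support_bound[OF g] by blast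
  obtain \<rho> :: "real \<Rightarrow> real" where \<rho>: "\<And>k. C_k k \<rho>" "\<And>s. s \<le> 3 / 2 \<Longrightarrow> \<rho> s = 1" "\<And>s. 2 \<le> s \<Longrightarrow> \<rho> s = 0"
    by (rule smooth_cutoff_exists) blast
  have tg: "(\<lambda>t. t * g t) \<in> test_functions {a<..<1}"
  proof (rule test_functions_mult'[OF g])
    show "C_k k (\<lambda>t::real. t)" for k using C_k_inner[of k "1::real"] by (simp only: inner_real_def mult_1_right)
  qed
  have d1: "(G1 has_real_derivative g s) (at s)" for s
    unfolding G1_def by (rule smooth_antiderivative[OF g a_bounds(1)])
  \<comment> \<open>\<open>G2 s\<close> is the integral of (s - t) g(t) over t < s, with the factor
    \<open>s\<close> taken outside; on differentiation the two terms containing g(s) cancel.\<close>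
  have d2: "(G2 has_real_derivative G1 s) (at s)" for s
  proof -
    have "(G2 has_real_derivative (1 * G1 s + g s * s) - s * g s) (at s)"
      unfolding G2_def using DERIV_diff[OF DERIV_mult[OF DERIV_ident d1] smooth_antiderivative[OF tg a_bounds(1)]]
      by (simp add: G1_def)
    then show ?thesis by (simp add: mult.commute)
  qed
  have cg: "C_k k g" for k by (rule test_functionsD(1)[OF g])
  have cG1: "C_k k G1" for k by (rule C_k_antiderivative[OF cg d1])
  have cG2: "C_k k G2" for k by (rule C_k_antiderivative[OF cG1 d2])
  define \<rho>1 \<rho>2 where "\<rho>1 = gradient \<rho>" and "\<rho>2 = gradient \<rho>1"
  have d\<rho>: "(\<rho> has_real_derivative \<rho>1 s) (at s)" for s unfolding \<rho>1_def using C_k_real_SucD(1)[OF \<rho>(1)] .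
  have c\<rho>1: "C_k k \<rho>1" for k unfolding \<rho>1_def using C_k_real_SucD(2)[OF \<rho>(1)] .
  have d\<rho>1: "(\<rho>1 has_real_derivative \<rho>2 s) (at s)" for s unfolding \<rho>2_def using C_k_real_SucD(1)[OF c\<rho>1] .
  have c\<rho>2: "C_k k \<rho>2" for k unfolding \<rho>2_def using C_k_real_SucD(2)[OF c\<rho>1] .
  have \<rho>1_0: "\<rho>1 s = 0" if "s < 3/2" for s
  proof -
    have "(\<rho> has_real_derivative 0) (at s)"
      by (rule has_field_derivative_transform_within_open[of "\<lambda>_. 1" 0 s "{..<3/2}"]) (use that \<rho>(2) in auto)
    then show ?thesis using DERIV_unique[OF d\<rho>] by blast
  qed
  have \<rho>2_0: "\<rho>2 s = 0" if "s < 3/2" for s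
  proof -
    have "(\<rho>1 has_real_derivative 0) (at s)"
      by (rule has_field_derivative_transform_within_open[of "\<lambda>_. 0" 0 s "{..<3/2}"]) (use that \<rho>1_0 in auto)
    then show ?thesis using DERIV_unique[OF d\<rho>1] by blast
  qed
  \<comment> \<open>The antiderivatives of a bump need not have compact support, so they are
    multiplied by a cutoff that is 1 for s \<le> 3/2.\<close>
  define \<xi> \<xi>1 \<xi>2 where "\<xi> s = G2 s * \<rho> s" and "\<xi>1 s = G1 s * \<rho> s + \<rho>1 s * G2 s"
    and "\<xi>2 s = (g s * \<rho> s + \<rho>1 s * G1 s) + (\<rho>2 s * G2 s + G1 s * \<rho>1 s)" for s
  have c\<xi>: "C_k k \<xi>" for k unfolding \<xi>_def[abs_def] by (intro C_k_mult cG2 \<rho>(1))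
  have low: "G2 s = 0" if "s < b" for s
  proof -
    have *: "indicator {..<s} t * g t = 0" "indicator {..<s} t * (t * g t) = 0" for t
      using b(2)[of t] that by (auto simp: indicator_def)
    show ?thesis unfolding G2_def * by simp
  qed
  have d\<xi>: "(\<xi> has_real_derivative \<xi>1 s) (at s)" "(\<xi>1 has_real_derivative \<xi>2 s) (at s)" for s
    unfolding \<xi>_def[abs_def] \<xi>1_def[abs_def] \<xi>2_def
    using DERIV_mult[OF d2 d\<rho>] DERIV_add[OF DERIV_mult[OF d1 d\<rho>] DERIV_mult[OF d\<rho>1 d2]] by blast+
  have c\<xi>2: "continuous_on UNIV \<xi>2"
    unfolding \<xi>2_def[abs_def]
    by (intro continuous_intros C_k_continuous[OF cg] C_k_continuous[OF \<rho>(1)] C_k_continuous[OF c\<rho>1] C_k_continuous[OF cG1]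
        C_k_continuous[OF c\<rho>2] C_k_continuous[OF cG2])
  have eq: "(4 * c * \<xi>1 1 + \<beta> * R\<^sub>2\<^sup>2 * \<xi> 1) * \<tau> =
    (LINT x|lebesgue_on A. (2 * n * \<xi>1 (rad x) + 4 * rad x * \<xi>2 (rad x) + lam * R\<^sub>2\<^sup>2 * \<xi> (rad x)) * v x)"
    by (rule weak_radial_equation[OF c\<xi> _ _ b(1) d\<xi> c\<xi>2]) (auto simp: \<xi>_def low \<rho>(3))
  have small: "\<xi> s = G2 s" "\<xi>1 s = G1 s" "\<xi>2 s = g s" if "s \<le> 1" for s
    using that \<rho>(2)[of s] \<rho>1_0[of s] \<rho>2_0[of s] by (auto simp: \<xi>_def \<xi>1_def \<xi>2_def)
  define q0 where "q0 s = 2 * n * G1 s + 4 * s * g s + \<Lambda> * G2 s" for s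
  have cq0: "continuous_on UNIV q0"
    unfolding q0_def[abs_def] by (intro continuous_intros C_k_continuous[OF cg] C_k_continuous[OF cG1] C_k_continuous[OF cG2])
  \<comment> \<open>Restricted to (a, 1), where \<open>p\<close> lives, to obtain the global bound
    asked for in the representation of radial integrals.\<close>
  define q where "q s = indicator {a<..<1} s * q0 s" for s
  have "compact (q0 ` {a..1})" by (intro compact_continuous_image continuous_on_subset[OF cq0]) auto
  then obtain B where B: "\<And>y. y \<in> q0 ` {a..1} \<Longrightarrow> norm y \<le> B" "0 < B" using compact_imp_bounded bounded_pos by metis
  have qB: "\<bar>q s\<bar> \<le> B" for s
    using B(1)[of "q0 s"] B(2) by (cases "s \<in> {a<..<1}") (auto simp: q_def)
  have mq: "q \<in> borel_measurable borel"
    unfolding q_def[abs_def] using borel_measurable_continuous_onI[OF cq0] by measurable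
  have "(LINT x|lebesgue_on A. (2 * n * \<xi>1 (rad x) + 4 * rad x * \<xi>2 (rad x) + lam * R\<^sub>2\<^sup>2 * \<xi> (rad x)) * v x) =
    (LINT x|lebesgue_on A. q (rad x) * v x)"
  proof (rule Bochner_Integration.integral_cong[OF refl])
    fix x assume "x \<in> space (lebesgue_on A)"
    then have "a < rad x" "rad x < 1" using A_rad_iff[of x] by auto
    then show "(2 * n * \<xi>1 (rad x) + 4 * rad x * \<xi>2 (rad x) + lam * R\<^sub>2\<^sup>2 * \<xi> (rad x)) * v x = q (rad x) * v x"
      by (simp add: q_def q0_def small)
  qed
  also have "\<dots> = (LINT s|lborel. q s * p s)" by (rule p(3)[OF mq qB])
  also have "\<dots> = (LINT s|lborel. q0 s * p s)"
  proof (rule Bochner_Integration.integral_cong[OF refl])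
    show "q s * p s = q0 s * p s" for s using p(2)[of s] by (cases "s \<in> {a<..<1}") (auto simp: q_def)
  qed
  finally show ?thesis using eq small[of 1] unfolding q0_def by simp
qed

text \<open>Fubini turns the tested equation into one in which \<open>g\<close> multiplies a
  function of t on both sides, and the fundamental lemma identifies these functions. The boundary
  factor arises from G1(1), the integral of g, and G2(1), the integral of (1 - t) g.\<close>

lemma integral_equation_AE:
  assumes p: "integrable lborel p" "\<And>s. s \<notin> {a<..<1} \<Longrightarrow> p s = 0"
    "\<And>q B. q \<in> borel_measurable borel \<Longrightarrow> (\<And>s. \<bar>q s\<bar> \<le> B) \<Longrightarrow>
      (LINT x|lebesgue_on A. q (rad x) * v x) = (LINT s|lborel. q s * p s)"
  shows "AE t in lborel. t \<in> {a<..<1} \<longrightarrow> 4 * t * p t = (4 * c + \<beta>\<^sub>R * (1 - t)) * \<tau> - kernel p t"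
proof -
  have [measurable]: "p \<in> borel_measurable borel" using p(1) by auto
  define K where "K = 2 * n + \<bar>\<Lambda>\<bar>"
  have K: "\<bar>2 * n + \<Lambda> * (s - t)\<bar> \<le> K" if "s \<in> {a<..<1}" "t \<in> {a<..<1}" for s t
  proof -
    have "\<bar>s - t\<bar> \<le> 1" using that a_bounds by auto
    then have "\<bar>\<Lambda> * (s - t)\<bar> \<le> \<bar>\<Lambda>\<bar>" by (simp add: abs_mult mult_left_le)
    then show ?thesis using n2 by (simp add: K_def abs_le_iff)
  qed
  have mker: "kernel p \<in> borel_measurable borel" unfolding kernel_def[abs_def] by measurable
  have kerB: "\<bar>kernel p t\<bar> \<le> K * (LINT s|lborel. \<bar>p s\<bar>)" if t: "t \<in> {a<..<1}" for t
  proof -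
    have "\<bar>kernel p t\<bar> \<le> (LINT s|lborel. \<bar>if t < s then (2 * n + \<Lambda> * (s - t)) * p s else 0\<bar>)"
      unfolding kernel_def by (rule integral_abs_bound)
    also have "\<dots> \<le> (LINT s|lborel. K * \<bar>p s\<bar>)"
    proof (rule integral_mono_AE')
      show "integrable lborel (\<lambda>s. K * \<bar>p s\<bar>)" using p(1) by auto
      show "AE s in lborel. \<bar>if t < s then (2 * n + \<Lambda> * (s - t)) * p s else 0\<bar> \<le> K * \<bar>p s\<bar>"
      proof (rule AE_I2)
        fix s
        show "\<bar>if t < s then (2 * n + \<Lambda> * (s - t)) * p s else 0\<bar> \<le> K * \<bar>p s\<bar>"
        proof (cases "s \<in> {a<..<1}")
          case True
          then have "\<bar>2 * n + \<Lambda> * (s - t)\<bar> * \<bar>p s\<bar> \<le> K * \<bar>p s\<bar>" by (intro mult_right_mono K t) auto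
          moreover have "0 \<le> K * \<bar>p s\<bar>" using n2 by (simp add: K_def)
          ultimately show ?thesis by (simp add: abs_mult)
        next
          case False
          then show ?thesis using p(2) by simp
        qed
      qed
      show "AE s in lborel. 0 \<le> K * \<bar>p s\<bar>" using n2 by (simp add: K_def)
    qed
    also have "\<dots> = K * (LINT s|lborel. \<bar>p s\<bar>)" by simp
    finally show ?thesis .
  qed
  \<comment> \<open>The difference of the two sides, set to 0 outside (a, 1) so that it is
    integrable on the line.\<close>
  define F where "F t = indicator {a<..<1} t * (4 * t * p t + kernel p t - (4 * c + \<beta>\<^sub>R * (1 - t)) * \<tau>)" for t
  have iF: "integrable lborel F"
  proof (rule Bochner_Integration.integrable_bound)
    let ?D = "K * (LINT s|lborel. \<bar>p s\<bar>) + (4 * c + \<beta>\<^sub>R) * \<bar>\<tau>\<bar>"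
    have "integrable lborel (indicator {a<..<1} :: real \<Rightarrow> real)" using a_bounds by (intro integrable_real_indicator) auto
    then show "integrable lborel (\<lambda>t. 4 * \<bar>p t\<bar> + ?D * indicator {a<..<1} t)"
      using p(1) by (intro Bochner_Integration.integrable_add integrable_mult_right integrable_abs)
    show "F \<in> borel_measurable lborel" unfolding F_def[abs_def] using mker by measurable
    show "AE t in lborel. norm (F t) \<le> norm (4 * \<bar>p t\<bar> + ?D * indicator {a<..<1} t)"
    proof (rule AE_I2)
      fix t
      show "norm (F t) \<le> norm (4 * \<bar>p t\<bar> + ?D * indicator {a<..<1} t)"
      proof (cases "t \<in> {a<..<1}")
        case True
        have "\<bar>4 * t * p t\<bar> \<le> 4 * \<bar>p t\<bar>" using True a_bounds by (simp add: abs_mult mult_left_le_one_le)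
        moreover have "\<bar>(4 * c + \<beta>\<^sub>R * (1 - t)) * \<tau>\<bar> \<le> (4 * c + \<beta>\<^sub>R) * \<bar>\<tau>\<bar>"
        proof -
          have bR: "0 \<le> \<beta>\<^sub>R" using \<beta> by simp
          have "0 \<le> \<beta>\<^sub>R * (1 - t)" by (intro mult_nonneg_nonneg bR) (use True in simp)
          moreover have "\<beta>\<^sub>R * (1 - t) \<le> \<beta>\<^sub>R * 1"
            by (rule mult_left_mono[OF _ bR]) (use True a_bounds in simp)
          moreover have "0 \<le> 4 * c" using c by simp
          ultimately have "\<bar>4 * c + \<beta>\<^sub>R * (1 - t)\<bar> \<le> 4 * c + \<beta>\<^sub>R" by linarith
          then show ?thesis unfolding abs_mult by (intro mult_right_mono) auto
        qed
        ultimately show ?thesis using True kerB[OF True] by (simp add: F_def)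
      qed (simp add: F_def)
    qed
  qed
  have "(LINT t|lborel. g t * F t) = 0" if g: "g \<in> test_functions {a<..<1}" for g
  proof -
    have cg: "continuous_on UNIV g" by (rule test_functions_continuous[OF g])
    have [measurable]: "g \<in> borel_measurable borel" by (rule continuous_on_UNIV_borel[OF cg])
    have out: "g t = 0" if "t \<notin> {a<..<1}" for t
      using that test_functionsD(3)[OF g] spt_not_in[of t g] by blast
    have ig: "integrable lborel g"
      by (rule integrable_continuous_compact_support[OF cg test_functionsD(2)[OF g]]) (rule spt_not_in)
    have itg: "integrable lborel (\<lambda>t. t * g t)"
      by (rule integrable_continuous_compact_support[OF _ test_functionsD(2)[OF g]])
        (use cg spt_not_in[of _ g] in \<open>auto intro!: continuous_intros\<close>)
    have i_ind: "integrable lborel (\<lambda>t. indicator {..<s} t * g t)" "integrable lborel (\<lambda>t. indicator {..<s} t * (t * g t))" for s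
      using integrable_mult_indicator[OF _ ig, of "{..<s}"] integrable_mult_indicator[OF _ itg, of "{..<s}"] by auto
    define G1 where "G1 s = (LINT t|lborel. indicator {..<s} t * g t)" for s
    define G2 where "G2 s = s * (LINT t|lborel. indicator {..<s} t * g t) - (LINT t|lborel. indicator {..<s} t * (t * g t))" for s
    have tested: "(4 * c * G1 1 + \<beta>\<^sub>R * G2 1) * \<tau> = (LINT s|lborel. (2 * n * G1 s + 4 * s * g s + \<Lambda> * G2 s) * p s)"
      unfolding G1_def G2_def by (rule tested_equation[OF p g])
    \<comment> \<open>The joint integrand: integrated over \<open>t\<close> it gives the
      antiderivatives times \<open>p\<close>, integrated over \<open>s\<close> it gives
      \<open>g\<close> times \<open>kernel p\<close>.\<close>
    define k where "k s t = p s * (if t < s then (2 * n + \<Lambda> * (s - t)) * g t else 0)" for s t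
    have mk [measurable]: "case_prod k \<in> borel_measurable (lborel \<Otimes>\<^sub>M lborel)"
      unfolding k_def[abs_def] by measurable
    have ipg: "integrable (lborel \<Otimes>\<^sub>M lborel) (\<lambda>(s, t). \<bar>p s\<bar> * \<bar>g t\<bar>)"
    proof (rule lborel_pair.Fubini_integrable)
      show "integrable lborel (\<lambda>s. LINT t|lborel. norm (case (s, t) of (s, t) \<Rightarrow> \<bar>p s\<bar> * \<bar>g t\<bar>))"
        using p(1) ig by (simp add: abs_mult)
      show "AE s in lborel. integrable lborel (\<lambda>t. case (s, t) of (s, t) \<Rightarrow> \<bar>p s\<bar> * \<bar>g t\<bar>)" using ig by simp
    qed measurable
    have ik: "integrable (lborel \<Otimes>\<^sub>M lborel) (case_prod k)"
    proof (rule Bochner_Integration.integrable_bound[of _ "\<lambda>x. K * (case x of (s, t) \<Rightarrow> \<bar>p s\<bar> * \<bar>g t\<bar>)"])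
      show "integrable (lborel \<Otimes>\<^sub>M lborel) (\<lambda>x. K * (case x of (s, t) \<Rightarrow> \<bar>p s\<bar> * \<bar>g t\<bar>))" using ipg by simp
      show "AE x in lborel \<Otimes>\<^sub>M lborel. norm (case_prod k x) \<le> norm (K * (case x of (s, t) \<Rightarrow> \<bar>p s\<bar> * \<bar>g t\<bar>))"
      proof (rule AE_I2)
        fix x :: "real \<times> real"
        obtain s t where x: "x = (s, t)" by (cases x)
        have K0: "0 \<le> K" using n2 by (simp add: K_def)
        show "norm (case_prod k x) \<le> norm (K * (case x of (s, t) \<Rightarrow> \<bar>p s\<bar> * \<bar>g t\<bar>))"
        proof (cases "s \<in> {a<..<1} \<and> t \<in> {a<..<1} \<and> t < s")
          case True
          have "\<bar>2 * n + \<Lambda> * (s - t)\<bar> * (\<bar>p s\<bar> * \<bar>g t\<bar>) \<le> K * (\<bar>p s\<bar> * \<bar>g t\<bar>)"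
            using True by (intro mult_right_mono K) auto
          then show ?thesis using True K0 by (simp add: x k_def abs_mult ac_simps)
        next
          case False
          then have "k s t = 0" using p(2)[of s] out[of t] by (auto simp: k_def)
          then show ?thesis by (simp add: x)
        qed
      qed
    qed (rule mk)
    have inner_t: "(LINT t|lborel. k s t) = (2 * n * G1 s + \<Lambda> * G2 s) * p s" for s
    proof -
      have "(LINT t|lborel. k s t) = (LINT t|lborel. p s * ((2 * n + \<Lambda> * s) * (indicator {..<s} t * g t) - \<Lambda> * (indicator {..<s} t * (t * g t))))"
        by (intro Bochner_Integration.integral_cong) (auto simp: k_def indicator_def algebra_simps)
      also have "\<dots> = p s * ((2 * n + \<Lambda> * s) * (LINT t|lborel. indicator {..<s} t * g t) - \<Lambda> * (LINT t|lborel. indicator {..<s} t * (t * g t)))"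
        using i_ind by simp
      finally show ?thesis by (simp add: G1_def G2_def algebra_simps)
    qed
    have inner_s: "(LINT s|lborel. k s t) = g t * kernel p t" for t
    proof -
      have "(LINT s|lborel. k s t) = (LINT s|lborel. g t * (if t < s then (2 * n + \<Lambda> * (s - t)) * p s else 0))"
        by (intro Bochner_Integration.integral_cong) (auto simp: k_def)
      then show ?thesis by (simp add: kernel_def)
    qed
    have fub: "(LINT t|lborel. g t * kernel p t) = (LINT s|lborel. (2 * n * G1 s + \<Lambda> * G2 s) * p s)"
      using lborel_pair.Fubini_integral[OF ik] by (simp add: inner_t inner_s)
    have i1: "integrable lborel (\<lambda>s. (2 * n * G1 s + \<Lambda> * G2 s) * p s)"
      using lborel_pair.integrable_fst[OF ik] by (simp add: inner_t)
    have i2: "integrable lborel (\<lambda>t. g t * kernel p t)"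
      using lborel_pair.integrable_snd[OF ik] by (simp add: inner_s)
    have i3: "integrable lborel (\<lambda>t. 4 * t * g t * p t)"
    proof -
      obtain B where B: "\<And>t. norm (t * g t) \<le> B" "0 < B"
        by (rule bounded_continuous_compact_support[of "\<lambda>t. t * g t", OF _ test_functionsD(2)[OF g]])
          (use cg spt_not_in[of _ g] in \<open>auto intro!: continuous_intros\<close>)
      show ?thesis
      proof (rule Bochner_Integration.integrable_bound[of _ "\<lambda>t. 4 * B * \<bar>p t\<bar>"])
        show "AE t in lborel. norm (4 * t * g t * p t) \<le> norm (4 * B * \<bar>p t\<bar>)"
        proof (rule AE_I2)
          fix t
          have "\<bar>t * g t\<bar> * \<bar>p t\<bar> \<le> B * \<bar>p t\<bar>" using B(1)[of t] by (intro mult_right_mono) auto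
          then show "norm (4 * t * g t * p t) \<le> norm (4 * B * \<bar>p t\<bar>)" using B(2) by (simp add: abs_mult)
        qed
      qed (use p(1) in auto)
    qed
    have i4: "integrable lborel (\<lambda>t. (4 * c + \<beta>\<^sub>R * (1 - t)) * \<tau> * g t)"
    proof -
      have "integrable lborel (\<lambda>t. (4 * c + \<beta>\<^sub>R) * \<tau> * g t - \<beta>\<^sub>R * \<tau> * (t * g t))" using ig itg by auto
      then show ?thesis by (simp add: algebra_simps)
    qed
    have G1_1: "G1 1 = (LINT t|lborel. g t)" and G2_1: "G2 1 = (LINT t|lborel. g t) - (LINT t|lborel. t * g t)"
    proof -
      have *: "indicator {..<1} t * g t = g t" "indicator {..<1} t * (t * g t) = t * g t" for t
        using out[of t] by (auto simp: indicator_def)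
      show "G1 1 = (LINT t|lborel. g t)" "G2 1 = (LINT t|lborel. g t) - (LINT t|lborel. t * g t)"
        unfolding G1_def G2_def * by simp_all
    qed
    have "(LINT t|lborel. (4 * c + \<beta>\<^sub>R * (1 - t)) * \<tau> * g t) = (LINT t|lborel. (4 * c + \<beta>\<^sub>R) * \<tau> * g t - \<beta>\<^sub>R * \<tau> * (t * g t))"
      by (intro Bochner_Integration.integral_cong) (auto simp: algebra_simps)
    also have "\<dots> = (4 * c + \<beta>\<^sub>R) * \<tau> * (LINT t|lborel. g t) - \<beta>\<^sub>R * \<tau> * (LINT t|lborel. t * g t)"
      using ig itg by simp
    also have "\<dots> = (4 * c * G1 1 + \<beta>\<^sub>R * G2 1) * \<tau>" unfolding G1_1 G2_1 by (simp add: algebra_simps)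
    finally have bd: "(LINT t|lborel. (4 * c + \<beta>\<^sub>R * (1 - t)) * \<tau> * g t) = (4 * c * G1 1 + \<beta>\<^sub>R * G2 1) * \<tau>" .
    have "(LINT s|lborel. (2 * n * G1 s + 4 * s * g s + \<Lambda> * G2 s) * p s) =
      (LINT s|lborel. (2 * n * G1 s + \<Lambda> * G2 s) * p s + 4 * s * g s * p s)"
      by (intro Bochner_Integration.integral_cong) (auto simp: algebra_simps)
    also have "\<dots> = (LINT t|lborel. g t * kernel p t) + (LINT t|lborel. 4 * t * g t * p t)"
      using i1 i3 fub by simp
    finally have main: "(LINT t|lborel. (4 * c + \<beta>\<^sub>R * (1 - t)) * \<tau> * g t) = (LINT t|lborel. g t * kernel p t) + (LINT t|lborel. 4 * t * g t * p t)"
      using tested bd by simp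
    have "(LINT t|lborel. g t * F t) = (LINT t|lborel. (g t * kernel p t + 4 * t * g t * p t) - (4 * c + \<beta>\<^sub>R * (1 - t)) * \<tau> * g t)"
    proof (intro Bochner_Integration.integral_cong refl)
      fix t
      show "g t * F t = (g t * kernel p t + 4 * t * g t * p t) - (4 * c + \<beta>\<^sub>R * (1 - t)) * \<tau> * g t"
        using out[of t] by (cases "t \<in> {a<..<1}") (auto simp: F_def algebra_simps)
    qed
    also have "\<dots> = 0" using i2 i3 i4 main by simp
    finally show ?thesis .
  qed
  then have "AE t in lborel. t \<in> {a<..<1} \<longrightarrow> F t = 0"
    using iF by (intro AE_eq_0_if_integral_test_functions_eq_0) auto
  then show ?thesis by (rule eventually_mono) (auto simp: F_def)
qed

text \<open>\<open>v\<close> is positive almost everywhere and the shell is a nonempty open part of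
  the annulus, hence not negligible. This is how positivity of \<open>v\<close> reaches the
  profile.\<close>

lemma shell_integral_pos:
  assumes xy: "a \<le> x" "x < y" "y \<le> 1"
  shows "0 < (LINT z|lebesgue_on A. indicator {x<..<y} (rad z) * v z)"
proof -
  have mr: "(\<lambda>z. indicator {x<..<y} (rad z) :: real) \<in> borel_measurable borel"
    using measurable_compose[OF borel_measurable_continuous_onI[OF continuous_on_rad], of "indicator {x<..<y}" borel] by simp
  have L2v: "L2 (lebesgue_on A) v" using v_H1 by (simp add: H1_def)
  have m: "(\<lambda>z. indicator {x<..<y} (rad z) * v z) \<in> borel_measurable (lebesgue_on A)"
    using borel_imp_measurable_A[OF mr] L2_measurable[OF L2v] by (rule borel_measurable_times)
  have i: "integrable (lebesgue_on A) (\<lambda>z. indicator {x<..<y} (rad z) * v z)"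
  proof (rule Bochner_Integration.integrable_bound[OF finite_measure.L2_imp_integrable[OF finite_measure_A L2v] m])
    show "AE z in lebesgue_on A. norm (indicator {x<..<y} (rad z) * v z) \<le> norm (v z)" by (intro AE_I2) (simp add: indicator_def)
  qed
  have nn: "AE z in lebesgue_on A. 0 \<le> indicator {x<..<y} (rad z) * v z"
    using v_pos by eventually_elim (simp add: indicator_def)
  have "(LINT z|lebesgue_on A. indicator {x<..<y} (rad z) * v z) \<noteq> 0"
  proof
    assume "(LINT z|lebesgue_on A. indicator {x<..<y} (rad z) * v z) = 0"
    then have "AE z in lebesgue_on A. indicator {x<..<y} (rad z) * v z = 0"
      using integral_nonneg_eq_0_iff_AE[OF i nn] by simp
    with v_pos have "AE z in lebesgue_on A. rad z \<notin> {x<..<y}"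
      by eventually_elim (auto simp: indicator_def split: if_splits)
    then have "AE z in lebesgue. z \<in> A \<longrightarrow> rad z \<notin> {x<..<y}" by (subst (asm) AE_restrict_space_iff) auto
    then have "AE z in lebesgue. z \<notin> {z. x < rad z \<and> rad z < y}"
      by eventually_elim (use xy in \<open>auto simp: A_rad_iff\<close>)
    moreover have op: "open {z. x < rad z \<and> rad z < y}"
      by (intro open_Collect_conj open_Collect_less continuous_on_rad continuous_on_const)
    ultimately have "{z. x < rad z \<and> rad z < y} \<in> null_sets lebesgue"
      by (subst AE_iff_null_sets) auto
    then have neg: "negligible {z. x < rad z \<and> rad z < y}" by (simp add: negligible_iff_null_sets)
    obtain \<omega> :: "real ^ 'n" where \<omega>: "norm \<omega> = R\<^sub>2" by (rule vector_choose_size[of R\<^sub>2]) (use R2 in auto)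
    have "rad (sqrt ((x + y) / 2) *\<^sub>R \<omega>) = (x + y) / 2" using a_bounds xy by (intro rad_polar[OF \<omega>]) auto
    then have "sqrt ((x + y) / 2) *\<^sub>R \<omega> \<in> {z. x < rad z \<and> rad z < y}" using xy by simp
    then show False using open_not_negligible[OF op] neg by blast
  qed
  then show ?thesis using integral_nonneg_AE[OF nn] by simp
qed

text \<open>For integrable \<open>p\<close> the right-hand side of the integral equation is
  continuous in t, so \<open>p\<close> has a continuous version; inserted back, it satisfies the
  equation at every point of [a, 1].\<close>

lemma profile_exists:
  obtains P0 where "continuous_on {a..1} P0"
    "\<And>q B. q \<in> borel_measurable borel \<Longrightarrow> (\<And>s. \<bar>q s\<bar> \<le> B) \<Longrightarrow>
      (LINT x|lebesgue_on A. q (rad x) * v x) = (LINT s|lborel. indicator {a..1} s * (q s * P0 s))"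
    "\<And>t. t \<in> {a..1} \<Longrightarrow> 4 * t * P0 t = (4 * c + \<beta>\<^sub>R * (1 - t)) * \<tau> -
      ((2 * n - \<Lambda> * t) * integral {t..1} P0 + \<Lambda> * integral {t..1} (\<lambda>s. s * P0 s))"
proof -
  obtain p where p: "integrable lborel p" "\<And>s. s \<notin> {a<..<1} \<Longrightarrow> p s = 0"
    "\<And>q B. q \<in> borel_measurable borel \<Longrightarrow> (\<And>s. \<bar>q s\<bar> \<le> B) \<Longrightarrow>
      (LINT x|lebesgue_on A. q (rad x) * v x) = (LINT s|lborel. q s * p s)"
    using radial_density by blast
  have [measurable]: "p \<in> borel_measurable borel" using p(1) by auto
  have isp: "integrable lborel (\<lambda>s. s * p s)"
  proof (rule Bochner_Integration.integrable_bound[OF p(1)])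
    show "AE s in lborel. norm (s * p s) \<le> norm (p s)"
    proof (rule AE_I2)
      fix s
      show "norm (s * p s) \<le> norm (p s)"
        using p(2)[of s] a_bounds by (cases "s \<in> {a<..<1}") (auto simp: abs_mult mult_left_le_one_le)
    qed
  qed auto
  have set_int: "set_integrable lborel {t..1} p" "set_integrable lborel {t..1} (\<lambda>s. s * p s)" for t
    unfolding set_integrable_def using integrable_mult_indicator[OF _ p(1), of "{t..1}"] integrable_mult_indicator[OF _ isp, of "{t..1}"] by auto
  have on: "p integrable_on {a..1}" "(\<lambda>s. s * p s) integrable_on {a..1}"
    using set_borel_integral_eq_integral(1)[OF set_int(1)] set_borel_integral_eq_integral(1)[OF set_int(2)] by auto
  \<comment> \<open>\<open>kernel p\<close> with the coefficient expanded so that t stands outside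
    the integrals; continuity of indefinite integrals then applies.\<close>
  define W where "W t = (2 * n - \<Lambda> * t) * integral {t..1} p + \<Lambda> * integral {t..1} (\<lambda>s. s * p s)" for t
  have cW: "continuous_on {a..1} W"
    unfolding W_def[abs_def] by (intro continuous_intros indefinite_integral_continuous_1' on)
  have W: "kernel p t = W t" if t: "t \<in> {a..1}" for t
  proof -
    have AEs: "AE s in lborel. s \<noteq> t" by (rule AE_lborel_singleton)
    have "kernel p t = (LINT s|lborel. (2 * n - \<Lambda> * t) * (indicator {t..1} s *\<^sub>R p s) + \<Lambda> * (indicator {t..1} s *\<^sub>R (s * p s)))"
      unfolding kernel_def
    proof (rule integral_cong_AE)
      show "AE s in lborel. (if t < s then (2 * n + \<Lambda> * (s - t)) * p s else 0) =
        (2 * n - \<Lambda> * t) * (indicator {t..1} s *\<^sub>R p s) + \<Lambda> * (indicator {t..1} s *\<^sub>R (s * p s))"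
        using AEs
      proof eventually_elim
        case (elim s)
        show ?case
        proof (cases "s \<in> {a<..<1}")
          case True
          then show ?thesis using elim by (auto simp: indicator_def algebra_simps)
        next
          case False
          then show ?thesis using p(2) by simp
        qed
      qed
    qed auto
    also have "\<dots> = (2 * n - \<Lambda> * t) * (LINT s|lborel. indicator {t..1} s *\<^sub>R p s) + \<Lambda> * (LINT s|lborel. indicator {t..1} s *\<^sub>R (s * p s))"
      by (simp only: Bochner_Integration.integral_add[OF integrable_mult_right[OF set_int(1)[unfolded set_integrable_def]]
            integrable_mult_right[OF set_int(2)[unfolded set_integrable_def]]] integral_mult_right_zero)
    also have "\<dots> = W t"
      using set_borel_integral_eq_integral(2)[OF set_int(1)[of t]] set_borel_integral_eq_integral(2)[OF set_int(2)[of t]]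
      unfolding W_def set_lebesgue_integral_def by (simp only:)
    finally show ?thesis .
  qed
  define P0 where "P0 t = ((4 * c + \<beta>\<^sub>R * (1 - t)) * \<tau> - W t) / (4 * t)" for t
  have cP0: "continuous_on {a..1} P0"
    unfolding P0_def[abs_def] using a_bounds by (intro continuous_intros cW) auto
  have AEp: "AE t in lborel. p t = indicator {a..1} t * P0 t"
  proof -
    have "AE t in lborel. t \<noteq> a" "AE t in lborel. t \<noteq> (1::real)" by (rule AE_lborel_singleton)+
    moreover have "AE t in lborel. t \<in> {a<..<1} \<longrightarrow> 4 * t * p t = (4 * c + \<beta>\<^sub>R * (1 - t)) * \<tau> - kernel p t"
      by (rule integral_equation_AE) (fact p)+
    ultimately show ?thesis
    proof eventually_elim
      case (elim t)
      show ?case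
      proof (cases "t \<in> {a<..<1}")
        case True
        then have "4 * t * p t = (4 * c + \<beta>\<^sub>R * (1 - t)) * \<tau> - W t" using elim(3) W[of t] by auto
        then show ?thesis using True a_bounds by (simp add: P0_def field_simps)
      next
        case False
        then have "t \<notin> {a..1}" using elim by auto
        then show ?thesis using p(2)[OF False] by simp
      qed
    qed
  qed
  have mP0: "(\<lambda>t. indicator {a..1} t * P0 t) \<in> borel_measurable borel"
    using borel_measurable_continuous_on_indicator[OF _ cP0] by simp
  have int_eq: "integral {t..1} p = integral {t..1} P0" "integral {t..1} (\<lambda>s. s * p s) = integral {t..1} (\<lambda>s. s * P0 s)"
    if t: "t \<in> {a..1}" for t
  proof -
    have cs: "continuous_on {t..1} P0" "continuous_on {t..1} (\<lambda>s. s * P0 s)"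
      using continuous_on_subset[OF cP0, of "{t..1}"] t by (auto intro!: continuous_intros)
    have m: "(\<lambda>s. indicator {t..1} s *\<^sub>R P0 s) \<in> borel_measurable borel" "(\<lambda>s. indicator {t..1} s *\<^sub>R (s * P0 s)) \<in> borel_measurable borel"
      using cs by (intro borel_measurable_continuous_on_indicator; simp)+
    have "(LINT s|lborel. indicator {t..1} s *\<^sub>R p s) = (LINT s|lborel. indicator {t..1} s *\<^sub>R P0 s)"
      by (rule integral_cong_AE) (use AEp m t in \<open>auto elim!: eventually_mono simp: indicator_def\<close>)
    then show "integral {t..1} p = integral {t..1} P0"
      using set_borel_integral_eq_integral(2)[OF set_int(1)[of t]] set_borel_integral_eq_integral(2)[OF borel_integrable_atLeastAtMost'[OF cs(1)]]
      unfolding set_lebesgue_integral_def by (simp only:)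
    have "(LINT s|lborel. indicator {t..1} s *\<^sub>R (s * p s)) = (LINT s|lborel. indicator {t..1} s *\<^sub>R (s * P0 s))"
      by (rule integral_cong_AE) (use AEp m t in \<open>auto elim!: eventually_mono simp: indicator_def\<close>)
    then show "integral {t..1} (\<lambda>s. s * p s) = integral {t..1} (\<lambda>s. s * P0 s)"
      using set_borel_integral_eq_integral(2)[OF set_int(2)[of t]] set_borel_integral_eq_integral(2)[OF borel_integrable_atLeastAtMost'[OF cs(2)]]
      unfolding set_lebesgue_integral_def by (simp only:)
  qed
  show thesis
  proof (rule that[OF cP0])
    fix q :: "real \<Rightarrow> real" and B assume q: "q \<in> borel_measurable borel" "\<And>s. \<bar>q s\<bar> \<le> B"
    have "(LINT x|lebesgue_on A. q (rad x) * v x) = (LINT s|lborel. q s * p s)" by (rule p(3)[OF q])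
    also have "\<dots> = (LINT s|lborel. indicator {a..1} s * (q s * P0 s))"
    proof (rule integral_cong_AE)
      have "(\<lambda>s. q s * (indicator {a..1} s * P0 s)) \<in> borel_measurable borel" using q(1) mP0 by (rule borel_measurable_times)
      then show "(\<lambda>s. indicator {a..1} s * (q s * P0 s)) \<in> borel_measurable lborel" by (simp add: ac_simps)
      show "AE s in lborel. q s * p s = indicator {a..1} s * (q s * P0 s)"
        using AEp by eventually_elim (simp add: ac_simps)
    qed (use q in auto)
    finally show "(LINT x|lebesgue_on A. q (rad x) * v x) = (LINT s|lborel. indicator {a..1} s * (q s * P0 s))" .
  next
    fix t assume t: "t \<in> {a..1}"
    have "4 * t * P0 t = (4 * c + \<beta>\<^sub>R * (1 - t)) * \<tau> - W t" using t a_bounds by (simp add: P0_def)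
    then show "4 * t * P0 t = (4 * c + \<beta>\<^sub>R * (1 - t)) * \<tau> -
      ((2 * n - \<Lambda> * t) * integral {t..1} P0 + \<Lambda> * integral {t..1} (\<lambda>s. s * P0 s))"
      unfolding W_def int_eq[OF t] .
  qed
qed

text \<open>Testing with \<open>v\<close> itself: the form is nonnegative because \<beta> > 0, and
  the integral of v^2 is positive.\<close>

lemma lam_nonneg: "0 \<le> lam"
proof -
  have v: "v \<in> H1_vanishing (sphere 0 R\<^sub>1) A"
    unfolding H1_vanishing_def using v_H1 f_test f_spt f_lim by blast
  have L2v: "L2 (lebesgue_on A) v" using v_H1 by (simp add: H1_def)
  have i: "integrable (lebesgue_on A) (\<lambda>x. v x * v x)" using L2_integrable[OF L2v] by (simp add: power2_eq_square)
  have "0 \<le> robin_form \<beta> R\<^sub>1 R\<^sub>2 v v"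
    unfolding robin_form_def using \<beta>
    by (intro add_nonneg_nonneg mult_nonneg_nonneg[OF less_imp_le] Bochner_Integration.integral_nonneg inner_ge_zero zero_le_square)
  then have "0 \<le> lam * L2_form R\<^sub>1 R\<^sub>2 v v" using eigen[OF v] by simp
  moreover have "0 < L2_form R\<^sub>1 R\<^sub>2 v v"
  proof -
    have L: "L2_form R\<^sub>1 R\<^sub>2 v v = (LINT x|lebesgue_on A. v x * v x)" by (simp add: L2_form_def A_def)
    have "(LINT x|lebesgue_on A. v x * v x) \<noteq> 0"
    proof
      assume "(LINT x|lebesgue_on A. v x * v x) = 0"
      then have "AE x in lebesgue_on A. v x * v x = 0" using integral_nonneg_eq_0_iff_AE[OF i] by simp
      with v_pos have "AE x in lebesgue_on A. False" by eventually_elim simp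
      then have "AE x in lebesgue_on A. indicator {a<..<1} (rad x) * v x = 0" by eventually_elim simp
      then have "(LINT x|lebesgue_on A. indicator {a<..<1} (rad x) * v x) = 0" by (rule integral_eq_zero_AE)
      then show False using shell_integral_pos[of a 1] a_bounds by simp
    qed
    moreover have "0 \<le> (LINT x|lebesgue_on A. v x * v x)" by (intro Bochner_Integration.integral_nonneg) auto
    ultimately show ?thesis unfolding L by linarith
  qed
  ultimately show ?thesis by (simp add: zero_le_mult_iff)
qed

text \<open>\<open>P\<close> is the continuous density divided by the Jacobian power t^(n/2 - 1), so
  a multiple of the spherical mean, and \<Phi> = 4 t^(n/2) P' is the flux. One differentiation of
  the integral equation yields P', a second one the equation for \<Phi>. At t = 1 all integrals
  vanish, which gives both boundary values and with them the Robin condition.\<close>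

lemma profile_ode:
  obtains P \<Phi> where "continuous_on {a..1} P" "continuous_on {a..1} \<Phi>"
    "\<And>t. t \<in> {a..1} \<Longrightarrow> (P has_real_derivative \<Phi> t / (4 * t powr (n / 2))) (at t within {a..1})"
    "\<And>t. t \<in> {a..1} \<Longrightarrow> (\<Phi> has_real_derivative - (\<Lambda> * (t powr (n / 2 - 1) * P t))) (at t within {a..1})"
    "P 1 = c * \<tau>" "\<Phi> 1 = - (\<beta>\<^sub>R * \<tau>)"
    "\<And>q B. q \<in> borel_measurable borel \<Longrightarrow> (\<And>s. \<bar>q s\<bar> \<le> B) \<Longrightarrow>
      (LINT x|lebesgue_on A. q (rad x) * v x) = (LINT s|lborel. indicator {a..1} s * (q s * (s powr (n / 2 - 1) * P s)))"
    "\<And>t. t \<in> {a..1} \<Longrightarrow> \<Phi> t = \<Lambda> * integral {t..1} (\<lambda>s. s powr (n / 2 - 1) * P s) - \<beta>\<^sub>R * \<tau>"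
proof -
  obtain P0 where cP0: "continuous_on {a..1} P0" and
    test: "\<And>q B. q \<in> borel_measurable borel \<Longrightarrow> (\<And>s. \<bar>q s\<bar> \<le> B) \<Longrightarrow>
      (LINT x|lebesgue_on A. q (rad x) * v x) = (LINT s|lborel. indicator {a..1} s * (q s * P0 s))" and
    eq: "\<And>t. t \<in> {a..1} \<Longrightarrow> 4 * t * P0 t = (4 * c + \<beta>\<^sub>R * (1 - t)) * \<tau> -
      ((2 * n - \<Lambda> * t) * integral {t..1} P0 + \<Lambda> * integral {t..1} (\<lambda>s. s * P0 s))"
    using profile_exists by blast
  define J where "J t = integral {t..1} P0" for t
  define \<Phi> where "\<Phi> t = \<Lambda> * J t - \<beta>\<^sub>R * \<tau>" for t
  \<comment> \<open>The integral equation says that \<open>E t\<close> is 4 t P0(t). Thus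
    \<open>P\<close> is P0 times t^(1 - n/2), in a form whose differentiability is visible.\<close>
  define E where "E t = (4 * c + \<beta>\<^sub>R * (1 - t)) * \<tau> - ((2 * n - \<Lambda> * t) * J t + \<Lambda> * integral {t..1} (\<lambda>s. s * P0 s))" for t
  define P where "P t = E t * t powr (- (n / 2)) / 4" for t
  have dJ: "(J has_real_derivative - P0 t) (at t within {a..1})" if "t \<in> {a..1}" for t
    unfolding J_def[abs_def] by (rule integral_has_real_derivative'[OF cP0 that])
  have dJ1: "((\<lambda>t. integral {t..1} (\<lambda>s. s * P0 s)) has_real_derivative - (t * P0 t)) (at t within {a..1})" if "t \<in> {a..1}" for t
    by (rule integral_has_real_derivative'[OF _ that]) (intro continuous_intros cP0)
  have dE: "(E has_real_derivative \<Phi> t + 2 * n * P0 t) (at t within {a..1})" if t: "t \<in> {a..1}" for t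
  proof -
    have d1: "((\<lambda>t. (4 * c + \<beta>\<^sub>R * (1 - t)) * \<tau>) has_real_derivative (\<beta>\<^sub>R * (0 - 1)) * \<tau>) (at t within {a..1})"
      by (auto intro!: derivative_eq_intros)
    have d2: "((\<lambda>t. 2 * n - \<Lambda> * t) has_real_derivative 0 - \<Lambda> * 1) (at t within {a..1})"
      by (auto intro!: derivative_eq_intros)
    have "(E has_real_derivative (\<beta>\<^sub>R * (0 - 1)) * \<tau> - (((2 * n - \<Lambda> * t) * - P0 t + (0 - \<Lambda> * 1) * J t) + \<Lambda> * - (t * P0 t))) (at t within {a..1})"
      unfolding E_def[abs_def] by (rule DERIV_diff[OF d1 DERIV_add[OF DERIV_mult'[OF d2 dJ[OF t]] DERIV_cmult[OF dJ1[OF t]]]])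
    moreover have "(\<beta>\<^sub>R * (0 - 1)) * \<tau> - (((2 * n - \<Lambda> * t) * - P0 t + (0 - \<Lambda> * 1) * J t) + \<Lambda> * - (t * P0 t)) = \<Phi> t + 2 * n * P0 t"
      by (simp add: \<Phi>_def algebra_simps)
    ultimately show ?thesis by (simp only:)
  qed
  have tp: "0 < t" if "t \<in> {a..1}" for t using that a_bounds by simp
  have EP0: "E t = 4 * t * P0 t" if "t \<in> {a..1}" for t using eq[OF that] by (simp add: E_def J_def)
  have PP0: "t powr (n / 2 - 1) * P t = P0 t" if t: "t \<in> {a..1}" for t
  proof -
    have "t powr (n / 2 - 1) * t powr (- (n / 2)) * t = 1"
    proof -
      have "t powr (n / 2 - 1) * t powr (- (n / 2)) * t powr 1 = t powr (n / 2 - 1 + - (n / 2) + 1)" by (simp only: powr_add)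
      then show ?thesis using tp[OF t] by simp
    qed
    moreover have "t powr (n / 2 - 1) * P t = (t powr (n / 2 - 1) * t powr (- (n / 2)) * t) * P0 t"
      by (simp add: P_def EP0[OF t])
    ultimately show ?thesis by simp
  qed
  have dP: "(P has_real_derivative \<Phi> t / (4 * t powr (n / 2))) (at t within {a..1})" if t: "t \<in> {a..1}" for t
  proof -
    have dp: "((\<lambda>t. t powr (- (n / 2))) has_real_derivative - (n / 2) * t powr (- (n / 2) - 1)) (at t within {a..1})"
      by (rule has_field_derivative_at_within[OF has_real_derivative_powr[OF tp[OF t]]])
    have "(P has_real_derivative (E t * (- (n / 2) * t powr (- (n / 2) - 1)) + (\<Phi> t + 2 * n * P0 t) * t powr (- (n / 2))) / 4) (at t within {a..1})"
      unfolding P_def[abs_def] by (intro DERIV_cdivide DERIV_mult' dE[OF t] dp)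
    \<comment> \<open>The derivative of the power cancels the term 2 n P0, and only the flux is
      left.\<close>
    moreover have "(E t * (- (n / 2) * t powr (- (n / 2) - 1)) + (\<Phi> t + 2 * n * P0 t) * t powr (- (n / 2))) / 4 = (\<Phi> t * t powr (- (n / 2))) / 4"
    proof -
      have u: "t powr (- (n / 2)) = t * t powr (- (n / 2) - 1)" 
        using powr_add[of t 1 "- (n / 2) - 1"] tp[OF t] by simp
      have "(4 * t * P0 t * (- (n / 2) * w) + (\<Phi> t + 2 * n * P0 t) * (t * w)) / 4 = (\<Phi> t * (t * w)) / 4" for w
        by (simp add: algebra_simps)
      then show ?thesis unfolding EP0[OF t] u .
    qed
    ultimately have "(P has_real_derivative (\<Phi> t * t powr (- (n / 2))) / 4) (at t within {a..1})" by (simp only:)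
    moreover have "(\<Phi> t * t powr (- (n / 2))) / 4 = \<Phi> t / (4 * t powr (n / 2))" by (simp add: powr_minus_divide)
    ultimately show ?thesis by (simp only:)
  qed
  show thesis
  proof (rule that[of P \<Phi>])
    show "continuous_on {a..1} P" using dP by (intro DERIV_continuous_on)
    have d\<Phi>: "(\<Phi> has_real_derivative \<Lambda> * - P0 t - 0) (at t within {a..1})" if "t \<in> {a..1}" for t
      unfolding \<Phi>_def[abs_def] by (intro DERIV_diff DERIV_cmult dJ[OF that] DERIV_const)
    then show "continuous_on {a..1} \<Phi>" by (intro DERIV_continuous_on)
    show "(\<Phi> has_real_derivative - (\<Lambda> * (t powr (n / 2 - 1) * P t))) (at t within {a..1})" if "t \<in> {a..1}" for t
      using d\<Phi>[OF that] PP0[OF that] by simp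
    have "1 \<in> {a..1}" using a_bounds by simp
    then show "P 1 = c * \<tau>" using EP0[of 1] eq[of 1] by (simp add: P_def)
    show "\<Phi> 1 = - (\<beta>\<^sub>R * \<tau>)" by (simp add: \<Phi>_def J_def)
    show "\<Phi> t = \<Lambda> * integral {t..1} (\<lambda>s. s powr (n / 2 - 1) * P s) - \<beta>\<^sub>R * \<tau>" if t: "t \<in> {a..1}" for t
    proof -
      have "integral {t..1} (\<lambda>s. s powr (n / 2 - 1) * P s) = integral {t..1} P0"
        using t PP0 by (intro integral_cong) auto
      then show ?thesis by (simp add: \<Phi>_def J_def)
    qed
    show "(LINT x|lebesgue_on A. q (rad x) * v x) = (LINT s|lborel. indicator {a..1} s * (q s * (s powr (n / 2 - 1) * P s)))"
      if "q \<in> borel_measurable borel" "\<And>s. \<bar>q s\<bar> \<le> B" for q B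
    proof -
      have "indicator {a..1} s * (q s * P0 s) = indicator {a..1} s * (q s * (s powr (n / 2 - 1) * P s))" for s
        using PP0[of s] by (cases "s \<in> {a..1}") auto
      then show ?thesis using test[OF that] by (simp only:)
    qed
  qed (rule dP)
qed

end

section \<open>Functions with small gradient\<close>

lemma nn_integral_lborel_translation:
  fixes g :: "'a::euclidean_space \<Rightarrow> ennreal"
  assumes "g \<in> borel_measurable borel"
  shows "(\<integral>\<^sup>+y. g y \<partial>lborel) = (\<integral>\<^sup>+h. g (x + h) \<partial>lborel)"
proof -
  have "(\<integral>\<^sup>+y. g y \<partial>lborel) = (\<integral>\<^sup>+y. g y \<partial>distr lborel borel ((+) x))" by (simp only: lborel_distr_plus)
  also have "\<dots> = (\<integral>\<^sup>+h. g (x + h) \<partial>lborel)" using assms by (intro nn_integral_distr) auto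
  finally show ?thesis .
qed

text \<open>The fundamental theorem along the segment from x to x + h. The indicator of B sits
  inside the integrand so that it is measurable on the whole space and can be translated.\<close>

lemma difference_le_gradient_integral:
  fixes z :: "'a::euclidean_space \<Rightarrow> real"
  assumes B: "convex B" "B \<in> sets borel" and z: "\<And>x. x \<in> B \<Longrightarrow> z differentiable (at x)" "continuous_on B (gradient z)"
    and x: "x \<in> B" "x + h \<in> B"
  shows "ennreal \<bar>z (x + h) - z x\<bar> \<le>
    ennreal (norm h) * (\<integral>\<^sup>+t. indicator {0..1} t * ennreal (indicator B (x + t *\<^sub>R h) * norm (gradient z (x + t *\<^sub>R h))) \<partial>lborel)"
proof -
  define \<gamma> where "\<gamma> t = x + t *\<^sub>R h" for t :: real
  have \<gamma>: "\<gamma> t \<in> B" if "t \<in> {0..1}" for t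
  proof -
    have "\<gamma> t = (1 - t) *\<^sub>R x + t *\<^sub>R (x + h)" by (simp add: \<gamma>_def algebra_simps)
    then show ?thesis using convexD_alt[OF B(1) x, of t] that by simp
  qed
  have "(\<lambda>y. indicator B y *\<^sub>R gradient z y) \<in> borel_measurable borel"
    by (rule borel_measurable_continuous_on_indicator[OF B(2) z(2)])
  then have "(\<lambda>y. norm (indicator B y *\<^sub>R gradient z y)) \<in> borel_measurable borel" by measurable
  then have mG [measurable]: "(\<lambda>y. indicator B y * norm (gradient z y)) \<in> borel_measurable borel" by simp
  have m\<gamma> [measurable]: "(\<lambda>t. indicator B (x + t *\<^sub>R h) * norm (gradient z (x + t *\<^sub>R h))) \<in> borel_measurable borel"
    by (rule measurable_compose[OF _ mG]) simp
  have "has_bochner_integral lborel (\<lambda>t. indicator {0..1} t *\<^sub>R (gradient z (\<gamma> t) \<bullet> h)) (z (\<gamma> 1) - z (\<gamma> 0))"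
  proof (rule has_bochner_integral_FTC_Icc)
    fix t :: real assume t: "0 \<le> t" "t \<le> 1"
    have "(\<gamma> has_derivative (\<lambda>s. s *\<^sub>R h)) (at t within {0..1})"
      unfolding \<gamma>_def[abs_def] by (auto intro!: derivative_eq_intros)
    moreover have "(z has_derivative (\<lambda>y. gradient z (\<gamma> t) \<bullet> y)) (at (\<gamma> t))"
      using gradient_has_derivative[OF z(1)[OF \<gamma>]] t by simp
    ultimately have "((\<lambda>t. z (\<gamma> t)) has_derivative (\<lambda>s. gradient z (\<gamma> t) \<bullet> (s *\<^sub>R h))) (at t within {0..1})"
      by (rule has_derivative_compose)
    then show "((\<lambda>t. z (\<gamma> t)) has_vector_derivative gradient z (\<gamma> t) \<bullet> h) (at t within {0..1})"
      by (simp add: has_vector_derivative_def)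
  next
    have "continuous_on {0..1} \<gamma>" unfolding \<gamma>_def[abs_def] by (intro continuous_intros)
    then show "continuous_on {0..1} (\<lambda>t. gradient z (\<gamma> t) \<bullet> h)"
      using \<gamma> by (intro continuous_intros continuous_on_compose2[OF z(2)]) auto
  qed simp
  then have i: "integrable lborel (\<lambda>t. indicator {0..1} t *\<^sub>R (gradient z (\<gamma> t) \<bullet> h))"
    and e: "(LINT t|lborel. indicator {0..1} t *\<^sub>R (gradient z (\<gamma> t) \<bullet> h)) = z (x + h) - z x"
    by (auto simp: has_bochner_integral_iff \<gamma>_def)
  have "ennreal \<bar>z (x + h) - z x\<bar> \<le> (\<integral>\<^sup>+t. ennreal (norm (indicator {0..1} t *\<^sub>R (gradient z (\<gamma> t) \<bullet> h))) \<partial>lborel)"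
    using integral_norm_bound_ennreal[OF i] unfolding e by simp
  also have "\<dots> \<le> (\<integral>\<^sup>+t. ennreal (norm h) * (indicator {0..1} t * ennreal (indicator B (\<gamma> t) * norm (gradient z (\<gamma> t)))) \<partial>lborel)"
  proof (rule nn_integral_mono)
    fix t :: real
    show "ennreal (norm (indicator {0..1} t *\<^sub>R (gradient z (\<gamma> t) \<bullet> h)))
      \<le> ennreal (norm h) * (indicator {0..1} t * ennreal (indicator B (\<gamma> t) * norm (gradient z (\<gamma> t))))"
    proof (cases "t \<in> {0..1}")
      case True
      then show ?thesis using \<gamma>[OF True] Cauchy_Schwarz_ineq2[of "gradient z (\<gamma> t)" h]
        by (simp add: ennreal_mult[symmetric] ennreal_leI mult.commute)
    qed simp
  qed
  also have "\<dots> = ennreal (norm h) * (\<integral>\<^sup>+t. indicator {0..1} t * ennreal (indicator B (\<gamma> t) * norm (gradient z (\<gamma> t))) \<partial>lborel)"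
    unfolding \<gamma>_def by (intro nn_integral_cmult) measurable
  finally show ?thesis unfolding \<gamma>_def .
qed

text \<open>A Poincare inequality in L1. After substituting y = x + h and applying the segment
  bound, x is integrated before t: translation invariance removes the shift by t h, leaving the
  gradient integral times the volume of the admissible h.\<close>

lemma mean_oscillation_le_gradient:
  fixes z :: "'a::euclidean_space \<Rightarrow> real"
  assumes B: "convex B" "B \<in> sets borel" and z: "\<And>x. x \<in> B \<Longrightarrow> z differentiable (at x)" "continuous_on B (gradient z)"
    and d: "\<And>x y. x \<in> B \<Longrightarrow> y \<in> B \<Longrightarrow> norm (y - x) \<le> d"
  shows "(\<integral>\<^sup>+x. \<integral>\<^sup>+y. indicator B x * (indicator B y * ennreal \<bar>z y - z x\<bar>) \<partial>lborel \<partial>lborel) \<le>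
    ennreal d * emeasure lborel (cball (0::'a) d) * (\<integral>\<^sup>+x. indicator B x * ennreal (norm (gradient z x)) \<partial>lborel)"
proof -
  define G where "G y = ennreal (indicator B y * norm (gradient z y))" for y
  have "(\<lambda>y. indicator B y *\<^sub>R gradient z y) \<in> borel_measurable borel"
    by (rule borel_measurable_continuous_on_indicator[OF B(2) z(2)])
  then have "(\<lambda>y. norm (indicator B y *\<^sub>R gradient z y)) \<in> borel_measurable borel" by measurable
  then have [measurable]: "G \<in> borel_measurable borel" unfolding G_def by simp
  have cz: "continuous_on B z"
    by (intro continuous_at_imp_continuous_on ballI differentiable_imp_continuous_within z(1))
  have mz [measurable]: "(\<lambda>y. indicator B y * z y) \<in> borel_measurable borel"
    using borel_measurable_continuous_on_indicator[OF B(2) cz] by simp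
  have [measurable]: "B \<in> sets borel" "cball (0::'a) d \<in> sets borel" using B(2) by auto
  have mG2: "(\<lambda>(p, t). indicator {0..1::real} t * G (fst p + t *\<^sub>R snd p)) \<in> borel_measurable ((borel \<Otimes>\<^sub>M borel) \<Otimes>\<^sub>M lborel)"
    by measurable
  have mG3 [measurable]: "(\<lambda>p. \<integral>\<^sup>+t. indicator {0..1::real} t * G (fst p + t *\<^sub>R snd p) \<partial>lborel) \<in> borel_measurable (borel \<Otimes>\<^sub>M borel)"
    using lborel.borel_measurable_nn_integral[OF mG2] by simp
  have mF: "(\<lambda>p. indicator (cball 0 d) (snd p) * (ennreal d * (\<integral>\<^sup>+t. indicator {0..1::real} t * G (fst p + t *\<^sub>R snd p) \<partial>lborel))) \<in> borel_measurable (borel \<Otimes>\<^sub>M borel)"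
    by measurable
  have "(\<integral>\<^sup>+x. \<integral>\<^sup>+y. indicator B x * (indicator B y * ennreal \<bar>z y - z x\<bar>) \<partial>lborel \<partial>lborel)
    \<le> (\<integral>\<^sup>+x. \<integral>\<^sup>+h. indicator (cball 0 d) h * (ennreal d * (\<integral>\<^sup>+t. indicator {0..1::real} t * G (x + t *\<^sub>R h) \<partial>lborel)) \<partial>lborel \<partial>lborel)"
  proof (rule nn_integral_mono)
    fix x :: 'a
    have "(\<integral>\<^sup>+y. indicator B x * (indicator B y * ennreal \<bar>z y - z x\<bar>) \<partial>lborel) =
        (\<integral>\<^sup>+y. indicator B x * (indicator B y * ennreal \<bar>indicator B y * z y - z x\<bar>) \<partial>lborel)"
      by (intro nn_integral_cong) (simp add: indicator_def)
    also have "\<dots> = (\<integral>\<^sup>+h. indicator B x * (indicator B (x + h) * ennreal \<bar>indicator B (x + h) * z (x + h) - z x\<bar>) \<partial>lborel)"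
      by (rule nn_integral_lborel_translation) measurable
    also have "\<dots> \<le> (\<integral>\<^sup>+h. indicator (cball 0 d) h * (ennreal d * (\<integral>\<^sup>+t. indicator {0..1::real} t * G (x + t *\<^sub>R h) \<partial>lborel)) \<partial>lborel)"
    proof (rule nn_integral_mono)
      fix h :: 'a
      show "indicator B x * (indicator B (x + h) * ennreal \<bar>indicator B (x + h) * z (x + h) - z x\<bar>)
        \<le> indicator (cball 0 d) h * (ennreal d * (\<integral>\<^sup>+t. indicator {0..1::real} t * G (x + t *\<^sub>R h) \<partial>lborel))"
      proof (cases "x \<in> B \<and> x + h \<in> B")
        case True
        then have h: "norm h \<le> d" using d[of x "x + h"] by simp
        have "ennreal \<bar>z (x + h) - z x\<bar> \<le> ennreal (norm h) * (\<integral>\<^sup>+t. indicator {0..1} t * G (x + t *\<^sub>R h) \<partial>lborel)"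
          unfolding G_def using True by (intro difference_le_gradient_integral[OF B z]) auto
        also have "\<dots> \<le> ennreal d * (\<integral>\<^sup>+t. indicator {0..1} t * G (x + t *\<^sub>R h) \<partial>lborel)"
          using h by (intro mult_right_mono ennreal_leI) auto
        finally show ?thesis using True h by simp
      qed (auto simp: indicator_def)
    qed
    finally show "(\<integral>\<^sup>+y. indicator B x * (indicator B y * ennreal \<bar>z y - z x\<bar>) \<partial>lborel)
      \<le> (\<integral>\<^sup>+h. indicator (cball 0 d) h * (ennreal d * (\<integral>\<^sup>+t. indicator {0..1::real} t * G (x + t *\<^sub>R h) \<partial>lborel)) \<partial>lborel)" .
  qed
  also have "\<dots> = (\<integral>\<^sup>+h. \<integral>\<^sup>+x. indicator (cball 0 d) h * (ennreal d * (\<integral>\<^sup>+t. indicator {0..1::real} t * G (x + t *\<^sub>R h) \<partial>lborel)) \<partial>lborel \<partial>lborel)"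
    by (rule lborel_pair.Fubini'[symmetric]) (use mF in \<open>simp add: case_prod_unfold cong: measurable_cong_sets sets_pair_measure_cong\<close>)
  also have "\<dots> = (\<integral>\<^sup>+h. indicator (cball 0 d) h * (ennreal d * (\<integral>\<^sup>+x. G x \<partial>lborel)) \<partial>(lborel :: 'a measure))"
  proof (rule nn_integral_cong)
    fix h :: 'a
    have "(\<integral>\<^sup>+x. \<integral>\<^sup>+t. indicator {0..1::real} t * G (x + t *\<^sub>R h) \<partial>lborel \<partial>lborel)
        = (\<integral>\<^sup>+t. \<integral>\<^sup>+x. indicator {0..1::real} t * G (x + t *\<^sub>R h) \<partial>lborel \<partial>lborel)"
      by (rule lborel_pair.Fubini'[symmetric]) measurable
    also have "\<dots> = (\<integral>\<^sup>+t. indicator {0..1::real} t * (\<integral>\<^sup>+x. G x \<partial>lborel) \<partial>lborel)"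
    proof (rule nn_integral_cong)
      fix t :: real
      have "(\<integral>\<^sup>+x. G (x + t *\<^sub>R h) \<partial>lborel) = (\<integral>\<^sup>+x. G x \<partial>lborel)"
        using nn_integral_lborel_translation[of G "t *\<^sub>R h"] by (simp add: add.commute)
      then show "(\<integral>\<^sup>+x. indicator {0..1} t * G (x + t *\<^sub>R h) \<partial>lborel) = indicator {0..1} t * (\<integral>\<^sup>+x. G x \<partial>lborel)"
        by (simp add: nn_integral_cmult)
    qed
    also have "\<dots> = (\<integral>\<^sup>+x. G x \<partial>lborel)" by (simp add: nn_integral_multc)
    finally show "(\<integral>\<^sup>+x. indicator (cball 0 d) h * (ennreal d * (\<integral>\<^sup>+t. indicator {0..1::real} t * G (x + t *\<^sub>R h) \<partial>lborel)) \<partial>lborel)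
      = indicator (cball 0 d) h * (ennreal d * (\<integral>\<^sup>+x. G x \<partial>lborel))"
      by (simp add: nn_integral_cmult)
  qed
  also have "\<dots> = (\<integral>\<^sup>+h. (ennreal d * (\<integral>\<^sup>+x. G x \<partial>lborel)) * indicator (cball 0 d) h \<partial>(lborel :: 'a measure))"
    by (simp only: mult.commute)
  also have "\<dots> = (ennreal d * (\<integral>\<^sup>+x. G x \<partial>lborel)) * emeasure lborel (cball (0::'a) d)"
    by (rule nn_integral_cmult_indicator) simp
  also have "\<dots> = ennreal d * emeasure lborel (cball (0::'a) d) * (\<integral>\<^sup>+x. G x \<partial>lborel)" by (simp only: ac_simps)
  also have "(\<integral>\<^sup>+x. G x \<partial>lborel) = (\<integral>\<^sup>+x. indicator B x * ennreal (norm (gradient z x)) \<partial>lborel)"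
    unfolding G_def by (intro nn_integral_cong) (simp add: indicator_def)
  finally show ?thesis .
qed

text \<open>\<open>D\<close>, the double integral of |\<zeta> y - \<zeta> x| over the ball, is at
  most the oscillation of z j plus twice its L1 distance to \<zeta>, up to constant factors. All of
  this tends to 0, so D = 0.\<close>

lemma AE_ball_const_if_gradient_tendsto_0:
  fixes z :: "nat \<Rightarrow> 'a::euclidean_space \<Rightarrow> real"
  assumes z: "\<And>j x. x \<in> ball p r \<Longrightarrow> z j differentiable (at x)" "\<And>j. continuous_on (ball p r) (gradient (z j))"
    and r: "0 < r" and \<zeta> [measurable]: "\<zeta> \<in> borel_measurable borel"
    and lim: "(\<lambda>j. \<integral>\<^sup>+x. indicator (ball p r) x * ennreal \<bar>z j x - \<zeta> x\<bar> \<partial>lborel) \<longlonglongrightarrow> 0"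
    and grad: "(\<lambda>j. \<integral>\<^sup>+x. indicator (ball p r) x * ennreal (norm (gradient (z j) x)) \<partial>lborel) \<longlonglongrightarrow> 0"
  obtains C where "AE x in lborel. x \<in> ball p r \<longrightarrow> \<zeta> x = C"
proof -
  let ?B = "ball p r"
  define b :: "'a \<Rightarrow> ennreal" where "b = indicator ?B"
  have [measurable]: "b \<in> borel_measurable borel" unfolding b_def by (intro borel_measurable_indicator) simp
  define V where "V = emeasure lborel ?B"
  define E where "E j = (\<integral>\<^sup>+x. b x * ennreal \<bar>z j x - \<zeta> x\<bar> \<partial>lborel)" for j
  define I where "I j = (\<integral>\<^sup>+x. b x * ennreal (norm (gradient (z j) x)) \<partial>lborel)" for j
  define D where "D = (\<integral>\<^sup>+x. \<integral>\<^sup>+y. b x * (b y * ennreal \<bar>\<zeta> y - \<zeta> x\<bar>) \<partial>lborel \<partial>lborel)"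
  define K where "K = ennreal (2 * r) * emeasure lborel (cball (0::'a) (2 * r))"
  have V: "V < top" using emeasure_bounded_finite[OF bounded_ball, of p r] by (simp add: V_def less_top[symmetric])
  have K: "K < top" unfolding K_def using emeasure_bounded_finite[OF bounded_cball, of "0::'a" "2 * r"]
    by (simp add: ennreal_mult_less_top)
  have b_int: "(\<integral>\<^sup>+x. b x \<partial>lborel) = V" by (simp add: b_def V_def)
  have bound: "D \<le> V * E j + K * I j + V * E j" for j
  proof -
    have cz: "continuous_on ?B (z j)"
      by (intro continuous_at_imp_continuous_on ballI differentiable_imp_continuous_within z(1))
    define w where "w y = indicator ?B y * z j y" for y
    have [measurable]: "w \<in> borel_measurable borel"
      using borel_measurable_continuous_on_indicator[OF _ cz] by (simp add: w_def[abs_def])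
    have bw: "b y * ennreal \<bar>z j y - u\<bar> = b y * ennreal \<bar>w y - u\<bar>" for y u by (simp add: b_def w_def indicator_def)
    have bw2: "b x * (b y * ennreal \<bar>z j y - z j x\<bar>) = b x * (b y * ennreal \<bar>w y - w x\<bar>)" for x y
      by (simp add: b_def w_def indicator_def)
    have "D \<le> (\<integral>\<^sup>+x. \<integral>\<^sup>+y. b x * (b y * ennreal \<bar>w y - \<zeta> y\<bar>) + b x * (b y * ennreal \<bar>w y - w x\<bar>) + b y * (b x * ennreal \<bar>w x - \<zeta> x\<bar>) \<partial>lborel \<partial>lborel)"
      unfolding D_def
    proof (intro nn_integral_mono)
      fix x y
      have "\<bar>\<zeta> y - \<zeta> x\<bar> \<le> \<bar>w y - \<zeta> y\<bar> + \<bar>w y - w x\<bar> + \<bar>w x - \<zeta> x\<bar>" by linarith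
      then have "ennreal \<bar>\<zeta> y - \<zeta> x\<bar> \<le> ennreal \<bar>w y - \<zeta> y\<bar> + ennreal \<bar>w y - w x\<bar> + ennreal \<bar>w x - \<zeta> x\<bar>"
        by (simp add: ennreal_plus[symmetric] ennreal_leI del: ennreal_plus)
      then show "b x * (b y * ennreal \<bar>\<zeta> y - \<zeta> x\<bar>)
        \<le> b x * (b y * ennreal \<bar>w y - \<zeta> y\<bar>) + b x * (b y * ennreal \<bar>w y - w x\<bar>) + b y * (b x * ennreal \<bar>w x - \<zeta> x\<bar>)"
        by (simp add: b_def indicator_def)
    qed
    also have "\<dots> = (\<integral>\<^sup>+x. b x * E j + (\<integral>\<^sup>+y. b x * (b y * ennreal \<bar>w y - w x\<bar>) \<partial>lborel) + V * (b x * ennreal \<bar>w x - \<zeta> x\<bar>) \<partial>lborel)"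
      by (intro nn_integral_cong) (simp add: nn_integral_add nn_integral_cmult nn_integral_multc b_int E_def bw)
    also have "\<dots> = V * E j + (\<integral>\<^sup>+x. \<integral>\<^sup>+y. b x * (b y * ennreal \<bar>w y - w x\<bar>) \<partial>lborel \<partial>lborel) + V * E j"
      by (simp add: nn_integral_add nn_integral_cmult nn_integral_multc b_int E_def bw)
    also have "(\<integral>\<^sup>+x. \<integral>\<^sup>+y. b x * (b y * ennreal \<bar>w y - w x\<bar>) \<partial>lborel \<partial>lborel) \<le> K * I j"
      unfolding bw2[symmetric] unfolding K_def I_def b_def
    proof (rule mean_oscillation_le_gradient)
      show "norm (y - x) \<le> 2 * r" if "x \<in> ?B" "y \<in> ?B" for x y
        using that dist_triangle[of y x p] by (simp add: dist_norm norm_minus_commute)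
    qed (use z in auto)
    finally show ?thesis by (simp add: add_mono)
  qed
  have "(\<lambda>j. V * E j + K * I j + V * E j) \<longlonglongrightarrow> V * 0 + K * 0 + V * 0"
    using lim grad unfolding E_def I_def b_def by (intro tendsto_add ennreal_tendsto_cmult V K)
  then have "D \<le> V * 0 + K * 0 + V * 0" by (rule LIMSEQ_le_const) (use bound in auto)
  then have D0: "D = 0" by simp
  have "AE x in lborel. (\<integral>\<^sup>+y. b x * (b y * ennreal \<bar>\<zeta> y - \<zeta> x\<bar>) \<partial>lborel) = 0"
    using D0 unfolding D_def by (subst (asm) nn_integral_0_iff_AE) measurable
  then have AE0: "AE x in lborel. AE y in lborel. b x * (b y * ennreal \<bar>\<zeta> y - \<zeta> x\<bar>) = 0"
    by (rule eventually_mono) (subst (asm) nn_integral_0_iff_AE, measurable)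
  \<comment> \<open>The exceptional set is null and the ball is not, so a reference point can be
    found in the ball.\<close>
  have "\<exists>x\<in>?B. AE y in lborel. b x * (b y * ennreal \<bar>\<zeta> y - \<zeta> x\<bar>) = 0"
  proof (rule ccontr)
    assume "\<not> ?thesis"
    with AE0 have "AE x in lborel. x \<notin> ?B" by (auto elim: eventually_mono)
    then have "?B \<in> null_sets lborel" by (subst AE_iff_null_sets) auto
    then have "negligible ?B" by (simp add: negligible_iff_null_sets null_sets_completionI)
    then show False using open_not_negligible[of ?B] r by simp
  qed
  then obtain x where x: "x \<in> ?B" "AE y in lborel. b x * (b y * ennreal \<bar>\<zeta> y - \<zeta> x\<bar>) = 0" by blast
  show thesis
  proof (rule that[of "\<zeta> x"])
    show "AE y in lborel. y \<in> ?B \<longrightarrow> \<zeta> y = \<zeta> x"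
      using x(2) by eventually_elim (use x(1) in \<open>auto simp: b_def indicator_def split: if_splits\<close>)
  qed
qed

text \<open>Local constants at nearby centres agree, because an open nonempty overlap is not a null
  set; connectedness makes them all equal. The exceptional set is then locally negligible, hence
  negligible.\<close>

lemma AE_const_connected:
  fixes \<zeta> :: "'a::euclidean_space \<Rightarrow> real"
  assumes \<Omega>: "open \<Omega>" "connected \<Omega>" "\<Omega> \<noteq> {}"
    and loc: "\<And>p. p \<in> \<Omega> \<Longrightarrow> \<exists>r>0. \<exists>C. AE x in lborel. x \<in> ball p r \<longrightarrow> \<zeta> x = C"
  obtains C where "AE x in lebesgue_on \<Omega>. \<zeta> x = C"
proof -
  have "\<exists>C. \<exists>r>0. AE x in lborel. x \<in> ball p r \<longrightarrow> \<zeta> x = C" if "p \<in> \<Omega>" for p using loc[OF that] by blast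
  then obtain \<kappa> where \<kappa>: "\<And>p. p \<in> \<Omega> \<Longrightarrow> \<exists>r>0. AE x in lborel. x \<in> ball p r \<longrightarrow> \<zeta> x = \<kappa> p" by metis
  have const: "\<kappa> p = \<kappa> q" if "p \<in> \<Omega>" "q \<in> \<Omega>" for p q
  proof (rule connected_local_const[OF \<Omega>(2) that])
    show "\<forall>p\<in>\<Omega>. eventually (\<lambda>q. \<kappa> p = \<kappa> q) (at p within \<Omega>)"
    proof
      fix p assume p: "p \<in> \<Omega>"
      then obtain r where r: "0 < r" "AE x in lborel. x \<in> ball p r \<longrightarrow> \<zeta> x = \<kappa> p" using \<kappa> by blast
      have "\<kappa> p = \<kappa> q" if q: "q \<in> \<Omega>" "dist q p < r" for q
      proof (rule ccontr)
        assume ne: "\<kappa> p \<noteq> \<kappa> q"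
        obtain r' where r': "0 < r'" "AE x in lborel. x \<in> ball q r' \<longrightarrow> \<zeta> x = \<kappa> q" using \<kappa> q by blast
        have "AE x in lborel. x \<notin> ball p r \<inter> ball q r'"
          using r(2) r'(2) by eventually_elim (use ne in auto)
        then have "ball p r \<inter> ball q r' \<in> null_sets lborel" by (subst AE_iff_null_sets) auto
        then have "negligible (ball p r \<inter> ball q r')" by (simp add: negligible_iff_null_sets null_sets_completionI)
        moreover have "q \<in> ball p r \<inter> ball q r'" using q r'(1) by (simp add: dist_commute)
        moreover have "open (ball p r \<inter> ball q r')" by auto
        ultimately show False using open_not_negligible by blast
      qed
      then show "eventually (\<lambda>q. \<kappa> p = \<kappa> q) (at p within \<Omega>)"
        using r(1) by (auto simp: eventually_at)
    qed
  qed
  obtain p0 where p0: "p0 \<in> \<Omega>" using \<Omega>(3) by blast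
  define N where "N = {x \<in> \<Omega>. \<zeta> x \<noteq> \<kappa> p0}"
  have "negligible N"
  proof (subst locally_negligible_alt, intro ballI)
    fix p assume p: "p \<in> N"
    then have p\<Omega>: "p \<in> \<Omega>" by (simp add: N_def)
    then obtain r where r: "0 < r" "AE x in lborel. x \<in> ball p r \<longrightarrow> \<zeta> x = \<kappa> p" using \<kappa> by blast
    obtain N' where N': "{x \<in> space lborel. \<not> (x \<in> ball p r \<longrightarrow> \<zeta> x = \<kappa> p)} \<subseteq> N'" "N' \<in> null_sets lborel"
      using r(2) unfolding eventually_ae_filter by blast
    have "negligible N'" using N'(2) by (simp add: negligible_iff_null_sets null_sets_completionI)
    moreover have "N \<inter> ball p r \<subseteq> N'" using N'(1) const[OF p\<Omega> p0] by (auto simp: N_def)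
    ultimately have "negligible (N \<inter> ball p r)" by (rule negligible_subset)
    moreover have "openin (top_of_set N) (N \<inter> ball p r)" by (auto intro: openin_open_Int)
    ultimately show "\<exists>U. openin (top_of_set N) U \<and> p \<in> U \<and> negligible U" using p r(1) by (intro exI[of _ "N \<inter> ball p r"]) auto
  qed
  then have "AE x in lebesgue. x \<notin> N" using AE_not_in by (auto simp: negligible_iff_null_sets)
  then have "AE x in lebesgue_on \<Omega>. \<zeta> x = \<kappa> p0"
    using \<Omega>(1) by (subst AE_restrict_space_iff) (auto simp: N_def elim: eventually_mono)
  then show thesis by (rule that)
qed

lemma L2_tendsto_0_imp_nn_integral_tendsto_0:
  fixes G :: "nat \<Rightarrow> 'a::euclidean_space \<Rightarrow> 'b::euclidean_space"
  assumes \<Omega>: "open \<Omega>" "bounded \<Omega>" and G: "\<And>j. G j \<in> borel_measurable borel"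
    and lim: "L2_tendsto (lebesgue_on \<Omega>) G (\<lambda>_. 0)"
  shows "(\<lambda>j. \<integral>\<^sup>+x. indicator \<Omega> x * ennreal (norm (G j x)) \<partial>lborel) \<longlonglongrightarrow> 0"
proof -
  have fin: "finite_measure (lebesgue_on \<Omega>)" by (rule finite_measure_bounded_open[OF \<Omega>])
  have [measurable]: "G j \<in> borel_measurable (lebesgue_on \<Omega>)" for j using lim by (simp add: L2_tendsto_def L2_def)
  have "(\<lambda>x. norm (G j x)) \<in> borel_measurable (lebesgue_on \<Omega>)" for j by measurable
  then have nlim: "L2_tendsto (lebesgue_on \<Omega>) (\<lambda>j x. norm (G j x)) (\<lambda>_. 0)"
    using lim by (simp add: L2_tendsto_def L2_def)
  have "(\<lambda>j. LINT x|lebesgue_on \<Omega>. norm (G j x)) \<longlonglongrightarrow> 0"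
    using L2_tendsto_imp_integral_tendsto[OF fin nlim] by simp
  then have "(\<lambda>j. ennreal (LINT x|lebesgue_on \<Omega>. norm (G j x))) \<longlonglongrightarrow> ennreal 0" by (rule tendsto_ennrealI)
  moreover have "ennreal (LINT x|lebesgue_on \<Omega>. norm (G j x)) = (\<integral>\<^sup>+x. indicator \<Omega> x * ennreal (norm (G j x)) \<partial>lborel)" for j
  proof -
    have "L2 (lebesgue_on \<Omega>) (\<lambda>x. norm (G j x))" using nlim by (auto simp: L2_tendsto_def)
    then have "integrable (lebesgue_on \<Omega>) (\<lambda>x. norm (G j x))" by (rule finite_measure.L2_imp_integrable[OF fin])
    then have "ennreal (LINT x|lebesgue_on \<Omega>. norm (G j x)) = (\<integral>\<^sup>+x. ennreal (norm (G j x)) \<partial>lebesgue_on \<Omega>)"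
      by (intro nn_integral_eq_integral[symmetric]) auto
    also have "\<dots> = (\<integral>\<^sup>+x. ennreal (norm (G j x)) * indicator \<Omega> x \<partial>lebesgue)"
      using \<Omega>(1) by (intro nn_integral_restrict_space) auto
    also have "\<dots> = (\<integral>\<^sup>+x. ennreal (norm (G j x)) * indicator \<Omega> x \<partial>lborel)"
      using G[of j] \<Omega>(1) by (intro nn_integral_completion)
    finally show ?thesis by (simp add: mult.commute)
  qed
  ultimately show ?thesis by simp
qed

section \<open>Picone's identity and the shape of the profile\<close>

text \<open>The divergence theorem asks for weights continuous on the line; freezing a function at
  the end points of [b, 1] provides them.\<close>

lemma continuous_on_clamp:
  fixes g :: "real \<Rightarrow> 'a::topological_space"
  assumes "continuous_on {b..1} g" "b \<le> 1"
  shows "continuous_on UNIV (\<lambda>s. g (max b (min s 1)))"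
  by (rule continuous_on_compose2[OF assms(1)]) (use assms(2) in \<open>auto intro!: continuous_intros\<close>)

lemma L2_tendsto_imp_diff_tendsto_0:
  assumes "L2_tendsto M F f"
  shows "L2_tendsto M (\<lambda>k x. F k x - f x) (\<lambda>_. 0)"
  using assms by (simp add: L2_tendsto_def L2_diff L2_zero)

locale radial_profile = robin_solution R\<^sub>1 R\<^sub>2 c a A H L n \<beta> lam v f
  for R\<^sub>1 R\<^sub>2 c a :: real and A :: "(real ^ 'n) set" and H L n \<beta> lam v f +
  fixes P \<Phi> :: "real \<Rightarrow> real"
  assumes P_cont: "continuous_on {a..1} P" and \<Phi>_cont: "continuous_on {a..1} \<Phi>"
    and P_deriv: "\<And>t. t \<in> {a..1} \<Longrightarrow> (P has_real_derivative \<Phi> t / (4 * t powr (n / 2))) (at t within {a..1})"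
    and \<Phi>_deriv: "\<And>t. t \<in> {a..1} \<Longrightarrow> (\<Phi> has_real_derivative - (\<Lambda> * (t powr (n / 2 - 1) * P t))) (at t within {a..1})"
    and P_1: "P 1 = c * \<tau>" and \<Phi>_1: "\<Phi> 1 = - (\<beta>\<^sub>R * \<tau>)"
    and radial_integral: "\<And>q B. q \<in> borel_measurable borel \<Longrightarrow> (\<And>s. \<bar>q s\<bar> \<le> B) \<Longrightarrow>
      (LINT x|lebesgue_on A. q (rad x) * v x) = (LINT s|lborel. indicator {a..1} s * (q s * (s powr (n / 2 - 1) * P s)))"
begin

lemma at_within_open_interval: "t \<in> {a<..<1} \<Longrightarrow> at t within {a..1} = at t"
  by (rule at_within_interior) simp

lemma P_DERIV: "t \<in> {a<..<1} \<Longrightarrow> (P has_real_derivative \<Phi> t / (4 * t powr (n / 2))) (at t)"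
  using P_deriv[of t] at_within_open_interval[of t] by simp

lemma \<Phi>_DERIV: "t \<in> {a<..<1} \<Longrightarrow> (\<Phi> has_real_derivative - (\<Lambda> * (t powr (n / 2 - 1) * P t))) (at t)"
  using \<Phi>_deriv[of t] at_within_open_interval[of t] by simp

lemma shell_profile_pos:
  assumes "a \<le> x" "x < y" "y \<le> 1"
  shows "0 < (LINT s|lborel. indicator {a..1} s * (indicator {x<..<y} s * (s powr (n / 2 - 1) * P s)))"
  using shell_integral_pos[OF assms] radial_integral[of "indicator {x<..<y}" 1] by (simp add: indicator_def[abs_def] split: if_splits)

section \<open>Positivity and monotonicity of the profile\<close>

text \<open>By continuity a negative value would persist on an interval, against the positive
  integrals over shells.\<close>

lemma P_nonneg: "0 \<le> P t" if t: "t \<in> {a..1}"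
proof (rule ccontr)
  assume neg: "\<not> 0 \<le> P t"
  then obtain \<delta> where \<delta>: "0 < \<delta>" "\<And>s. s \<in> {a..1} \<Longrightarrow> dist s t < \<delta> \<Longrightarrow> dist (P s) (P t) < - P t"
    using P_cont t unfolding continuous_on_iff by (metis neg_0_less_iff_less not_le)
  \<comment> \<open>A neighbourhood of \<open>t\<close> trimmed to [a, 1]; it has positive length
    also when \<open>t\<close> is an end point.\<close>
  define x y where "x = max a (t - \<delta> / 2)" and "y = min 1 (t + \<delta> / 2)"
  have xy: "a \<le> x" "x < y" "y \<le> 1" using t a_bounds \<delta>(1) by (auto simp: x_def y_def)
  have "0 \<le> (LINT s|lborel. - (indicator {a..1} s * (indicator {x<..<y} s * (s powr (n / 2 - 1) * P s))))"
  proof (rule Bochner_Integration.integral_nonneg)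
    fix s :: real
    show "0 \<le> - (indicator {a..1} s * (indicator {x<..<y} s * (s powr (n / 2 - 1) * P s)))"
    proof (cases "s \<in> {x<..<y}")
      case True
      then have "s \<in> {a..1}" "dist s t < \<delta>" using xy \<delta>(1) by (auto simp: x_def y_def dist_real_def)
      then have "\<bar>P s - P t\<bar> < - P t" using \<delta>(2)[of s] by (simp add: dist_real_def)
      then have "P s \<le> 0" by linarith
      then show ?thesis by (simp add: indicator_def mult_nonneg_nonpos)
    qed simp
  qed
  then show False using shell_profile_pos[OF xy] by simp
qed

text \<open>Both \<open>lam\<close> and \<open>P\<close> are nonnegative, so the flux cannot
  grow.\<close>

lemma \<Phi>_antimono: "\<Phi> t \<le> \<Phi> s" if "a \<le> s" "s \<le> t" "t \<le> 1"
proof (rule DERIV_nonpos_imp_decreasing_open[OF that(2)])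
  show "\<exists>y. (\<Phi> has_real_derivative y) (at x) \<and> y \<le> 0" if x: "s < x" "x < t" for x
  proof (intro exI conjI)
    have xa: "x \<in> {a<..<1}" using x \<open>a \<le> s\<close> \<open>t \<le> 1\<close> by simp
    show "(\<Phi> has_real_derivative - (\<Lambda> * (x powr (n / 2 - 1) * P x))) (at x)" by (rule \<Phi>_DERIV[OF xa])
    have "0 \<le> \<Lambda> * (x powr (n / 2 - 1) * P x)"
      using xa by (intro mult_nonneg_nonneg lam_nonneg P_nonneg) auto
    then show "- (\<Lambda> * (x powr (n / 2 - 1) * P x)) \<le> 0" by simp
  qed
  show "continuous_on {s..t} \<Phi>" using \<Phi>_cont by (rule continuous_on_subset) (use that in auto)
qed

text \<open>P' is \<Phi> divided by a positive factor, so the sign of the flux decides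
  monotonicity.\<close>

lemma P_mono_sign:
  assumes st: "a \<le> s" "s \<le> t" "t \<le> 1"
  shows "(\<And>x. s < x \<Longrightarrow> x < t \<Longrightarrow> 0 \<le> \<Phi> x) \<Longrightarrow> P s \<le> P t"
    and "(\<And>x. s < x \<Longrightarrow> x < t \<Longrightarrow> \<Phi> x \<le> 0) \<Longrightarrow> P t \<le> P s"
    and "s < t \<Longrightarrow> (\<And>x. s < x \<Longrightarrow> x < t \<Longrightarrow> 0 < \<Phi> x) \<Longrightarrow> P s < P t"
    and "s < t \<Longrightarrow> (\<And>x. s < x \<Longrightarrow> x < t \<Longrightarrow> \<Phi> x < 0) \<Longrightarrow> P t < P s"
proof -
  have c: "continuous_on {s..t} P" using P_cont by (rule continuous_on_subset) (use st in auto)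
  have D: "(P has_real_derivative \<Phi> x / (4 * x powr (n / 2))) (at x)" and w: "0 < 4 * x powr (n / 2)" if "s < x" "x < t" for x
    using that st a_bounds P_DERIV[of x] by auto
  show "P s \<le> P t" if p: "\<And>x. s < x \<Longrightarrow> x < t \<Longrightarrow> 0 \<le> \<Phi> x"
    by (rule DERIV_nonneg_imp_increasing_open[OF st(2) _ c]) (use D p w in \<open>blast intro: divide_nonneg_pos\<close>)
  show "P t \<le> P s" if p: "\<And>x. s < x \<Longrightarrow> x < t \<Longrightarrow> \<Phi> x \<le> 0"
    by (rule DERIV_nonpos_imp_decreasing_open[OF st(2) _ c]) (use D p w in \<open>blast intro: divide_nonpos_pos\<close>)
  show "P s < P t" if "s < t" and p: "\<And>x. s < x \<Longrightarrow> x < t \<Longrightarrow> 0 < \<Phi> x"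
    by (rule DERIV_pos_imp_increasing_open[OF that(1) _ c]) (use D p w in \<open>blast intro: divide_pos_pos\<close>)
  show "P t < P s" if "s < t" and p: "\<And>x. s < x \<Longrightarrow> x < t \<Longrightarrow> \<Phi> x < 0"
    by (rule DERIV_neg_imp_decreasing_open[OF that(1) _ c]) (use D p w in \<open>blast intro: divide_neg_pos\<close>)
qed

text \<open>If \<tau> = 0, the nonincreasing flux ends at 0 and is nonnegative; then
  \<open>P\<close> increases to P 1 = 0 and vanishes identically, against the positive shell
  integrals.\<close>

lemma \<tau>_pos: "0 < \<tau>"
proof (rule ccontr)
  assume "\<not> 0 < \<tau>"
  moreover have "0 \<le> c * \<tau>" using P_nonneg[of 1] P_1 a_bounds by simp
  ultimately have \<tau>0: "\<tau> = 0" using c by (simp add: zero_le_mult_iff)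
  have "P t = 0" if t: "t \<in> {a..1}" for t
  proof -
    have "P t \<le> P 1" using t \<Phi>_antimono[of _ 1] \<Phi>_1 \<tau>0 by (intro P_mono_sign(1)) auto
    then show ?thesis using P_1 \<tau>0 P_nonneg[OF t] by simp
  qed
  then have zero: "indicator {a..1} s * (indicator {a<..<1} s * (s powr (n / 2 - 1) * P s)) = 0" for s
    by (simp add: indicator_def)
  show False using shell_profile_pos[of a 1] a_bounds unfolding zero by simp
qed

text \<open>Either \<Phi> t \<le> 0, and \<open>P\<close> decreases from t on, so P t \<ge> P 1 > 0;
  or the flux is positive up to t, and P t exceeds P a \<ge> 0. The point \<open>a\<close> itself is
  left open.\<close>

lemma P_pos: "0 < P t" if t: "t \<in> {a<..1}"
proof (cases "\<Phi> t \<le> 0")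
  case True
  have "P 1 \<le> P t"
  proof (rule P_mono_sign(2))
    show "\<Phi> x \<le> 0" if "t < x" "x < 1" for x using \<Phi>_antimono[of t x] that t True by simp
  qed (use t in auto)
  then show ?thesis using P_1 c \<tau>_pos mult_pos_pos[of c \<tau>] by linarith
next
  case False
  have "P a < P t"
  proof (rule P_mono_sign(3))
    show "0 < \<Phi> x" if "a < x" "x < t" for x using \<Phi>_antimono[of x t] that t False by simp
  qed (use t in auto)
  then show ?thesis using P_nonneg[of a] a_bounds by simp
qed

text \<open>On radial functions, \<open>\<kappa> (rad x) x\<close> is the logarithmic gradient of \<open>P (rad x)\<close>.\<close>

definition \<kappa> :: "real \<Rightarrow> real" where
  "\<kappa> s = \<Phi> s / (2 * R\<^sub>2\<^sup>2 * (s powr (n / 2) * P s))"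

text \<open>The value that the Riccati equation prescribes for the derivative of
  \<open>\<kappa>\<close>. So \<open>riccati\<close> is immediate, and the differential equation of
  the profile enters through \<open>\<kappa>_deriv\<close>.\<close>

definition \<kappa>' :: "real \<Rightarrow> real" where
  "\<kappa>' s = (- lam - n * \<kappa> s - (\<kappa> s)\<^sup>2 * s * R\<^sub>2\<^sup>2) / (2 * s)"

lemma riccati: "0 < s \<Longrightarrow> n * \<kappa> s + 2 * s * \<kappa>' s + (\<kappa> s)\<^sup>2 * s * R\<^sub>2\<^sup>2 = - lam"
  by (simp add: \<kappa>'_def)

text \<open>The Robin condition in logarithmic form. The left side is the coefficient with which the
  outer boundary term enters the divergence theorem for the weight \<open>\<kappa>\<close>.\<close>

lemma \<kappa>_1: "2 * c * \<kappa> 1 = - \<beta>"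
  using c \<tau>_pos R2 by (simp add: \<kappa>_def P_1 \<Phi>_1 field_simps)

lemma powr_deriv: "t \<in> {a..1} \<Longrightarrow> ((\<lambda>t. t powr (n / 2)) has_real_derivative n / 2 * (t powr (n / 2) / t)) (at t within {a..1})"
  using has_real_derivative_powr[of t "n / 2"] a_bounds
  by (auto simp: powr_diff intro: has_field_derivative_at_within)

lemma powr_minus_one: "t \<in> {a..1} \<Longrightarrow> t powr (n / 2 - 1) = t powr (n / 2) / t"
  using a_bounds by (simp add: powr_diff)

lemma \<kappa>_deriv:
  assumes t: "t \<in> {a..1}" and Pt: "P t \<noteq> 0"
  shows "(\<kappa> has_real_derivative \<kappa>' t) (at t within {a..1})"
proof -
  have nz: "t \<noteq> 0" "t powr (n / 2) \<noteq> 0" "R\<^sub>2\<^sup>2 \<noteq> 0" using t a_bounds R2 by auto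
  have "(\<kappa> has_real_derivative ((- (\<Lambda> * (t powr (n / 2 - 1) * P t))) * (2 * R\<^sub>2\<^sup>2 * (t powr (n / 2) * P t)) -
      \<Phi> t * (2 * R\<^sub>2\<^sup>2 * (t powr (n / 2) * (\<Phi> t / (4 * t powr (n / 2))) + (n / 2 * (t powr (n / 2) / t)) * P t))) /
      ((2 * R\<^sub>2\<^sup>2 * (t powr (n / 2) * P t)) * (2 * R\<^sub>2\<^sup>2 * (t powr (n / 2) * P t)))) (at t within {a..1})"
    unfolding \<kappa>_def[abs_def]
    by (intro DERIV_divide \<Phi>_deriv[OF t] DERIV_cmult DERIV_mult' powr_deriv[OF t] P_deriv[OF t]) (use nz Pt in simp)
  also have "(- (\<Lambda> * (t powr (n / 2 - 1) * P t))) * (2 * R\<^sub>2\<^sup>2 * (t powr (n / 2) * P t)) -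
      \<Phi> t * (2 * R\<^sub>2\<^sup>2 * (t powr (n / 2) * (\<Phi> t / (4 * t powr (n / 2))) + (n / 2 * (t powr (n / 2) / t)) * P t)) =
      (- (lam * R\<^sub>2\<^sup>2 * (t powr (n / 2) / t * P t))) * (2 * R\<^sub>2\<^sup>2 * (t powr (n / 2) * P t)) -
      \<Phi> t * (2 * R\<^sub>2\<^sup>2 * (t powr (n / 2) * (\<Phi> t / (4 * t powr (n / 2))) + (n / 2 * (t powr (n / 2) / t)) * P t))"
    unfolding powr_minus_one[OF t] ..
  also have "\<dots> / ((2 * R\<^sub>2\<^sup>2 * (t powr (n / 2) * P t)) * (2 * R\<^sub>2\<^sup>2 * (t powr (n / 2) * P t))) = \<kappa>' t"
  proof -
    \<comment> \<open>Powers, profile and flux are abstracted to variables, so that a purely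
      rational identity remains.\<close>
    have "(- (lam * R * (w / t * p)) * (2 * R * (w * p)) - \<phi> * (2 * R * (w * (\<phi> / (4 * w)) + (n / 2 * (w / t)) * p))) / ((2 * R * (w * p)) * (2 * R * (w * p)))
      = (- lam - n * (\<phi> / (2 * R * (w * p))) - (\<phi> / (2 * R * (w * p)))\<^sup>2 * t * R) / (2 * t)"
      if "w \<noteq> 0" "p \<noteq> 0" "R \<noteq> 0" for w p R \<phi> :: real
      using that nz(1) by (simp add: field_simps power2_eq_square)
    from this[OF nz(2) Pt nz(3)] show ?thesis unfolding \<kappa>'_def \<kappa>_def .
  qed
  finally show ?thesis .
qed

text \<open>\<open>\<kappa>\<close> is regular on any [b, 1] without zeros of \<open>P\<close>; the
  clamp extends it and its derivative continuously to the line.\<close>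

lemma \<kappa>_clamped:
  assumes b: "a \<le> b" "b < 1" and pos: "\<And>s. s \<in> {b..1} \<Longrightarrow> P s \<noteq> 0"
  shows "continuous_on UNIV (\<lambda>s. \<kappa> (max b (min s 1)))" "continuous_on UNIV (\<lambda>s. \<kappa>' (max b (min s 1)))"
    and "s \<in> {b..1} \<Longrightarrow> ((\<lambda>s. \<kappa> (max b (min s 1))) has_real_derivative \<kappa>' (max b (min s 1))) (at s within {b..1})"
proof -
  have d: "(\<kappa> has_real_derivative \<kappa>' s) (at s within {b..1})" if "s \<in> {b..1}" for s
    using that b by (intro DERIV_subset[OF \<kappa>_deriv[OF _ pos[OF that]]]) auto
  then have c1: "continuous_on {b..1} \<kappa>" by (intro DERIV_continuous_on)
  then have c2: "continuous_on {b..1} \<kappa>'"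
    unfolding \<kappa>'_def[abs_def] using b a_bounds by (intro continuous_intros) auto
  show "continuous_on UNIV (\<lambda>s. \<kappa> (max b (min s 1)))" "continuous_on UNIV (\<lambda>s. \<kappa>' (max b (min s 1)))"
    using b by (intro continuous_on_clamp c1 c2; simp)+
  show "((\<lambda>s. \<kappa> (max b (min s 1))) has_real_derivative \<kappa>' (max b (min s 1))) (at s within {b..1})" if s: "s \<in> {b..1}"
  proof -
    have "max b (min s 1) = s" using s by simp
    moreover have "((\<lambda>s. \<kappa> (max b (min s 1))) has_real_derivative \<kappa>' s) (at s within {b..1})"
      by (rule has_field_derivative_transform_within[OF d[OF s], of 1]) (use s in auto)
    ultimately show ?thesis by simp
  qed
qed

section \<open>Smooth approximants near the inner sphere and Picone's identity\<close>

text \<open>The support of \<open>f j\<close> is compact and misses the inner sphere, so on its part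
  with a \<le> rad x the function \<open>rad\<close> has a minimum greater than \<open>a\<close>,
  unless that part is empty.\<close>

lemma cut_exists: "\<exists>b. a < b \<and> b < 1 \<and> (\<forall>x. a < rad x \<longrightarrow> rad x \<le> b \<longrightarrow> x \<notin> spt (f j))"
proof -
  define K where "K = spt (f j) \<inter> {x. a \<le> rad x}"
  have K: "compact K" unfolding K_def
    by (intro compact_Int_closed test_functionsD(2)[OF f_test] closed_Collect_le continuous_on_rad continuous_on_const)
  obtain b where b: "a < b" "\<And>x. x \<in> K \<Longrightarrow> b \<le> rad x"
  proof (cases "K = {}")
    case True
    then show thesis using that[of 1] a_bounds by simp
  next
    case False
    then obtain x0 where x0: "x0 \<in> K" "\<And>x. x \<in> K \<Longrightarrow> rad x0 \<le> rad x"
      using continuous_attains_inf[OF K False continuous_on_subset[OF continuous_on_rad]] by auto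
    have "rad x0 \<noteq> a"
    proof
      assume "rad x0 = a"
      then have "(norm x0)\<^sup>2 = R\<^sub>1\<^sup>2" using R2 by (simp add: rad_def a_def power_divide)
      then have "norm x0 = R\<^sub>1" using R1 by (simp add: power2_eq_iff_nonneg)
      then show False using x0(1) f_spt[of j] by (auto simp: K_def)
    qed
    then show thesis using that[of "rad x0"] x0 by (auto simp: K_def)
  qed
  \<comment> \<open>Strictly between \<open>a\<close> and both \<open>b\<close> and 1, so that
    equality rad x = b' is excluded on the support as well.\<close>
  define b' where "b' = (a + min b 1) / 2"
  have "a < b'" "b' < 1" "b' < b" using b(1) a_bounds by (auto simp: b'_def)
  then show ?thesis using b(2) by (intro exI[of _ b']) (force simp: K_def)
qed

definition cut :: "nat \<Rightarrow> real" where
  "cut j = (SOME b. a < b \<and> b < 1 \<and> (\<forall>x. a < rad x \<longrightarrow> rad x \<le> b \<longrightarrow> x \<notin> spt (f j)))"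

lemma cut: "a < cut j" "cut j < 1"
  and f_cut: "a < rad x \<Longrightarrow> rad x \<le> cut j \<Longrightarrow> f j x = 0 \<and> gradient (f j) x = 0"
  using someI_ex[OF cut_exists[of j]] spt_not_in gradient_spt unfolding cut_def[symmetric] by blast+

text \<open>On the annulus this is \<open>P\<close> times the gradient of f j / P. The clamp acts
  there only where \<open>f j\<close> and its gradient vanish, and it makes the field continuous on
  the whole space.\<close>

definition defect :: "nat \<Rightarrow> real ^ 'n \<Rightarrow> real ^ 'n" where
  "defect j x = gradient (f j) x - (\<kappa> (max (cut j) (min (rad x) 1)) * f j x) *\<^sub>R x"

lemma f_cont: "continuous_on UNIV (f j)" "continuous_on UNIV (gradient (f j))"
  using test_functions_continuous[OF f_test] test_functions_continuous_gradient[OF f_test] by auto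

lemma P_nz_cut: "s \<in> {cut j..1} \<Longrightarrow> P s \<noteq> 0"
  using P_pos[of s] cut(1)[of j] by simp

lemma \<kappa>_cut:
  shows "continuous_on UNIV (\<lambda>s. \<kappa> (max (cut j) (min s 1)))" "continuous_on UNIV (\<lambda>s. \<kappa>' (max (cut j) (min s 1)))"
    and "s \<in> {cut j..1} \<Longrightarrow> ((\<lambda>s. \<kappa> (max (cut j) (min s 1))) has_real_derivative \<kappa>' (max (cut j) (min s 1))) (at s within {cut j..1})"
  using \<kappa>_clamped[OF less_imp_le[OF cut(1)[of j]] cut(2)[of j] P_nz_cut[where j = j]] by auto

lemma defect_cont: "continuous_on UNIV (defect j)"
  unfolding defect_def[abs_def]
  by (intro continuous_intros f_cont continuous_on_compose2[OF \<kappa>_cut(1) continuous_on_rad]) auto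

lemma defect_eq:
  assumes x: "x \<in> A"
  shows "gradient (f j) x = defect j x + (\<kappa> (rad x) * f j x) *\<^sub>R x"
proof (cases "rad x \<le> cut j")
  case True
  then show ?thesis using x f_cut[of x j] by (simp add: A_rad_iff defect_def)
next
  case False
  then have "max (cut j) (min (rad x) 1) = rad x" using x by (simp add: A_rad_iff)
  then show ?thesis by (simp add: defect_def)
qed

lemma inner_rad: "x \<bullet> x = rad x * R\<^sub>2\<^sup>2"
  using R2 by (simp add: rad_def power2_norm_eq_inner)

text \<open>Picone's identity for the comparison function \<open>P (rad x)\<close>; the Robin condition of \<open>P\<close> cancels the
  boundary term.\<close>

lemma picone:
  "(LINT x|lebesgue_on A. defect j x \<bullet> defect j x) =
    (LINT x|lebesgue_on A. gradient (f j) x \<bullet> gradient (f j) x) + \<beta> * (LINT \<omega>|H. f j \<omega> * f j \<omega>)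
    - lam * (LINT x|lebesgue_on A. f j x * f j x)"
proof -
  define k k' where "k s = \<kappa> (max (cut j) (min s 1))" and "k' s = \<kappa>' (max (cut j) (min s 1))" for s
  define F where "F = f j"
  have cF: "continuous_on UNIV F" "continuous_on UNIV (gradient F)" unfolding F_def by (rule f_cont)+
  have dF: "F differentiable (at x)" for x unfolding F_def by (rule test_functions_differentiable[OF f_test])
  have ck: "continuous_on UNIV (\<lambda>x. k (rad x))" "continuous_on UNIV (\<lambda>x. k' (rad x))"
    unfolding k_def k'_def
    by (rule continuous_on_compose2[OF \<kappa>_cut(1) continuous_on_rad] continuous_on_compose2[OF \<kappa>_cut(2) continuous_on_rad]; simp)+
  have g: "gradient (\<lambda>x. F x * F x) x = (2 * F x) *\<^sub>R gradient F x" for x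
    using gradient_mult[OF dF dF, of x] by (simp add: scaleR_add_left[symmetric])
  define X where "X x = (n * k (rad x) + 2 * rad x * k' (rad x)) * (F x * F x) + k (rad x) * (((2 * F x) *\<^sub>R gradient F x) \<bullet> x)" for x
  \<comment> \<open>The divergence theorem for k(rad x) F(x)^2 x. Since F vanishes where rad x = cut
    j, only the outer term survives, with coefficient \<open>2 * c * \<kappa> 1\<close>.\<close>
  have "(LINT x|lebesgue_on A. (n * k (rad x) + 2 * rad x * k' (rad x)) * (F x * F x) + k (rad x) * (gradient (\<lambda>x. F x * F x) x \<bullet> x))
    = 2 * c * (k 1 * (LINT \<omega>|H. F \<omega> * F \<omega>) - cut j powr (n / 2) * k (cut j) * (LINT \<omega>|H. F (sqrt (cut j) *\<^sub>R \<omega>) * F (sqrt (cut j) *\<^sub>R \<omega>)))"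
  proof (rule radial_identity)
    show "(\<lambda>x. F x * F x) differentiable (at x)" for x using dF by (intro differentiable_mult)
    show "continuous_on UNIV (gradient (\<lambda>x. F x * F x))"
      unfolding g[abs_def] by (intro continuous_intros cF)
    show "continuous_on UNIV k" "continuous_on UNIV k'" unfolding k_def[abs_def] k'_def[abs_def] by (rule \<kappa>_cut)+
    show "(k has_real_derivative k' s) (at s within {cut j..1})" if "s \<in> {cut j..1}" for s
      unfolding k_def[abs_def] k'_def by (rule \<kappa>_cut(3)[OF that])
    show "F x * F x = 0 \<and> gradient (\<lambda>x. F x * F x) x = 0" if "a < rad x" "rad x < cut j" for x
      unfolding g using f_cut[of x j] that by (simp add: F_def)
  qed (use cut[of j] in auto)
  moreover have "(LINT \<omega>|H. F (sqrt (cut j) *\<^sub>R \<omega>) * F (sqrt (cut j) *\<^sub>R \<omega>)) = 0"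
  proof (rule integral_eq_zero_AE)
    show "AE \<omega> in H. F (sqrt (cut j) *\<^sub>R \<omega>) * F (sqrt (cut j) *\<^sub>R \<omega>) = 0"
      using AE_H
    proof eventually_elim
      case (elim \<omega>)
      have "rad (sqrt (cut j) *\<^sub>R \<omega>) = cut j" using cut[of j] a_bounds elim by (intro rad_polar) auto
      then show ?case using f_cut[of "sqrt (cut j) *\<^sub>R \<omega>" j] cut[of j] by (simp add: F_def)
    qed
  qed
  moreover have "k 1 = \<kappa> 1" using cut(2)[of j] by (simp add: k_def)
  ultimately have intX: "(LINT x|lebesgue_on A. X x) = - \<beta> * (LINT \<omega>|H. F \<omega> * F \<omega>)"
    using \<kappa>_1 unfolding g X_def by (simp add: mult.assoc[symmetric])
  have pw: "defect j x \<bullet> defect j x = gradient F x \<bullet> gradient F x - lam * (F x * F x) - X x" if x: "x \<in> A" for x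
  proof (cases "rad x \<le> cut j")
    case True
    then have "F x = 0" "gradient F x = 0" using x f_cut[of x j] by (auto simp: A_rad_iff F_def)
    then show ?thesis by (simp add: defect_def X_def F_def)
  next
    case False
    then have m: "max (cut j) (min (rad x) 1) = rad x" using x by (simp add: A_rad_iff)
    then have kk: "k (rad x) = \<kappa> (rad x)" "k' (rad x) = \<kappa>' (rad x)" by (simp_all add: k_def k'_def)
    have "defect j x \<bullet> defect j x = gradient F x \<bullet> gradient F x - 2 * (\<kappa> (rad x) * F x) * (gradient F x \<bullet> x) + (\<kappa> (rad x))\<^sup>2 * rad x * R\<^sub>2\<^sup>2 * (F x * F x)"
    proof -
      have "defect j x \<bullet> defect j x = gradient F x \<bullet> gradient F x - 2 * (\<kappa> (rad x) * F x) * (gradient F x \<bullet> x) + (\<kappa> (rad x))\<^sup>2 * (F x * F x) * (x \<bullet> x)"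
        unfolding defect_def m F_def
        by (simp add: inner_diff_left inner_diff_right inner_commute[of x "gradient (f j) x"] power2_eq_square algebra_simps)
      then show ?thesis unfolding inner_rad[of x] by (simp add: algebra_simps)
    qed
    \<comment> \<open>The Riccati equation trades the quadratic term for -lam and the coefficient of
      F^2 in the divergence \<open>X\<close>.\<close>
    also have "(\<kappa> (rad x))\<^sup>2 * rad x * R\<^sub>2\<^sup>2 = - lam - (n * \<kappa> (rad x) + 2 * rad x * \<kappa>' (rad x))"
      using riccati[of "rad x"] x a_bounds by (simp add: A_rad_iff)
    finally show ?thesis unfolding X_def kk by (simp add: algebra_simps)
  qed
  have iX: "integrable (lebesgue_on A) X"
    unfolding X_def[abs_def] by (intro integrable_continuous_A continuous_intros ck cF continuous_on_rad)
  have iG: "integrable (lebesgue_on A) (\<lambda>x. gradient F x \<bullet> gradient F x)" and iF: "integrable (lebesgue_on A) (\<lambda>x. lam * (F x * F x))"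
    by (intro integrable_continuous_A continuous_intros cF)+
  have "(LINT x|lebesgue_on A. defect j x \<bullet> defect j x) = (LINT x|lebesgue_on A. gradient F x \<bullet> gradient F x - lam * (F x * F x) - X x)"
    by (rule Bochner_Integration.integral_cong) (use pw in auto)
  also have "\<dots> = (LINT x|lebesgue_on A. gradient F x \<bullet> gradient F x) - lam * (LINT x|lebesgue_on A. F x * F x) - (LINT x|lebesgue_on A. X x)"
    by (simp only: Bochner_Integration.integral_diff[OF Bochner_Integration.integrable_diff[OF iG iF] iX]
        Bochner_Integration.integral_diff[OF iG iF] integral_mult_right_zero)
  finally show ?thesis unfolding intX F_def by simp
qed

text \<open>By Picone's identity the square integral of the defect is the form of \<open>f j\<close>
  minus \<open>lam\<close> times its L2 form; the limit is zero because \<open>v\<close> is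
  admissible in its own weak equation.\<close>

lemma defect_tendsto: "L2_tendsto (lebesgue_on A) defect (\<lambda>_. 0)"
proof -
  have v: "v \<in> H1_vanishing (sphere 0 R\<^sub>1) A"
    unfolding H1_vanishing_def using v_H1 f_test f_spt f_lim by blast
  have "(\<lambda>j. (LINT x|lebesgue_on A. gradient (f j) x \<bullet> gradient (f j) x) + \<beta> * (LINT \<omega>|H. f j \<omega> * f j \<omega>)
    - lam * (LINT x|lebesgue_on A. f j x * f j x)) \<longlonglongrightarrow> robin_form \<beta> R\<^sub>1 R\<^sub>2 v v - lam * L2_form R\<^sub>1 R\<^sub>2 v v"
    by (intro tendsto_diff tendsto_mult_left robin_form_tendsto v_H1 f_test f_lim)
  then have "(\<lambda>j. LINT x|lebesgue_on A. defect j x \<bullet> defect j x) \<longlonglongrightarrow> 0"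
    unfolding picone eigen[OF v] by simp
  moreover have "L2 (lebesgue_on A) (defect j)" for j by (rule L2_continuous_A[OF defect_cont])
  ultimately show ?thesis by (simp add: L2_tendsto_def L2_zero power2_norm_eq_inner)
qed

text \<open>The Dirichlet condition: the radial identity with weight \<open>1 - s\<close> has no boundary term for the \<open>f j\<close>,
  while for \<open>P\<close> itself it has the boundary term \<open>P a\<close>.\<close>

lemma P_a: "P a = 0"
proof (rule ccontr)
  assume Pa: "P a \<noteq> 0"
  \<comment> \<open>Under the assumption to be refuted, the logarithmic derivative is regular on all
    of [a, 1], so the clamp can be placed at \<open>a\<close> for every j.\<close>
  have Pnz: "P s \<noteq> 0" if "s \<in> {a..1}" for s using P_pos[of s] Pa that by (cases "s = a") auto
  define k where "k s = \<kappa> (max a (min s 1))" for s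
  have ck: "continuous_on UNIV k" unfolding k_def[abs_def] using a_bounds by (intro \<kappa>_clamped(1) Pnz) auto
  \<comment> \<open>The coefficient of \<open>f j\<close> in the radial identity with weight 1 - s,
    once the gradient of \<open>f j\<close> is replaced by the defect plus
    \<open>\<kappa> (rad x) * f j x\<close> times x.\<close>
  define q where "q s = n * (1 - s) - 2 * s + (1 - s) * k s * s * R\<^sub>2\<^sup>2" for s
  have cq: "continuous_on UNIV q" unfolding q_def[abs_def] by (intro continuous_intros ck)
  define X where "X x = (1 - rad x) *\<^sub>R x" for x :: "real ^ 'n"
  have cX: "continuous_on UNIV X" unfolding X_def[abs_def] by (intro continuous_intros continuous_on_rad)
  have cqr: "continuous_on UNIV (\<lambda>x. q (rad x))" by (rule continuous_on_compose2[OF cq continuous_on_rad]) simp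
  have id: "(LINT x|lebesgue_on A. q (rad x) * f j x) + (LINT x|lebesgue_on A. defect j x \<bullet> X x) = 0" for j
  proof -
    have df: "f j differentiable (at x)" for x by (rule test_functions_differentiable[OF f_test])
    have "(LINT x|lebesgue_on A. (n * (1 - rad x) + 2 * rad x * (- 1)) * f j x + (1 - rad x) * (gradient (f j) x \<bullet> x))
      = 2 * c * ((1 - 1) * (LINT \<omega>|H. f j \<omega>) - cut j powr (n / 2) * (1 - cut j) * (LINT \<omega>|H. f j (sqrt (cut j) *\<^sub>R \<omega>)))"
    proof (rule radial_identity[where k = "\<lambda>s. 1 - s" and k' = "\<lambda>_. - 1"])
      show "f j x = 0 \<and> gradient (f j) x = 0" if "a < rad x" "rad x < cut j" for x using f_cut[of x j] that by simp
    qed (use cut[of j] df f_cont in \<open>auto intro!: derivative_eq_intros continuous_intros\<close>)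
    moreover have "(LINT \<omega>|H. f j (sqrt (cut j) *\<^sub>R \<omega>)) = 0"
    proof (rule integral_eq_zero_AE)
      show "AE \<omega> in H. f j (sqrt (cut j) *\<^sub>R \<omega>) = 0"
        using AE_H
      proof eventually_elim
        case (elim \<omega>)
        have "rad (sqrt (cut j) *\<^sub>R \<omega>) = cut j" using cut[of j] a_bounds elim by (intro rad_polar) auto
        then show ?case using f_cut[of "sqrt (cut j) *\<^sub>R \<omega>" j] cut[of j] by simp
      qed
    qed
    ultimately have "(LINT x|lebesgue_on A. (n * (1 - rad x) + 2 * rad x * (- 1)) * f j x + (1 - rad x) * (gradient (f j) x \<bullet> x)) = 0"
      by simp
    also have "(LINT x|lebesgue_on A. (n * (1 - rad x) + 2 * rad x * (- 1)) * f j x + (1 - rad x) * (gradient (f j) x \<bullet> x)) =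
      (LINT x|lebesgue_on A. q (rad x) * f j x + defect j x \<bullet> X x)"
    proof (rule Bochner_Integration.integral_cong)
      fix x assume "x \<in> space (lebesgue_on A)"
      then have x: "x \<in> A" by simp
      then have "k (rad x) = \<kappa> (rad x)" by (simp add: k_def A_rad_iff)
      then show "(n * (1 - rad x) + 2 * rad x * (- 1)) * f j x + (1 - rad x) * (gradient (f j) x \<bullet> x) = q (rad x) * f j x + defect j x \<bullet> X x"
        unfolding defect_eq[OF x] q_def X_def by (simp add: inner_add_left inner_rad algebra_simps)
    qed simp
    also have "\<dots> = (LINT x|lebesgue_on A. q (rad x) * f j x) + (LINT x|lebesgue_on A. defect j x \<bullet> X x)"
      by (intro Bochner_Integration.integral_add integrable_continuous_A continuous_intros cqr cX f_cont defect_cont)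
    finally show ?thesis by simp
  qed
  have "(\<lambda>j. (LINT x|lebesgue_on A. q (rad x) * f j x) + (LINT x|lebesgue_on A. defect j x \<bullet> X x))
    \<longlonglongrightarrow> (LINT x|lebesgue_on A. q (rad x) * v x) + (LINT x|lebesgue_on A. 0 \<bullet> X x)"
    by (intro tendsto_add f_integral_A[OF cqr] L2_tendsto_inner[OF defect_tendsto L2_tendsto_const[OF L2_continuous_A[OF cX]]])
  \<comment> \<open>The defect disappears in the limit, and \<open>v\<close> inherits the identity
    without boundary terms.\<close>
  then have "(LINT x|lebesgue_on A. q (rad x) * v x) = 0" unfolding id by (simp add: LIMSEQ_const_iff)
  moreover have "(LINT x|lebesgue_on A. q (rad x) * v x) = (LINT x|lebesgue_on A. (indicator {a..1} (rad x) * q (rad x)) * v x)"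
    by (intro Bochner_Integration.integral_cong) (auto simp: A_rad_iff)
  moreover have "(LINT x|lebesgue_on A. (indicator {a..1} (rad x) * q (rad x)) * v x) =
      (LINT s|lborel. indicator {a..1} s * ((indicator {a..1} s * q s) * (s powr (n / 2 - 1) * P s)))"
  proof -
    have "compact (q ` {a..1})" using cq by (intro compact_continuous_image) (auto intro: continuous_on_subset)
    then obtain B where B: "\<And>y. y \<in> q ` {a..1} \<Longrightarrow> norm y \<le> B" using compact_imp_bounded bounded_iff by metis
    have "\<bar>indicator {a..1} s * q s\<bar> \<le> max B 0" for s using B[of "q s"] by (auto simp: indicator_def)
    moreover have "(\<lambda>s. indicator {a..1} s * q s) \<in> borel_measurable borel"
      using continuous_on_UNIV_borel[OF cq] by measurable
    ultimately show ?thesis by (intro radial_integral)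
  qed
  moreover have "(LINT s|lborel. indicator {a..1} s * ((indicator {a..1} s * q s) * (s powr (n / 2 - 1) * P s))) =
      (LINT s|lborel. indicator {a..1} s *\<^sub>R (q s * (s powr (n / 2 - 1) * P s)))"
    by (intro Bochner_Integration.integral_cong) (auto simp: indicator_def)
  \<comment> \<open>Expressed through the profile, the same integrand is the derivative of 2 s^(n/2)
    (1 - s) P(s). It vanishes at 1, so its value at \<open>a\<close>, a positive multiple of P a,
    must be zero.\<close>
  moreover have "has_bochner_integral lborel (\<lambda>s. indicator {a..1} s *\<^sub>R (q s * (s powr (n / 2 - 1) * P s)))
    (2 * (1 powr (n / 2) * ((1 - 1) * P 1)) - 2 * (a powr (n / 2) * ((1 - a) * P a)))"
  proof (rule has_bochner_integral_FTC_Icc)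
    fix t assume "a \<le> t" "t \<le> 1"
    then have t: "t \<in> {a..1}" by simp
    have nz: "t \<noteq> 0" "t powr (n / 2) \<noteq> 0" "R\<^sub>2\<^sup>2 \<noteq> 0" using t a_bounds R2 by auto
    have "((\<lambda>t. 1 - t) has_real_derivative - 1) (at t within {a..1})" by (auto intro!: derivative_eq_intros)
    then have "((\<lambda>t. 2 * (t powr (n / 2) * ((1 - t) * P t))) has_real_derivative
      2 * (t powr (n / 2) * ((1 - t) * (\<Phi> t / (4 * t powr (n / 2))) + - 1 * P t) + (n / 2 * (t powr (n / 2) / t)) * ((1 - t) * P t))) (at t within {a..1})"
      by (intro DERIV_cmult DERIV_mult' powr_deriv[OF t] P_deriv[OF t])
    moreover have "q t * (t powr (n / 2 - 1) * P t) =
      2 * (t powr (n / 2) * ((1 - t) * (\<Phi> t / (4 * t powr (n / 2))) + - 1 * P t) + (n / 2 * (t powr (n / 2) / t)) * ((1 - t) * P t))"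
    proof -
      have "(n * (1 - t) - 2 * t + (1 - t) * (\<phi> / (2 * R * (w * p))) * t * R) * (w / t * p) =
        2 * (w * ((1 - t) * (\<phi> / (4 * w)) + - 1 * p) + (n / 2 * (w / t)) * ((1 - t) * p))"
        if "w \<noteq> 0" "p \<noteq> 0" "R \<noteq> 0" for w p R \<phi> :: real
        using that nz(1) by (simp add: field_simps)
      from this[OF nz(2) Pnz[OF t] nz(3)] have "(n * (1 - t) - 2 * t + (1 - t) * \<kappa> t * t * R\<^sub>2\<^sup>2) * (t powr (n / 2) / t * P t) =
        2 * (t powr (n / 2) * ((1 - t) * (\<Phi> t / (4 * t powr (n / 2))) + - 1 * P t) + (n / 2 * (t powr (n / 2) / t)) * ((1 - t) * P t))"
        unfolding \<kappa>_def .
      moreover have "k t = \<kappa> t" using t by (simp add: k_def)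
      ultimately show ?thesis unfolding q_def powr_minus_one[OF t] by (simp only:)
    qed
    ultimately show "((\<lambda>t. 2 * (t powr (n / 2) * ((1 - t) * P t))) has_vector_derivative q t * (t powr (n / 2 - 1) * P t)) (at t within {a..1})"
      by (simp only: has_real_derivative_iff_has_vector_derivative)
  next
    show "continuous_on {a..1} (\<lambda>s. q s * (s powr (n / 2 - 1) * P s))"
      by (intro continuous_intros continuous_on_subset[OF cq] powr_continuous_on P_cont) auto
  qed (use a_bounds in simp)
  ultimately have "2 * (a powr (n / 2) * ((1 - a) * P a)) = 0"
    by (simp add: has_bochner_integral_iff)
  then show False using Pa a_bounds by simp
qed

section \<open>Constancy of the quotient of the eigenfunction by the profile\<close>

lemma P_rad_has_derivative:
  assumes x: "x \<in> A"
  shows "((\<lambda>x. P (rad x)) has_derivative (\<lambda>y. ((P (rad x) * \<kappa> (rad x)) *\<^sub>R x) \<bullet> y)) (at x)"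
proof -
  have r: "rad x \<in> {a<..<1}" using x by (simp add: A_rad_iff)
  have e: "2 * (\<Phi> (rad x) / (4 * rad x powr (n / 2))) / R\<^sub>2\<^sup>2 = P (rad x) * \<kappa> (rad x)"
    using P_pos[of "rad x"] r R2 a_bounds by (simp add: \<kappa>_def field_simps)
  from radial_has_derivative[OF P_DERIV[OF r]] show ?thesis unfolding e .
qed

lemma quotient_gradient:
  assumes x: "x \<in> A"
  shows "(\<lambda>x. f j x / P (rad x)) differentiable (at x)"
    and "gradient (\<lambda>x. f j x / P (rad x)) x = (1 / P (rad x)) *\<^sub>R defect j x"
proof -
  have p: "P (rad x) \<noteq> 0" using P_pos[of "rad x"] x by (simp add: A_rad_iff)
  have df: "(f j has_derivative (\<lambda>y. gradient (f j) x \<bullet> y)) (at x)"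
    by (rule gradient_has_derivative[OF test_functions_differentiable[OF f_test]])
  have "((\<lambda>x. f j x / P (rad x)) has_derivative
      (\<lambda>y. (gradient (f j) x \<bullet> y * P (rad x) - f j x * (((P (rad x) * \<kappa> (rad x)) *\<^sub>R x) \<bullet> y)) / (P (rad x) * P (rad x)))) (at x)"
    by (rule has_derivative_divide'[OF df P_rad_has_derivative[OF x] p])
  moreover have "(gradient (f j) x \<bullet> y * P (rad x) - f j x * (((P (rad x) * \<kappa> (rad x)) *\<^sub>R x) \<bullet> y)) / (P (rad x) * P (rad x))
     = ((1 / P (rad x)) *\<^sub>R defect j x) \<bullet> y" for y
    unfolding defect_eq[OF x] using p by (simp add: inner_add_left field_simps)
  ultimately have D: "((\<lambda>x. f j x / P (rad x)) has_derivative (\<lambda>y. ((1 / P (rad x)) *\<^sub>R defect j x) \<bullet> y)) (at x)" by simp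
  then show "(\<lambda>x. f j x / P (rad x)) differentiable (at x)" by (auto simp: differentiable_def)
  show "gradient (\<lambda>x. f j x / P (rad x)) x = (1 / P (rad x)) *\<^sub>R defect j x" by (rule gradient_eqI[OF D])
qed

lemma connected_A: "connected A"
proof -
  have "A = {x. R\<^sub>1 < norm (x - 0) \<and> norm (x - 0) < R\<^sub>2}" by (auto simp: A_def annulus_iff)
  then show ?thesis using dim connected_annulus(1)[of R\<^sub>1 "0 :: real ^ 'n" R\<^sub>2] by simp
qed

lemma AE_A_nontrivial: "\<not> (AE x in lebesgue_on A. False)"
proof
  assume "AE x in lebesgue_on A. False"
  then have "AE x in lebesgue_on A. indicator {a<..<1} (rad x) * v x = 0" by eventually_elim simp
  then have "(LINT x|lebesgue_on A. indicator {a<..<1} (rad x) * v x) = 0" by (rule integral_eq_zero_AE)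
  then show False using shell_integral_pos[of a 1] a_bounds by simp
qed

text \<open>The quotients f j / P have gradient defect / P, which tends to 0 locally in L1, while
  the quotients tend to v / P. So v / P is constant on small balls and then on the connected
  annulus; the sign of the constant comes from v > 0.\<close>

lemma v_eq_profile:
  obtains C where "0 < C" "AE x in lebesgue_on A. v x = C * P (rad x)"
proof -
  have L2v: "L2 (lebesgue_on A) v" using v_H1 by (simp add: H1_def)
  obtain u where u: "u \<in> borel_measurable borel" "AE x in lebesgue_on A. v x = u x"
    using borel_representative[OF L2_measurable[OF L2v] A_borel] by metis
  \<comment> \<open>A continuous extension of the radial profile to the whole space, so that the
    quotient \<zeta> is Borel measurable everywhere.\<close>
  define Pc where "Pc x = P (max a (min (rad x) 1))" for x
  have cPc: "continuous_on UNIV Pc" unfolding Pc_def[abs_def]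
    using a_bounds by (intro continuous_on_compose2[OF continuous_on_clamp[OF P_cont] continuous_on_rad]) auto
  have Pc: "Pc x = P (rad x)" "0 < Pc x" if "x \<in> A" for x
    using that P_pos[of "rad x"] by (auto simp: Pc_def A_rad_iff)
  define \<zeta> where "\<zeta> x = u x / Pc x" for x
  have m\<zeta>: "\<zeta> \<in> borel_measurable borel"
    unfolding \<zeta>_def[abs_def] using u(1) continuous_on_UNIV_borel[OF cPc] by measurable
  have mfu: "(\<lambda>x. f j x - u x) \<in> borel_measurable borel" for j
    using u(1) continuous_on_UNIV_borel[OF f_cont(1)] by measurable
  have fu: "L2_tendsto (lebesgue_on A) (\<lambda>j x. f j x - u x) (\<lambda>_. 0)"
    by (rule L2_tendsto_imp_diff_tendsto_0[OF L2_tendsto_cong_AE[OF f_tendsto(1) u(2) borel_imp_measurable_A[OF u(1)]]])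
  note lim = L2_tendsto_0_imp_nn_integral_tendsto_0[OF A_open A_bounded mfu fu]
  have mdef: "defect j \<in> borel_measurable borel" for j by (rule continuous_on_UNIV_borel[OF defect_cont])
  note gradlim = L2_tendsto_0_imp_nn_integral_tendsto_0[OF A_open A_bounded mdef defect_tendsto]
  have loc: "\<exists>r>0. \<exists>C. AE x in lborel. x \<in> ball p r \<longrightarrow> \<zeta> x = C" if p: "p \<in> A" for p
  proof -
    \<comment> \<open>On a closed ball inside the annulus the profile has a positive minimum. Near
      the inner sphere no such bound holds, which is why the argument is local.\<close>
    obtain r where r: "0 < r" "cball p r \<subseteq> A" using A_open p open_contains_cball by blast
    have "cball p r \<noteq> {}" using r by simp
    then obtain x0 where x0: "x0 \<in> cball p r" "\<And>x. x \<in> cball p r \<Longrightarrow> Pc x0 \<le> Pc x"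
      using continuous_attains_inf[OF compact_cball _ continuous_on_subset[OF cPc]] by blast
    define m where "m = Pc x0"
    have m: "0 < m" using Pc(2) x0(1) r(2) by (auto simp: m_def)
    have ball: "x \<in> A" "m \<le> Pc x" if "x \<in> ball p r" for x
      using that r(2) x0(2)[of x] by (auto simp: m_def)
    have K: "ennreal (1 / m) < top" by simp
    \<comment> \<open>Dividing by the profile costs at most the factor 1/m. This is applied once to
      the values and once to the gradients of the quotients.\<close>
    have small: "(\<lambda>j. \<integral>\<^sup>+x. indicator (ball p r) x * ennreal (g j x) \<partial>lborel) \<longlonglongrightarrow> 0"
      if le: "\<And>j x. x \<in> ball p r \<Longrightarrow> g j x \<le> norm (G j x) / Pc x" and mG: "\<And>j. G j \<in> borel_measurable borel"
        and G: "(\<lambda>j. \<integral>\<^sup>+x. indicator A x * ennreal (norm (G j x)) \<partial>lborel) \<longlonglongrightarrow> 0" for g and G :: "nat \<Rightarrow> real ^ 'n \<Rightarrow> 'z::euclidean_space"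
    proof (rule tendsto_sandwich[where f = "\<lambda>_. 0" and h = "\<lambda>j. ennreal (1 / m) * (\<integral>\<^sup>+x. indicator A x * ennreal (norm (G j x)) \<partial>lborel)"])
      show "\<forall>\<^sub>F j in sequentially. (\<integral>\<^sup>+x. indicator (ball p r) x * ennreal (g j x) \<partial>lborel) \<le>
          ennreal (1 / m) * (\<integral>\<^sup>+x. indicator A x * ennreal (norm (G j x)) \<partial>lborel)"
      proof (intro always_eventually allI)
        fix j
        have [measurable]: "G j \<in> borel_measurable borel" "A \<in> sets borel" using mG by auto
        have "(\<integral>\<^sup>+x. indicator (ball p r) x * ennreal (g j x) \<partial>lborel) \<le>
          (\<integral>\<^sup>+x. ennreal (1 / m) * (indicator A x * ennreal (norm (G j x))) \<partial>lborel)"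
        proof (rule nn_integral_mono)
          fix x
          show "indicator (ball p r) x * ennreal (g j x) \<le> ennreal (1 / m) * (indicator A x * ennreal (norm (G j x)))"
          proof (cases "x \<in> ball p r")
            case True
            have "g j x \<le> norm (G j x) / Pc x" by (rule le[OF True])
            also have "\<dots> \<le> norm (G j x) / m" using m ball(2)[OF True] by (intro divide_left_mono) auto
            finally have "ennreal (g j x) \<le> ennreal (1 / m * norm (G j x))" by (intro ennreal_leI) simp
            then show ?thesis using True ball(1)[OF True] m by (simp add: ennreal_mult[symmetric])
          qed simp
        qed
        also have "\<dots> = ennreal (1 / m) * (\<integral>\<^sup>+x. indicator A x * ennreal (norm (G j x)) \<partial>lborel)"
          by (intro nn_integral_cmult) measurable
        finally show "(\<integral>\<^sup>+x. indicator (ball p r) x * ennreal (g j x) \<partial>lborel) \<le>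
          ennreal (1 / m) * (\<integral>\<^sup>+x. indicator A x * ennreal (norm (G j x)) \<partial>lborel)" .
      qed
      show "(\<lambda>j. ennreal (1 / m) * (\<integral>\<^sup>+x. indicator A x * ennreal (norm (G j x)) \<partial>lborel)) \<longlonglongrightarrow> 0"
        using ennreal_tendsto_cmult[OF K G] by simp
    qed auto
    obtain C where "AE x in lborel. x \<in> ball p r \<longrightarrow> \<zeta> x = C"
    proof (rule AE_ball_const_if_gradient_tendsto_0[where z = "\<lambda>j x. f j x / P (rad x)" and p = p and r = r and \<zeta> = \<zeta>])
      show "(\<lambda>x. f j x / P (rad x)) differentiable (at x)" if "x \<in> ball p r" for j x
        by (rule quotient_gradient(1)[OF ball(1)[OF that]])
      show "continuous_on (ball p r) (gradient (\<lambda>x. f j x / P (rad x)))" for j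
      proof -
        have "continuous_on (ball p r) (\<lambda>x. (1 / Pc x) *\<^sub>R defect j x)"
          by (intro continuous_intros continuous_on_subset[OF cPc] continuous_on_subset[OF defect_cont]) (use Pc(2)[OF ball(1)] in force)+
        then show ?thesis
          by (subst continuous_on_cong[OF refl, of _ _ "\<lambda>x. (1 / Pc x) *\<^sub>R defect j x"]) (use quotient_gradient(2) ball(1) Pc(1) in auto)
      qed
      show "(\<lambda>j. \<integral>\<^sup>+x. indicator (ball p r) x * ennreal \<bar>f j x / P (rad x) - \<zeta> x\<bar> \<partial>lborel) \<longlonglongrightarrow> 0"
      proof (rule small[OF _ mfu lim])
        show "\<bar>f j x / P (rad x) - \<zeta> x\<bar> \<le> norm (f j x - u x) / Pc x" if "x \<in> ball p r" for j x
          using Pc[OF ball(1)[OF that]] by (simp add: \<zeta>_def diff_divide_distrib[symmetric])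
      qed
      show "(\<lambda>j. \<integral>\<^sup>+x. indicator (ball p r) x * ennreal (norm (gradient (\<lambda>x. f j x / P (rad x)) x)) \<partial>lborel) \<longlonglongrightarrow> 0"
      proof (rule small[OF _ mdef gradlim])
        show "norm (gradient (\<lambda>x. f j x / P (rad x)) x) \<le> norm (defect j x) / Pc x" if "x \<in> ball p r" for j x
          using Pc[OF ball(1)[OF that]] quotient_gradient(2)[OF ball(1)[OF that], of j] by simp
      qed
    qed (use r m\<zeta> in auto)
    then show ?thesis using r(1) by blast
  qed
  obtain x0 where "x0 \<in> A" using AE_A_nontrivial by (metis AE_I2 space_lebesgue_on)
  then have "A \<noteq> {}" by blast
  from AE_const_connected[OF A_open connected_A this loc]
  obtain C where C: "AE x in lebesgue_on A. \<zeta> x = C" by blast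
  have inA: "AE x in lebesgue_on A. x \<in> A" by (intro AE_I2) simp
  have eq: "AE x in lebesgue_on A. v x = C * P (rad x)"
    using C u(2) inA
  proof eventually_elim
    case (elim x)
    then show ?case using Pc[OF elim(3)] by (auto simp: \<zeta>_def field_simps)
  qed
  have "0 < C"
  proof (rule ccontr)
    assume C0: "\<not> 0 < C"
    have "AE x in lebesgue_on A. False"
      using eq v_pos inA
    proof eventually_elim
      case (elim x)
      then have "0 < C * P (rad x)" "0 < P (rad x)" using Pc[OF elim(3)] by auto
      then show ?case using C0 by (simp add: zero_less_mult_iff)
    qed
    then show False using AE_A_nontrivial by blast
  qed
  then show thesis using eq by (rule that)
qed

section \<open>Shape of the profile\<close>

text \<open>At 1 the sign is the Robin condition with \<beta> and \<tau> positive. Were \<Phi> a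
  \<le> 0, \<open>P\<close> would be nonincreasing on [a, 1] from P a = 0 on, against P 1 >
  0.\<close>

lemma \<Phi>_signs: "0 < \<Phi> a" "\<Phi> 1 < 0"
proof -
  show "\<Phi> 1 < 0" using \<Phi>_1 \<beta> R2 \<tau>_pos by simp
  show "0 < \<Phi> a"
  proof (rule ccontr)
    assume "\<not> 0 < \<Phi> a"
    then have "\<Phi> x \<le> 0" if "a < x" "x < 1" for x using \<Phi>_antimono[of a x] that by simp
    then have "P 1 \<le> P a" using a_bounds by (intro P_mono_sign(2)) auto
    then show False using P_a P_pos[of 1] a_bounds by simp
  qed
qed

text \<open>If \<open>lam\<close> were 0 the flux would be constant, which its opposite signs at the
  ends exclude. So \<open>lam\<close> is positive, and positivity of \<open>P\<close> makes the
  derivative of \<Phi> negative.\<close>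

lemma \<Phi>_strict_antimono:
  assumes st: "a \<le> s" "s < t" "t \<le> 1"
  shows "\<Phi> t < \<Phi> s"
proof -
  have "lam \<noteq> 0"
  proof
    assume 0: "lam = 0"
    have "\<Phi> a \<le> \<Phi> 1"
    proof (rule DERIV_nonneg_imp_increasing_open[OF _ _ \<Phi>_cont])
      show "\<exists>y. (\<Phi> has_real_derivative y) (at x) \<and> 0 \<le> y" if "a < x" "x < 1" for x
        using \<Phi>_DERIV[of x] that by (intro exI[of _ 0]) (simp add: 0)
    qed (use a_bounds in simp)
    then show False using \<Phi>_signs by simp
  qed
  then have lam: "0 < \<Lambda>" using lam_nonneg R2 by simp
  show ?thesis
  proof (rule DERIV_neg_imp_decreasing_open[OF st(2)])
    show "\<exists>y. (\<Phi> has_real_derivative y) (at x) \<and> y < 0" if x: "s < x" "x < t" for x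
    proof (intro exI conjI)
      have xa: "x \<in> {a<..<1}" using x st by simp
      show "(\<Phi> has_real_derivative - (\<Lambda> * (x powr (n / 2 - 1) * P x))) (at x)" by (rule \<Phi>_DERIV[OF xa])
      have "0 < \<Lambda> * (x powr (n / 2 - 1) * P x)"
        using xa a_bounds by (intro mult_pos_pos lam P_pos) auto
      then show "- (\<Lambda> * (x powr (n / 2 - 1) * P x)) < 0" by simp
    qed
    show "continuous_on {s..t} \<Phi>" using \<Phi>_cont by (rule continuous_on_subset) (use st in auto)
  qed
qed

lemma \<Phi>_zero:
  obtains t where "t \<in> {a<..<1}" "\<Phi> t = 0"
proof -
  obtain t where t: "a \<le> t" "t \<le> 1" "\<Phi> t = 0"
    using IVT2'[of \<Phi> 1 0 a] \<Phi>_signs a_bounds \<Phi>_cont by auto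
  moreover have "t \<noteq> a" "t \<noteq> 1" using t(3) \<Phi>_signs by auto
  ultimately show thesis by (intro that) auto
qed

text \<open>The substitution \<open>s = r\<^sup>2 / R\<^sub>2\<^sup>2\<close> is increasing and maps
  the interval of radii onto [a, 1], so the sign pattern of the flux becomes that of the derivative
  of \<phi> by the chain rule.\<close>

lemma radial_and_unimodal:
  "\<exists>\<phi> :: real \<Rightarrow> real.
    continuous_on {R\<^sub>1..R\<^sub>2} \<phi> \<and> \<phi> differentiable_on {R\<^sub>1<..<R\<^sub>2} \<and>
    (\<forall>r\<in>{R\<^sub>1<..<R\<^sub>2}. 0 < \<phi> r) \<and>
    (AE x in lebesgue_on A. v x = \<phi> (norm x)) \<and>
    (\<exists>R\<in>{R\<^sub>1<..<R\<^sub>2}.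
       (\<forall>r\<in>{R\<^sub>1<..<R\<^sub>2}. deriv \<phi> r = 0 \<longleftrightarrow> r = R) \<and>
       strict_mono_on {R\<^sub>1..R} \<phi> \<and> strict_antimono_on {R..R\<^sub>2} \<phi>)"
proof -
  obtain C where C: "0 < C" "AE x in lebesgue_on A. v x = C * P (rad x)" by (rule v_eq_profile)
  obtain t where t: "t \<in> {a<..<1}" "\<Phi> t = 0" by (rule \<Phi>_zero)
  define \<sigma> where "\<sigma> r = r\<^sup>2 / R\<^sub>2\<^sup>2" for r
  define \<phi> where "\<phi> r = C * P (\<sigma> r)" for r
  \<comment> \<open>The radius that the substitution sends to the zero \<open>t\<close> of the
    flux.\<close>
  define R where "R = R\<^sub>2 * sqrt t"
  have \<sigma>1: "\<sigma> R\<^sub>1 = a" and \<sigma>2: "\<sigma> R\<^sub>2 = 1" using R2 by (auto simp: \<sigma>_def a_def power_divide)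
  have \<sigma>R: "\<sigma> R = t" using t(1) a_bounds R2 by (simp add: \<sigma>_def R_def power_mult_distrib)
  have \<sigma>_less: "\<sigma> r < \<sigma> s \<longleftrightarrow> r < s" if "0 \<le> r" "0 \<le> s" for r s
    using that R2 power_strict_mono[of r s 2] power2_less_imp_less[of r s]
    by (auto simp: \<sigma>_def divide_strict_right_mono divide_less_cancel)
  have R0: "0 \<le> R" using R2 t(1) a_bounds by (simp add: R_def)
  have RR: "R \<in> {R\<^sub>1<..<R\<^sub>2}"
    using \<sigma>_less[of R\<^sub>1 R] \<sigma>_less[of R R\<^sub>2] R1 R2 R0 t(1) by (simp add: \<sigma>1 \<sigma>2 \<sigma>R)
  have \<sigma>_le: "\<sigma> r \<le> \<sigma> s" if "0 \<le> r" "r \<le> s" for r s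
    using \<sigma>_less[of s r] that by (simp add: not_less[symmetric])
  have \<sigma>_in: "\<sigma> r \<in> {a<..<1}" if "r \<in> {R\<^sub>1<..<R\<^sub>2}" for r
    using \<sigma>_less[of R\<^sub>1 r] \<sigma>_less[of r R\<^sub>2] that R1 by (simp add: \<sigma>1 \<sigma>2)
  have d: "(\<phi> has_real_derivative C * (\<Phi> (\<sigma> r) / (4 * \<sigma> r powr (n / 2)) * (2 * r / R\<^sub>2\<^sup>2))) (at r)" if r: "r \<in> {R\<^sub>1<..<R\<^sub>2}" for r
  proof -
    have "(\<sigma> has_real_derivative 2 * r / R\<^sub>2\<^sup>2) (at r)"
      unfolding \<sigma>_def[abs_def] by (rule DERIV_cdivide) (auto intro!: derivative_eq_intros)
    then show ?thesis unfolding \<phi>_def[abs_def] by (intro DERIV_cmult DERIV_chain2[where f = P and g = \<sigma>, OF P_DERIV[OF \<sigma>_in[OF r]]])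
  qed
  have "continuous_on {R\<^sub>1..R\<^sub>2} \<phi>"
  proof -
    have "continuous_on {R\<^sub>1..R\<^sub>2} \<sigma>" unfolding \<sigma>_def[abs_def] using R2 by (intro continuous_intros) auto
    moreover have "\<sigma> ` {R\<^sub>1..R\<^sub>2} \<subseteq> {a..1}"
    proof clarify
      fix r assume "r \<in> {R\<^sub>1..R\<^sub>2}"
      then show "\<sigma> r \<in> {a..1}" using \<sigma>_le[of R\<^sub>1 r] \<sigma>_le[of r R\<^sub>2] R1 by (simp add: \<sigma>1 \<sigma>2)
    qed
    ultimately show ?thesis
      unfolding \<phi>_def[abs_def] by (intro continuous_intros continuous_on_compose2[OF P_cont])
  qed
  moreover have "\<phi> differentiable_on {R\<^sub>1<..<R\<^sub>2}"
    unfolding differentiable_on_def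
  proof
    fix r assume "r \<in> {R\<^sub>1<..<R\<^sub>2}"
    then have "\<phi> differentiable (at r)" using d[of r] real_differentiable_def by blast
    then show "\<phi> differentiable at r within {R\<^sub>1<..<R\<^sub>2}" by (rule differentiable_at_withinI)
  qed
  moreover have "\<forall>r\<in>{R\<^sub>1<..<R\<^sub>2}. 0 < \<phi> r"
  proof
    fix r assume "r \<in> {R\<^sub>1<..<R\<^sub>2}"
    then show "0 < \<phi> r" using \<sigma>_in[of r] P_pos[of "\<sigma> r"] C(1) by (simp add: \<phi>_def)
  qed
  moreover have "AE x in lebesgue_on A. v x = \<phi> (norm x)"
    using C(2) by (simp add: \<phi>_def \<sigma>_def rad_def)
  moreover have "\<forall>r\<in>{R\<^sub>1<..<R\<^sub>2}. deriv \<phi> r = 0 \<longleftrightarrow> r = R"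
  proof
    fix r assume r: "r \<in> {R\<^sub>1<..<R\<^sub>2}"
    have s: "\<sigma> r \<in> {a<..<1}" by (rule \<sigma>_in[OF r])
    have "deriv \<phi> r = C * (\<Phi> (\<sigma> r) / (4 * \<sigma> r powr (n / 2)) * (2 * r / R\<^sub>2\<^sup>2))" by (rule DERIV_imp_deriv[OF d[OF r]])
    \<comment> \<open>All factors of the derivative other than the flux are positive.\<close>
    then have "deriv \<phi> r = 0 \<longleftrightarrow> \<Phi> (\<sigma> r) = 0" using C(1) r R1 R2 s a_bounds by simp
    also have "\<dots> \<longleftrightarrow> \<sigma> r = t"
    proof
      assume z: "\<Phi> (\<sigma> r) = 0"
      show "\<sigma> r = t"
      proof (rule ccontr)
        assume "\<sigma> r \<noteq> t"
        then consider "\<sigma> r < t" | "t < \<sigma> r" by linarith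
        then show False
        proof cases
          case 1
          then show False using \<Phi>_strict_antimono[of "\<sigma> r" t] s t z by simp
        next
          case 2
          then show False using \<Phi>_strict_antimono[of t "\<sigma> r"] s t z by simp
        qed
      qed
    qed (use t in simp)
    also have "\<dots> \<longleftrightarrow> r = R"
      using \<sigma>_less[of r R] \<sigma>_less[of R r] r R1 R0 \<sigma>R by auto
    finally show "deriv \<phi> r = 0 \<longleftrightarrow> r = R" .
  qed
  moreover have "strict_mono_on {R\<^sub>1..R} \<phi>"
  proof (rule monotone_onI)
    fix r s assume rs: "r \<in> {R\<^sub>1..R}" "s \<in> {R\<^sub>1..R}" "r < s"
    have \<sigma>: "a \<le> \<sigma> r" "\<sigma> r < \<sigma> s" "\<sigma> s \<le> t"
      using \<sigma>_le[of R\<^sub>1 r] \<sigma>_less[of r s] \<sigma>_le[of s R] rs R1 by (auto simp: \<sigma>1 \<sigma>R)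
    have "P (\<sigma> r) < P (\<sigma> s)"
    proof (rule P_mono_sign(3))
      show "0 < \<Phi> x" if "\<sigma> r < x" "x < \<sigma> s" for x using \<Phi>_strict_antimono[of x t] that \<sigma> t by simp
    qed (use \<sigma> t in auto)
    then show "\<phi> r < \<phi> s" using C(1) by (simp add: \<phi>_def)
  qed
  moreover have "strict_antimono_on {R..R\<^sub>2} \<phi>"
  proof (rule monotone_onI)
    fix r s assume rs: "r \<in> {R..R\<^sub>2}" "s \<in> {R..R\<^sub>2}" "r < s"
    have \<sigma>: "t \<le> \<sigma> r" "\<sigma> r < \<sigma> s" "\<sigma> s \<le> 1"
      using \<sigma>_le[of R r] \<sigma>_less[of r s] \<sigma>_le[of s R\<^sub>2] rs R0 by (auto simp: \<sigma>2 \<sigma>R)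
    have "P (\<sigma> s) < P (\<sigma> r)"
    proof (rule P_mono_sign(4))
      show "\<Phi> x < 0" if "\<sigma> r < x" "x < \<sigma> s" for x using \<Phi>_strict_antimono[of t x] that \<sigma> t by simp
    qed (use \<sigma> t in auto)
    then show "\<phi> s < \<phi> r" using C(1) by (simp add: \<phi>_def)
  qed
  ultimately show ?thesis using RR by blast
qed

end

text \<open>Elements of the Sobolev space are functions up to null sets, so positivity is assumed
  and radial symmetry concluded almost everywhere, with a profile that is continuous up to both
  spheres. The equivalence between a vanishing derivative and \<open>r = R\<close> expresses
  existence and uniqueness of the critical radius at once.\<close>

theorem proposition3p9:
  fixes \<beta> R\<^sub>1 R\<^sub>2 :: real and v :: "real ^ 'n \<Rightarrow> real"
  assumes "2 \<le> CARD('n)" and "0 < \<beta>" and "0 < R\<^sub>1" and "R\<^sub>1 < R\<^sub>2"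
    and "robin_eigenfunction \<beta> R\<^sub>1 R\<^sub>2 v"
    and "AE x in lebesgue_on (annulus R\<^sub>1 R\<^sub>2). 0 < v x"
  shows "\<exists>\<phi> :: real \<Rightarrow> real.
    continuous_on {R\<^sub>1..R\<^sub>2} \<phi> \<and> \<phi> differentiable_on {R\<^sub>1<..<R\<^sub>2} \<and>
    (\<forall>r\<in>{R\<^sub>1<..<R\<^sub>2}. 0 < \<phi> r) \<and>
    (AE x in lebesgue_on (annulus R\<^sub>1 R\<^sub>2). v x = \<phi> (norm x)) \<and>
    (\<exists>R\<in>{R\<^sub>1<..<R\<^sub>2}.
       (\<forall>r\<in>{R\<^sub>1<..<R\<^sub>2}. deriv \<phi> r = 0 \<longleftrightarrow> r = R) \<and>
       strict_mono_on {R\<^sub>1..R} \<phi> \<and> strict_antimono_on {R..R\<^sub>2} \<phi>)"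
proof -
  define lam where "lam = robin_eigenvalue TYPE(real ^ 'n) \<beta> R\<^sub>1 R\<^sub>2"
  from assms(5) have v: "v \<in> annulus_space R\<^sub>1 R\<^sub>2"
    and eigen: "\<And>\<phi>. \<phi> \<in> annulus_space R\<^sub>1 R\<^sub>2 \<Longrightarrow> robin_form \<beta> R\<^sub>1 R\<^sub>2 v \<phi> = lam * L2_form R\<^sub>1 R\<^sub>2 v \<phi>"
    unfolding robin_eigenfunction_def lam_def by auto
  from v obtain f where f: "\<And>k. f k \<in> test_functions UNIV" "\<And>k. spt (f k) \<inter> sphere 0 R\<^sub>1 = {}"
      "(\<lambda>k. H1_norm (annulus R\<^sub>1 R\<^sub>2) (\<lambda>x. f k x - v x)) \<longlonglongrightarrow> 0" and vH1: "v \<in> H1 (annulus R\<^sub>1 R\<^sub>2)"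
    unfolding H1_vanishing_def by blast
  obtain c where c: "0 < c"
    "distr (sphere_measure R\<^sub>2 \<Otimes>\<^sub>M annulus_law CARD('n) ((R\<^sub>1 / R\<^sub>2)\<^sup>2) c) borel (\<lambda>p. sqrt (snd p) *\<^sub>R fst p)
      = density lborel (indicator (annulus R\<^sub>1 R\<^sub>2 :: (real ^ 'n) set))"
    by (rule annulus_polar[OF assms(3,4)])
  interpret robin_solution R\<^sub>1 R\<^sub>2 c "(R\<^sub>1 / R\<^sub>2)\<^sup>2" "annulus R\<^sub>1 R\<^sub>2 :: (real ^ 'n) set" "sphere_measure R\<^sub>2"
    "annulus_law CARD('n) ((R\<^sub>1 / R\<^sub>2)\<^sup>2) c" "real CARD('n)" \<beta> lam v f
    using assms c f vH1 eigen by unfold_locales auto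
  \<comment> \<open>The profile is obtained inside the interpreted context, and its properties
    discharge the axioms of the locale in which Picone's identity is proved.\<close>
  obtain P \<Phi> where "radial_profile R\<^sub>1 R\<^sub>2 c ((R\<^sub>1 / R\<^sub>2)\<^sup>2) (annulus R\<^sub>1 R\<^sub>2 :: (real ^ 'n) set) (sphere_measure R\<^sub>2)
    (annulus_law CARD('n) ((R\<^sub>1 / R\<^sub>2)\<^sup>2) c) (real CARD('n)) \<beta> lam v f P \<Phi>"
  proof (rule profile_ode, goal_cases)
    case (1 P \<Phi>)
    show ?case
      by (rule 1(1), intro radial_profile.intro robin_solution_axioms radial_profile_axioms.intro) (fact 1)+
  qed
  then interpret radial_profile R\<^sub>1 R\<^sub>2 c "(R\<^sub>1 / R\<^sub>2)\<^sup>2" "annulus R\<^sub>1 R\<^sub>2 :: (real ^ 'n) set" "sphere_measure R\<^sub>2"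
    "annulus_law CARD('n) ((R\<^sub>1 / R\<^sub>2)\<^sup>2) c" "real CARD('n)" \<beta> lam v f P \<Phi> .
  show ?thesis by (rule radial_and_unimodal)
qed

end
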